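(* Suppose Assumption (A) and Assumption (B) of the context hold. Let $u^*(\cdot)\in\mathbb{U}$ be an optimal control, i.e. $J(u^*(\cdot))=\inf_{u(\cdot)\in\mathbb{U}}J(u(\cdot))$, let $(x^*(\cdot),y^*(\cdot))$ be the corresponding solution of the state equation, and let $(p^*(\cdot),r^*(\cdot))\in N^2(\overline{\mathbb{T}};\mathbb{R}^{2n})$ be the corresponding solution of the adjoint equation. Fix $s\in\mathbb{T}$ and $u(\cdot)\in\mathbb{U}$, and for $\varepsilon\in[0,1]$ let $u^\varepsilon_k=u^*_k+\delta_{ks}\,\varepsilon\,(u_k-u^*_k)$, $k\in\mathbb{T}$, where $\delta_{ks}$ is the Kronecker delta. Then $$\frac{d}{d\varepsilon}J(u^\varepsilon(\cdot))\Big|_{\varepsilon=0}:=\lim_{\varepsilon\to0^+}\frac{J(u^\varepsilon(\cdot))-J(u^*(\cdot))}{\varepsilon}=\mathbb{E}\big[\langle H_u^*(s),u_s-u_s^*\rangle\big].$$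
   Context: Setting. $N$ is a positive integer, $\mathbb{T}=\{0,\dots,N-1\}$, $\overline{\mathbb{T}}=\{0,\dots,N\}$. $(\Omega,\mathcal{F},\mathbb{P})$ is a complete probability space, $\{w_k\}_{k\in\mathbb{T}}$ (also written $\omega_k$) is a real martingale difference sequence with $\mathbb{E}[w_k\mid\mathcal{F}_{k-1}]=0$, $\mathbb{E}[w_k^2\mid\mathcal{F}_{k-1}]=1$ for $k\in\mathbb{T}$, where $\mathcal{F}_k=\sigma(x_0,w_0,\dots,w_k)$ and $\mathcal{F}_{-1}=\{\emptyset,\Omega\}$. For a Hilbert space $\mathbb{H}$ and an index set $I$ equal to $\mathbb{T}$ or $\overline{\mathbb{T}}$, $L^2_{\mathbb{F}}(I;\mathbb{H})$ is the set of $\mathbb{H}$-valued processes $(f_k)_{k\in I}$ with $f_k$ $\mathcal{F}_{k-1}$-measurable and $\mathbb{E}\sum_{k\in I}\|f_k\|^2<\infty$; $L^\infty_{\mathbb{F}}$ is the analogous set of essentially bounded processes; $N^2(\overline{\mathbb{T}};\mathbb{R}^{2n})=L^2_{\mathbb{F}}(\overline{\mathbb{T}};\mathbb{R}^n)\times L^2_{\mathbb{F}}(\overline{\mathbb{T}};\mathbb{R}^n)$. $U_k\subset\mathbb{R}^m$ ($k\in\mathbb{T}$) are nonempty convex sets and $\mathbb{U}$ is the set of $u(\cdot)=(u_0,\dots,u_{N-1})$ with $u_k$ $\mathcal{F}_{k-1}$-measurable, $u_k\in U_k$, $\mathbb{E}\sum_{k}|u_k|^2<\infty$. State equation. For $u(\cdot)\in\mathbb{U}$,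 for $k\in\mathbb{T}$, $$x_{k+1}=b(k,x_k,y'_{k+1},z'_{k+1},u_k)+\sigma(k,x_k,y'_{k+1},z'_{k+1},u_k)\omega_k,\quad y_k=-f(k+1,x_k,y'_{k+1},z'_{k+1},u_k),$$ $$y'_{k+1}=\mathbb{E}[y_{k+1}\mid\mathcal{F}_{k-1}],\quad z'_{k+1}=\mathbb{E}[y_{k+1}w_k\mid\mathcal{F}_{k-1}],\quad x_0=\Lambda(y_0),\quad y_N=\Phi(x_N).$$ Here $b(k,\cdot),\sigma(k,\cdot),f(k+1,\cdot)$ ($k\in\mathbb{T}$) are random maps $\mathbb{R}^n\times\mathbb{R}^n\times\mathbb{R}^n\times\mathbb{R}^m\to\mathbb{R}^n$; $\Phi:\Omega\times\mathbb{R}^n\to\mathbb{R}^n$ and $\varphi:\Omega\times\mathbb{R}^n\to\mathbb{R}$ with $\Phi(x),\varphi(x)$ square integrable and $\mathcal{F}_{N-1}$-measurable for each $x$; $\Lambda:\mathbb{R}^n\to\mathbb{R}^n$ and $\gamma:\mathbb{R}^n\to\mathbb{R}$ are deterministic; $l(k,\cdot)$ is real-valued. Cost. $J(u(\cdot))=\mathbb{E}\{\varphi(x_N)+\gamma(y_0)+\sum_{k=0}^{N-1}l(k,x_k,y'_{k+1},z'_{k+1},u_k)\}$. Assumption (A). (i) For all $x,y,z\in\mathbb{R}^n$, $u\in U_k$, $k\in\mathbb{T}$: $b(k,x,y,z,u)$, $\sigma(k,x,y,z,u)$, $f(k+1,x,y,z,u)$ are $\mathcal{F}_{k-1}$-measurable,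 and the processes $b(k,0,0,0,0)$, $\sigma(k,0,0,0,0)$, $f(k+1,0,0,0,0)$, $k\in\mathbb{T}$, lie in $L^2_{\mathbb{F}}(\mathbb{T};\mathbb{R}^n)$. (ii) $b,\sigma,f$ are differentiable in $(x,y,z,u)$ with continuous and uniformly bounded derivatives. (iii) $l$ is differentiable in $(x,y,z,u)$ with continuous derivatives; $\Phi,\varphi$ (in $x$) and $\Lambda,\gamma$ (in $y$) are differentiable with continuous derivatives; and for a constant $C>0$: $|l(k,x,y,z,u)|\le C(1+|x|^2+|y|^2+|z|^2+|u|^2)$, $|l_a(k,x,y,z,u)|\le C(1+|x|+|y|+|z|+|u|)$ for $a=x,y,z,u$, $|\Phi_x(x)|,|\varphi_x(x)|\le C(1+|x|)$, $|\Lambda_y(y)|,|\gamma_y(y)|\le C(1+|y|)$. Assumption (B). There are constants $\mu,v\ge0$, a matrix $M\in\mathbb{R}^{\tilde m\times n}$, a bounded $\mathcal{F}_{N-1}$-measurable random matrix $G$ with values in $\mathbb{R}^{\tilde m\times n}$, and $A(\cdot),B(\cdot),C(\cdot)\in L^\infty_{\mathbb{F}}(\mathbb{T};\mathbb{R}^{m\times n})$ such that: (i) either $\mu>0,v=0$ or $\mu=0,v>0$. (ii) For all $k\in\mathbb{T}$, a.a. $\omega$, all $u\in U_k$, $x,\bar x,y,\bar y,z,\bar z\in\mathbb{R}^n$, with $\hat x=x-\bar x$, $\hat y=y-\bar y$, $\hat z=z-\bar z$: $|\Lambda(y)-\Lambda(\bar y)|\le\frac1\mu|M\hat y|$, $|\Phi(x)-\Phi(\bar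 x)|\le\frac1v|G\hat x|$, $|f(k+1,x,y,z,u)-f(k+1,\bar x,y,z,u)|\le\frac1v|A_k\hat x|$, $|h(k,x,y,z,u)-h(k,x,\bar y,\bar z,u)|\le\frac1\mu|B_k\hat y+C_k\hat z|$ for $h=b,\sigma$ (a bound with coefficient $1/0$ is void). (iii) With $\theta=(x,y,z)$, $\Gamma(k,\theta,u)=(f(k+1,\theta,u),b(k,\theta,u),\sigma(k,\theta,u))$, for all $k\in\mathbb{T}$, a.a. $\omega$, all $u\in U_k$, $\theta,\bar\theta\in\mathbb{R}^{3n}$, $\hat\theta=\theta-\bar\theta$: either $\langle\Lambda(y)-\Lambda(\bar y),\hat y\rangle\le-\mu|M\hat y|^2$, $\langle\Phi(x)-\Phi(\bar x),\hat x\rangle\ge v|G\hat x|^2$, $\langle\Gamma(k,\theta,u)-\Gamma(k,\bar\theta,u),\hat\theta\rangle\le-v|A_k\hat x|^2-\mu|B_k\hat y+C_k\hat z|^2$; or $\langle\Lambda(y)-\Lambda(\bar y),\hat y\rangle\ge\mu|M\hat y|^2$, $\langle\Phi(x)-\Phi(\bar x),\hat x\rangle\le-v|G\hat x|^2$, $\langle\Gamma(k,\theta,u)-\Gamma(k,\bar\theta,u),\hat\theta\rangle\ge v|A_k\hat x|^2+\mu|B_k\hat y+C_k\hat z|^2$. Under (A) and (B) the paper recalls from the literature that for each $u(\cdot)\in\mathbb{U}$ the state equation has a unique solution $(x(\cdot),y(\cdot))\in N^2(\overline{\mathbb{T}};\mathbb{R}^{2n})$. Hamiltonian. $H(k,x,y,z,u,p,q,r)=b^\top(k,x,y,z,u)p+\sigma^\top(k,x,y,z,u)q+f^\top(k+1,x,y,z,u)r+l(k,x,y,z,u)$.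 Adjoint equation. For $u^*(\cdot)$ with trajectory $(x^*(\cdot),y^*(\cdot))$, the adjoint processes $(p^*(\cdot),r^*(\cdot))$ satisfy, for $k\in\mathbb{T}$, $$r^*_{k+1}=-H^*_y(k)-H^*_z(k)\omega_k,\quad p^*_k=H^*_x(k),\quad r^*_0=-\gamma_y(y^*_0)-\Lambda_y^\top(y^*_0)p^*_0,\quad p^*_N=\varphi_x(x^*_N)-\Phi_x^\top(x^*_N)r^*_N,$$ where $p'^*_{k+1}=\mathbb{E}[p^*_{k+1}\mid\mathcal{F}_{k-1}]$, $q'^*_{k+1}=\mathbb{E}[p^*_{k+1}\omega_k\mid\mathcal{F}_{k-1}]$, and $H^*_a(k)$, $a=x,y,z,u$, is the partial derivative of $H$ in its $x,y,z,u$ argument evaluated at $(k,x^*_k,y'^*_{k+1},z'^*_{k+1},u^*_k,p'^*_{k+1},q'^*_{k+1},r^*_k)$.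
   Formalization: When v = 0, the terminal map Φ is additionally assumed Lipschitz in x uniformly in ω; with only |Φ_x(x)| ≤ C(1+|x|), the state equation may have no square-integrable solution, and the derivative formula can fail even when it has one. *)

theory Defs
  imports "HOL-Probability.Probability"
begin

section \<open>Filtration, conditional expectation and process spaces\<close>

text \<open>
  Index shift: \<open>filt M w k\<close> is the sigma-algebra \<open>F\<^sub>k\<^sub>-\<^sub>1\<close> generated by \<open>w\<^sub>0, \<dots>, w\<^sub>k\<^sub>-\<^sub>1\<close>; in particular
  \<open>filt M w 0\<close> is the trivial \<open>F\<^sub>-\<^sub>1\<close>. The initial state \<open>x\<^sub>0\<close> is not listed among the generators:
  it is \<open>F\<^sub>-\<^sub>1\<close>-measurable, hence constant, and a constant generator adds nothing, see
  \<open>sets_filt_with_constant\<close> below.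
\<close>

definition filt :: "'w measure \<Rightarrow> (nat \<Rightarrow> 'w \<Rightarrow> real) \<Rightarrow> nat \<Rightarrow> 'w measure" where
  "filt M w k = sigma (space M) {w j -` A \<inter> space M | j A. j < k \<and> A \<in> sets borel}"

lemma sets_filt_with_constant:
  fixes x0 :: "'w \<Rightarrow> 'b::topological_space"
  assumes "\<forall>\<omega>\<in>space M. x0 \<omega> = c"
  shows "sets (sigma (space M)
           ({x0 -` A \<inter> space M | A. A \<in> sets borel} \<union>
            {w j -` A \<inter> space M | j A. j < k \<and> A \<in> sets borel}))
         = sets (filt M w k)"
proof -
  let ?G = "{w j -` A \<inter> space M | j A. j < k \<and> A \<in> sets borel}"
  let ?X = "{x0 -` A \<inter> space M | A. A \<in> sets borel}"
  have X: "?X \<subseteq> {{}, space M}"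
    using assms by auto
  have "sigma_sets (space M) (?X \<union> ?G) = sigma_sets (space M) ?G"
  proof (rule sigma_sets_eqI)
    fix a assume "a \<in> ?X \<union> ?G"
    then have "a = {} \<or> a = space M \<or> a \<in> ?G"
      using X by blast
    then show "a \<in> sigma_sets (space M) ?G"
      by (elim disjE) (simp_all only: sigma_sets.Empty sigma_sets_top sigma_sets.Basic)
  next
    fix a assume "a \<in> ?G"
    then show "a \<in> sigma_sets (space M) (?X \<union> ?G)"
      by (intro sigma_sets.Basic) blast
  qed
  moreover have "?X \<union> ?G \<subseteq> Pow (space M)" "?G \<subseteq> Pow (space M)"
    by auto
  ultimately show ?thesis
    unfolding filt_def by (simp only: sets_measure_of)
qed

definition martingale_difference :: "'w measure \<Rightarrow> nat \<Rightarrow> (nat \<Rightarrow> 'w \<Rightarrow> real) \<Rightarrow> bool" where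
  "martingale_difference M N w \<longleftrightarrow>
    (\<forall>k<N. w k \<in> borel_measurable M \<and>
       integrable M (w k) \<and> integrable M (\<lambda>\<omega>. (w k \<omega>)\<^sup>2) \<and>
       (AE \<omega> in M. real_cond_exp M (filt M w k) (w k) \<omega> = 0) \<and>
       (AE \<omega> in M. real_cond_exp M (filt M w k) (\<lambda>\<omega>. (w k \<omega>)\<^sup>2) \<omega> = 1))"

definition vec_cond_exp ::
  "'w measure \<Rightarrow> 'w measure \<Rightarrow> ('w \<Rightarrow> real^'n) \<Rightarrow> 'w \<Rightarrow> real^'n" where
  "vec_cond_exp M F X = (\<lambda>\<omega>. \<chi> i. real_cond_exp M F (\<lambda>\<omega>. X \<omega> $ i) \<omega>)"

text \<open>
  \<open>cond_mean M w y k\<close> is \<open>y'\<^sub>k\<^sub>+\<^sub>1\<close> (for the adjoint state, \<open>p'\<^sub>k\<^sub>+\<^sub>1\<close>) and \<open>cond_corr M w y k\<close> is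
  \<open>z'\<^sub>k\<^sub>+\<^sub>1\<close> (for the adjoint state, \<open>q'\<^sub>k\<^sub>+\<^sub>1\<close>).
\<close>

definition cond_mean ::
  "'w measure \<Rightarrow> (nat \<Rightarrow> 'w \<Rightarrow> real) \<Rightarrow> (nat \<Rightarrow> 'w \<Rightarrow> real^'n) \<Rightarrow> nat \<Rightarrow> 'w \<Rightarrow> real^'n" where
  "cond_mean M w y k = vec_cond_exp M (filt M w k) (y (Suc k))"

definition cond_corr ::
  "'w measure \<Rightarrow> (nat \<Rightarrow> 'w \<Rightarrow> real) \<Rightarrow> (nat \<Rightarrow> 'w \<Rightarrow> real^'n) \<Rightarrow> nat \<Rightarrow> 'w \<Rightarrow> real^'n" where
  "cond_corr M w y k = vec_cond_exp M (filt M w k) (\<lambda>\<omega>. w k \<omega> *\<^sub>R y (Suc k) \<omega>)"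

text \<open>
  Processes are functions on all of \<open>nat\<close>; their values outside the index set \<open>I\<close> are irrelevant.
\<close>

definition L2F ::
  "'w measure \<Rightarrow> (nat \<Rightarrow> 'w \<Rightarrow> real) \<Rightarrow> nat set \<Rightarrow> (nat \<Rightarrow> 'w \<Rightarrow> 'h::euclidean_space) set" where
  "L2F M w I = {f. (\<forall>k\<in>I. f k \<in> borel_measurable (filt M w k)) \<and>
                   integrable M (\<lambda>\<omega>. \<Sum>k\<in>I. (norm (f k \<omega>))\<^sup>2)}"

definition LinfF ::
  "'w measure \<Rightarrow> (nat \<Rightarrow> 'w \<Rightarrow> real) \<Rightarrow> nat set \<Rightarrow> (nat \<Rightarrow> 'w \<Rightarrow> 'h::euclidean_space) set" where
  "LinfF M w I = {f. (\<forall>k\<in>I. f k \<in> borel_measurable (filt M w k)) \<and>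
                     (\<exists>K. \<forall>k\<in>I. AE \<omega> in M. norm (f k \<omega>) \<le> K)}"

definition controls ::
  "'w measure \<Rightarrow> nat \<Rightarrow> (nat \<Rightarrow> 'w \<Rightarrow> real) \<Rightarrow> (nat \<Rightarrow> (real^'m) set) \<Rightarrow>
    (nat \<Rightarrow> 'w \<Rightarrow> real^'m) set" where
  "controls M N w U = {u. u \<in> L2F M w {..<N} \<and> (\<forall>k<N. \<forall>\<omega>\<in>space M. u k \<omega> \<in> U k)}"

section \<open>State equation and cost\<close>

text \<open>
  The coefficients \<open>b, \<sigma>, f, l, \<Phi>, \<varphi>, \<Lambda>, \<gamma>\<close> of the control problem, in this order.
\<close>

record ('w, 'n::finite, 'm::finite) system =
  drift :: "nat \<Rightarrow> real^'n \<Rightarrow> real^'n \<Rightarrow> real^'n \<Rightarrow> real^'m \<Rightarrow> 'w \<Rightarrow> real^'n"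
  diffusion :: "nat \<Rightarrow> real^'n \<Rightarrow> real^'n \<Rightarrow> real^'n \<Rightarrow> real^'m \<Rightarrow> 'w \<Rightarrow> real^'n"
  backward :: "nat \<Rightarrow> real^'n \<Rightarrow> real^'n \<Rightarrow> real^'n \<Rightarrow> real^'m \<Rightarrow> 'w \<Rightarrow> real^'n"
  run_cost :: "nat \<Rightarrow> real^'n \<Rightarrow> real^'n \<Rightarrow> real^'n \<Rightarrow> real^'m \<Rightarrow> 'w \<Rightarrow> real"
  end_map :: "'w \<Rightarrow> real^'n \<Rightarrow> real^'n"
  end_cost :: "'w \<Rightarrow> real^'n \<Rightarrow> real"
  init_map :: "real^'n \<Rightarrow> real^'n"
  init_cost :: "real^'n \<Rightarrow> real"

definition state_solution ::
  "('w, 'n::finite, 'm::finite) system \<Rightarrow> 'w measure \<Rightarrow> nat \<Rightarrow> (nat \<Rightarrow> 'w \<Rightarrow> real) \<Rightarrow>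
    (nat \<Rightarrow> 'w \<Rightarrow> real^'m) \<Rightarrow> (nat \<Rightarrow> 'w \<Rightarrow> real^'n) \<Rightarrow> (nat \<Rightarrow> 'w \<Rightarrow> real^'n) \<Rightarrow> bool" where
  "state_solution S M N w u x y \<longleftrightarrow>
     x \<in> L2F M w {..N} \<and> y \<in> L2F M w {..N} \<and>
     (\<forall>k<N. AE \<omega> in M.
        x (Suc k) \<omega> =
          drift S k (x k \<omega>) (cond_mean M w y k \<omega>) (cond_corr M w y k \<omega>) (u k \<omega>) \<omega> +
          w k \<omega> *\<^sub>R
          diffusion S k (x k \<omega>) (cond_mean M w y k \<omega>) (cond_corr M w y k \<omega>) (u k \<omega>) \<omega>) \<and>
     (\<forall>k<N. AE \<omega> in M.
        y k \<omega> =
          - backward S (Suc k) (x k \<omega>) (cond_mean M w y k \<omega>) (cond_corr M w y k \<omega>) (u k \<omega>) \<omega>) \<and>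
     (AE \<omega> in M. x 0 \<omega> = init_map S (y 0 \<omega>)) \<and>
     (AE \<omega> in M. y N \<omega> = end_map S \<omega> (x N \<omega>))"

definition trajectory_cost ::
  "('w, 'n::finite, 'm::finite) system \<Rightarrow> 'w measure \<Rightarrow> nat \<Rightarrow> (nat \<Rightarrow> 'w \<Rightarrow> real) \<Rightarrow>
    (nat \<Rightarrow> 'w \<Rightarrow> real^'m) \<Rightarrow> (nat \<Rightarrow> 'w \<Rightarrow> real^'n) \<Rightarrow> (nat \<Rightarrow> 'w \<Rightarrow> real^'n) \<Rightarrow> real" where
  "trajectory_cost S M N w u x y =
     (LINT \<omega>|M. end_cost S \<omega> (x N \<omega>) + init_cost S (y 0 \<omega>) +
        (\<Sum>k<N. run_cost S k (x k \<omega>) (cond_mean M w y k \<omega>) (cond_corr M w y k \<omega>) (u k \<omega>) \<omega>))"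

text \<open>
  The functional \<open>J\<close>. The state equation determines the trajectory only up to null sets, so some
  solution is chosen; the cost does not depend on the choice.
\<close>

definition cost ::
  "('w, 'n::finite, 'm::finite) system \<Rightarrow> 'w measure \<Rightarrow> nat \<Rightarrow> (nat \<Rightarrow> 'w \<Rightarrow> real) \<Rightarrow>
    (nat \<Rightarrow> 'w \<Rightarrow> real^'m) \<Rightarrow> real" where
  "cost S M N w u =
     (let (x, y) = (SOME (x, y). state_solution S M N w u x y) in trajectory_cost S M N w u x y)"

section \<open>Assumptions on the data\<close>

definition terminal_data ::
  "('w, 'n::finite, 'm::finite) system \<Rightarrow> 'w measure \<Rightarrow> nat \<Rightarrow> (nat \<Rightarrow> 'w \<Rightarrow> real) \<Rightarrow> bool" where
  "terminal_data S M N w \<longleftrightarrow>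
    (\<forall>x. (\<lambda>\<omega>. end_map S \<omega> x) \<in> borel_measurable (filt M w N) \<and>
         integrable M (\<lambda>\<omega>. (norm (end_map S \<omega> x))\<^sup>2) \<and>
         (\<lambda>\<omega>. end_cost S \<omega> x) \<in> borel_measurable (filt M w N) \<and>
         integrable M (\<lambda>\<omega>. (end_cost S \<omega> x)\<^sup>2))"

definition C1 :: "('a::real_normed_vector \<Rightarrow> 'b::real_normed_vector) \<Rightarrow> bool" where
  "C1 g \<longleftrightarrow> (\<exists>D :: 'a \<Rightarrow> 'a \<Rightarrow>\<^sub>L 'b.
     (\<forall>a. (g has_derivative blinfun_apply (D a)) (at a)) \<and> continuous_on UNIV D)"

definition dnorm :: "('a::real_normed_vector \<Rightarrow> 'b::real_normed_vector) \<Rightarrow> 'a \<Rightarrow> real" where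
  "dnorm g a = onorm (frechet_derivative g (at a))"

text \<open>
  Assumption (A). The running cost is allowed to be random; it is then required to be adapted like
  the other coefficients. A deterministic \<open>l\<close> is the special case of a constant in \<open>\<omega>\<close>.
\<close>

definition assumption_A ::
  "('w, 'n::finite, 'm::finite) system \<Rightarrow> 'w measure \<Rightarrow> nat \<Rightarrow> (nat \<Rightarrow> 'w \<Rightarrow> real) \<Rightarrow>
    (nat \<Rightarrow> (real^'m) set) \<Rightarrow> bool" where
  "assumption_A S M N w U \<longleftrightarrow>
    (\<forall>k<N. \<forall>x y z. \<forall>u\<in>U k.
       drift S k x y z u \<in> borel_measurable (filt M w k) \<and>
       diffusion S k x y z u \<in> borel_measurable (filt M w k) \<and>
       backward S (Suc k) x y z u \<in> borel_measurable (filt M w k) \<and>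
       run_cost S k x y z u \<in> borel_measurable (filt M w k)) \<and>
    (\<lambda>k. drift S k 0 0 0 0) \<in> L2F M w {..<N} \<and>
    (\<lambda>k. diffusion S k 0 0 0 0) \<in> L2F M w {..<N} \<and>
    (\<lambda>k. backward S (Suc k) 0 0 0 0) \<in> L2F M w {..<N} \<and>
    (\<exists>K. \<forall>k<N. \<forall>\<omega>\<in>space M. \<forall>h\<in>{drift S k, diffusion S k, backward S (Suc k)}.
       C1 (\<lambda>(x, y, z, u). h x y z u \<omega>) \<and>
       (\<forall>a. dnorm (\<lambda>(x, y, z, u). h x y z u \<omega>) a \<le> K)) \<and>
    (\<forall>k<N. \<forall>\<omega>\<in>space M. C1 (\<lambda>(x, y, z, u). run_cost S k x y z u \<omega>)) \<and>
    (\<forall>\<omega>\<in>space M. C1 (end_map S \<omega>) \<and> C1 (end_cost S \<omega>)) \<and>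
    C1 (init_map S) \<and> C1 (init_cost S) \<and>
    (\<exists>C>0.
       (\<forall>k<N. \<forall>\<omega>\<in>space M. \<forall>x y z u.
          \<bar>run_cost S k x y z u \<omega>\<bar>
            \<le> C * (1 + (norm x)\<^sup>2 + (norm y)\<^sup>2 + (norm z)\<^sup>2 + (norm u)\<^sup>2) \<and>
          dnorm (\<lambda>x. run_cost S k x y z u \<omega>) x \<le> C * (1 + norm x + norm y + norm z + norm u) \<and>
          dnorm (\<lambda>y. run_cost S k x y z u \<omega>) y \<le> C * (1 + norm x + norm y + norm z + norm u) \<and>
          dnorm (\<lambda>z. run_cost S k x y z u \<omega>) z \<le> C * (1 + norm x + norm y + norm z + norm u) \<and>
          dnorm (\<lambda>u. run_cost S k x y z u \<omega>) u \<le> C * (1 + norm x + norm y + norm z + norm u)) \<and>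
       (\<forall>\<omega>\<in>space M. \<forall>x. dnorm (end_map S \<omega>) x \<le> C * (1 + norm x) \<and>
                        dnorm (end_cost S \<omega>) x \<le> C * (1 + norm x)) \<and>
       (\<forall>y. dnorm (init_map S) y \<le> C * (1 + norm y) \<and>
            dnorm (init_cost S) y \<le> C * (1 + norm y)))"

definition Gamma_map ::
  "('w, 'n::finite, 'm::finite) system \<Rightarrow> nat \<Rightarrow> real^'n \<Rightarrow> real^'n \<Rightarrow> real^'n \<Rightarrow> real^'m \<Rightarrow> 'w \<Rightarrow>
    (real^'n) \<times> (real^'n) \<times> (real^'n)" where
  "Gamma_map S k x y z u \<omega> =
     (backward S (Suc k) x y z u \<omega>, drift S k x y z u \<omega>, diffusion S k x y z u \<omega>)"

text \<open>
  The two monotonicity conditions of Assumption (B)(iii) are alternatives for the whole system, not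
  pointwise in \<open>k\<close>, \<open>\<omega>\<close> and the arguments.
\<close>

definition monotone_1 ::
  "('w, 'n::finite, 'm::finite) system \<Rightarrow> 'w measure \<Rightarrow> nat \<Rightarrow> (nat \<Rightarrow> (real^'m) set) \<Rightarrow>
    real \<Rightarrow> real \<Rightarrow> real^'n^'mt \<Rightarrow> ('w \<Rightarrow> real^'n^'mt) \<Rightarrow>
    (nat \<Rightarrow> 'w \<Rightarrow> real^'n^'m) \<Rightarrow> (nat \<Rightarrow> 'w \<Rightarrow> real^'n^'m) \<Rightarrow> (nat \<Rightarrow> 'w \<Rightarrow> real^'n^'m) \<Rightarrow> bool" where
  "monotone_1 S M N U \<mu> \<nu> M0 G A B C \<longleftrightarrow>
    (\<forall>y y'. (init_map S y - init_map S y') \<bullet> (y - y') \<le> - \<mu> * (norm (M0 *v (y - y')))\<^sup>2) \<and>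
    (AE \<omega> in M. \<forall>x x'.
       (end_map S \<omega> x - end_map S \<omega> x') \<bullet> (x - x') \<ge> \<nu> * (norm (G \<omega> *v (x - x')))\<^sup>2) \<and>
    (\<forall>k<N. AE \<omega> in M. \<forall>u\<in>U k. \<forall>x x' y y' z z'.
       (Gamma_map S k x y z u \<omega> - Gamma_map S k x' y' z' u \<omega>) \<bullet> (x - x', y - y', z - z')
         \<le> - \<nu> * (norm (A k \<omega> *v (x - x')))\<^sup>2
           - \<mu> * (norm (B k \<omega> *v (y - y') + C k \<omega> *v (z - z')))\<^sup>2)"

definition monotone_2 ::
  "('w, 'n::finite, 'm::finite) system \<Rightarrow> 'w measure \<Rightarrow> nat \<Rightarrow> (nat \<Rightarrow> (real^'m) set) \<Rightarrow>
    real \<Rightarrow> real \<Rightarrow> real^'n^'mt \<Rightarrow> ('w \<Rightarrow> real^'n^'mt) \<Rightarrow>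
    (nat \<Rightarrow> 'w \<Rightarrow> real^'n^'m) \<Rightarrow> (nat \<Rightarrow> 'w \<Rightarrow> real^'n^'m) \<Rightarrow> (nat \<Rightarrow> 'w \<Rightarrow> real^'n^'m) \<Rightarrow> bool" where
  "monotone_2 S M N U \<mu> \<nu> M0 G A B C \<longleftrightarrow>
    (\<forall>y y'. (init_map S y - init_map S y') \<bullet> (y - y') \<ge> \<mu> * (norm (M0 *v (y - y')))\<^sup>2) \<and>
    (AE \<omega> in M. \<forall>x x'.
       (end_map S \<omega> x - end_map S \<omega> x') \<bullet> (x - x') \<le> - \<nu> * (norm (G \<omega> *v (x - x')))\<^sup>2) \<and>
    (\<forall>k<N. AE \<omega> in M. \<forall>u\<in>U k. \<forall>x x' y y' z z'.
       (Gamma_map S k x y z u \<omega> - Gamma_map S k x' y' z' u \<omega>) \<bullet> (x - x', y - y', z - z')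
         \<ge> \<nu> * (norm (A k \<omega> *v (x - x')))\<^sup>2
           + \<mu> * (norm (B k \<omega> *v (y - y') + C k \<omega> *v (z - z')))\<^sup>2)"

text \<open>
  Assumption (B). The bounds with coefficient \<open>1/\<mu>\<close> and \<open>1/\<nu>\<close> are void when the denominator is
  \<open>0\<close>, so they carry explicit guards (in HOL, \<open>1/0 = 0\<close> would turn them into strong conditions).
\<close>

definition assumption_B ::
  "('w, 'n::finite, 'm::finite) system \<Rightarrow> 'w measure \<Rightarrow> nat \<Rightarrow> (nat \<Rightarrow> 'w \<Rightarrow> real) \<Rightarrow>
    (nat \<Rightarrow> (real^'m) set) \<Rightarrow>
    real \<Rightarrow> real \<Rightarrow> real^'n^'mt \<Rightarrow> ('w \<Rightarrow> real^'n^'mt) \<Rightarrow>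
    (nat \<Rightarrow> 'w \<Rightarrow> real^'n^'m) \<Rightarrow> (nat \<Rightarrow> 'w \<Rightarrow> real^'n^'m) \<Rightarrow> (nat \<Rightarrow> 'w \<Rightarrow> real^'n^'m) \<Rightarrow> bool" where
  "assumption_B S M N w U \<mu> \<nu> M0 G A B C \<longleftrightarrow>
    G \<in> borel_measurable (filt M w N) \<and> (\<exists>K. AE \<omega> in M. norm (G \<omega>) \<le> K) \<and>
    A \<in> LinfF M w {..<N} \<and> B \<in> LinfF M w {..<N} \<and> C \<in> LinfF M w {..<N} \<and>
    (\<mu> > 0 \<and> \<nu> = 0 \<or> \<mu> = 0 \<and> \<nu> > 0) \<and>
    (\<mu> > 0 \<longrightarrow>
       (\<forall>y y'. norm (init_map S y - init_map S y') \<le> 1 / \<mu> * norm (M0 *v (y - y'))) \<and>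
       (\<forall>k<N. AE \<omega> in M. \<forall>u\<in>U k. \<forall>x y y' z z'. \<forall>h\<in>{drift S k, diffusion S k}.
          norm (h x y z u \<omega> - h x y' z' u \<omega>)
            \<le> 1 / \<mu> * norm (B k \<omega> *v (y - y') + C k \<omega> *v (z - z')))) \<and>
    (\<nu> > 0 \<longrightarrow>
       (AE \<omega> in M. \<forall>x x'. norm (end_map S \<omega> x - end_map S \<omega> x') \<le> 1 / \<nu> * norm (G \<omega> *v (x - x'))) \<and>
       (\<forall>k<N. AE \<omega> in M. \<forall>u\<in>U k. \<forall>x x' y z.
          norm (backward S (Suc k) x y z u \<omega> - backward S (Suc k) x' y z u \<omega>)
            \<le> 1 / \<nu> * norm (A k \<omega> *v (x - x')))) \<and>
    (monotone_1 S M N U \<mu> \<nu> M0 G A B C \<or> monotone_2 S M N U \<mu> \<nu> M0 G A B C)"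

text \<open>
  For \<open>\<nu> > 0\<close> Assumption (B) makes the terminal map \<open>\<Phi>\<close> Lipschitz. For \<open>\<nu> = 0\<close> Assumptions (A) and
  (B) only give \<open>\<bar>\<Phi>\<^sub>x(x)\<bar> \<le> C(1 + \<bar>x\<bar>)\<close>, so that \<open>\<Phi>(x\<^sub>N)\<close> need not be square integrable for
  square integrable \<open>x\<^sub>N\<close> and the state equation need not have a solution with \<open>y\<^sub>N\<close> in \<open>L\<^sup>2\<close>.
  The well-posedness of the state equation requires \<open>\<Phi>\<close> to be Lipschitz uniformly in \<open>\<omega>\<close> in that
  case, too.
\<close>

definition lipschitz_end_map ::
  "('w, 'n::finite, 'm::finite) system \<Rightarrow> 'w measure \<Rightarrow> bool" where
  "lipschitz_end_map S M \<longleftrightarrow>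
     (\<exists>L. AE \<omega> in M. \<forall>x x'. norm (end_map S \<omega> x - end_map S \<omega> x') \<le> L * norm (x - x'))"

section \<open>Hamiltonian and adjoint equation\<close>

definition hamiltonian ::
  "('w, 'n::finite, 'm::finite) system \<Rightarrow> nat \<Rightarrow> real^'n \<Rightarrow> real^'n \<Rightarrow> real^'n \<Rightarrow> real^'m \<Rightarrow>
    real^'n \<Rightarrow> real^'n \<Rightarrow> real^'n \<Rightarrow> 'w \<Rightarrow> real" where
  "hamiltonian S k x y z u p q r \<omega> =
     drift S k x y z u \<omega> \<bullet> p + diffusion S k x y z u \<omega> \<bullet> q + backward S (Suc k) x y z u \<omega> \<bullet> r +
     run_cost S k x y z u \<omega>"

definition gradient :: "(real^'d \<Rightarrow> real) \<Rightarrow> real^'d \<Rightarrow> real^'d" where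
  "gradient g a = (\<chi> i. frechet_derivative g (at a) (axis i 1))"

definition ham_x where
  "ham_x S k x y z u p q r \<omega> = gradient (\<lambda>x. hamiltonian S k x y z u p q r \<omega>) x"

definition ham_y where
  "ham_y S k x y z u p q r \<omega> = gradient (\<lambda>y. hamiltonian S k x y z u p q r \<omega>) y"

definition ham_z where
  "ham_z S k x y z u p q r \<omega> = gradient (\<lambda>z. hamiltonian S k x y z u p q r \<omega>) z"

definition ham_u where
  "ham_u S k x y z u p q r \<omega> = gradient (\<lambda>u. hamiltonian S k x y z u p q r \<omega>) u"

text \<open>
  \<open>along M w u x y p r h k\<close> evaluates \<open>h\<close> (one of the partial gradients of the Hamiltonian) at
  \<open>(k, x\<^sub>k, y'\<^sub>k\<^sub>+\<^sub>1, z'\<^sub>k\<^sub>+\<^sub>1, u\<^sub>k, p'\<^sub>k\<^sub>+\<^sub>1, q'\<^sub>k\<^sub>+\<^sub>1, r\<^sub>k)\<close>.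
\<close>

definition along ::
  "'w measure \<Rightarrow> (nat \<Rightarrow> 'w \<Rightarrow> real) \<Rightarrow> (nat \<Rightarrow> 'w \<Rightarrow> real^'m) \<Rightarrow>
    (nat \<Rightarrow> 'w \<Rightarrow> real^'n) \<Rightarrow> (nat \<Rightarrow> 'w \<Rightarrow> real^'n) \<Rightarrow>
    (nat \<Rightarrow> 'w \<Rightarrow> real^'n) \<Rightarrow> (nat \<Rightarrow> 'w \<Rightarrow> real^'n) \<Rightarrow>
    (nat \<Rightarrow> real^'n \<Rightarrow> real^'n \<Rightarrow> real^'n \<Rightarrow> real^'m \<Rightarrow> real^'n \<Rightarrow> real^'n \<Rightarrow> real^'n \<Rightarrow> 'w \<Rightarrow> 'c) \<Rightarrow>
    nat \<Rightarrow> 'w \<Rightarrow> 'c" where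
  "along M w u x y p r h k \<omega> =
     h k (x k \<omega>) (cond_mean M w y k \<omega>) (cond_corr M w y k \<omega>) (u k \<omega>)
       (cond_mean M w p k \<omega>) (cond_corr M w p k \<omega>) (r k \<omega>) \<omega>"

definition adjoint_solution ::
  "('w, 'n::finite, 'm::finite) system \<Rightarrow> 'w measure \<Rightarrow> nat \<Rightarrow> (nat \<Rightarrow> 'w \<Rightarrow> real) \<Rightarrow>
    (nat \<Rightarrow> 'w \<Rightarrow> real^'m) \<Rightarrow> (nat \<Rightarrow> 'w \<Rightarrow> real^'n) \<Rightarrow> (nat \<Rightarrow> 'w \<Rightarrow> real^'n) \<Rightarrow>
    (nat \<Rightarrow> 'w \<Rightarrow> real^'n) \<Rightarrow> (nat \<Rightarrow> 'w \<Rightarrow> real^'n) \<Rightarrow> bool" where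
  "adjoint_solution S M N w u x y p r \<longleftrightarrow>
     p \<in> L2F M w {..N} \<and> r \<in> L2F M w {..N} \<and>
     (\<forall>k<N. AE \<omega> in M.
        r (Suc k) \<omega> =
          - along M w u x y p r (ham_y S) k \<omega> - w k \<omega> *\<^sub>R along M w u x y p r (ham_z S) k \<omega>) \<and>
     (\<forall>k<N. AE \<omega> in M. p k \<omega> = along M w u x y p r (ham_x S) k \<omega>) \<and>
     (AE \<omega> in M. r 0 \<omega> =
        - gradient (init_cost S) (y 0 \<omega>) - transpose (jacobian (init_map S) (at (y 0 \<omega>))) *v p 0 \<omega>) \<and>
     (AE \<omega> in M. p N \<omega> =
        gradient (end_cost S \<omega>) (x N \<omega>) - transpose (jacobian (end_map S \<omega>) (at (x N \<omega>))) *v r N \<omega>)"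

definition perturbed ::
  "nat \<Rightarrow> (nat \<Rightarrow> 'w \<Rightarrow> real^'m) \<Rightarrow> (nat \<Rightarrow> 'w \<Rightarrow> real^'m) \<Rightarrow> real \<Rightarrow> nat \<Rightarrow> 'w \<Rightarrow> real^'m" where
  "perturbed s us u \<epsilon> k \<omega> = us k \<omega> + (if k = s then \<epsilon> *\<^sub>R (u k \<omega> - us k \<omega>) else 0)"

end

theory Submission
  imports Defs
begin

text \<open>
  No variational equation is needed. Let \<open>(x, y)\<close> be the state for \<open>u\<^sup>\<epsilon>\<close>. Summing the increments of
  \<open>E(\<langle>p\<^sub>k, x\<^sub>k - x\<^sup>*\<^sub>k\<rangle> + \<langle>r\<^sub>k, y\<^sub>k - y\<^sup>*\<^sub>k\<rangle>)\<close> and inserting the adjoint equation gives exactly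
  \<open>J(u\<^sup>\<epsilon>) - J(u\<^sup>*) = \<epsilon> E\<langle>H\<^sub>u(s), u\<^sub>s - u\<^sup>*\<^sub>s\<rangle>\<close> plus the expected first order Taylor remainders of the
  Hamiltonians, of \<open>\<phi> - \<langle>r\<^sub>N, \<Phi>\<rangle>\<close> at \<open>x\<^sup>*\<^sub>N\<close> and of \<open>\<gamma> + \<langle>p\<^sub>0, \<Lambda>\<rangle>\<close> at \<open>y\<^sup>*\<^sub>0\<close>. Monotonicity makes the
  state depend on the control in such a way that all increments are \<open>O(\<epsilon>)\<close> in \<open>L\<^sup>2\<close>, so the
  remainders are \<open>o(\<epsilon>)\<close> by dominated convergence.

  The cost is defined through some solution of the state equation, so solvability for \<open>u\<^sup>\<epsilon>\<close> has to be
  shown as well: with \<open>x\<^sub>0\<close> frozen it follows by continuation in a scaling of the coefficients, and the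
  condition \<open>x\<^sub>0 = \<Lambda>(y\<^sub>0)\<close> is then a finite-dimensional fixed point problem, since \<open>y\<^sub>0\<close> is constant.
  It is solved by Brouwer's theorem because \<open>\<Lambda>\<close> need not be Lipschitz.
\<close>

section \<open>Square integrable functions\<close>

text \<open>The parameter that is positive decides the order of integration. For
  \<open>\<mu> > 0\<close> the forward coefficients depend on \<open>(y', z')\<close> only through
  the monotonicity defect, so the forward state is bounded first; for \<open>\<nu> > 0\<close> the
  backward coefficient and the terminal map depend on \<open>x\<close> only through the defect, so
  the backward state comes first. Either way Gronwall bounds the state by initial data, defect and
  residual, while the energy identity for E<x, y> bounds the defect by the residual and a small
  multiple of the state, up to the initial pairing; the two inequalities close. For
  \<open>\<nu> > 0\<close> the initial map contributes a term of higher order, which can be absorbed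
  only if the residual is small; this suffices as \<epsilon> tends to 0. An O(\<epsilon>) bound in
  L2 gives no pointwise majorant, but along sequences with \<epsilon>(n) at most 4^-n it does. Hence
  the limit is shown by contradiction along such sequences. No moment of the noise beyond the second
  enters: conditional variance 1 makes multiplication by \<open>w k\<close> an L2 isometry on
  adapted functions, so \<open>cond_corr\<close> is its adjoint and a contraction.\<close>

definition sqint :: "'w measure \<Rightarrow> ('w \<Rightarrow> 'v::euclidean_space) \<Rightarrow> bool" where
  "sqint M f \<longleftrightarrow> f \<in> borel_measurable M \<and> integrable M (\<lambda>\<omega>. (norm (f \<omega>))\<^sup>2)"

definition sqn :: "'w measure \<Rightarrow> ('w \<Rightarrow> 'v::euclidean_space) \<Rightarrow> real" where
  "sqn M f = (LINT \<omega>|M. (norm (f \<omega>))\<^sup>2)"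

lemma sqintD [dest]:
  assumes "sqint M f"
  shows "f \<in> borel_measurable M" "integrable M (\<lambda>\<omega>. (norm (f \<omega>))\<^sup>2)"
  using assms by (auto simp: sqint_def)

lemma sqn_nonneg [simp]: "0 \<le> sqn M f"
  by (simp add: sqn_def)

lemma norm_add_sq_le:
  fixes a b :: "'v::real_normed_vector"
  shows "(norm (a + b))\<^sup>2 \<le> 2 * (norm a)\<^sup>2 + 2 * (norm b)\<^sup>2"
proof -
  have "(norm (a + b))\<^sup>2 \<le> (norm a + norm b)\<^sup>2"
    by (intro power_mono norm_triangle_ineq) auto
  also have "\<dots> \<le> 2 * (norm a)\<^sup>2 + 2 * (norm b)\<^sup>2"
    using sum_squares_bound[of "norm a" "norm b"] by (simp add: power2_sum)
  finally show ?thesis .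
qed

lemma sqint_bound:
  assumes "integrable M g" "f \<in> borel_measurable M" "AE \<omega> in M. (norm (f \<omega>))\<^sup>2 \<le> g \<omega>"
  shows "sqint M f" "sqn M f \<le> (LINT \<omega>|M. g \<omega>)"
proof -
  show *: "sqint M f"
    unfolding sqint_def
    using assms by (auto intro!: Bochner_Integration.integrable_bound[OF assms(1)] elim!: AE_mp)
  show "sqn M f \<le> (LINT \<omega>|M. g \<omega>)"
    unfolding sqn_def using * assms by (intro integral_mono_AE) auto
qed

lemma sqint_add:
  assumes "sqint M f" "sqint M g"
  shows "sqint M (\<lambda>\<omega>. f \<omega> + g \<omega>)" "sqn M (\<lambda>\<omega>. f \<omega> + g \<omega>) \<le> 2 * sqn M f + 2 * sqn M g"
proof -
  have [measurable]: "f \<in> borel_measurable M" "g \<in> borel_measurable M"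
    and i: "integrable M (\<lambda>\<omega>. (norm (f \<omega>))\<^sup>2)" "integrable M (\<lambda>\<omega>. (norm (g \<omega>))\<^sup>2)"
    using assms by auto
  have I: "integrable M (\<lambda>\<omega>. 2 * (norm (f \<omega>))\<^sup>2 + 2 * (norm (g \<omega>))\<^sup>2)"
    using i by auto
  have B: "AE \<omega> in M. (norm (f \<omega> + g \<omega>))\<^sup>2 \<le> 2 * (norm (f \<omega>))\<^sup>2 + 2 * (norm (g \<omega>))\<^sup>2"
    using norm_add_sq_le by blast
  show "sqint M (\<lambda>\<omega>. f \<omega> + g \<omega>)"
    by (rule sqint_bound[OF I _ B]) simp
  have "sqn M (\<lambda>\<omega>. f \<omega> + g \<omega>) \<le> (LINT \<omega>|M. 2 * (norm (f \<omega>))\<^sup>2 + 2 * (norm (g \<omega>))\<^sup>2)"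
    by (rule sqint_bound[OF I _ B]) simp
  also have "\<dots> = 2 * sqn M f + 2 * sqn M g"
    unfolding sqn_def using i by simp
  finally show "sqn M (\<lambda>\<omega>. f \<omega> + g \<omega>) \<le> 2 * sqn M f + 2 * sqn M g" .
qed

lemma sqint_scaleR:
  assumes "sqint M f"
  shows "sqint M (\<lambda>\<omega>. c *\<^sub>R f \<omega>)" "sqn M (\<lambda>\<omega>. c *\<^sub>R f \<omega>) = c\<^sup>2 * sqn M f"
  using assms by (auto simp: sqint_def sqn_def power_mult_distrib)

lemma sqint_minus:
  assumes "sqint M f"
  shows "sqint M (\<lambda>\<omega>. - f \<omega>)" "sqn M (\<lambda>\<omega>. - f \<omega>) = sqn M f"
  using assms by (auto simp: sqint_def sqn_def)

lemma sqint_diff: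
  assumes "sqint M f" "sqint M g"
  shows "sqint M (\<lambda>\<omega>. f \<omega> - g \<omega>)" "sqn M (\<lambda>\<omega>. f \<omega> - g \<omega>) \<le> 2 * sqn M f + 2 * sqn M g"
  using sqint_add[OF assms(1) sqint_minus(1)[OF assms(2)]] sqint_minus(2)[OF assms(2)] by auto

lemma sqn_commute: "sqn M (\<lambda>\<omega>. f \<omega> - g \<omega>) = sqn M (\<lambda>\<omega>. g \<omega> - f \<omega>)"
  by (simp add: sqn_def norm_minus_commute)

lemma sqn_cong_AE:
  assumes "f \<in> borel_measurable M" "g \<in> borel_measurable M" "AE \<omega> in M. f \<omega> = g \<omega>"
  shows "sqn M f = sqn M g"
  unfolding sqn_def using assms by (intro integral_cong_AE) auto

lemma sqn_eq_0_iff: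
  assumes "sqint M f"
  shows "sqn M f = 0 \<longleftrightarrow> (AE \<omega> in M. f \<omega> = 0)"
  unfolding sqn_def using assms by (subst integral_nonneg_eq_0_iff_AE) auto

lemma abs_inner_le_sq: "\<bar>a \<bullet> b\<bar> \<le> ((norm a)\<^sup>2 + (norm b)\<^sup>2) / 2" for a b :: "'v::euclidean_space"
proof -
  have "\<bar>a \<bullet> b\<bar> \<le> norm a * norm b" by (rule Cauchy_Schwarz_ineq2)
  also have "\<dots> \<le> ((norm a)\<^sup>2 + (norm b)\<^sup>2) / 2"
    using sum_squares_bound[of "norm a" "norm b"] by simp
  finally show ?thesis .
qed

lemma sqint_inner:
  assumes "sqint M f" "sqint M g"
  shows "integrable M (\<lambda>\<omega>. f \<omega> \<bullet> g \<omega>)"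
proof -
  have [measurable]: "f \<in> borel_measurable M" "g \<in> borel_measurable M"
    and i: "integrable M (\<lambda>\<omega>. (norm (f \<omega>))\<^sup>2)" "integrable M (\<lambda>\<omega>. (norm (g \<omega>))\<^sup>2)"
    using assms by auto
  have "integrable M (\<lambda>\<omega>. ((norm (f \<omega>))\<^sup>2 + (norm (g \<omega>))\<^sup>2) / 2)"
    using i by auto
  then show ?thesis
  proof (rule Bochner_Integration.integrable_bound)
    show "AE \<omega> in M. norm (f \<omega> \<bullet> g \<omega>) \<le> norm (((norm (f \<omega>))\<^sup>2 + (norm (g \<omega>))\<^sup>2) / 2)"
      by (intro AE_I2) (simp add: abs_inner_le_sq[simplified])
  qed simp
qed

text \<open>The weight \<open>t\<close> stays free: it is taken small to absorb the norm of the
  state, or optimised to recover a geometric mean.\<close>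

lemma young_integral:
  assumes "sqint M f" "sqint M g" "t > 0"
  shows "\<bar>LINT \<omega>|M. f \<omega> \<bullet> g \<omega>\<bar> \<le> t * sqn M f + sqn M g / (4 * t)"
proof -
  have i: "integrable M (\<lambda>\<omega>. (norm (f \<omega>))\<^sup>2)" "integrable M (\<lambda>\<omega>. (norm (g \<omega>))\<^sup>2)"
    using assms by auto
  have *: "\<bar>a \<bullet> b\<bar> \<le> t * (norm a)\<^sup>2 + (norm b)\<^sup>2 / (4 * t)" for a b :: 'b
  proof -
    have "\<bar>a \<bullet> b\<bar> \<le> norm a * norm b" by (rule Cauchy_Schwarz_ineq2)
    moreover have "0 \<le> (2 * t * norm a - norm b)\<^sup>2 / (4 * t)" using assms by simp
    moreover have "(2 * t * norm a - norm b)\<^sup>2 / (4 * t)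
        = t * (norm a)\<^sup>2 + (norm b)\<^sup>2 / (4 * t) - norm a * norm b"
      using assms(3) by (simp add: field_simps power2_eq_square)
    ultimately show ?thesis by linarith
  qed
  have "\<bar>LINT \<omega>|M. f \<omega> \<bullet> g \<omega>\<bar> \<le> (LINT \<omega>|M. \<bar>f \<omega> \<bullet> g \<omega>\<bar>)"
    by (rule integral_abs_bound)
  also have "\<dots> \<le> (LINT \<omega>|M. t * (norm (f \<omega>))\<^sup>2 + (norm (g \<omega>))\<^sup>2 / (4 * t))"
    using i sqint_inner[OF assms(1,2)] * by (intro integral_mono) auto
  also have "\<dots> = t * sqn M f + sqn M g / (4 * t)"
    unfolding sqn_def using i by simp
  finally show ?thesis .
qed

lemma sqint_const [simp]: "finite_measure M \<Longrightarrow> sqint M (\<lambda>_. c)"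
  by (simp add: sqint_def finite_measure.integrable_const)

lemma sqint_imp_integrable:
  assumes "finite_measure M" "sqint M f"
  shows "integrable M f"
proof -
  have "integrable M (\<lambda>\<omega>. 1 + (norm (f \<omega>))\<^sup>2)"
    using assms by (auto intro!: finite_measure.integrable_const)
  moreover have "norm a \<le> norm (1 + (norm a)\<^sup>2)" for a :: 'b
    using sum_squares_bound[of "norm a" 1] by (smt (verit) norm_ge_zero power_one real_norm_def)
  ultimately show ?thesis
    using assms by (auto intro: Bochner_Integration.integrable_bound)
qed

lemma sqint_Pair:
  assumes "sqint M f" "sqint M g"
  shows "sqint M (\<lambda>\<omega>. (f \<omega>, g \<omega>))" "sqn M (\<lambda>\<omega>. (f \<omega>, g \<omega>)) = sqn M f + sqn M g"
  using assms by (auto simp: sqint_def sqn_def norm_Pair)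

lemma sqint_fst_snd:
  assumes "sqint M f"
  shows "sqint M (\<lambda>\<omega>. fst (f \<omega>))" "sqint M (\<lambda>\<omega>. snd (f \<omega>))"
    "sqn M f = sqn M (\<lambda>\<omega>. fst (f \<omega>)) + sqn M (\<lambda>\<omega>. snd (f \<omega>))"
proof -
  have [measurable]: "f \<in> borel_measurable M" and i: "integrable M (\<lambda>\<omega>. (norm (f \<omega>))\<^sup>2)"
    using assms by auto
  have eq: "(norm a)\<^sup>2 = (norm (fst a))\<^sup>2 + (norm (snd a))\<^sup>2" for a :: "'b \<times> 'c"
    by (cases a) (simp add: norm_Pair)
  show 1: "sqint M (\<lambda>\<omega>. fst (f \<omega>))" and 2: "sqint M (\<lambda>\<omega>. snd (f \<omega>))"
    using i by (auto intro!: sqint_bound(1)[OF i] borel_measurable_continuous_on[where f=fst and g=f]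
        borel_measurable_continuous_on[where f=snd and g=f] continuous_intros simp: eq)
  show "sqn M f = sqn M (\<lambda>\<omega>. fst (f \<omega>)) + sqn M (\<lambda>\<omega>. snd (f \<omega>))"
    unfolding sqn_def using sqintD(2)[OF 1] sqintD(2)[OF 2] by (simp add: eq)
qed

text \<open>Young's inequality with the optimal weight \<open>b / (2 * a)\<close>. If one of the
  norms vanishes there is no optimal weight, and the integrand is zero almost everywhere.\<close>

lemma cauchy_schwarz_integral:
  assumes "sqint M f" "sqint M g"
  shows "\<bar>LINT \<omega>|M. f \<omega> \<bullet> g \<omega>\<bar> \<le> sqrt (sqn M f) * sqrt (sqn M g)"
proof (cases "sqn M f = 0 \<or> sqn M g = 0")
  case True
  then have "(AE \<omega> in M. f \<omega> = 0) \<or> (AE \<omega> in M. g \<omega> = 0)"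
    using assms sqn_eq_0_iff by blast
  then have "AE \<omega> in M. f \<omega> \<bullet> g \<omega> = 0"
    by (elim disjE) (auto elim: eventually_mono)
  then have "(LINT \<omega>|M. f \<omega> \<bullet> g \<omega>) = (LINT \<omega>|M. 0)"
    using sqint_inner[OF assms] by (intro integral_cong_AE) auto
  then show ?thesis by simp
next
  case False
  then have pos: "sqn M f > 0" "sqn M g > 0"
    using sqn_nonneg by (metis less_eq_real_def)+
  define a b where "a = sqrt (sqn M f)" and "b = sqrt (sqn M g)"
  have ab: "a > 0" "b > 0" "sqn M f = a\<^sup>2" "sqn M g = b\<^sup>2"
    using pos by (auto simp: a_def b_def)
  have "\<bar>LINT \<omega>|M. f \<omega> \<bullet> g \<omega>\<bar> \<le> (b / (2 * a)) * a\<^sup>2 + b\<^sup>2 / (4 * (b / (2 * a)))"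
    using young_integral[OF assms, of "b / (2 * a)"] ab by simp
  also have "\<dots> = a * b"
    using ab by (simp add: field_simps power2_eq_square)
  finally show ?thesis by (simp add: a_def b_def)
qed

lemma sqint_vec:
  fixes f :: "'w \<Rightarrow> real^'n"
  shows "sqint M f \<longleftrightarrow> (\<forall>i. sqint M (\<lambda>\<omega>. f \<omega> $ i))"
    "sqint M f \<Longrightarrow> sqn M f = (\<Sum>i\<in>UNIV. sqn M (\<lambda>\<omega>. f \<omega> $ i))"
proof -
  have eq: "(norm a)\<^sup>2 = (\<Sum>i\<in>UNIV. (norm (a $ i))\<^sup>2)" for a :: "real^'n"
    by (simp add: norm_vec_def L2_set_def sum_nonneg)
  have le: "(norm (a $ i))\<^sup>2 \<le> (norm a)\<^sup>2" for a :: "real^'n" and i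
    by (intro power_mono component_le_norm_cart) (use component_le_norm_cart in auto)
  have 1: "sqint M (\<lambda>\<omega>. f \<omega> $ i)" if "sqint M f" for i
  proof (rule sqint_bound(1))
    show "integrable M (\<lambda>\<omega>. (norm (f \<omega>))\<^sup>2)" using that by auto
    show "(\<lambda>\<omega>. f \<omega> $ i) \<in> borel_measurable M"
      using that by (intro borel_measurable_continuous_on[where f="\<lambda>a. a $ i" and g=f] continuous_intros) auto
    show "AE \<omega> in M. (norm (f \<omega> $ i))\<^sup>2 \<le> (norm (f \<omega>))\<^sup>2" using le by blast
  qed
  have 2: "sqint M f" if "\<forall>i. sqint M (\<lambda>\<omega>. f \<omega> $ i)"
  proof (rule sqint_bound(1))
    show "integrable M (\<lambda>\<omega>. \<Sum>i\<in>UNIV. (norm (f \<omega> $ i))\<^sup>2)"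
      using that by (intro Bochner_Integration.integrable_sum) (simp add: sqint_def)
    show "f \<in> borel_measurable M"
      using that by (subst borel_measurable_euclidean_space)
        (auto simp: Basis_vec_def inner_axis dest!: sqintD(1))
  qed (auto simp: eq)
  show "sqint M f \<longleftrightarrow> (\<forall>i. sqint M (\<lambda>\<omega>. f \<omega> $ i))"
    using 1 2 by blast
  show "sqn M f = (\<Sum>i\<in>UNIV. sqn M (\<lambda>\<omega>. f \<omega> $ i))" if "sqint M f"
    unfolding sqn_def eq using sqintD(2)[OF 1[OF that]]
    by (subst Bochner_Integration.integral_sum) auto
qed

section \<open>The driving noise\<close>

lemma space_filt [simp]: "space (filt M w k) = space M"
  by (auto simp: filt_def space_measure_of_conv)

lemma sets_filt:
  "sets (filt M w k) = sigma_sets (space M) {w j -` A \<inter> space M | j A. j < k \<and> A \<in> sets borel}"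
  unfolding filt_def by (rule sets_measure_of) auto

lemma sets_filt_mono: "j \<le> k \<Longrightarrow> sets (filt M w j) \<subseteq> sets (filt M w k)"
  unfolding sets_filt by (intro sigma_sets_mono') (blast intro: less_le_trans)

lemma measurable_filt_mono:
  "j \<le> k \<Longrightarrow> f \<in> borel_measurable (filt M w j) \<Longrightarrow> f \<in> borel_measurable (filt M w k)"
  using sets_filt_mono[of j k M w] unfolding measurable_def by auto

lemma measurable_filt_self: "j < k \<Longrightarrow> w j \<in> borel_measurable (filt M w k)"
  by (auto simp: measurable_def sets_filt intro!: sigma_sets.Basic)

lemma sets_filt_0: "sets (filt M w 0) = {{}, space M}"
  by (simp add: sets_filt sigma_sets_empty_eq)

text \<open>The trivial sigma-algebra contains only the empty set and the whole space, so the
  constancy is pointwise and not merely almost sure. Initial values of adapted processes can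
  therefore be treated as fixed vectors.\<close>

lemma filt_0_constant:
  fixes f :: "'w \<Rightarrow> 'v::t1_space"
  assumes "f \<in> borel_measurable (filt M w 0)" "\<omega> \<in> space M" "\<omega>' \<in> space M"
  shows "f \<omega> = f \<omega>'"
proof -
  have "f -` {f \<omega>'} \<inter> space M \<in> sets (filt M w 0)"
    using measurable_sets[OF assms(1), of "{f \<omega>'}"] by simp
  then have "f -` {f \<omega>'} \<inter> space M = space M"
    using assms(3) by (auto simp: sets_filt_0)
  then show ?thesis using assms(2) by auto
qed

locale noise = prob_space M for M :: "'w measure" +
  fixes N :: nat and w :: "nat \<Rightarrow> 'w \<Rightarrow> real"
  assumes martingale_difference: "martingale_difference M N w"
begin

lemma noise_measurable: "k < N \<Longrightarrow> w k \<in> borel_measurable M"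
  and noise_sq_integrable: "k < N \<Longrightarrow> integrable M (\<lambda>\<omega>. (w k \<omega>)\<^sup>2)"
  and noise_variance: "k < N \<Longrightarrow> AE \<omega> in M. real_cond_exp M (filt M w k) (\<lambda>\<omega>. (w k \<omega>)\<^sup>2) \<omega> = 1"
  using martingale_difference unfolding martingale_difference_def by auto

lemma subalgebra_filt:
  assumes "k \<le> N"
  shows "subalgebra M (filt M w k)"
  unfolding subalgebra_def
proof
  show "sets (filt M w k) \<subseteq> sets M"
    unfolding sets_filt using assms noise_measurable
    by (intro sets.sigma_sets_subset) (auto intro: measurable_sets)
qed simp

lemma filt_measurable_imp: "k \<le> N \<Longrightarrow> f \<in> borel_measurable (filt M w k) \<Longrightarrow> f \<in> borel_measurable M"
  using measurable_from_subalg[OF subalgebra_filt] by blast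

lemma sigma_finite_filt: "k \<le> N \<Longrightarrow> sigma_finite_subalgebra M (filt M w k)"
  by (intro finite_measure_subalgebra_is_sigma_finite finite_measure_subalgebra.intro
      finite_measure_axioms finite_measure_subalgebra_axioms.intro subalgebra_filt)

text \<open>The variance condition is stated through \<open>real_cond_exp\<close>, a difference of
  two \<open>enn2real\<close> values. The proof recovers from it that the nonnegative conditional
  expectation of the square equals 1. Working with extended reals makes the identity available
  before any integrability of the product is known.\<close>

lemma nn_integral_noise_sq:
  assumes k: "k < N" and g: "g \<in> borel_measurable (filt M w k)"
  shows "(\<integral>\<^sup>+\<omega>. g \<omega> * ennreal ((w k \<omega>)\<^sup>2) \<partial>M) = (\<integral>\<^sup>+\<omega>. g \<omega> \<partial>M)"
proof -
  interpret F: sigma_finite_subalgebra M "filt M w k" using k by (intro sigma_finite_filt) simp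
  note [measurable] = noise_measurable[OF k]
  have [measurable]: "g \<in> borel_measurable M" 
    by (rule measurable_from_subalg[OF F.subalg g])
  let ?n = "nn_cond_exp M (filt M w k) (\<lambda>\<omega>. ennreal ((w k \<omega>)\<^sup>2))"
  have "(\<integral>\<^sup>+\<omega>. 1 * ?n \<omega> \<partial>M) = (\<integral>\<^sup>+\<omega>. 1 * ennreal ((w k \<omega>)\<^sup>2) \<partial>M)"
    by (rule F.nn_cond_exp_intg) auto
  also have "\<dots> < \<infinity>"
    using noise_sq_integrable[OF k] by (simp add: nn_integral_eq_integral)
  finally have "AE \<omega> in M. ?n \<omega> \<noteq> \<infinity>"
    by (intro nn_integral_noteq_infinite) auto
  moreover have "AE \<omega> in M. nn_cond_exp M (filt M w k) (\<lambda>\<omega>. ennreal (- (w k \<omega>)\<^sup>2)) \<omega> = 0"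
  proof -
    have "AE \<omega> in M. 0 = nn_cond_exp M (filt M w k) (\<lambda>\<omega>. ennreal (- (w k \<omega>)\<^sup>2)) \<omega>"
      by (rule F.nn_cond_exp_charact[of _ "\<lambda>_. 0"]) (auto simp: ennreal_neg)
    then show ?thesis by auto
  qed
  ultimately have "AE \<omega> in M. ?n \<omega> = 1"
    using noise_variance[OF k]
  proof eventually_elim
    case (elim \<omega>)
    then have "enn2real (?n \<omega>) = 1" by (simp add: real_cond_exp_def)
    with elim(1) show ?case
      by (metis ennreal_1 ennreal_enn2real_if infinity_ennreal_def)
  qed
  then have "(\<integral>\<^sup>+\<omega>. g \<omega> \<partial>M) = (\<integral>\<^sup>+\<omega>. g \<omega> * ?n \<omega> \<partial>M)"
    by (intro nn_integral_cong_AE) auto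
  also have "\<dots> = (\<integral>\<^sup>+\<omega>. g \<omega> * ennreal ((w k \<omega>)\<^sup>2) \<partial>M)"
    by (rule F.nn_cond_exp_intg) (use g in auto)
  finally show ?thesis by simp
qed

text \<open>Square integrability of the product is part of the claim: \<open>g\<close> and the noise
  are each only in L2, and it is the conditional variance that makes their product square
  integrable.\<close>

lemma sqint_noise:
  assumes k: "k < N" and g: "g \<in> borel_measurable (filt M w k)" "sqint M g"
  shows "sqint M (\<lambda>\<omega>. w k \<omega> *\<^sub>R g \<omega>)" "sqn M (\<lambda>\<omega>. w k \<omega> *\<^sub>R g \<omega>) = sqn M g"
proof -
  note [measurable] = noise_measurable[OF k]
  have [measurable]: "g \<in> borel_measurable M" and i: "integrable M (\<lambda>\<omega>. (norm (g \<omega>))\<^sup>2)"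
    using g by auto
  have "(\<lambda>\<omega>. ennreal ((norm (g \<omega>))\<^sup>2)) \<in> borel_measurable (filt M w k)" using g by measurable
  from nn_integral_noise_sq[OF k this]
  have eq: "(\<integral>\<^sup>+\<omega>. ennreal ((norm (w k \<omega> *\<^sub>R g \<omega>))\<^sup>2) \<partial>M) = (\<integral>\<^sup>+\<omega>. ennreal ((norm (g \<omega>))\<^sup>2) \<partial>M)"
    by (simp add: ennreal_mult[symmetric] power_mult_distrib mult.commute)
  also have "\<dots> < \<infinity>"
    using i by (simp add: nn_integral_eq_integral)
  finally have fin: "(\<integral>\<^sup>+\<omega>. ennreal ((norm (w k \<omega> *\<^sub>R g \<omega>))\<^sup>2) \<partial>M) < \<infinity>" .
  show "sqint M (\<lambda>\<omega>. w k \<omega> *\<^sub>R g \<omega>)"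
    unfolding sqint_def by (intro conjI integrableI_nonneg) (use fin in auto)
  show "sqn M (\<lambda>\<omega>. w k \<omega> *\<^sub>R g \<omega>) = sqn M g"
    unfolding sqn_def using eq by (subst (1 2) integral_eq_nn_integral) (auto simp del: norm_scaleR)
qed

text \<open>One argument for both conditional quantities, with \<open>m = 1\<close> for the mean and
  \<open>m = w k\<close> for the correlation. Multiplication by \<open>m\<close> is an isometry on
  adapted functions, and the conditional expectation of \<open>m * y\<close> is its adjoint applied
  to \<open>y\<close>, hence a contraction. Since \<open>m * y\<close> is a priori only integrable,
  membership of \<open>z\<close> in L2 has to be proved as well.\<close>

lemma cond_exp_L2_aux:
  fixes y m :: "'w \<Rightarrow> real"
  assumes k: "k \<le> N" and y: "sqint M y" and m [measurable]: "m \<in> borel_measurable M"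
    and iso: "\<And>g. g \<in> borel_measurable (filt M w k) \<Longrightarrow> sqint M g \<Longrightarrow>
       sqint M (\<lambda>\<omega>. m \<omega> * g \<omega>) \<and> sqn M (\<lambda>\<omega>. m \<omega> * g \<omega>) = sqn M g"
  defines "z \<equiv> real_cond_exp M (filt M w k) (\<lambda>\<omega>. m \<omega> * y \<omega>)"
  shows "sqint M z" "sqn M z \<le> sqn M y"
    "g \<in> borel_measurable (filt M w k) \<Longrightarrow> sqint M g \<Longrightarrow>
      (LINT \<omega>|M. g \<omega> * z \<omega>) = (LINT \<omega>|M. m \<omega> * g \<omega> * y \<omega>)"
proof -
  interpret F: sigma_finite_subalgebra M "filt M w k" using k by (rule sigma_finite_filt)
  have [measurable]: "y \<in> borel_measurable M" using y by auto
  have zF [measurable]: "z \<in> borel_measurable (filt M w k)" by (simp add: z_def)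
  have zM [measurable]: "z \<in> borel_measurable M" by (simp add: z_def)
  have dual: "(LINT \<omega>|M. g \<omega> * z \<omega>) = (LINT \<omega>|M. m \<omega> * g \<omega> * y \<omega>)"
    if g: "g \<in> borel_measurable (filt M w k)" "sqint M g" for g
  proof -
    have "integrable M (\<lambda>\<omega>. (m \<omega> * g \<omega>) * y \<omega>)"
      using sqint_inner[OF conjunct1[OF iso[OF g]] y] by simp
    then have "integrable M (\<lambda>\<omega>. g \<omega> * (m \<omega> * y \<omega>))" by (simp add: ac_simps)
    from F.real_cond_exp_intg(2)[OF this] g show ?thesis
      unfolding z_def by (simp add: ac_simps)
  qed
  then show "g \<in> borel_measurable (filt M w k) \<Longrightarrow> sqint M g \<Longrightarrow>
      (LINT \<omega>|M. g \<omega> * z \<omega>) = (LINT \<omega>|M. m \<omega> * g \<omega> * y \<omega>)" .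
  \<comment> \<open>Testing against the truncations of \<open>z\<close> bounds their norms by that of \<open>y\<close>.\<close>
  define t where "t n \<omega> = (if \<bar>z \<omega>\<bar> \<le> real n then z \<omega> else 0)" for n :: nat and \<omega>
  have tF [measurable]: "t n \<in> borel_measurable (filt M w k)" for n
    unfolding t_def by measurable
  have tM [measurable]: "t n \<in> borel_measurable M" for n
    unfolding t_def by measurable
  have ts: "sqint M (t n)" for n
  proof (rule sqint_bound(1))
    show "AE \<omega> in M. (norm (t n \<omega>))\<^sup>2 \<le> (real n)\<^sup>2"
      by (intro AE_I2 power_mono) (auto simp: t_def)
  qed auto
  have tb: "sqn M (t n) \<le> sqn M y" for n
  proof -
    have 1: "sqn M (t n) = (LINT \<omega>|M. t n \<omega> * z \<omega>)"
      unfolding sqn_def by (intro Bochner_Integration.integral_cong) (auto simp: t_def power2_eq_square)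
    have 2: "(LINT \<omega>|M. t n \<omega> * z \<omega>) = (LINT \<omega>|M. (m \<omega> * t n \<omega>) \<bullet> y \<omega>)"
      unfolding inner_real_def by (rule dual[OF tF[of n] ts[of n]])
    have mt: "sqint M (\<lambda>\<omega>. m \<omega> * t n \<omega>)" "sqn M (\<lambda>\<omega>. m \<omega> * t n \<omega>) = sqn M (t n)"
      using iso[OF tF[of n] ts[of n]] by auto
    \<comment> \<open>Weight 1/2 leaves half of the norm of \<open>t n\<close> on the right; it is
      finite and is absorbed on the left.\<close>
    show ?thesis
      using young_integral[OF mt(1) y, of "1/2"] 1 2 mt(2) by simp
  qed
  have "(\<integral>\<^sup>+\<omega>. ennreal ((z \<omega>)\<^sup>2) \<partial>M) = (\<integral>\<^sup>+\<omega>. (SUP n. ennreal ((t n \<omega>)\<^sup>2)) \<partial>M)"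
  proof (intro nn_integral_cong antisym SUP_least)
    fix \<omega>
    obtain n where "\<bar>z \<omega>\<bar> \<le> real n" using real_arch_simple by blast
    then show "ennreal ((z \<omega>)\<^sup>2) \<le> (SUP n. ennreal ((t n \<omega>)\<^sup>2))"
      by (intro SUP_upper2[of n]) (auto simp: t_def)
  qed (auto simp: t_def)
  also have "\<dots> = (SUP n. \<integral>\<^sup>+\<omega>. ennreal ((t n \<omega>)\<^sup>2) \<partial>M)"
    by (intro nn_integral_monotone_convergence_SUP) (auto simp: incseq_def le_fun_def t_def)
  also have "\<dots> \<le> ennreal (sqn M y)"
  proof (rule SUP_least)
    fix n
    have "(\<integral>\<^sup>+\<omega>. ennreal ((t n \<omega>)\<^sup>2) \<partial>M) = ennreal (sqn M (t n))"
      unfolding sqn_def using ts[of n] by (subst nn_integral_eq_integral) (auto dest!: sqintD(2))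
    then show "(\<integral>\<^sup>+\<omega>. ennreal ((t n \<omega>)\<^sup>2) \<partial>M) \<le> ennreal (sqn M y)"
      using tb by (simp add: ennreal_leI)
  qed
  finally have le: "(\<integral>\<^sup>+\<omega>. ennreal ((z \<omega>)\<^sup>2) \<partial>M) \<le> ennreal (sqn M y)" .
  have "(\<integral>\<^sup>+\<omega>. ennreal ((z \<omega>)\<^sup>2) \<partial>M) < \<infinity>"
    using le by (rule le_less_trans) simp
  then have "integrable M (\<lambda>\<omega>. (z \<omega>)\<^sup>2)"
    by (intro integrableI_nonneg) auto
  then show zs: "sqint M z" by (simp add: sqint_def)
  have "ennreal (sqn M z) \<le> ennreal (sqn M y)"
    using le zs by (simp add: sqn_def nn_integral_eq_integral sqint_def)
  then show "sqn M z \<le> sqn M y" by simp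
qed

lemma vec_cond_exp_measurable:
  fixes X :: "'w \<Rightarrow> real^'n"
  shows "vec_cond_exp M (filt M w k) X \<in> borel_measurable (filt M w k)"
  by (subst borel_measurable_euclidean_space)
    (auto simp: Basis_vec_def inner_axis vec_cond_exp_def)

lemma vec_cond_exp_L2_aux:
  fixes y :: "'w \<Rightarrow> real^'n" and m :: "'w \<Rightarrow> real"
  assumes k: "k \<le> N" and y: "sqint M y" and m: "m \<in> borel_measurable M"
    and iso: "\<And>g::'w \<Rightarrow> real. g \<in> borel_measurable (filt M w k) \<Longrightarrow> sqint M g \<Longrightarrow>
       sqint M (\<lambda>\<omega>. m \<omega> * g \<omega>) \<and> sqn M (\<lambda>\<omega>. m \<omega> * g \<omega>) = sqn M g"
  defines "z \<equiv> vec_cond_exp M (filt M w k) (\<lambda>\<omega>. m \<omega> *\<^sub>R y \<omega>)"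
  shows "sqint M z" "sqn M z \<le> sqn M y"
    "X \<in> borel_measurable (filt M w k) \<Longrightarrow> sqint M X \<Longrightarrow>
      (LINT \<omega>|M. X \<omega> \<bullet> z \<omega>) = (LINT \<omega>|M. (m \<omega> *\<^sub>R X \<omega>) \<bullet> y \<omega>)"
proof -
  have yi: "sqint M (\<lambda>\<omega>. y \<omega> $ i)" for i using y sqint_vec(1) by blast
  have zi: "(\<lambda>\<omega>. z \<omega> $ i) = real_cond_exp M (filt M w k) (\<lambda>\<omega>. m \<omega> * y \<omega> $ i)" for i
    by (simp add: z_def vec_cond_exp_def)
  note aux = cond_exp_L2_aux[OF k yi m iso, folded zi]
  show zs: "sqint M z" using aux(1) sqint_vec(1) by blast
  show "sqn M z \<le> sqn M y"
    using aux(2) by (simp add: sqint_vec(2)[OF zs] sqint_vec(2)[OF y] sum_mono)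
  assume X: "X \<in> borel_measurable (filt M w k)" "sqint M X"
  have Xi: "sqint M (\<lambda>\<omega>. X \<omega> $ i)" for i using X sqint_vec(1) by blast
  have XF: "(\<lambda>\<omega>. X \<omega> $ i) \<in> borel_measurable (filt M w k)" for i
    using X(1) by (intro borel_measurable_continuous_on[where f="\<lambda>a. a $ i" and g=X] continuous_intros)
  have iz: "integrable M (\<lambda>\<omega>. X \<omega> $ i * z \<omega> $ i)" for i
    using sqint_inner[OF Xi aux(1)] by simp
  have iy: "integrable M (\<lambda>\<omega>. m \<omega> * X \<omega> $ i * y \<omega> $ i)" for i
    using sqint_inner[OF conjunct1[OF iso[OF XF Xi]] yi] by simp
  have "(LINT \<omega>|M. X \<omega> \<bullet> z \<omega>) = (\<Sum>i\<in>UNIV. LINT \<omega>|M. X \<omega> $ i * z \<omega> $ i)"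
    using iz by (simp add: inner_vec_def)
  also have "\<dots> = (\<Sum>i\<in>UNIV. LINT \<omega>|M. m \<omega> * X \<omega> $ i * y \<omega> $ i)"
    by (intro sum.cong refl aux(3) XF Xi)
  also have "\<dots> = (LINT \<omega>|M. (m \<omega> *\<^sub>R X \<omega>) \<bullet> y \<omega>)"
    using iy by (simp add: inner_vec_def)
  finally show "(LINT \<omega>|M. X \<omega> \<bullet> z \<omega>) = (LINT \<omega>|M. (m \<omega> *\<^sub>R X \<omega>) \<bullet> y \<omega>)" .
qed

lemma cond_mean_measurable: "cond_mean M w y k \<in> borel_measurable (filt M w k)"
  and cond_corr_measurable: "cond_corr M w y k \<in> borel_measurable (filt M w k)"
  by (simp_all add: cond_mean_def cond_corr_def vec_cond_exp_measurable)

lemma cond_mean_L2: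
  assumes k: "k < N" and y: "sqint M (y (Suc k))"
  shows "sqint M (cond_mean M w y k)" "sqn M (cond_mean M w y k) \<le> sqn M (y (Suc k))"
    "X \<in> borel_measurable (filt M w k) \<Longrightarrow> sqint M X \<Longrightarrow>
      (LINT \<omega>|M. X \<omega> \<bullet> cond_mean M w y k \<omega>) = (LINT \<omega>|M. X \<omega> \<bullet> y (Suc k) \<omega>)"
  using vec_cond_exp_L2_aux[of k "y (Suc k)" "\<lambda>_. 1"] k y by (auto simp: cond_mean_def)

lemma cond_corr_L2:
  assumes k: "k < N" and y: "sqint M (y (Suc k))"
  shows "sqint M (cond_corr M w y k)" "sqn M (cond_corr M w y k) \<le> sqn M (y (Suc k))"
    "X \<in> borel_measurable (filt M w k) \<Longrightarrow> sqint M X \<Longrightarrow>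
      (LINT \<omega>|M. X \<omega> \<bullet> cond_corr M w y k \<omega>) = (LINT \<omega>|M. (w k \<omega> *\<^sub>R X \<omega>) \<bullet> y (Suc k) \<omega>)"
proof -
  have iso: "sqint M (\<lambda>\<omega>. w k \<omega> * g \<omega>) \<and> sqn M (\<lambda>\<omega>. w k \<omega> * g \<omega>) = sqn M g"
    if "g \<in> borel_measurable (filt M w k)" "sqint M g" for g :: "'w \<Rightarrow> real"
    using sqint_noise[OF k that] by simp
  note aux = vec_cond_exp_L2_aux[OF less_imp_le[OF k] y noise_measurable[OF k] iso, folded cond_corr_def]
  show "sqint M (cond_corr M w y k)" "sqn M (cond_corr M w y k) \<le> sqn M (y (Suc k))"
    using aux by auto
  show "X \<in> borel_measurable (filt M w k) \<Longrightarrow> sqint M X \<Longrightarrow>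
      (LINT \<omega>|M. X \<omega> \<bullet> cond_corr M w y k \<omega>) = (LINT \<omega>|M. (w k \<omega> *\<^sub>R X \<omega>) \<bullet> y (Suc k) \<omega>)"
    using aux(3) .
qed

lemma noise_mult_integrable:
  assumes "k < N" "sqint M f"
  shows "integrable M (\<lambda>\<omega>. w k \<omega> * f \<omega>)"
  using sqint_inner[of M "w k" f] assms noise_measurable noise_sq_integrable
  by (simp add: sqint_def)

text \<open>Each conditional expectation is a separately chosen version, so linearity holds only
  almost surely. There are finitely many components, so one null set serves for the whole
  vector.\<close>

lemma cond_mean_diff:
  assumes k: "k < N" and y: "sqint M (y (Suc k))" "sqint M (y' (Suc k))"
  shows "AE \<omega> in M. cond_mean M w (\<lambda>k \<omega>. y k \<omega> - y' k \<omega>) k \<omega> = cond_mean M w y k \<omega> - cond_mean M w y' k \<omega>"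
proof -
  interpret F: sigma_finite_subalgebra M "filt M w k" using k by (intro sigma_finite_filt) simp
  have "integrable M (\<lambda>\<omega>. y (Suc k) \<omega> $ i)" "integrable M (\<lambda>\<omega>. y' (Suc k) \<omega> $ i)" for i
    using y sqint_vec(1) sqint_imp_integrable[OF finite_measure_axioms] by blast+
  then have "AE \<omega> in M. \<forall>i. real_cond_exp M (filt M w k) (\<lambda>\<omega>. y (Suc k) \<omega> $ i - y' (Suc k) \<omega> $ i) \<omega>
      = real_cond_exp M (filt M w k) (\<lambda>\<omega>. y (Suc k) \<omega> $ i) \<omega>
        - real_cond_exp M (filt M w k) (\<lambda>\<omega>. y' (Suc k) \<omega> $ i) \<omega>"
    by (simp add: AE_all_countable)
  then show ?thesis
    by (auto simp: cond_mean_def vec_cond_exp_def vec_eq_iff)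
qed

lemma cond_corr_diff:
  assumes k: "k < N" and y: "sqint M (y (Suc k))" "sqint M (y' (Suc k))"
  shows "AE \<omega> in M. cond_corr M w (\<lambda>k \<omega>. y k \<omega> - y' k \<omega>) k \<omega> = cond_corr M w y k \<omega> - cond_corr M w y' k \<omega>"
proof -
  interpret F: sigma_finite_subalgebra M "filt M w k" using k by (intro sigma_finite_filt) simp
  have "integrable M (\<lambda>\<omega>. w k \<omega> * y (Suc k) \<omega> $ i)" "integrable M (\<lambda>\<omega>. w k \<omega> * y' (Suc k) \<omega> $ i)" for i
    using y sqint_vec(1) noise_mult_integrable[OF k] by blast+
  then have "AE \<omega> in M. \<forall>i. real_cond_exp M (filt M w k)
        (\<lambda>\<omega>. w k \<omega> * y (Suc k) \<omega> $ i - w k \<omega> * y' (Suc k) \<omega> $ i) \<omega>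
      = real_cond_exp M (filt M w k) (\<lambda>\<omega>. w k \<omega> * y (Suc k) \<omega> $ i) \<omega>
        - real_cond_exp M (filt M w k) (\<lambda>\<omega>. w k \<omega> * y' (Suc k) \<omega> $ i) \<omega>"
    by (simp add: AE_all_countable)
  then show ?thesis
    by (auto simp: cond_corr_def vec_cond_exp_def vec_eq_iff right_diff_distrib)
qed

end

text \<open>The weights 4^n still leave a convergent series of norms, so the weighted sum of all
  squares is integrable and dominates every member at a geometric rate. It serves twice: for
  completeness of L2 and as the dominating function of the Taylor remainders.\<close>

lemma L2_summable_majorant:
  fixes h :: "nat \<Rightarrow> 'w \<Rightarrow> 'v::euclidean_space"
  assumes h: "\<And>n. sqint M (h n)" and le: "\<And>n. sqn M (h n) \<le> c * (1/16)^n"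
  obtains W where "integrable M W" "\<And>\<omega>. 0 \<le> W \<omega>"
    "AE \<omega> in M. \<forall>n. (norm (h n \<omega>))\<^sup>2 \<le> (1/4)^n * W \<omega>"
proof -
  have [measurable]: "h n \<in> borel_measurable M" for n using h by auto
  define W' where "W' \<omega> = (\<Sum>n. ennreal (4^n * (norm (h n \<omega>))\<^sup>2))" for \<omega>
  have [measurable]: "W' \<in> borel_measurable M" unfolding W'_def by measurable
  have c: "0 \<le> c" using order_trans[OF sqn_nonneg le[of 0]] by simp
  have "(\<integral>\<^sup>+\<omega>. W' \<omega> \<partial>M) = (\<Sum>n. \<integral>\<^sup>+\<omega>. ennreal (4^n * (norm (h n \<omega>))\<^sup>2) \<partial>M)"
    unfolding W'_def by (rule nn_integral_suminf) auto
  also have "\<dots> \<le> (\<Sum>n. ennreal (c * (1/4)^n))"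
  proof (intro suminf_le allI summableI)
    fix n
    have "(\<integral>\<^sup>+\<omega>. ennreal (4^n * (norm (h n \<omega>))\<^sup>2) \<partial>M) = ennreal (4^n * sqn M (h n))"
      unfolding sqn_def using sqintD(2)[OF h[of n]] by (subst nn_integral_eq_integral) auto
    also have "4^n * sqn M (h n) \<le> 4^n * (c * (1/16)^n)"
      using le[of n] by (intro mult_left_mono) auto
    also have "\<dots> = c * (1/4)^n"
      by (simp add: power_mult_distrib[symmetric] mult.left_commute)
    finally show "(\<integral>\<^sup>+\<omega>. ennreal (4^n * (norm (h n \<omega>))\<^sup>2) \<partial>M) \<le> ennreal (c * (1/4)^n)"
      by (simp add: ennreal_leI)
  qed
  also have "\<dots> < \<infinity>"
  proof -
    have "summable (\<lambda>n. c * (1/4::real)^n)" by (intro summable_mult summable_geometric) simp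
    then show ?thesis using c by (subst suminf_ennreal2) auto
  qed
  finally have fin: "(\<integral>\<^sup>+\<omega>. W' \<omega> \<partial>M) < \<infinity>" .
  then have ae: "AE \<omega> in M. W' \<omega> \<noteq> \<infinity>"
    by (intro nn_integral_noteq_infinite) auto
  show thesis
  proof
    \<comment> \<open>\<open>enn2real\<close> replaces an infinite sum by 0; this happens on a null
      set only and makes the majorant real and nonnegative everywhere.\<close>
    show "integrable M (\<lambda>\<omega>. enn2real (W' \<omega>))"
    proof (rule integrableI_nonneg)
      have "(\<integral>\<^sup>+\<omega>. ennreal (enn2real (W' \<omega>)) \<partial>M) \<le> (\<integral>\<^sup>+\<omega>. W' \<omega> \<partial>M)"
        by (intro nn_integral_mono) (simp add: ennreal_enn2real_if)
      then show "(\<integral>\<^sup>+\<omega>. ennreal (enn2real (W' \<omega>)) \<partial>M) < \<infinity>"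
        using fin by (rule le_less_trans)
    qed auto
    show "AE \<omega> in M. \<forall>n. (norm (h n \<omega>))\<^sup>2 \<le> (1/4)^n * enn2real (W' \<omega>)"
      using ae
    proof eventually_elim
      case (elim \<omega>)
      show ?case
      proof
        fix n
        have "sum (\<lambda>n. ennreal (4^n * (norm (h n \<omega>))\<^sup>2)) {n} \<le> W' \<omega>"
          unfolding W'_def by (rule sum_le_suminf) auto
        then have "enn2real (ennreal (4^n * (norm (h n \<omega>))\<^sup>2)) \<le> enn2real (W' \<omega>)"
          using elim by (intro enn2real_mono) (auto simp: top.not_eq_extremum)
        then have "4^n * (norm (h n \<omega>))\<^sup>2 \<le> enn2real (W' \<omega>)" by simp
        then show "(norm (h n \<omega>))\<^sup>2 \<le> (1/4)^n * enn2real (W' \<omega>)"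
          by (simp add: power_one_over field_simps)
      qed
    qed
  qed simp
qed

text \<open>Completeness in a form that keeps the limit measurable for the smaller sigma-algebra:
  \<open>g\<close> is a pointwise limit and not just a class modulo null sets. The rate 1/16 for
  squared norms becomes 1/4 pointwise for squares after passing to the majorant, so increments are
  summable with ratio 1/2.\<close>

lemma L2_limit:
  fixes f :: "nat \<Rightarrow> 'w \<Rightarrow> 'v::euclidean_space"
  assumes F: "subalgebra M F" and fF: "\<And>n. f n \<in> borel_measurable F"
    and f: "\<And>n. sqint M (f n)"
    and le: "\<And>n. sqn M (\<lambda>\<omega>. f (Suc n) \<omega> - f n \<omega>) \<le> c * (1/16)^n"
  obtains g where "g \<in> borel_measurable F" "sqint M g" "(\<lambda>n. sqn M (\<lambda>\<omega>. f n \<omega> - g \<omega>)) \<longlonglongrightarrow> 0"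
proof -
  have "sqint M (\<lambda>\<omega>. f (Suc n) \<omega> - f n \<omega>)" for n by (intro sqint_diff f)
  then obtain W where W: "integrable M W" "\<And>\<omega>. 0 \<le> W \<omega>"
    and ae: "AE \<omega> in M. \<forall>n. (norm (f (Suc n) \<omega> - f n \<omega>))\<^sup>2 \<le> (1/4)^n * W \<omega>"
    using L2_summable_majorant[OF _ le] by blast
  define g where "g \<omega> = lim (\<lambda>n. f n \<omega>)" for \<omega>
  have gF: "g \<in> borel_measurable F"
    unfolding g_def using fF by (intro borel_measurable_lim_metric)
  note [measurable] = measurable_from_subalg[OF F gF] measurable_from_subalg[OF F fF]
  have bd: "AE \<omega> in M. \<forall>n. (norm (f n \<omega> - g \<omega>))\<^sup>2 \<le> (1/4)^n * (4 * W \<omega>)"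
    using ae
  proof eventually_elim
    case (elim \<omega>)
    let ?d = "\<lambda>n. f (Suc n) \<omega> - f n \<omega>"
    have d: "norm (?d n) \<le> (1/2)^n * sqrt (W \<omega>)" for n
    proof -
      have "sqrt ((norm (?d n))\<^sup>2) \<le> sqrt ((1/4)^n * W \<omega>)"
        using elim by (intro real_sqrt_le_mono) auto
      also have "\<dots> = (1/2)^n * sqrt (W \<omega>)"
        by (simp add: real_sqrt_mult real_sqrt_power real_sqrt_divide)
      finally show ?thesis by simp
    qed
    have sg: "summable (\<lambda>n. (1/2::real)^n)" by (rule summable_geometric) simp
    have sd: "summable (\<lambda>n. norm (?d n))"
      by (rule summable_comparison_test'[OF summable_mult2[OF sg], of 0]) (use d in auto)
    then have s: "summable ?d" by (rule summable_norm_cancel)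
    have "(\<lambda>n. f 0 \<omega> + (\<Sum>i<n. ?d i)) \<longlonglongrightarrow> f 0 \<omega> + suminf ?d"
      by (intro tendsto_intros summable_LIMSEQ s)
    then have lim: "(\<lambda>n. f n \<omega>) \<longlonglongrightarrow> f 0 \<omega> + suminf ?d"
      by (simp add: sum_lessThan_telescope[of "\<lambda>n. f n \<omega>"])
    then have gl: "g \<omega> = f 0 \<omega> + suminf ?d" unfolding g_def by (rule limI)
    show ?case
    proof
      fix n
      have "g \<omega> - f n \<omega> = suminf (\<lambda>i. ?d (i + n))"
        using suminf_split_initial_segment[OF s, of n] gl
        by (simp add: sum_lessThan_telescope[of "\<lambda>n. f n \<omega>"] algebra_simps)
      also have "norm \<dots> \<le> (\<Sum>i. norm (?d (i + n)))"
        using sd by (intro summable_norm) (simp add: summable_iff_shift[of "\<lambda>n. norm (?d n)"])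
      also have "\<dots> \<le> (\<Sum>i. (1/2)^i * ((1/2)^n * sqrt (W \<omega>)))"
        using sd d by (intro suminf_le summable_mult2 sg)
          (auto simp: summable_iff_shift[of "\<lambda>n. norm (?d n)"] power_add mult.assoc[symmetric]
            intro: order_trans[OF d])
      also have "\<dots> = 2 * ((1/2)^n * sqrt (W \<omega>))"
        using suminf_mult2[OF sg] by (simp add: suminf_geometric)
      finally have "(norm (g \<omega> - f n \<omega>))\<^sup>2 \<le> (2 * ((1/2)^n * sqrt (W \<omega>)))\<^sup>2"
        by (intro power_mono) auto
      also have "\<dots> = (1/4)^n * (4 * W \<omega>)"
      proof -
        have "((1/2::real)^n)\<^sup>2 = (1/4)^n"
          by (simp add: power2_eq_square power_mult_distrib[symmetric])
        then show ?thesis using W(2)[of \<omega>] by (simp add: power_mult_distrib)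
      qed
      finally show "(norm (f n \<omega> - g \<omega>))\<^sup>2 \<le> (1/4)^n * (4 * W \<omega>)"
        by (simp add: norm_minus_commute)
    qed
  qed
  have I: "integrable M (\<lambda>\<omega>. (1/4)^n * (4 * W \<omega>))" for n :: nat using W(1) by auto
  have s: "sqint M (\<lambda>\<omega>. f n \<omega> - g \<omega>)" for n
    by (rule sqint_bound(1)[OF I[of n]]) (use bd in auto)
  have b: "sqn M (\<lambda>\<omega>. f n \<omega> - g \<omega>) \<le> (1/4)^n * (LINT \<omega>|M. 4 * W \<omega>)" for n
  proof -
    have "sqn M (\<lambda>\<omega>. f n \<omega> - g \<omega>) \<le> (LINT \<omega>|M. (1/4)^n * (4 * W \<omega>))"
      by (rule sqint_bound(2)[OF I[of n]]) (use bd in auto)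
    then show ?thesis by simp
  qed
  show thesis
  proof
    show "g \<in> borel_measurable F" by fact
    show "sqint M g" using sqint_diff(1)[OF f s, of 0 0] by simp
    have "(\<lambda>n. (1/4::real)^n * (LINT \<omega>|M. 4 * W \<omega>)) \<longlonglongrightarrow> 0 * (LINT \<omega>|M. 4 * W \<omega>)"
      by (intro tendsto_intros LIMSEQ_power_zero) simp
    then have "(\<lambda>n. (1/4::real)^n * (LINT \<omega>|M. 4 * W \<omega>)) \<longlonglongrightarrow> 0" by simp
    then show "(\<lambda>n. sqn M (\<lambda>\<omega>. f n \<omega> - g \<omega>)) \<longlonglongrightarrow> 0"
      by (rule Lim_null_comparison[rotated]) (use b in auto)
  qed
qed

text \<open>The argument is approximated by points of a countable dense subset, on which
  \<open>g\<close> is measurable, and continuity carries the limit. The set \<open>S\<close> is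
  arbitrary because adaptedness of the coefficients is assumed only for control values in
  \<open>U k\<close>.\<close>

lemma caratheodory_measurable:
  fixes g :: "'w \<Rightarrow> 'a::{metric_space, second_countable_topology} \<Rightarrow> 'b::metric_space"
  assumes g: "\<And>v. v \<in> S \<Longrightarrow> (\<lambda>\<omega>. g \<omega> v) \<in> borel_measurable F"
    and cont: "\<And>\<omega>. \<omega> \<in> space F \<Longrightarrow> continuous_on S (g \<omega>)"
    and a [measurable]: "a \<in> borel_measurable F" and aS: "\<And>\<omega>. \<omega> \<in> space F \<Longrightarrow> a \<omega> \<in> S"
  shows "(\<lambda>\<omega>. g \<omega> (a \<omega>)) \<in> borel_measurable F"
proof (cases "space F = {}")
  case True
  then show ?thesis by (simp add: measurable_def)
next
  case False
  obtain T where T: "countable T" "T \<subseteq> S" "S \<subseteq> closure T"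
    using separable[of S] by blast
  from False aS T have "T \<noteq> {}" by (metis closure_empty empty_iff equals0I subset_empty)
  define d where "d = from_nat_into T"
  have dT: "d i \<in> T" for i unfolding d_def using \<open>T \<noteq> {}\<close> by (rule from_nat_into)
  \<comment> \<open>Choosing the least admissible index makes the selection of an approximating
    point measurable.\<close>
  define ix where "ix n \<omega> = (LEAST i. dist (d i) (a \<omega>) < 1 / Suc n)" for n \<omega>
  have ix [measurable]: "ix n \<in> measurable F (count_space UNIV)" for n
    unfolding ix_def
  proof (rule measurable_Least)
    fix i
    have "(\<lambda>\<omega>. dist (d i) (a \<omega>)) \<in> borel_measurable F"
      by (intro borel_measurable_dist borel_measurable_const a)
    then show "Measurable.pred F (\<lambda>\<omega>. dist (d i) (a \<omega>) < 1 / real (Suc n))"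
      by (intro borel_measurable_pred_less borel_measurable_const)
  qed
  have close: "dist (d (ix n \<omega>)) (a \<omega>) < 1 / Suc n" if "\<omega> \<in> space F" for n \<omega>
  proof -
    have "a \<omega> \<in> closure T" using aS[OF that] T by blast
    moreover have "0 < 1 / real (Suc n)" by simp
    ultimately obtain t where t: "t \<in> T" "dist t (a \<omega>) < 1 / Suc n"
      unfolding closure_approachable by blast
    obtain i where "d i = t"
      unfolding d_def using from_nat_into_surj[OF T(1) t(1)] by blast
    then have "dist (d i) (a \<omega>) < 1 / Suc n" using t by simp
    then show ?thesis unfolding ix_def by (rule LeastI)
  qed
  have lim: "(\<lambda>n. d (ix n \<omega>)) \<longlonglongrightarrow> a \<omega>" if "\<omega> \<in> space F" for \<omega>
  proof (rule metric_LIMSEQ_I)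
    fix r :: real assume "r > 0"
    then obtain n0 where n0: "1 / real (Suc n0) < r" using nat_approx_posE by blast
    show "\<exists>no. \<forall>n\<ge>no. dist (d (ix n \<omega>)) (a \<omega>) < r"
    proof (intro exI allI impI)
      fix n assume "n \<ge> n0"
      then have "1 / real (Suc n) \<le> 1 / real (Suc n0)" by (intro divide_left_mono) auto
      then show "dist (d (ix n \<omega>)) (a \<omega>) < r" using close[OF that, of n] n0 by linarith
    qed
  qed
  show ?thesis
  proof (rule borel_measurable_LIMSEQ_metric)
    show "(\<lambda>\<omega>. g \<omega> (d (ix n \<omega>))) \<in> borel_measurable F" for n
      by (rule measurable_compose_countable[where f="\<lambda>i \<omega>. g \<omega> (d i)" and g="ix n", OF g ix])
        (use dT T(2) in blast)
    show "(\<lambda>n. g \<omega> (d (ix n \<omega>))) \<longlonglongrightarrow> g \<omega> (a \<omega>)" if "\<omega> \<in> space F" for \<omega>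
    proof (rule continuous_on_tendsto_compose[OF cont[OF that] lim[OF that] aS[OF that]])
      show "\<forall>\<^sub>F n in sequentially. d (ix n \<omega>) \<in> S" using dT T(2) by (intro always_eventually) blast
    qed
  qed
qed

section \<open>Adapted square integrable processes\<close>

definition psq :: "'w measure \<Rightarrow> nat \<Rightarrow> (nat \<Rightarrow> 'w \<Rightarrow> 'v::euclidean_space) \<Rightarrow> real" where
  "psq M N \<theta> = (\<Sum>k\<le>N. sqn M (\<theta> k))"

lemma psq_nonneg [simp]: "0 \<le> psq M N \<theta>"
  by (simp add: psq_def sum_nonneg)

lemma sqn_le_psq: "k \<le> N \<Longrightarrow> sqn M (\<theta> k) \<le> psq M N \<theta>"
  unfolding psq_def by (rule member_le_sum) auto

lemma psq_commute: "psq M N (\<lambda>k \<omega>. f k \<omega> - g k \<omega>) = psq M N (\<lambda>k \<omega>. g k \<omega> - f k \<omega>)"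
  unfolding psq_def by (intro sum.cong refl sqn_commute)

context noise
begin

lemma L2F_iff:
  assumes "I \<subseteq> {..N}"
  shows "f \<in> L2F M w I \<longleftrightarrow> (\<forall>k\<in>I. f k \<in> borel_measurable (filt M w k) \<and> sqint M (f k))"
proof -
  have fin: "finite I" using assms finite_subset by blast
  have kN: "k \<in> I \<Longrightarrow> k \<le> N" for k using assms by auto
  show ?thesis
  proof
    assume f: "f \<in> L2F M w I"
    then have F: "f k \<in> borel_measurable (filt M w k)" if "k \<in> I" for k
      using that by (auto simp: L2F_def)
    have I: "integrable M (\<lambda>\<omega>. \<Sum>k\<in>I. (norm (f k \<omega>))\<^sup>2)" using f by (auto simp: L2F_def)
    have "sqint M (f k)" if "k \<in> I" for k
    proof (rule sqint_bound(1)[OF I])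
      show "f k \<in> borel_measurable M" using filt_measurable_imp[OF kN F] that by blast
      show "AE \<omega> in M. (norm (f k \<omega>))\<^sup>2 \<le> (\<Sum>k\<in>I. (norm (f k \<omega>))\<^sup>2)"
        using fin that by (intro AE_I2 member_le_sum) auto
    qed
    then show "\<forall>k\<in>I. f k \<in> borel_measurable (filt M w k) \<and> sqint M (f k)" using F by auto
  next
    assume "\<forall>k\<in>I. f k \<in> borel_measurable (filt M w k) \<and> sqint M (f k)"
    then show "f \<in> L2F M w I" by (auto simp: L2F_def sqint_def)
  qed
qed

lemma L2F_atMost:
  "f \<in> L2F M w {..N} \<longleftrightarrow> (\<forall>k\<le>N. f k \<in> borel_measurable (filt M w k) \<and> sqint M (f k))"
  by (auto simp: L2F_iff)

lemma L2F_I: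
  assumes "\<And>k. k \<le> N \<Longrightarrow> f k \<in> borel_measurable (filt M w k)" "\<And>k. k \<le> N \<Longrightarrow> sqint M (f k)"
  shows "f \<in> L2F M w {..N}"
  using assms by (simp add: L2F_atMost)

lemma L2F_D:
  assumes "f \<in> L2F M w {..N}" "k \<le> N"
  shows "f k \<in> borel_measurable (filt M w k)" "sqint M (f k)" "f k \<in> borel_measurable M"
proof -
  show "f k \<in> borel_measurable (filt M w k)" "sqint M (f k)"
    using assms by (auto simp: L2F_atMost)
  then show "f k \<in> borel_measurable M" by blast
qed

lemma L2F_linear:
  assumes "f \<in> L2F M w {..N}" "g \<in> L2F M w {..N}"
  shows "(\<lambda>k \<omega>. f k \<omega> + g k \<omega>) \<in> L2F M w {..N}"
    "(\<lambda>k \<omega>. f k \<omega> - g k \<omega>) \<in> L2F M w {..N}"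
  by (intro L2F_I borel_measurable_add borel_measurable_diff
      sqint_add(1) sqint_diff(1) L2F_D[OF assms(1)] L2F_D[OF assms(2)]; assumption)+

lemma L2F_scaleR:
  assumes "f \<in> L2F M w {..N}"
  shows "(\<lambda>k \<omega>. c *\<^sub>R f k \<omega>) \<in> L2F M w {..N}"
  by (intro L2F_I borel_measurable_scaleR borel_measurable_const sqint_scaleR(1) L2F_D[OF assms]; assumption)

lemma L2F_0: "(\<lambda>k \<omega>. 0) \<in> L2F M w {..N}"
  by (simp add: L2F_atMost finite_measure_axioms)

lemma psq_add:
  assumes "f \<in> L2F M w {..N}" "g \<in> L2F M w {..N}"
  shows "psq M N (\<lambda>k \<omega>. f k \<omega> + g k \<omega>) \<le> 2 * psq M N f + 2 * psq M N g"
  unfolding psq_def sum_distrib_left sum.distrib[symmetric]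
  using assms by (intro sum_mono sqint_add(2)) (auto simp: L2F_atMost)

lemma psq_diff:
  assumes "f \<in> L2F M w {..N}" "g \<in> L2F M w {..N}"
  shows "psq M N (\<lambda>k \<omega>. f k \<omega> - g k \<omega>) \<le> 2 * psq M N f + 2 * psq M N g"
  unfolding psq_def sum_distrib_left sum.distrib[symmetric]
  using assms by (intro sum_mono sqint_diff(2)) (auto simp: L2F_atMost)

lemma psq_scaleR:
  assumes "f \<in> L2F M w {..N}"
  shows "psq M N (\<lambda>k \<omega>. c *\<^sub>R f k \<omega>) = c\<^sup>2 * psq M N f"
  unfolding psq_def sum_distrib_left
  using assms by (intro sum.cong sqint_scaleR(2)) (auto simp: L2F_atMost)

lemma psq_eq_0_iff:
  assumes "f \<in> L2F M w {..N}"
  shows "psq M N f = 0 \<longleftrightarrow> (\<forall>k\<le>N. AE \<omega> in M. f k \<omega> = 0)"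
  unfolding psq_def using assms
  by (subst sum_nonneg_eq_0_iff) (auto simp: L2F_atMost sqn_eq_0_iff)

lemma L2F_limit:
  fixes f :: "nat \<Rightarrow> nat \<Rightarrow> 'w \<Rightarrow> 'v::euclidean_space"
  assumes f: "\<And>n. f n \<in> L2F M w {..N}"
    and le: "\<And>n. psq M N (\<lambda>k \<omega>. f (Suc n) k \<omega> - f n k \<omega>) \<le> c * (1/16)^n"
  obtains g where "g \<in> L2F M w {..N}" "(\<lambda>n. psq M N (\<lambda>k \<omega>. f n k \<omega> - g k \<omega>)) \<longlonglongrightarrow> 0"
proof -
  have "\<exists>g. g \<in> borel_measurable (filt M w k) \<and> sqint M g \<and> (\<lambda>n. sqn M (\<lambda>\<omega>. f n k \<omega> - g \<omega>)) \<longlonglongrightarrow> 0"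
    if "k \<le> N" for k
  proof -
    have "sqn M (\<lambda>\<omega>. f (Suc n) k \<omega> - f n k \<omega>) \<le> c * (1/16)^n" for n
      using sqn_le_psq[OF that, of M "\<lambda>k \<omega>. f (Suc n) k \<omega> - f n k \<omega>"] le[of n] by simp
    from L2_limit[OF subalgebra_filt[OF that] L2F_D(1)[OF f that] L2F_D(2)[OF f that] this]
    obtain g where "g \<in> borel_measurable (filt M w k)" "sqint M g"
      "(\<lambda>n. sqn M (\<lambda>\<omega>. f n k \<omega> - g \<omega>)) \<longlonglongrightarrow> 0" .
    then show ?thesis by blast
  qed
  then obtain g where g: "\<And>k. k \<le> N \<Longrightarrow> g k \<in> borel_measurable (filt M w k) \<and> sqint M (g k) \<and>
      (\<lambda>n. sqn M (\<lambda>\<omega>. f n k \<omega> - g k \<omega>)) \<longlonglongrightarrow> 0" by metis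
  show thesis
  proof
    show "g \<in> L2F M w {..N}" using g by (simp add: L2F_atMost)
    have "(\<lambda>n. psq M N (\<lambda>k \<omega>. f n k \<omega> - g k \<omega>)) \<longlonglongrightarrow> (\<Sum>k\<le>N. 0)"
      unfolding psq_def by (intro tendsto_sum) (use g in auto)
    then show "(\<lambda>n. psq M N (\<lambda>k \<omega>. f n k \<omega> - g k \<omega>)) \<longlonglongrightarrow> 0" by simp
  qed
qed

end

section \<open>The continuation method in the space of adapted processes\<close>

context noise
begin

lemma psq_cong_AE:
  assumes "f \<in> L2F M w {..N}" "g \<in> L2F M w {..N}" "\<And>k. k \<le> N \<Longrightarrow> AE \<omega> in M. f k \<omega> = g k \<omega>"
  shows "psq M N f = psq M N g"
  unfolding psq_def
  by (intro sum.cong refl sqn_cong_AE L2F_D(3)[OF assms(1)] L2F_D(3)[OF assms(2)] assms(3)) auto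

text \<open>Given solvability at the level \<open>\<alpha>\<close>, the equation at
  \<open>\<alpha> + \<delta>\<close> is a fixed point problem: solve at \<open>\<alpha>\<close> with
  right-hand side \<open>\<eta> + \<delta> F \<theta>\<close>. Stability and the smallness of
  \<open>\<delta>\<close> make this a contraction with factor 1/16 for squared norms, the rate that
  \<open>L2F_limit\<close> asks for. Equations hold only almost everywhere and \<open>psq\<close> is
  a seminorm, so the iteration is carried out by hand and the limit is identified through a
  vanishing residual.\<close>

lemma continuation_step:
  fixes F :: "(nat \<Rightarrow> 'w \<Rightarrow> 'v::euclidean_space) \<Rightarrow> nat \<Rightarrow> 'w \<Rightarrow> 'v"
  defines "X \<equiv> L2F M w {..N} :: (nat \<Rightarrow> 'w \<Rightarrow> 'v) set"
  assumes F: "\<And>\<theta>. \<theta> \<in> X \<Longrightarrow> F \<theta> \<in> X"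
    and lip: "\<And>\<theta> \<theta>'. \<theta> \<in> X \<Longrightarrow> \<theta>' \<in> X \<Longrightarrow>
      psq M N (\<lambda>k \<omega>. F \<theta> k \<omega> - F \<theta>' k \<omega>) \<le> Lp * psq M N (\<lambda>k \<omega>. \<theta> k \<omega> - \<theta>' k \<omega>)"
    and stab: "\<And>\<theta> \<theta>'. \<theta> \<in> X \<Longrightarrow> \<theta>' \<in> X \<Longrightarrow> psq M N (\<lambda>k \<omega>. \<theta> k \<omega> - \<theta>' k \<omega>)
      \<le> C * psq M N (\<lambda>k \<omega>. (\<theta> k \<omega> - \<alpha> *\<^sub>R F \<theta> k \<omega>) - (\<theta>' k \<omega> - \<alpha> *\<^sub>R F \<theta>' k \<omega>))"
    and C: "0 \<le> C" and small: "\<delta>\<^sup>2 * C * Lp \<le> 1 / 16"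
    and solv: "\<And>\<eta>. \<eta> \<in> X \<Longrightarrow> \<exists>\<theta>\<in>X. \<forall>k\<le>N. AE \<omega> in M. \<theta> k \<omega> - \<alpha> *\<^sub>R F \<theta> k \<omega> = \<eta> k \<omega>"
    and \<eta>: "\<eta> \<in> X"
  shows "\<exists>\<theta>\<in>X. \<forall>k\<le>N. AE \<omega> in M. \<theta> k \<omega> - (\<alpha> + \<delta>) *\<^sub>R F \<theta> k \<omega> = \<eta> k \<omega>"
proof -
  note lin = L2F_linear[where 'a='v, folded X_def] and sc = L2F_scaleR[where 'a='v, folded X_def]
  obtain sol where sol: "\<And>\<eta>. \<eta> \<in> X \<Longrightarrow> sol \<eta> \<in> X"
    and sol_eq: "\<And>\<eta> k. \<eta> \<in> X \<Longrightarrow> k \<le> N \<Longrightarrow> AE \<omega> in M. sol \<eta> k \<omega> - \<alpha> *\<^sub>R F (sol \<eta>) k \<omega> = \<eta> k \<omega>"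
    using solv by metis
  define nxt where "nxt \<theta> = sol (\<lambda>k \<omega>. \<eta> k \<omega> + \<delta> *\<^sub>R F \<theta> k \<omega>)" for \<theta>
  have in_X: "(\<lambda>k \<omega>. \<eta> k \<omega> + \<delta> *\<^sub>R F \<theta> k \<omega>) \<in> X" if "\<theta> \<in> X" for \<theta>
    by (intro lin(1) \<eta> sc[OF F] that)
  have nxt: "nxt \<theta> \<in> X" if "\<theta> \<in> X" for \<theta>
    unfolding nxt_def by (intro sol in_X that)
  have nxt_eq: "AE \<omega> in M. nxt \<theta> k \<omega> - \<alpha> *\<^sub>R F (nxt \<theta>) k \<omega> = \<eta> k \<omega> + \<delta> *\<^sub>R F \<theta> k \<omega>"
    if "\<theta> \<in> X" "k \<le> N" for \<theta> k
    unfolding nxt_def using sol_eq[OF in_X[OF that(1)] that(2)] .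
  have contr: "psq M N (\<lambda>k \<omega>. nxt \<theta> k \<omega> - nxt \<theta>' k \<omega>) \<le> 1/16 * psq M N (\<lambda>k \<omega>. \<theta> k \<omega> - \<theta>' k \<omega>)"
    if \<theta>: "\<theta> \<in> X" "\<theta>' \<in> X" for \<theta> \<theta>'
  proof -
    have "psq M N (\<lambda>k \<omega>. (nxt \<theta> k \<omega> - \<alpha> *\<^sub>R F (nxt \<theta>) k \<omega>) - (nxt \<theta>' k \<omega> - \<alpha> *\<^sub>R F (nxt \<theta>') k \<omega>))
        = psq M N (\<lambda>k \<omega>. \<delta> *\<^sub>R (F \<theta> k \<omega> - F \<theta>' k \<omega>))"
    proof (rule psq_cong_AE, fold X_def)
      show "(\<lambda>k \<omega>. (nxt \<theta> k \<omega> - \<alpha> *\<^sub>R F (nxt \<theta>) k \<omega>) - (nxt \<theta>' k \<omega> - \<alpha> *\<^sub>R F (nxt \<theta>') k \<omega>)) \<in> X"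
        by (intro lin(2) sc[OF F] nxt \<theta>)
      show "(\<lambda>k \<omega>. \<delta> *\<^sub>R (F \<theta> k \<omega> - F \<theta>' k \<omega>)) \<in> X"
        by (rule sc[OF lin(2)]) (intro F \<theta>)+
      fix k assume "k \<le> N"
      from nxt_eq[OF \<theta>(1) this] nxt_eq[OF \<theta>(2) this]
      show "AE \<omega> in M. (nxt \<theta> k \<omega> - \<alpha> *\<^sub>R F (nxt \<theta>) k \<omega>) - (nxt \<theta>' k \<omega> - \<alpha> *\<^sub>R F (nxt \<theta>') k \<omega>)
          = \<delta> *\<^sub>R (F \<theta> k \<omega> - F \<theta>' k \<omega>)"
        by eventually_elim (simp add: algebra_simps)
    qed
    also have "\<dots> = \<delta>\<^sup>2 * psq M N (\<lambda>k \<omega>. F \<theta> k \<omega> - F \<theta>' k \<omega>)"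
      by (rule psq_scaleR, fold X_def) (intro lin(2) F \<theta>)
    also have "\<dots> \<le> \<delta>\<^sup>2 * (Lp * psq M N (\<lambda>k \<omega>. \<theta> k \<omega> - \<theta>' k \<omega>))"
      by (intro mult_left_mono lip \<theta>) simp
    finally have "psq M N (\<lambda>k \<omega>. nxt \<theta> k \<omega> - nxt \<theta>' k \<omega>)
        \<le> C * (\<delta>\<^sup>2 * (Lp * psq M N (\<lambda>k \<omega>. \<theta> k \<omega> - \<theta>' k \<omega>)))"
      using stab[OF nxt[OF \<theta>(1)] nxt[OF \<theta>(2)]] C by (meson mult_left_mono order_trans)
    also have "\<dots> = (\<delta>\<^sup>2 * C * Lp) * psq M N (\<lambda>k \<omega>. \<theta> k \<omega> - \<theta>' k \<omega>)" by simp
    also have "\<dots> \<le> 1/16 * psq M N (\<lambda>k \<omega>. \<theta> k \<omega> - \<theta>' k \<omega>)"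
      by (intro mult_right_mono small) simp
    finally show ?thesis .
  qed
  define it where "it n = (nxt ^^ n) (\<lambda>k \<omega>. 0)" for n
  have it: "it n \<in> X" for n
    by (induction n) (auto simp: it_def X_def L2F_0 nxt[unfolded X_def])
  have it_Suc: "it (Suc n) = nxt (it n)" for n by (simp add: it_def)
  have geo: "psq M N (\<lambda>k \<omega>. it (Suc n) k \<omega> - it n k \<omega>)
      \<le> psq M N (\<lambda>k \<omega>. it 1 k \<omega> - it 0 k \<omega>) * (1/16)^n" for n
  proof (induction n)
    case (Suc n)
    have "psq M N (\<lambda>k \<omega>. it (Suc (Suc n)) k \<omega> - it (Suc n) k \<omega>)
        \<le> 1/16 * psq M N (\<lambda>k \<omega>. it (Suc n) k \<omega> - it n k \<omega>)"
      using contr[OF it[of "Suc n"] it[of n]] by (simp add: it_Suc)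
    with Suc show ?case by simp
  qed simp
  obtain g where g: "g \<in> X" and lim: "(\<lambda>n. psq M N (\<lambda>k \<omega>. it n k \<omega> - g k \<omega>)) \<longlonglongrightarrow> 0"
    using L2F_limit[OF it[unfolded X_def] geo, folded X_def] by blast
  have \<theta>: "(\<lambda>k \<omega>. (g k \<omega> - (\<alpha> + \<delta>) *\<^sub>R F g k \<omega>) - \<eta> k \<omega>) \<in> X"
    by (intro lin(2) sc[OF F] g \<eta>)
  \<comment> \<open>Subtracting the equation of the iterate \<open>Suc n\<close> writes the residual
    of the limit as \<open>g - it (Suc n)\<close> minus the corresponding differences of
    \<open>F\<close>, weighted with \<open>\<alpha>\<close> and \<open>\<delta>\<close>; all of them
    tend to 0.\<close>
  have bound: "psq M N (\<lambda>k \<omega>. (g k \<omega> - (\<alpha> + \<delta>) *\<^sub>R F g k \<omega>) - \<eta> k \<omega>)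
      \<le> (2 + 4 * \<alpha>\<^sup>2 * Lp) * psq M N (\<lambda>k \<omega>. it (Suc n) k \<omega> - g k \<omega>)
        + 4 * \<delta>\<^sup>2 * Lp * psq M N (\<lambda>k \<omega>. it n k \<omega> - g k \<omega>)" for n
  proof -
    let ?A = "\<lambda>k \<omega>. g k \<omega> - it (Suc n) k \<omega>"
    let ?B = "\<lambda>k \<omega>. \<alpha> *\<^sub>R (F g k \<omega> - F (it (Suc n)) k \<omega>)"
    let ?D = "\<lambda>k \<omega>. \<delta> *\<^sub>R (F g k \<omega> - F (it n) k \<omega>)"
    have X: "?A \<in> X" "?B \<in> X" "?D \<in> X"
      by (intro lin(2) sc[OF lin(2)] F g it)+
    have "psq M N (\<lambda>k \<omega>. (g k \<omega> - (\<alpha> + \<delta>) *\<^sub>R F g k \<omega>) - \<eta> k \<omega>)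
        = psq M N (\<lambda>k \<omega>. ?A k \<omega> - (?B k \<omega> + ?D k \<omega>))"
    proof (rule psq_cong_AE[OF \<theta>[unfolded X_def]], fold X_def)
      show "(\<lambda>k \<omega>. ?A k \<omega> - (?B k \<omega> + ?D k \<omega>)) \<in> X"
        by (intro lin(2)[OF X(1)] lin(1) X)
      fix k assume "k \<le> N"
      from nxt_eq[OF it this, of n, folded it_Suc]
      show "AE \<omega> in M. (g k \<omega> - (\<alpha> + \<delta>) *\<^sub>R F g k \<omega>) - \<eta> k \<omega> = ?A k \<omega> - (?B k \<omega> + ?D k \<omega>)"
      proof eventually_elim
        case (elim \<omega>)
        then have e: "\<eta> k \<omega> = it (Suc n) k \<omega> - \<alpha> *\<^sub>R F (it (Suc n)) k \<omega> - \<delta> *\<^sub>R F (it n) k \<omega>"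
          by (simp add: algebra_simps)
        show ?case unfolding e by (simp add: algebra_simps)
      qed
    qed
    also have "\<dots> \<le> 2 * psq M N ?A + 2 * psq M N (\<lambda>k \<omega>. ?B k \<omega> + ?D k \<omega>)"
      using X lin(1)[OF X(2,3)] unfolding X_def by (rule_tac psq_diff) auto
    also have "\<dots> \<le> 2 * psq M N ?A + 2 * (2 * psq M N ?B + 2 * psq M N ?D)"
      using psq_add[OF X(2,3)[unfolded X_def]] by simp
    also have "psq M N ?B = \<alpha>\<^sup>2 * psq M N (\<lambda>k \<omega>. F g k \<omega> - F (it (Suc n)) k \<omega>)"
      by (rule psq_scaleR, fold X_def) (intro lin(2) F g it)
    also have "psq M N ?D = \<delta>\<^sup>2 * psq M N (\<lambda>k \<omega>. F g k \<omega> - F (it n) k \<omega>)"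
      by (rule psq_scaleR, fold X_def) (intro lin(2) F g it)
    also have "2 * psq M N ?A + 2 * (2 * (\<alpha>\<^sup>2 * psq M N (\<lambda>k \<omega>. F g k \<omega> - F (it (Suc n)) k \<omega>))
          + 2 * (\<delta>\<^sup>2 * psq M N (\<lambda>k \<omega>. F g k \<omega> - F (it n) k \<omega>)))
        \<le> 2 * psq M N ?A + 2 * (2 * (\<alpha>\<^sup>2 * (Lp * psq M N (\<lambda>k \<omega>. g k \<omega> - it (Suc n) k \<omega>)))
          + 2 * (\<delta>\<^sup>2 * (Lp * psq M N (\<lambda>k \<omega>. g k \<omega> - it n k \<omega>))))"
      by (intro add_mono mult_left_mono lip g it order_refl) auto
    also have "\<dots> = (2 + 4 * \<alpha>\<^sup>2 * Lp) * psq M N (\<lambda>k \<omega>. it (Suc n) k \<omega> - g k \<omega>)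
        + 4 * \<delta>\<^sup>2 * Lp * psq M N (\<lambda>k \<omega>. it n k \<omega> - g k \<omega>)"
      by (simp add: psq_commute[of M N g] algebra_simps)
    finally show ?thesis .
  qed
  have "(\<lambda>n. (2 + 4 * \<alpha>\<^sup>2 * Lp) * psq M N (\<lambda>k \<omega>. it (Suc n) k \<omega> - g k \<omega>)
        + 4 * \<delta>\<^sup>2 * Lp * psq M N (\<lambda>k \<omega>. it n k \<omega> - g k \<omega>)) \<longlonglongrightarrow>
      (2 + 4 * \<alpha>\<^sup>2 * Lp) * 0 + 4 * \<delta>\<^sup>2 * Lp * 0"
    by (intro tendsto_intros lim LIMSEQ_Suc[OF lim])
  then have "psq M N (\<lambda>k \<omega>. (g k \<omega> - (\<alpha> + \<delta>) *\<^sub>R F g k \<omega>) - \<eta> k \<omega>) \<le> (2 + 4 * \<alpha>\<^sup>2 * Lp) * 0 + 4 * \<delta>\<^sup>2 * Lp * 0"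
    by (rule LIMSEQ_le_const) (use bound in auto)
  then have "psq M N (\<lambda>k \<omega>. (g k \<omega> - (\<alpha> + \<delta>) *\<^sub>R F g k \<omega>) - \<eta> k \<omega>) = 0"
    using psq_nonneg[of M N "\<lambda>k \<omega>. (g k \<omega> - (\<alpha> + \<delta>) *\<^sub>R F g k \<omega>) - \<eta> k \<omega>"] by simp
  then have "\<forall>k\<le>N. AE \<omega> in M. (g k \<omega> - (\<alpha> + \<delta>) *\<^sub>R F g k \<omega>) - \<eta> k \<omega> = 0"
    using psq_eq_0_iff[OF \<theta>[unfolded X_def]] by blast
  then show ?thesis using g by auto
qed

text \<open>The stability constant does not depend on \<open>\<alpha>\<close>, so the admissible
  step has a fixed width \<open>1 / m\<close>, and \<open>m\<close> steps lead from the identity at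
  0 to the full equation at 1. The choice of \<open>m\<close> above 1 and
  \<open>16 * (C * Lp)\<close> gives the smallness required by a single step.\<close>

lemma continuation:
  fixes F :: "(nat \<Rightarrow> 'w \<Rightarrow> 'v::euclidean_space) \<Rightarrow> nat \<Rightarrow> 'w \<Rightarrow> 'v"
  defines "X \<equiv> L2F M w {..N} :: (nat \<Rightarrow> 'w \<Rightarrow> 'v) set"
  assumes F: "\<And>\<theta>. \<theta> \<in> X \<Longrightarrow> F \<theta> \<in> X"
    and lip: "\<And>\<theta> \<theta>'. \<theta> \<in> X \<Longrightarrow> \<theta>' \<in> X \<Longrightarrow>
      psq M N (\<lambda>k \<omega>. F \<theta> k \<omega> - F \<theta>' k \<omega>) \<le> Lp * psq M N (\<lambda>k \<omega>. \<theta> k \<omega> - \<theta>' k \<omega>)"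
    and stab: "\<And>\<alpha> \<theta> \<theta>'. 0 \<le> \<alpha> \<Longrightarrow> \<alpha> \<le> 1 \<Longrightarrow> \<theta> \<in> X \<Longrightarrow> \<theta>' \<in> X \<Longrightarrow> psq M N (\<lambda>k \<omega>. \<theta> k \<omega> - \<theta>' k \<omega>)
      \<le> C * psq M N (\<lambda>k \<omega>. (\<theta> k \<omega> - \<alpha> *\<^sub>R F \<theta> k \<omega>) - (\<theta>' k \<omega> - \<alpha> *\<^sub>R F \<theta>' k \<omega>))"
    and C: "0 \<le> C" and \<eta>: "\<eta> \<in> X"
  shows "\<exists>\<theta>\<in>X. \<forall>k\<le>N. AE \<omega> in M. \<theta> k \<omega> - F \<theta> k \<omega> = \<eta> k \<omega>"
proof -
  obtain m :: nat where "max 1 (16 * (C * Lp)) \<le> real m"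
    using real_arch_simple by blast
  then have m: "1 \<le> real m" "16 * (C * Lp) \<le> real m" by auto
  have small: "(1 / real m)\<^sup>2 * C * Lp \<le> 1 / 16"
  proof -
    have "real m \<le> real m * real m" using mult_left_mono[OF m(1), of "real m"] by simp
    with m(2) have "16 * (C * Lp) \<le> real m * real m" by linarith
    then show ?thesis using m by (simp add: field_simps power2_eq_square)
  qed
  have "\<forall>\<eta>\<in>X. \<exists>\<theta>\<in>X. \<forall>k\<le>N. AE \<omega> in M. \<theta> k \<omega> - (real j / real m) *\<^sub>R F \<theta> k \<omega> = \<eta> k \<omega>" if "j \<le> m" for j
    using that
  proof (induction j)
    case 0
    then show ?case by auto
  next
    case (Suc j)
    have eq: "real (Suc j) / real m = real j / real m + 1 / real m" by (simp add: add_divide_distrib)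
    have le: "0 \<le> real j / real m" "real j / real m \<le> 1" using Suc.prems m by auto
    have IH: "\<exists>\<theta>\<in>X. \<forall>k\<le>N. AE \<omega> in M. \<theta> k \<omega> - (real j / real m) *\<^sub>R F \<theta> k \<omega> = \<eta> k \<omega>"
      if "\<eta> \<in> X" for \<eta>
      using Suc that by simp
    show ?case
      unfolding eq
    proof
      fix \<eta> assume \<eta>: "\<eta> \<in> X"
      show "\<exists>\<theta>\<in>X. \<forall>k\<le>N. AE \<omega> in M. \<theta> k \<omega> - (real j / real m + 1 / real m) *\<^sub>R F \<theta> k \<omega> = \<eta> k \<omega>"
        by (rule continuation_step[where F=F and Lp=Lp and C=C, folded X_def])
          (fact F | fact lip | fact stab[OF le] | fact C | fact small | fact IH | fact \<eta>)+
    qed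
  qed
  from this[of m] m \<eta> show ?thesis by auto
qed

end

section \<open>Discrete Gronwall estimates for the two orders of integration\<close>

lemma discrete_gronwall:
  fixes a d :: "nat \<Rightarrow> real"
  assumes c: "1 \<le> c" and a: "\<And>k. 0 \<le> a k" and d: "\<And>k. 0 \<le> d k"
    and step: "\<And>k. k < N \<Longrightarrow> a (Suc k) \<le> c * (a k + d k)" and k: "k \<le> N"
  shows "a k \<le> c ^ N * (a 0 + (\<Sum>j<N. d j))"
proof -
  have "a k \<le> c ^ k * (a 0 + (\<Sum>j<k. d j))"
    using k
  proof (induction k)
    case (Suc k)
    have "1 \<le> c ^ k" using c by (rule one_le_power)
    then have "d k \<le> c ^ k * d k" using d[of k] by (simp add: mult_le_cancel_right1)
    then have "a k + d k \<le> c ^ k * (a 0 + (\<Sum>j<Suc k. d j))"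
      using Suc by (simp add: algebra_simps)
    then have "c * (a k + d k) \<le> c * (c ^ k * (a 0 + (\<Sum>j<Suc k. d j)))"
      using c by (intro mult_left_mono) auto
    then show ?case using step[of k] Suc.prems by simp
  qed simp
  also have "\<dots> \<le> c ^ N * (a 0 + (\<Sum>j<N. d j))"
    using k c a d
    by (intro mult_mono power_increasing add_mono sum_mono2) (auto intro!: add_nonneg_nonneg sum_nonneg)
  finally show ?thesis .
qed

lemma discrete_gronwall_backward:
  fixes a d :: "nat \<Rightarrow> real"
  assumes c: "1 \<le> c" and a: "\<And>k. 0 \<le> a k" and d: "\<And>k. 0 \<le> d k"
    and step: "\<And>k. k < N \<Longrightarrow> a k \<le> c * (a (Suc k) + d k)" and k: "k \<le> N"
  shows "a k \<le> c ^ N * (a N + (\<Sum>j<N. d j))"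
proof -
  have "a (N - (N - k)) \<le> c ^ N * (a (N - 0) + (\<Sum>j<N. d (N - Suc j)))"
  proof (rule discrete_gronwall[of c "\<lambda>j. a (N - j)"])
    fix j assume "j < N"
    then show "a (N - Suc j) \<le> c * (a (N - j) + d (N - Suc j))"
      using step[of "N - Suc j"] by (simp add: Suc_diff_Suc)
  qed (use assms in auto)
  also have "(\<Sum>j<N. d (N - Suc j)) = (\<Sum>j<N. d j)"
    by (rule sum.nat_diff_reindex)
  finally show ?thesis using k by simp
qed

text \<open>Origin of the factors: two Gronwall passes cost \<open>(8 * L) ^ N\<close> each, one
  more \<open>8 * L\<close> comes from linking them, each pass is summed over \<open>N + 1\<close>
  times, and 4 covers the sum of the three terms that arise.\<close>

definition fb_const :: "real \<Rightarrow> nat \<Rightarrow> real" where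
  "fb_const L N = 4 * (real N + 1)\<^sup>2 * (8 * L) ^ (2 * N + 1)"

lemma fb_const_ge_1: "1 \<le> L \<Longrightarrow> 1 \<le> fb_const L N"
proof -
  assume "1 \<le> L"
  then have "1 \<le> (8 * L) ^ (2 * N + 1)" by (intro one_le_power) simp
  moreover have "1 \<le> (real N + 1)\<^sup>2" by (intro one_le_power) simp
  ultimately have "1 * 1 \<le> (real N + 1)\<^sup>2 * (8 * L) ^ (2 * N + 1)" by (intro mult_mono) auto
  then show ?thesis unfolding fb_const_def by simp
qed

lemma fb_const_bounds:
  fixes L :: real and N :: nat
  assumes L: "1 \<le> L"
  defines "c \<equiv> 8 * L" and "n \<equiv> real N + 1"
  shows "n * c ^ N + n * (c ^ N * (c * (n * c ^ N + 1))) \<le> fb_const L N"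
    "n * (c ^ N * (1 + n * (c * c ^ N))) + n * (c * c ^ N) \<le> fb_const L N"
    "c * c ^ N \<le> fb_const L N"
proof -
  have c: "1 \<le> c" "1 \<le> n" using L by (auto simp: c_def n_def)
  have p: "1 \<le> c ^ N" using c by (intro one_le_power)
  define u where "u = n * c ^ N"
  define K where "K = n\<^sup>2 * (c * (c ^ N * c ^ N))"
  have n2: "n \<le> n\<^sup>2" using c by (simp add: power2_eq_square)
  have K: "fb_const L N = 4 * K"
    unfolding fb_const_def K_def c_def[symmetric] n_def[symmetric]
    by (simp add: power_add mult_2 power_mult_distrib)
  have a: "n * c ^ N \<le> K"
  proof -
    have "c ^ N * 1 \<le> c * c ^ N * c ^ N" using c p by (intro mult_mono) (auto simp: mult_le_cancel_right1)
    then have "n * c ^ N \<le> n\<^sup>2 * (c * (c ^ N * c ^ N))" using n2 c p by (intro mult_mono) (auto simp: mult.assoc)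
    then show ?thesis by (simp add: K_def)
  qed
  have b: "n * (c * c ^ N) \<le> K"
  proof -
    have "c * c ^ N * 1 \<le> c * c ^ N * c ^ N" using c p by (intro mult_mono) auto
    then have "n * (c * c ^ N) \<le> n\<^sup>2 * (c * (c ^ N * c ^ N))" using n2 c p by (intro mult_mono) (auto simp: mult.assoc)
    then show ?thesis by (simp add: K_def)
  qed
  have e: "c * c ^ N \<le> n * (c * c ^ N)" using mult_right_mono[OF c(2), of "c * c ^ N"] c p by simp
  have d: "n * (c ^ N * (c * (n * c ^ N))) = K" by (simp add: K_def power2_eq_square ac_simps)
  have f: "n * (c ^ N * (n * (c * c ^ N))) = K" by (simp add: K_def power2_eq_square ac_simps)
  have K0: "0 \<le> K" using c p by (simp add: K_def)
  show "n * c ^ N + n * (c ^ N * (c * (n * c ^ N + 1))) \<le> fb_const L N"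
    using a b d K K0 by (simp add: distrib_left mult.commute mult.left_commute)
  show "n * (c ^ N * (1 + n * (c * c ^ N))) + n * (c * c ^ N) \<le> fb_const L N"
    using a b f K K0 by (simp add: distrib_left)
  show "c * c ^ N \<le> fb_const L N"
    using b e K K0 by simp
qed

text \<open>The recursion for \<open>X\<close> contains no \<open>Y\<close>, so it is solved first;
  its sum then feeds the backward recursion for \<open>Y\<close>. In the application
  \<open>q\<close> is the scaled monotonicity defect and \<open>R\<close> the residual.\<close>

lemma fb_estimate_forward_first:
  fixes X Y q R :: "nat \<Rightarrow> real"
  assumes L: "1 \<le> L" and nn: "\<And>k. 0 \<le> X k" "\<And>k. 0 \<le> Y k" "\<And>k. k \<le> N \<Longrightarrow> 0 \<le> q k" "\<And>k. 0 \<le> R k"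
    and X: "\<And>k. k < N \<Longrightarrow> X (Suc k) \<le> 8 * L * (X k + q k + R (Suc k))"
    and Y: "\<And>k. k < N \<Longrightarrow> Y k \<le> 8 * L * (Y (Suc k) + X k + R k)"
    and YN: "Y N \<le> 8 * L * (X N + R N)"
  shows "(\<Sum>k\<le>N. X k + Y k) \<le> fb_const L N * (X 0 + (\<Sum>k\<le>N. q k) + (\<Sum>k\<le>N. R k))"
proof -
  define c where "c = 8 * L"
  define n where "n = real N + 1"
  define E where "E = X 0 + (\<Sum>k\<le>N. q k) + (\<Sum>k\<le>N. R k)"
  have c: "1 \<le> c" using L by (simp add: c_def)
  have p: "1 \<le> c ^ N" using c by (rule one_le_power)
  have E: "0 \<le> E" unfolding E_def using nn by (intro add_nonneg_nonneg sum_nonneg) auto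
  have "0 \<le> (\<Sum>k\<le>N. q k)" using nn by (intro sum_nonneg) auto
  then have RE: "(\<Sum>k\<le>N. R k) \<le> E" unfolding E_def using nn(1)[of 0] by simp
  have Xb: "X k \<le> c ^ N * E" if "k \<le> N" for k
  proof -
    \<comment> \<open>The Gronwall lemma asks for nonnegative data at all indices, while
      \<open>q\<close> is known to be nonnegative only up to \<open>N\<close>.\<close>
    define d where "d j = (if j < N then q j + R (Suc j) else 0)" for j
    have "X k \<le> c ^ N * (X 0 + (\<Sum>j<N. d j))"
      using c nn X that by (intro discrete_gronwall) (auto simp: d_def c_def add.assoc)
    also have "(\<Sum>j<N. d j) = (\<Sum>j<N. q j) + (\<Sum>j<N. R (Suc j))"
      by (simp add: d_def sum.distrib)
    also have "(\<Sum>j<N. q j) \<le> (\<Sum>k\<le>N. q k)" using nn by (intro sum_mono2) auto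
    also have "(\<Sum>j<N. R (Suc j)) \<le> (\<Sum>k\<le>N. R k)" using nn by (simp add: sum.atMost_shift)
    finally show ?thesis using p by (simp add: E_def mult_left_mono add.assoc)
  qed
  have sX: "(\<Sum>k\<le>N. X k) \<le> n * (c ^ N * E)"
    using sum_bounded_above[of "{..N}" X "c ^ N * E"] Xb by (simp add: n_def add.commute)
  have Yb: "Y k \<le> c ^ N * (c * (n * c ^ N + 1)) * E" if "k \<le> N" for k
  proof -
    have s0: "0 \<le> (\<Sum>j<N. X j + R j)" using nn by (intro sum_nonneg) auto
    have "Y k \<le> c ^ N * (Y N + (\<Sum>j<N. X j + R j))"
      using c nn Y that by (intro discrete_gronwall_backward) (auto simp: c_def add.assoc)
    also have "\<dots> \<le> c ^ N * (c * (X N + R N) + c * (\<Sum>j<N. X j + R j))"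
      using YN p mult_right_mono[OF c, of "\<Sum>j<N. X j + R j"] s0
      by (intro mult_left_mono add_mono) (auto simp: c_def)
    also have "\<dots> = c ^ N * (c * ((\<Sum>k\<le>N. X k) + (\<Sum>k\<le>N. R k)))"
      by (simp add: lessThan_Suc_atMost[symmetric] sum.distrib algebra_simps)
    also have "\<dots> \<le> c ^ N * (c * (n * (c ^ N * E) + E))"
      using sX RE c p by (intro mult_left_mono add_mono) auto
    finally show ?thesis by (simp add: algebra_simps)
  qed
  have sY: "(\<Sum>k\<le>N. Y k) \<le> n * (c ^ N * (c * (n * c ^ N + 1)) * E)"
    using sum_bounded_above[of "{..N}" Y "c ^ N * (c * (n * c ^ N + 1)) * E"] Yb by (simp add: n_def add.commute)
  have "(\<Sum>k\<le>N. X k + Y k) \<le> (n * c ^ N + n * (c ^ N * (c * (n * c ^ N + 1)))) * E"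
    using sX sY by (simp add: sum.distrib algebra_simps)
  also have "\<dots> \<le> fb_const L N * E"
    using fb_const_bounds(1)[OF L, of N] E by (intro mult_right_mono) (auto simp: c_def n_def)
  finally show ?thesis by (simp add: E_def)
qed

text \<open>Here the recursion for \<open>Y\<close>, including its terminal value, contains no
  \<open>X\<close>. This yields in addition a bound of \<open>Y 0\<close> without
  \<open>X 0\<close>, which breaks the circle \<open>x 0 = \<Lambda> (y 0)\<close> when the initial
  map is only locally Lipschitz.\<close>

lemma fb_estimate_backward_first:
  fixes X Y q R :: "nat \<Rightarrow> real"
  assumes L: "1 \<le> L" and nn: "\<And>k. 0 \<le> X k" "\<And>k. 0 \<le> Y k" "\<And>k. k \<le> N \<Longrightarrow> 0 \<le> q k" "\<And>k. 0 \<le> R k"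
    and X: "\<And>k. k < N \<Longrightarrow> X (Suc k) \<le> 8 * L * (X k + Y (Suc k) + R (Suc k))"
    and Y: "\<And>k. k < N \<Longrightarrow> Y k \<le> 8 * L * (Y (Suc k) + q k + R k)"
    and YN: "Y N \<le> 8 * L * (q N + R N)"
  shows "(\<Sum>k\<le>N. X k + Y k) \<le> fb_const L N * (X 0 + (\<Sum>k\<le>N. q k) + (\<Sum>k\<le>N. R k))"
    "Y 0 \<le> fb_const L N * ((\<Sum>k\<le>N. q k) + (\<Sum>k\<le>N. R k))"
proof -
  define c where "c = 8 * L"
  define n where "n = real N + 1"
  define E where "E = (\<Sum>k\<le>N. q k) + (\<Sum>k\<le>N. R k)"
  have c: "1 \<le> c" using L by (simp add: c_def)
  have p: "1 \<le> c ^ N" using c by (rule one_le_power)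
  have E: "0 \<le> E" unfolding E_def using nn by (intro add_nonneg_nonneg sum_nonneg) auto
  have "0 \<le> (\<Sum>k\<le>N. q k)" using nn by (intro sum_nonneg) auto
  then have RE: "(\<Sum>k\<le>N. R k) \<le> E" unfolding E_def using nn(1)[of 0] by simp
  have Yb: "Y k \<le> c * c ^ N * E" if "k \<le> N" for k
  proof -
    define d where "d j = (if j < N then q j + R j else 0)" for j
    have dn: "0 \<le> d j" for j using nn by (simp add: d_def)
    have "Y k \<le> c ^ N * (Y N + (\<Sum>j<N. d j))"
      using c nn Y that dn by (intro discrete_gronwall_backward) (auto simp: d_def c_def add.assoc)
    also have "\<dots> \<le> c ^ N * (c * (q N + R N) + c * (\<Sum>j<N. d j))"
      using YN c p sum_nonneg[of "{..<N}" d] dn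
      by (intro mult_left_mono add_mono) (auto simp: c_def mult_le_cancel_right1)
    also have "(\<Sum>j<N. d j) = (\<Sum>j<N. q j + R j)" by (simp add: d_def)
    also have "c ^ N * (c * (q N + R N) + c * (\<Sum>j<N. q j + R j)) = c * c ^ N * E"
      by (simp add: E_def lessThan_Suc_atMost[symmetric] sum.distrib algebra_simps)
    finally show ?thesis .
  qed
  have sY: "(\<Sum>k\<le>N. Y k) \<le> n * (c * c ^ N * E)"
    using sum_bounded_above[of "{..N}" Y "c * c ^ N * E"] Yb by (simp add: n_def add.commute)
  have Xb: "X k \<le> c ^ N * (1 + n * (c * c ^ N)) * (X 0 + E)" if "k \<le> N" for k
  proof -
    have "X k \<le> c ^ N * (X 0 + (\<Sum>j<N. Y (Suc j) + R (Suc j)))"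
      using c nn X that by (intro discrete_gronwall) (auto simp: c_def add.assoc)
    also have "(\<Sum>j<N. Y (Suc j) + R (Suc j)) \<le> (\<Sum>k\<le>N. Y k) + (\<Sum>k\<le>N. R k)"
      using nn by (simp add: sum.atMost_shift sum.distrib)
    also have "\<dots> \<le> n * (c * c ^ N * E) + E" using sY RE by simp
    also have "X 0 + (n * (c * c ^ N * E) + E) \<le> (1 + n * (c * c ^ N)) * (X 0 + E)"
      using nn(1)[of 0] c p by (simp add: algebra_simps n_def)
    finally show ?thesis using p by (simp add: mult_left_mono mult.assoc)
  qed
  have sX: "(\<Sum>k\<le>N. X k) \<le> n * (c ^ N * (1 + n * (c * c ^ N)) * (X 0 + E))"
    using sum_bounded_above[of "{..N}" X "c ^ N * (1 + n * (c * c ^ N)) * (X 0 + E)"] Xb by (simp add: n_def add.commute)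
  have "n * (c * c ^ N * E) \<le> n * (c * c ^ N) * (X 0 + E)"
    using nn(1)[of 0] c p by (simp add: algebra_simps n_def)
  then have "(\<Sum>k\<le>N. X k + Y k) \<le> (n * (c ^ N * (1 + n * (c * c ^ N))) + n * (c * c ^ N)) * (X 0 + E)"
    using sX sY unfolding sum.distrib distrib_right by (simp add: mult.assoc)
  also have "\<dots> \<le> fb_const L N * (X 0 + E)"
    using fb_const_bounds(2)[OF L, of N] E nn(1)[of 0] by (intro mult_right_mono) (auto simp: c_def n_def)
  finally show "(\<Sum>k\<le>N. X k + Y k) \<le> fb_const L N * (X 0 + (\<Sum>k\<le>N. q k) + (\<Sum>k\<le>N. R k))"
    by (simp add: E_def add.assoc)
  have "Y 0 \<le> c * c ^ N * E" using Yb by simp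
  also have "\<dots> \<le> fb_const L N * E"
    using fb_const_bounds(3)[OF L, of N] E by (intro mult_right_mono) (auto simp: c_def)
  finally show "Y 0 \<le> fb_const L N * ((\<Sum>k\<le>N. q k) + (\<Sum>k\<le>N. R k))" by (simp add: E_def)
qed

section \<open>Monotone forward-backward systems\<close>

type_synonym 'n triple = "(real^'n) \<times> (real^'n) \<times> (real^'n)"

definition fwd_coercive ::
  "'w measure \<Rightarrow> nat \<Rightarrow> (nat \<Rightarrow> 'n::finite triple \<Rightarrow> 'w \<Rightarrow> 'n triple) \<Rightarrow> real \<Rightarrow> real \<Rightarrow> bool" where
  "fwd_coercive M N g \<kappa> L \<longleftrightarrow> (\<forall>k<N. AE \<omega> in M. \<forall>\<theta> \<theta>'.
     (norm (snd (g k \<theta> \<omega> - g k \<theta>' \<omega>)))\<^sup>2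
       \<le> L * ((norm (fst (\<theta> - \<theta>')))\<^sup>2 - \<kappa> * ((g k \<theta> \<omega> - g k \<theta>' \<omega>) \<bullet> (\<theta> - \<theta>'))))"

definition bwd_coercive ::
  "'w measure \<Rightarrow> nat \<Rightarrow> (nat \<Rightarrow> 'n::finite triple \<Rightarrow> 'w \<Rightarrow> 'n triple) \<Rightarrow> ('w \<Rightarrow> real^'n \<Rightarrow> real^'n) \<Rightarrow>
    real \<Rightarrow> real \<Rightarrow> bool" where
  "bwd_coercive M N g \<Phi> \<kappa> L \<longleftrightarrow>
     (\<forall>k<N. AE \<omega> in M. \<forall>\<theta> \<theta>'.
       (norm (fst (g k \<theta> \<omega> - g k \<theta>' \<omega>)))\<^sup>2
         \<le> L * ((norm (snd (\<theta> - \<theta>')))\<^sup>2 - \<kappa> * ((g k \<theta> \<omega> - g k \<theta>' \<omega>) \<bullet> (\<theta> - \<theta>')))) \<and>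
     (AE \<omega> in M. \<forall>x x'. (norm (\<Phi> \<omega> x - \<Phi> \<omega> x'))\<^sup>2 \<le> L * (\<kappa> * ((\<Phi> \<omega> x - \<Phi> \<omega> x') \<bullet> (x - x'))))"

text \<open>
  Here \<open>g k\<close> is \<open>(f(k + 1), b(k), \<sigma>(k))\<close> with the control inserted, \<open>\<kappa> = 1\<close> and \<open>\<kappa> = -1\<close> are the two
  alternatives of Assumption (B)(iii), and the two kinds of coercivity are what remains of
  Assumption (B) for \<open>\<mu> > 0\<close> and for \<open>\<nu> > 0\<close>: the matrices are eliminated in favour of the
  monotonicity defect itself.
\<close>

locale fbs = noise M N w for M :: "'w measure" and N w +
  fixes g :: "nat \<Rightarrow> 'n::finite triple \<Rightarrow> 'w \<Rightarrow> 'n triple"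
    and \<Phi> :: "'w \<Rightarrow> real^'n \<Rightarrow> real^'n" and \<kappa> L :: real
  assumes L_ge_1: "1 \<le> L" and abs_kappa: "\<bar>\<kappa>\<bar> = 1"
    and g_measurable: "\<And>k \<theta>. k < N \<Longrightarrow> \<theta> \<in> borel_measurable (filt M w k) \<Longrightarrow>
      (\<lambda>\<omega>. g k (\<theta> \<omega>) \<omega>) \<in> borel_measurable (filt M w k)"
    and Phi_measurable: "\<And>x. x \<in> borel_measurable (filt M w N) \<Longrightarrow>
      (\<lambda>\<omega>. \<Phi> \<omega> (x \<omega>)) \<in> borel_measurable (filt M w N)"
    and g_0: "\<And>k. k < N \<Longrightarrow> sqint M (g k 0)" and Phi_0: "sqint M (\<lambda>\<omega>. \<Phi> \<omega> 0)"
    and g_lipschitz: "\<And>k. k < N \<Longrightarrow>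
      AE \<omega> in M. \<forall>\<theta> \<theta>'. (norm (g k \<theta> \<omega> - g k \<theta>' \<omega>))\<^sup>2 \<le> L * (norm (\<theta> - \<theta>'))\<^sup>2"
    and Phi_lipschitz: "AE \<omega> in M. \<forall>x x'. (norm (\<Phi> \<omega> x - \<Phi> \<omega> x'))\<^sup>2 \<le> L * (norm (x - x'))\<^sup>2"
    and g_monotone: "\<And>k. k < N \<Longrightarrow>
      AE \<omega> in M. \<forall>\<theta> \<theta>'. \<kappa> * ((g k \<theta> \<omega> - g k \<theta>' \<omega>) \<bullet> (\<theta> - \<theta>')) \<le> 0"
    and Phi_monotone: "AE \<omega> in M. \<forall>x x'. 0 \<le> \<kappa> * ((\<Phi> \<omega> x - \<Phi> \<omega> x') \<bullet> (x - x'))"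
    and coercive: "fwd_coercive M N g \<kappa> L \<or> bwd_coercive M N g \<Phi> \<kappa> L"
begin

definition tri :: "(nat \<Rightarrow> 'w \<Rightarrow> (real^'n) \<times> (real^'n)) \<Rightarrow> nat \<Rightarrow> 'w \<Rightarrow> 'n triple" where
  "tri h k \<omega> = (fst (h k \<omega>), cond_mean M w (\<lambda>k \<omega>. snd (h k \<omega>)) k \<omega>, cond_corr M w (\<lambda>k \<omega>. snd (h k \<omega>)) k \<omega>)"

definition coef :: "(nat \<Rightarrow> 'w \<Rightarrow> (real^'n) \<times> (real^'n)) \<Rightarrow> nat \<Rightarrow> 'w \<Rightarrow> 'n triple" where
  "coef h k \<omega> = g k (tri h k \<omega>) \<omega>"

text \<open>
  One pass through the system with the coefficients frozen along \<open>h\<close> and initial state \<open>0\<close>; the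
  initial condition is added as an inhomogeneity.
\<close>

definition sweep :: "(nat \<Rightarrow> 'w \<Rightarrow> (real^'n) \<times> (real^'n)) \<Rightarrow> nat \<Rightarrow> 'w \<Rightarrow> (real^'n) \<times> (real^'n)" where
  "sweep h k \<omega> =
    (case k of 0 \<Rightarrow> 0 | Suc j \<Rightarrow> fst (snd (coef h j \<omega>)) + w j \<omega> *\<^sub>R snd (snd (coef h j \<omega>)),
     if k < N then - fst (coef h k \<omega>) else \<Phi> \<omega> (fst (h k \<omega>)))"

lemma measurable_fst_snd:
  fixes f :: "'w \<Rightarrow> 'a::euclidean_space \<times> 'b::euclidean_space"
  assumes "f \<in> borel_measurable F"
  shows "(\<lambda>\<omega>. fst (f \<omega>)) \<in> borel_measurable F" "(\<lambda>\<omega>. snd (f \<omega>)) \<in> borel_measurable F"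
  using assms by (auto intro!: borel_measurable_continuous_on[where f=fst and g=f]
        borel_measurable_continuous_on[where f=snd and g=f] continuous_intros)

lemma process_fst_snd:
  assumes "h \<in> L2F M w {..N}" "k \<le> N"
  shows "(\<lambda>\<omega>. fst (h k \<omega>)) \<in> borel_measurable (filt M w k)" "sqint M (\<lambda>\<omega>. fst (h k \<omega>))"
    "(\<lambda>\<omega>. snd (h k \<omega>)) \<in> borel_measurable (filt M w k)" "sqint M (\<lambda>\<omega>. snd (h k \<omega>))"
  using measurable_fst_snd[OF L2F_D(1)[OF assms]] sqint_fst_snd[OF L2F_D(2)[OF assms]] by auto

lemma tri_L2:
  assumes "h \<in> L2F M w {..N}" "k < N"
  shows "tri h k \<in> borel_measurable (filt M w k)" "sqint M (tri h k)"
proof -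
  have y: "sqint M (\<lambda>\<omega>. snd (h (Suc k) \<omega>))" using assms by (intro process_fst_snd) auto
  have "(\<lambda>\<omega>. tri h k \<omega>) \<in> borel_measurable (filt M w k)"
    unfolding tri_def using assms
    by (intro borel_measurable_Pair process_fst_snd cond_mean_measurable cond_corr_measurable) auto
  then show "tri h k \<in> borel_measurable (filt M w k)" by simp
  have "sqint M (\<lambda>\<omega>. tri h k \<omega>)"
    unfolding tri_def using assms y
    by (intro sqint_Pair(1) process_fst_snd cond_mean_L2(1) cond_corr_L2(1)) auto
  then show "sqint M (tri h k)" by simp
qed

lemma coef_L2:
  assumes h: "h \<in> L2F M w {..N}" and k: "k < N"
  shows "coef h k \<in> borel_measurable (filt M w k)" "sqint M (coef h k)"
proof -
  have "(\<lambda>\<omega>. coef h k \<omega>) \<in> borel_measurable (filt M w k)"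
    unfolding coef_def by (intro g_measurable k tri_L2(1) h)
  then show m: "coef h k \<in> borel_measurable (filt M w k)" by simp
  show "sqint M (coef h k)"
  proof (rule sqint_bound(1))
    show "integrable M (\<lambda>\<omega>. 2 * (L * (norm (tri h k \<omega>))\<^sup>2) + 2 * (norm (g k 0 \<omega>))\<^sup>2)"
      using sqintD(2)[OF tri_L2(2)[OF h k]] sqintD(2)[OF g_0[OF k]] by simp
    show "coef h k \<in> borel_measurable M" using filt_measurable_imp[OF _ m] k by simp
    show "AE \<omega> in M. (norm (coef h k \<omega>))\<^sup>2 \<le> 2 * (L * (norm (tri h k \<omega>))\<^sup>2) + 2 * (norm (g k 0 \<omega>))\<^sup>2"
      using g_lipschitz[OF k]
    proof eventually_elim
      case (elim \<omega>)
      have "(norm (coef h k \<omega>))\<^sup>2 \<le> 2 * (norm (coef h k \<omega> - g k 0 \<omega>))\<^sup>2 + 2 * (norm (g k 0 \<omega>))\<^sup>2"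
        using norm_add_sq_le[of "coef h k \<omega> - g k 0 \<omega>" "g k 0 \<omega>"] by simp
      moreover have "(norm (coef h k \<omega> - g k 0 \<omega>))\<^sup>2 \<le> L * (norm (tri h k \<omega> - 0))\<^sup>2"
        unfolding coef_def using elim by blast
      ultimately show ?case by simp
    qed
  qed
qed

lemma end_value_L2:
  assumes h: "h \<in> L2F M w {..N}"
  shows "(\<lambda>\<omega>. \<Phi> \<omega> (fst (h N \<omega>))) \<in> borel_measurable (filt M w N)" "sqint M (\<lambda>\<omega>. \<Phi> \<omega> (fst (h N \<omega>)))"
proof -
  show m: "(\<lambda>\<omega>. \<Phi> \<omega> (fst (h N \<omega>))) \<in> borel_measurable (filt M w N)"
    by (intro Phi_measurable process_fst_snd h order_refl)
  show "sqint M (\<lambda>\<omega>. \<Phi> \<omega> (fst (h N \<omega>)))"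
  proof (rule sqint_bound(1))
    show "integrable M (\<lambda>\<omega>. 2 * (L * (norm (fst (h N \<omega>)))\<^sup>2) + 2 * (norm (\<Phi> \<omega> 0))\<^sup>2)"
      using sqintD(2)[OF process_fst_snd(2)[OF h order_refl]] sqintD(2)[OF Phi_0] by simp
    show "(\<lambda>\<omega>. \<Phi> \<omega> (fst (h N \<omega>))) \<in> borel_measurable M" using filt_measurable_imp[OF _ m] by simp
    show "AE \<omega> in M. (norm (\<Phi> \<omega> (fst (h N \<omega>))))\<^sup>2 \<le> 2 * (L * (norm (fst (h N \<omega>)))\<^sup>2) + 2 * (norm (\<Phi> \<omega> 0))\<^sup>2"
      using Phi_lipschitz
    proof eventually_elim
      case (elim \<omega>)
      have "(norm (\<Phi> \<omega> (fst (h N \<omega>))))\<^sup>2 \<le> 2 * (norm (\<Phi> \<omega> (fst (h N \<omega>)) - \<Phi> \<omega> 0))\<^sup>2 + 2 * (norm (\<Phi> \<omega> 0))\<^sup>2"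
        using norm_add_sq_le[of "\<Phi> \<omega> (fst (h N \<omega>)) - \<Phi> \<omega> 0" "\<Phi> \<omega> 0"] by simp
      moreover have "(norm (\<Phi> \<omega> (fst (h N \<omega>)) - \<Phi> \<omega> 0))\<^sup>2 \<le> L * (norm (fst (h N \<omega>) - 0))\<^sup>2"
        using elim by blast
      ultimately show ?case by simp
    qed
  qed
qed

lemma sweep_L2F:
  assumes h: "h \<in> L2F M w {..N}"
  shows "sweep h \<in> L2F M w {..N}"
proof (rule L2F_I)
  fix k assume k: "k \<le> N"
  have 1: "(\<lambda>\<omega>. fst (sweep h k \<omega>)) \<in> borel_measurable (filt M w k) \<and> sqint M (\<lambda>\<omega>. fst (sweep h k \<omega>))"
  proof (cases k)
    case 0
    then show ?thesis by (simp add: sweep_def finite_measure_axioms)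
  next
    case (Suc j)
    then have j: "j < N" using k by simp
    note m = measurable_fst_snd[OF measurable_fst_snd(2)[OF coef_L2(1)[OF h j]]]
    note s = sqint_fst_snd(1,2)[OF sqint_fst_snd(2)[OF coef_L2(2)[OF h j]]]
    have "(\<lambda>\<omega>. fst (snd (coef h j \<omega>)) + w j \<omega> *\<^sub>R snd (snd (coef h j \<omega>))) \<in> borel_measurable (filt M w (Suc j))"
      by (intro borel_measurable_add borel_measurable_scaleR measurable_filt_self lessI
          measurable_filt_mono[OF le_SucI[OF order_refl]] m)
    moreover have "sqint M (\<lambda>\<omega>. fst (snd (coef h j \<omega>)) + w j \<omega> *\<^sub>R snd (snd (coef h j \<omega>)))"
      by (intro sqint_add(1) s(1) sqint_noise(1)[OF j m(2) s(2)])
    ultimately show ?thesis using Suc by (simp add: sweep_def)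
  qed
  have 2: "(\<lambda>\<omega>. snd (sweep h k \<omega>)) \<in> borel_measurable (filt M w k) \<and> sqint M (\<lambda>\<omega>. snd (sweep h k \<omega>))"
  proof (cases "k < N")
    case True
    note m = measurable_fst_snd(1)[OF coef_L2(1)[OF h True]]
    note s = sqint_fst_snd(1)[OF coef_L2(2)[OF h True]]
    have "(\<lambda>\<omega>. - fst (coef h k \<omega>)) \<in> borel_measurable (filt M w k)"
      by (intro borel_measurable_uminus m)
    then show ?thesis using True sqint_minus(1)[OF s] by (simp add: sweep_def)
  next
    case False
    with k have "k = N" by simp
    then show ?thesis using end_value_L2[OF h] by (simp add: sweep_def)
  qed
  have "(\<lambda>\<omega>. (fst (sweep h k \<omega>), snd (sweep h k \<omega>))) \<in> borel_measurable (filt M w k)"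
    using 1 2 by (intro borel_measurable_Pair) auto
  then show "sweep h k \<in> borel_measurable (filt M w k)" by simp
  have "sqint M (\<lambda>\<omega>. (fst (sweep h k \<omega>), snd (sweep h k \<omega>)))"
    using 1 2 by (intro sqint_Pair(1)) auto
  then show "sqint M (sweep h k)" by simp
qed

lemma tri_diff:
  assumes h: "h \<in> L2F M w {..N}" "h' \<in> L2F M w {..N}" and k: "k < N"
  shows "AE \<omega> in M. tri h k \<omega> - tri h' k \<omega> = tri (\<lambda>k \<omega>. h k \<omega> - h' k \<omega>) k \<omega>"
proof -
  have y: "sqint M (\<lambda>\<omega>. snd (h (Suc k) \<omega>))" "sqint M (\<lambda>\<omega>. snd (h' (Suc k) \<omega>))"
    using h k by (auto intro!: process_fst_snd(4))
  from cond_mean_diff[OF k, of "\<lambda>k \<omega>. snd (h k \<omega>)" "\<lambda>k \<omega>. snd (h' k \<omega>)", OF y]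
    cond_corr_diff[OF k, of "\<lambda>k \<omega>. snd (h k \<omega>)" "\<lambda>k \<omega>. snd (h' k \<omega>)", OF y]
  show ?thesis
    by eventually_elim (simp add: tri_def)
qed

end

section \<open>Stability and energy estimates for the difference of two processes\<close>

locale fbs_pair = fbs M N w g \<Phi> \<kappa> L
  for M :: "'w measure" and N w and g :: "nat \<Rightarrow> 'n::finite triple \<Rightarrow> 'w \<Rightarrow> 'n triple" and \<Phi> \<kappa> L +
  fixes h h' :: "nat \<Rightarrow> 'w \<Rightarrow> (real^'n) \<times> (real^'n)"
  assumes h: "h \<in> L2F M w {..N}" and h': "h' \<in> L2F M w {..N}"
begin

definition dh :: "nat \<Rightarrow> 'w \<Rightarrow> (real^'n) \<times> (real^'n)" where "dh k \<omega> = h k \<omega> - h' k \<omega>"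
definition dtri :: "nat \<Rightarrow> 'w \<Rightarrow> 'n triple" where "dtri k \<omega> = tri h k \<omega> - tri h' k \<omega>"
definition dcoef :: "nat \<Rightarrow> 'w \<Rightarrow> 'n triple" where "dcoef k \<omega> = coef h k \<omega> - coef h' k \<omega>"
definition dPhi :: "'w \<Rightarrow> real^'n" where "dPhi \<omega> = \<Phi> \<omega> (fst (h N \<omega>)) - \<Phi> \<omega> (fst (h' N \<omega>))"
definition X :: "nat \<Rightarrow> real" where "X k = sqn M (\<lambda>\<omega>. fst (dh k \<omega>))"
definition Y :: "nat \<Rightarrow> real" where "Y k = sqn M (\<lambda>\<omega>. snd (dh k \<omega>))"

text \<open>The expected amount by which monotonicity is strict, with the sign chosen so that it is
  nonnegative under either orientation \<open>\<kappa>\<close>. The terminal map is stored at the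
  index \<open>N\<close>, so that one sum over \<open>k \<le> N\<close> collects everything.\<close>

definition defect :: "nat \<Rightarrow> real" where
  "defect k = (if k < N then - \<kappa> * (LINT \<omega>|M. dcoef k \<omega> \<bullet> dtri k \<omega>)
     else \<kappa> * (LINT \<omega>|M. dPhi \<omega> \<bullet> fst (dh N \<omega>)))"

lemma dh_L2F: "dh \<in> L2F M w {..N}"
  unfolding dh_def[abs_def] by (intro L2F_linear h h')

lemma dh_fst_snd:
  assumes "k \<le> N"
  shows "(\<lambda>\<omega>. fst (dh k \<omega>)) \<in> borel_measurable (filt M w k)" "sqint M (\<lambda>\<omega>. fst (dh k \<omega>))"
    "(\<lambda>\<omega>. snd (dh k \<omega>)) \<in> borel_measurable (filt M w k)" "sqint M (\<lambda>\<omega>. snd (dh k \<omega>))"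
  using process_fst_snd[OF dh_L2F assms] .

lemma psq_dh: "psq M N dh = (\<Sum>k\<le>N. X k + Y k)"
  unfolding psq_def X_def Y_def
  by (intro sum.cong refl sqint_fst_snd(3) L2F_D(2)[OF dh_L2F]) simp

lemma X_Y_nonneg [simp]: "0 \<le> X k" "0 \<le> Y k"
  by (simp_all add: X_def Y_def)

lemma X_Y_le_psq: "k \<le> N \<Longrightarrow> X k \<le> psq M N dh" "k \<le> N \<Longrightarrow> Y k \<le> psq M N dh"
  unfolding psq_dh
proof -
  have "X k + Y k \<le> (\<Sum>k\<le>N. X k + Y k)" if "k \<le> N"
    using that by (intro member_le_sum) auto
  then show "k \<le> N \<Longrightarrow> X k \<le> (\<Sum>k\<le>N. X k + Y k)" "k \<le> N \<Longrightarrow> Y k \<le> (\<Sum>k\<le>N. X k + Y k)"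
    using X_Y_nonneg(1)[of k] X_Y_nonneg(2)[of k] by linarith+
qed

lemma dtri_L2:
  assumes k: "k < N"
  shows "dtri k \<in> borel_measurable (filt M w k)" "sqint M (dtri k)"
  unfolding dtri_def[abs_def] using tri_L2[OF h k] tri_L2[OF h' k] by (auto intro: sqint_diff)

lemma dcoef_L2:
  assumes k: "k < N"
  shows "dcoef k \<in> borel_measurable (filt M w k)" "sqint M (dcoef k)"
  unfolding dcoef_def[abs_def] using coef_L2[OF h k] coef_L2[OF h' k] by (auto intro: sqint_diff)

lemma dPhi_L2: "sqint M dPhi"
  unfolding dPhi_def[abs_def] using end_value_L2(2)[OF h] end_value_L2(2)[OF h'] by (rule sqint_diff)

lemma dtri_AE: "k < N \<Longrightarrow> AE \<omega> in M. dtri k \<omega> = tri dh k \<omega>"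
  unfolding dtri_def dh_def[abs_def] by (rule tri_diff[OF h h'])

lemma fst_dtri: "fst (dtri k \<omega>) = fst (dh k \<omega>)"
  by (simp add: dtri_def dh_def tri_def)

text \<open>The conditional mean and the correlation with the noise are each contractions in L2,
  hence the factor 2.\<close>

lemma sqn_dtri:
  assumes k: "k < N"
  shows "sqn M (\<lambda>\<omega>. snd (dtri k \<omega>)) \<le> 2 * Y (Suc k)" "sqn M (dtri k) \<le> X k + 2 * Y (Suc k)"
proof -
  have y: "sqint M (\<lambda>\<omega>. snd (dh (Suc k) \<omega>))" using k by (intro dh_fst_snd) auto
  note cm = cond_mean_L2[OF k, of "\<lambda>k \<omega>. snd (dh k \<omega>)", OF y]
  note cc = cond_corr_L2[OF k, of "\<lambda>k \<omega>. snd (dh k \<omega>)", OF y]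
  have s: "sqint M (\<lambda>\<omega>. snd (tri dh k \<omega>))"
    using sqint_fst_snd(2)[OF tri_L2(2)[OF dh_L2F k]] .
  have "sqn M (\<lambda>\<omega>. snd (dtri k \<omega>)) = sqn M (\<lambda>\<omega>. snd (tri dh k \<omega>))"
    using sqint_fst_snd(2)[OF dtri_L2(2)[OF k]] s dtri_AE[OF k] by (intro sqn_cong_AE) auto
  also have "\<dots> = sqn M (cond_mean M w (\<lambda>k \<omega>. snd (dh k \<omega>)) k) + sqn M (cond_corr M w (\<lambda>k \<omega>. snd (dh k \<omega>)) k)"
    using sqint_Pair(2)[OF cm(1) cc(1)] by (simp add: tri_def)
  also have "\<dots> \<le> 2 * Y (Suc k)" using cm(2) cc(2) by (simp add: Y_def)
  finally show 1: "sqn M (\<lambda>\<omega>. snd (dtri k \<omega>)) \<le> 2 * Y (Suc k)" .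
  show "sqn M (dtri k) \<le> X k + 2 * Y (Suc k)"
    using sqint_fst_snd(3)[OF dtri_L2(2)[OF k]] 1 by (simp add: fst_dtri X_def)
qed

lemma sqn_dcoef:
  assumes k: "k < N"
  shows "sqn M (dcoef k) \<le> L * (X k + 2 * Y (Suc k))"
    "sqn M (\<lambda>\<omega>. fst (dcoef k \<omega>)) \<le> L * (X k + 2 * Y (Suc k))"
    "sqn M (\<lambda>\<omega>. snd (dcoef k \<omega>)) \<le> L * (X k + 2 * Y (Suc k))"
proof -
  note d = dtri_L2(2)[OF k] and e = dcoef_L2(2)[OF k]
  have "sqn M (dcoef k) \<le> (LINT \<omega>|M. L * (norm (dtri k \<omega>))\<^sup>2)"
  proof (rule sqint_bound(2))
    show "AE \<omega> in M. (norm (dcoef k \<omega>))\<^sup>2 \<le> L * (norm (dtri k \<omega>))\<^sup>2"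
      using g_lipschitz[OF k] unfolding dcoef_def dtri_def coef_def by eventually_elim blast
  qed (use d e in auto)
  also have "\<dots> = L * sqn M (dtri k)" by (simp add: sqn_def)
  also have "\<dots> \<le> L * (X k + 2 * Y (Suc k))"
    using sqn_dtri(2)[OF k] L_ge_1 by (intro mult_left_mono) auto
  finally show 1: "sqn M (dcoef k) \<le> L * (X k + 2 * Y (Suc k))" .
  show "sqn M (\<lambda>\<omega>. fst (dcoef k \<omega>)) \<le> L * (X k + 2 * Y (Suc k))"
    "sqn M (\<lambda>\<omega>. snd (dcoef k \<omega>)) \<le> L * (X k + 2 * Y (Suc k))"
    using 1 sqint_fst_snd(3)[OF e] sqn_nonneg[of M "\<lambda>\<omega>. fst (dcoef k \<omega>)"]
      sqn_nonneg[of M "\<lambda>\<omega>. snd (dcoef k \<omega>)"] by linarith+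
qed

lemma sqn_dPhi: "sqn M dPhi \<le> L * X N"
proof -
  have "sqn M dPhi \<le> (LINT \<omega>|M. L * (norm (fst (dh N \<omega>)))\<^sup>2)"
  proof (rule sqint_bound(2))
    show "AE \<omega> in M. (norm (dPhi \<omega>))\<^sup>2 \<le> L * (norm (fst (dh N \<omega>)))\<^sup>2"
      using Phi_lipschitz by eventually_elim (simp add: dPhi_def dh_def)
  qed (use dh_fst_snd(2)[of N] dPhi_L2 in auto)
  then show ?thesis by (simp add: X_def sqn_def)
qed

lemma defect_nonneg: "k \<le> N \<Longrightarrow> 0 \<le> defect k"
proof (cases "k < N")
  case True
  have "0 \<le> (LINT \<omega>|M. - \<kappa> * (dcoef k \<omega> \<bullet> dtri k \<omega>))"
  proof (rule integral_nonneg_AE)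
    show "AE \<omega> in M. 0 \<le> - \<kappa> * (dcoef k \<omega> \<bullet> dtri k \<omega>)"
      using g_monotone[OF True] unfolding dcoef_def dtri_def coef_def
      by eventually_elim (simp only: mult_minus_left neg_0_le_iff_le)
  qed
  then show ?thesis using True by (simp add: defect_def)
next
  case False
  have "0 \<le> (LINT \<omega>|M. \<kappa> * (dPhi \<omega> \<bullet> fst (dh N \<omega>)))"
  proof (rule integral_nonneg_AE)
    show "AE \<omega> in M. 0 \<le> \<kappa> * (dPhi \<omega> \<bullet> fst (dh N \<omega>))"
      using Phi_monotone by eventually_elim (simp add: dPhi_def dh_def)
  qed
  then show ?thesis using False by (simp add: defect_def)
qed

text \<open>Integrated coercivity: drift and diffusion are controlled without the backward state, at
  the price of the defect. This decouples the forward recursion.\<close>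

lemma sqn_dcoef_fwd:
  assumes "fwd_coercive M N g \<kappa> L" and k: "k < N"
  shows "sqn M (\<lambda>\<omega>. snd (dcoef k \<omega>)) \<le> L * (X k + defect k)"
proof -
  note e = dcoef_L2(2)[OF k]
  have i: "integrable M (\<lambda>\<omega>. (norm (fst (dtri k \<omega>)))\<^sup>2)" "integrable M (\<lambda>\<omega>. dcoef k \<omega> \<bullet> dtri k \<omega>)"
    using sqintD(2)[OF sqint_fst_snd(1)[OF dtri_L2(2)[OF k]]] sqint_inner[OF e dtri_L2(2)[OF k]] by auto
  have "sqn M (\<lambda>\<omega>. snd (dcoef k \<omega>)) \<le>
      (LINT \<omega>|M. L * ((norm (fst (dtri k \<omega>)))\<^sup>2 - \<kappa> * (dcoef k \<omega> \<bullet> dtri k \<omega>)))"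
  proof (rule sqint_bound(2))
    have "AE \<omega> in M. \<forall>\<theta> \<theta>'. (norm (snd (g k \<theta> \<omega> - g k \<theta>' \<omega>)))\<^sup>2
       \<le> L * ((norm (fst (\<theta> - \<theta>')))\<^sup>2 - \<kappa> * ((g k \<theta> \<omega> - g k \<theta>' \<omega>) \<bullet> (\<theta> - \<theta>')))"
      using assms by (auto simp: fwd_coercive_def)
    then show "AE \<omega> in M. (norm (snd (dcoef k \<omega>)))\<^sup>2
        \<le> L * ((norm (fst (dtri k \<omega>)))\<^sup>2 - \<kappa> * (dcoef k \<omega> \<bullet> dtri k \<omega>))"
      unfolding dcoef_def dtri_def coef_def by eventually_elim blast
  qed (use i sqint_fst_snd(2)[OF e] in auto)
  also have "\<dots> = L * (X k + defect k)"
    using i k by (simp add: defect_def X_def sqn_def fst_dtri)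
  finally show ?thesis .
qed

lemma sqn_dcoef_bwd:
  assumes "bwd_coercive M N g \<Phi> \<kappa> L" and k: "k < N"
  shows "sqn M (\<lambda>\<omega>. fst (dcoef k \<omega>)) \<le> L * (2 * Y (Suc k) + defect k)"
proof -
  note e = dcoef_L2(2)[OF k]
  have i: "integrable M (\<lambda>\<omega>. (norm (snd (dtri k \<omega>)))\<^sup>2)" "integrable M (\<lambda>\<omega>. dcoef k \<omega> \<bullet> dtri k \<omega>)"
    using sqintD(2)[OF sqint_fst_snd(2)[OF dtri_L2(2)[OF k]]] sqint_inner[OF e dtri_L2(2)[OF k]] by auto
  have "sqn M (\<lambda>\<omega>. fst (dcoef k \<omega>)) \<le>
      (LINT \<omega>|M. L * ((norm (snd (dtri k \<omega>)))\<^sup>2 - \<kappa> * (dcoef k \<omega> \<bullet> dtri k \<omega>)))"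
  proof (rule sqint_bound(2))
    have "AE \<omega> in M. \<forall>\<theta> \<theta>'. (norm (fst (g k \<theta> \<omega> - g k \<theta>' \<omega>)))\<^sup>2
       \<le> L * ((norm (snd (\<theta> - \<theta>')))\<^sup>2 - \<kappa> * ((g k \<theta> \<omega> - g k \<theta>' \<omega>) \<bullet> (\<theta> - \<theta>')))"
      using assms by (auto simp: bwd_coercive_def)
    then show "AE \<omega> in M. (norm (fst (dcoef k \<omega>)))\<^sup>2
        \<le> L * ((norm (snd (dtri k \<omega>)))\<^sup>2 - \<kappa> * (dcoef k \<omega> \<bullet> dtri k \<omega>))"
      unfolding dcoef_def dtri_def coef_def by eventually_elim blast
  qed (use i sqint_fst_snd(1)[OF e] in auto)
  also have "\<dots> = L * (sqn M (\<lambda>\<omega>. snd (dtri k \<omega>)) + defect k)"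
    using i k by (simp add: defect_def sqn_def)
  also have "\<dots> \<le> L * (2 * Y (Suc k) + defect k)"
    using sqn_dtri(1)[OF k] L_ge_1 by (intro mult_left_mono) auto
  finally show ?thesis .
qed

lemma sqn_dPhi_bwd:
  assumes "bwd_coercive M N g \<Phi> \<kappa> L"
  shows "sqn M dPhi \<le> L * defect N"
proof -
  have i: "integrable M (\<lambda>\<omega>. dPhi \<omega> \<bullet> fst (dh N \<omega>))"
    using sqint_inner[OF dPhi_L2 dh_fst_snd(2)[OF order_refl]] .
  have "sqn M dPhi \<le> (LINT \<omega>|M. L * (\<kappa> * (dPhi \<omega> \<bullet> fst (dh N \<omega>))))"
  proof (rule sqint_bound(2))
    have "AE \<omega> in M. \<forall>x x'. (norm (\<Phi> \<omega> x - \<Phi> \<omega> x'))\<^sup>2 \<le> L * (\<kappa> * ((\<Phi> \<omega> x - \<Phi> \<omega> x') \<bullet> (x - x')))"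
      using assms by (auto simp: bwd_coercive_def)
    then show "AE \<omega> in M. (norm (dPhi \<omega>))\<^sup>2 \<le> L * (\<kappa> * (dPhi \<omega> \<bullet> fst (dh N \<omega>)))"
      unfolding dPhi_def dh_def fst_diff by eventually_elim blast
  qed (use i dPhi_L2 in auto)
  then show ?thesis by (simp add: defect_def)
qed

text \<open>Neither process has to solve the system; what is missing is recorded here. The same
  estimates thus serve the continuation (\<open>\<alpha> \<le> 1\<close>), the comparison of two
  solutions (zero residual apart from the initial state) and the comparison of solutions for two
  controls (residual of the size of the control increment).\<close>

definition res :: "real \<Rightarrow> nat \<Rightarrow> 'w \<Rightarrow> (real^'n) \<times> (real^'n)" where
  "res \<alpha> k \<omega> = dh k \<omega> - \<alpha> *\<^sub>R (sweep h k \<omega> - sweep h' k \<omega>)"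

text \<open>The initial state is excluded from the residual, it enters the estimates separately.\<close>

definition rsq :: "real \<Rightarrow> nat \<Rightarrow> real" where
  "rsq \<alpha> k = (if k = 0 then 0 else sqn M (\<lambda>\<omega>. fst (res \<alpha> k \<omega>))) + sqn M (\<lambda>\<omega>. snd (res \<alpha> k \<omega>))"

lemma rsq_nonneg [simp]: "0 \<le> rsq \<alpha> k"
  by (simp add: rsq_def)

lemma res_L2F: "res \<alpha> \<in> L2F M w {..N}"
  unfolding res_def[abs_def] by (intro L2F_linear L2F_scaleR sweep_L2F dh_L2F h h')

lemma res_fst_snd:
  assumes "k \<le> N"
  shows "sqint M (\<lambda>\<omega>. fst (res \<alpha> k \<omega>))" "sqint M (\<lambda>\<omega>. snd (res \<alpha> k \<omega>))"
  using process_fst_snd[OF res_L2F assms] by auto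

lemma sum_rsq_le: "(\<Sum>k\<le>N. rsq \<alpha> k) \<le> psq M N (res \<alpha>)"
  unfolding psq_def
proof (rule sum_mono)
  fix k assume "k \<in> {..N}"
  then show "rsq \<alpha> k \<le> sqn M (res \<alpha> k)"
    using sqint_fst_snd(3)[OF L2F_D(2)[OF res_L2F, of k]] by (simp add: rsq_def)
qed

lemma fst_dh_Suc:
  "fst (dh (Suc k) \<omega>) = \<alpha> *\<^sub>R (fst (snd (dcoef k \<omega>)) + w k \<omega> *\<^sub>R snd (snd (dcoef k \<omega>))) + fst (res \<alpha> (Suc k) \<omega>)"
  by (simp add: res_def sweep_def dcoef_def algebra_simps)

lemma snd_dh: "k < N \<Longrightarrow> snd (dh k \<omega>) = - (\<alpha> *\<^sub>R fst (dcoef k \<omega>)) + snd (res \<alpha> k \<omega>)"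
  by (simp add: res_def sweep_def dcoef_def algebra_simps)

lemma snd_dh_N: "snd (dh N \<omega>) = \<alpha> *\<^sub>R dPhi \<omega> + snd (res \<alpha> N \<omega>)"
  by (simp add: res_def sweep_def dPhi_def algebra_simps)

lemma dcoef_components:
  assumes k: "k < N"
  shows "(\<lambda>\<omega>. fst (dcoef k \<omega>)) \<in> borel_measurable (filt M w k)" "sqint M (\<lambda>\<omega>. fst (dcoef k \<omega>))"
    "(\<lambda>\<omega>. fst (snd (dcoef k \<omega>))) \<in> borel_measurable (filt M w k)" "sqint M (\<lambda>\<omega>. fst (snd (dcoef k \<omega>)))"
    "(\<lambda>\<omega>. snd (snd (dcoef k \<omega>))) \<in> borel_measurable (filt M w k)" "sqint M (\<lambda>\<omega>. snd (snd (dcoef k \<omega>)))"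
    "sqn M (\<lambda>\<omega>. snd (dcoef k \<omega>)) = sqn M (\<lambda>\<omega>. fst (snd (dcoef k \<omega>))) + sqn M (\<lambda>\<omega>. snd (snd (dcoef k \<omega>)))"
  using measurable_fst_snd[OF dcoef_L2(1)[OF k]] measurable_fst_snd[OF measurable_fst_snd(2)[OF dcoef_L2(1)[OF k]]]
    sqint_fst_snd[OF dcoef_L2(2)[OF k]] sqint_fst_snd[OF sqint_fst_snd(2)[OF dcoef_L2(2)[OF k]]] by auto

lemma X_step:
  assumes k: "k < N"
  shows "X (Suc k) \<le> 4 * (\<alpha>\<^sup>2 * sqn M (\<lambda>\<omega>. snd (dcoef k \<omega>))) + 2 * rsq \<alpha> (Suc k)"
proof -
  note c = dcoef_components[OF k]
  let ?s = "\<lambda>\<omega>. fst (snd (dcoef k \<omega>)) + w k \<omega> *\<^sub>R snd (snd (dcoef k \<omega>))"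
  note n = sqint_noise[OF k c(5,6)]
  have s: "sqint M ?s" "sqn M ?s \<le> 2 * sqn M (\<lambda>\<omega>. snd (dcoef k \<omega>))"
    using sqint_add[OF c(4) n(1)] n(2) c(7) by auto
  have "X (Suc k) = sqn M (\<lambda>\<omega>. \<alpha> *\<^sub>R ?s \<omega> + fst (res \<alpha> (Suc k) \<omega>))"
    unfolding X_def fst_dh_Suc[of k _ \<alpha>] ..
  also have "\<dots> \<le> 2 * sqn M (\<lambda>\<omega>. \<alpha> *\<^sub>R ?s \<omega>) + 2 * sqn M (\<lambda>\<omega>. fst (res \<alpha> (Suc k) \<omega>))"
    using k by (intro sqint_add(2) sqint_scaleR(1) s(1) res_fst_snd) auto
  also have "sqn M (\<lambda>\<omega>. \<alpha> *\<^sub>R ?s \<omega>) = \<alpha>\<^sup>2 * sqn M ?s" by (rule sqint_scaleR(2)[OF s(1)])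
  also have "\<dots> \<le> \<alpha>\<^sup>2 * (2 * sqn M (\<lambda>\<omega>. snd (dcoef k \<omega>)))" by (intro mult_left_mono s(2)) simp
  also have "sqn M (\<lambda>\<omega>. fst (res \<alpha> (Suc k) \<omega>)) \<le> rsq \<alpha> (Suc k)" by (simp add: rsq_def)
  finally show ?thesis by simp
qed

lemma Y_step:
  assumes k: "k < N"
  shows "Y k \<le> 2 * (\<alpha>\<^sup>2 * sqn M (\<lambda>\<omega>. fst (dcoef k \<omega>))) + 2 * rsq \<alpha> k"
proof -
  note c = dcoef_components[OF k]
  have "Y k = sqn M (\<lambda>\<omega>. - (\<alpha> *\<^sub>R fst (dcoef k \<omega>)) + snd (res \<alpha> k \<omega>))"
    unfolding Y_def snd_dh[OF k, of _ \<alpha>] ..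
  also have "\<dots> \<le> 2 * sqn M (\<lambda>\<omega>. - (\<alpha> *\<^sub>R fst (dcoef k \<omega>))) + 2 * sqn M (\<lambda>\<omega>. snd (res \<alpha> k \<omega>))"
    using k by (intro sqint_add(2) sqint_minus(1) sqint_scaleR(1) c res_fst_snd) auto
  also have "sqn M (\<lambda>\<omega>. - (\<alpha> *\<^sub>R fst (dcoef k \<omega>))) = \<alpha>\<^sup>2 * sqn M (\<lambda>\<omega>. fst (dcoef k \<omega>))"
    using sqint_minus(2)[OF sqint_scaleR(1)[OF c(2)]] sqint_scaleR(2)[OF c(2)] by metis
  also have "sqn M (\<lambda>\<omega>. snd (res \<alpha> k \<omega>)) \<le> rsq \<alpha> k" by (simp add: rsq_def)
  finally show ?thesis by simp
qed

lemma Y_end: "Y N \<le> 2 * (\<alpha>\<^sup>2 * sqn M dPhi) + 2 * rsq \<alpha> N"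
proof -
  have "Y N = sqn M (\<lambda>\<omega>. \<alpha> *\<^sub>R dPhi \<omega> + snd (res \<alpha> N \<omega>))"
    unfolding Y_def snd_dh_N[of _ \<alpha>] ..
  also have "\<dots> \<le> 2 * sqn M (\<lambda>\<omega>. \<alpha> *\<^sub>R dPhi \<omega>) + 2 * sqn M (\<lambda>\<omega>. snd (res \<alpha> N \<omega>))"
    by (intro sqint_add(2) sqint_scaleR(1) dPhi_L2 res_fst_snd) simp
  also have "sqn M (\<lambda>\<omega>. \<alpha> *\<^sub>R dPhi \<omega>) = \<alpha>\<^sup>2 * sqn M dPhi" by (rule sqint_scaleR(2)[OF dPhi_L2])
  also have "sqn M (\<lambda>\<omega>. snd (res \<alpha> N \<omega>)) \<le> rsq \<alpha> N" by (simp add: rsq_def)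
  finally show ?thesis by simp
qed

text \<open>Squared norms produce the factor \<open>\<alpha>\<^sup>2\<close>, whereas the energy
  estimate controls \<open>\<alpha>\<close> times the defect. Since
  \<open>\<alpha>\<^sup>2 \<le> \<alpha>\<close> on the unit interval, the defect can be carried
  with the factor \<open>\<alpha>\<close>, and the constant is uniform in
  \<open>\<alpha>\<close>.\<close>

lemma stability:
  assumes \<alpha>: "0 \<le> \<alpha>" "\<alpha> \<le> 1"
  shows "psq M N dh \<le> fb_const L N * (X 0 + \<alpha> * (\<Sum>k\<le>N. defect k) + (\<Sum>k\<le>N. rsq \<alpha> k))"
    "bwd_coercive M N g \<Phi> \<kappa> L \<Longrightarrow> Y 0 \<le> fb_const L N * (\<alpha> * (\<Sum>k\<le>N. defect k) + (\<Sum>k\<le>N. rsq \<alpha> k))"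
proof -
  have a2: "\<alpha>\<^sup>2 \<le> 1" "\<alpha>\<^sup>2 \<le> \<alpha>"
    using \<alpha> by (auto simp: power2_eq_square mult_left_le_one_le mult_le_one)
  have dn: "0 \<le> \<alpha> * defect k" if "k \<le> N" for k using \<alpha> defect_nonneg[OF that] by simp
  have LL: "1 \<le> L" by (rule L_ge_1)
  have one: "\<alpha>\<^sup>2 * s \<le> L * a" if "s \<le> L * a" "0 \<le> a" "0 \<le> s" for s a
    using mult_mono[OF a2(1) that(1)] that by simp
  have two: "\<alpha>\<^sup>2 * s \<le> L * (a + \<alpha> * b)" if "s \<le> L * (a + b)" "0 \<le> a" "0 \<le> b" for s a b
  proof -
    have "\<alpha>\<^sup>2 * s \<le> \<alpha>\<^sup>2 * (L * (a + b))" using that by (intro mult_left_mono) auto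
    also have "\<dots> = L * (\<alpha>\<^sup>2 * a + \<alpha>\<^sup>2 * b)" by (simp add: algebra_simps)
    also have "\<dots> \<le> L * (1 * a + \<alpha> * b)" using that a2 LL by (intro mult_left_mono add_mono mult_right_mono) auto
    finally show ?thesis by simp
  qed
  have Lm: "a \<le> L * a" if "0 \<le> a" for a using mult_right_mono[OF LL that] by simp
  \<comment> \<open>The common factor 8 originates in the worst case, the forward step, where
    \<open>4 * (X k + 2 * Y (Suc k))\<close> has to be covered.\<close>
  have fin: "x \<le> 8 * L * c" if "s \<le> L * a" "x \<le> m * s + 2 * r" "0 \<le> m" "0 \<le> r" "m * a + 2 * r \<le> 8 * c"
    for x s a m r c
  proof -
    have "x \<le> m * (L * a) + 2 * (L * r)"
      using that(2) mult_left_mono[OF that(1,3)] Lm[OF that(4)] by linarith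
    also have "\<dots> = L * (m * a + 2 * r)" by (simp add: algebra_simps)
    also have "\<dots> \<le> L * (8 * c)" using that LL by (intro mult_left_mono) auto
    finally show ?thesis by simp
  qed
  have XL: "X (Suc k) \<le> 8 * L * (X k + Y (Suc k) + rsq \<alpha> (Suc k))" if k: "k < N" for k
  proof -
    have "\<alpha>\<^sup>2 * sqn M (\<lambda>\<omega>. snd (dcoef k \<omega>)) \<le> L * (X k + 2 * Y (Suc k))"
      by (rule one[OF sqn_dcoef(3)[OF k]]) auto
    then show ?thesis
      using X_step[OF k, of \<alpha>] by (rule fin) (use dn[of k] k in auto)
  qed
  have YL: "Y k \<le> 8 * L * (Y (Suc k) + X k + rsq \<alpha> k)" if k: "k < N" for k
  proof -
    have "\<alpha>\<^sup>2 * sqn M (\<lambda>\<omega>. fst (dcoef k \<omega>)) \<le> L * (X k + 2 * Y (Suc k))"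
      by (rule one[OF sqn_dcoef(2)[OF k]]) auto
    then show ?thesis
      using Y_step[OF k, of \<alpha>] by (rule fin) (use dn[of k] k in auto)
  qed
  have YN: "Y N \<le> 8 * L * (X N + rsq \<alpha> N)"
  proof -
    have "\<alpha>\<^sup>2 * sqn M dPhi \<le> L * X N" by (rule one[OF sqn_dPhi]) auto
    then show ?thesis
      using Y_end[of \<alpha>] by (rule fin) (use dn[of N] in auto)
  qed
  have bwd: "(\<Sum>k\<le>N. X k + Y k) \<le> fb_const L N * (X 0 + (\<Sum>k\<le>N. \<alpha> * defect k) + (\<Sum>k\<le>N. rsq \<alpha> k)) \<and>
      Y 0 \<le> fb_const L N * ((\<Sum>k\<le>N. \<alpha> * defect k) + (\<Sum>k\<le>N. rsq \<alpha> k))"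
    if b: "bwd_coercive M N g \<Phi> \<kappa> L"
  proof -
    have Yk: "Y k \<le> 8 * L * (Y (Suc k) + \<alpha> * defect k + rsq \<alpha> k)" if k: "k < N" for k
    proof -
      have "\<alpha>\<^sup>2 * sqn M (\<lambda>\<omega>. fst (dcoef k \<omega>)) \<le> L * (2 * Y (Suc k) + \<alpha> * defect k)"
        using k defect_nonneg[of k] by (intro two[OF sqn_dcoef_bwd[OF b k]]) auto
      then show ?thesis
        using Y_step[OF k, of \<alpha>] by (rule fin) (use dn[of k] k in auto)
    qed
    have YNb: "Y N \<le> 8 * L * (\<alpha> * defect N + rsq \<alpha> N)"
    proof -
      have "\<alpha>\<^sup>2 * sqn M dPhi \<le> L * (0 + \<alpha> * defect N)"
        using defect_nonneg[of N] sqn_dPhi_bwd[OF b] by (intro two) auto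
      then show ?thesis
        using Y_end[of \<alpha>] by (rule fin) (use dn[of N] in auto)
    qed
    show ?thesis
      using fb_estimate_backward_first[of L X Y N "\<lambda>k. \<alpha> * defect k" "rsq \<alpha>"] LL dn XL Yk YNb by simp
  qed
  have fwd: "(\<Sum>k\<le>N. X k + Y k) \<le> fb_const L N * (X 0 + (\<Sum>k\<le>N. \<alpha> * defect k) + (\<Sum>k\<le>N. rsq \<alpha> k))"
    if f: "fwd_coercive M N g \<kappa> L"
  proof -
    have Xk: "X (Suc k) \<le> 8 * L * (X k + \<alpha> * defect k + rsq \<alpha> (Suc k))" if k: "k < N" for k
    proof -
      have "\<alpha>\<^sup>2 * sqn M (\<lambda>\<omega>. snd (dcoef k \<omega>)) \<le> L * (X k + \<alpha> * defect k)"
        using k defect_nonneg[of k] by (intro two[OF sqn_dcoef_fwd[OF f k]]) auto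
      then show ?thesis
        using X_step[OF k, of \<alpha>] by (rule fin) (use dn[of k] k in auto)
    qed
    show ?thesis
      using fb_estimate_forward_first[of L X Y N "\<lambda>k. \<alpha> * defect k" "rsq \<alpha>"] LL dn Xk YL YN by simp
  qed
  show "psq M N dh \<le> fb_const L N * (X 0 + \<alpha> * (\<Sum>k\<le>N. defect k) + (\<Sum>k\<le>N. rsq \<alpha> k))"
    using fwd bwd coercive by (auto simp: psq_dh sum_distrib_left)
  show "bwd_coercive M N g \<Phi> \<kappa> L \<Longrightarrow> Y 0 \<le> fb_const L N * (\<alpha> * (\<Sum>k\<le>N. defect k) + (\<Sum>k\<le>N. rsq \<alpha> k))"
    using bwd by (auto simp: sum_distrib_left)
qed

text \<open>Product rule for E<x, y>. Drift and diffusion differences are adapted to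
  \<open>filt M w k\<close>, so testing them, the latter times the noise, against
  \<open>y (Suc k)\<close> reproduces exactly the conditional mean and correlation. The increment is
  therefore the monotonicity pairing of the coefficients with their own arguments, up to residual
  terms.\<close>

lemma duality_step:
  assumes k: "k < N"
  shows "(LINT \<omega>|M. fst (dh (Suc k) \<omega>) \<bullet> snd (dh (Suc k) \<omega>)) - (LINT \<omega>|M. fst (dh k \<omega>) \<bullet> snd (dh k \<omega>))
    = \<alpha> * (LINT \<omega>|M. dcoef k \<omega> \<bullet> dtri k \<omega>)
      + (LINT \<omega>|M. fst (res \<alpha> (Suc k) \<omega>) \<bullet> snd (dh (Suc k) \<omega>)) - (LINT \<omega>|M. fst (dh k \<omega>) \<bullet> snd (res \<alpha> k \<omega>))"
proof -
  note c = dcoef_components[OF k]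
  have y: "sqint M (\<lambda>\<omega>. snd (dh (Suc k) \<omega>))" using k by (intro dh_fst_snd) auto
  note cm = cond_mean_L2[OF k, of "\<lambda>k \<omega>. snd (dh k \<omega>)", OF y]
  note cc = cond_corr_L2[OF k, of "\<lambda>k \<omega>. snd (dh k \<omega>)", OF y]
  have x: "sqint M (\<lambda>\<omega>. fst (dh k \<omega>))" using k by (intro dh_fst_snd) auto
  have r1: "sqint M (\<lambda>\<omega>. fst (res \<alpha> (Suc k) \<omega>))" and r2: "sqint M (\<lambda>\<omega>. snd (res \<alpha> k \<omega>))"
    using k by (auto intro!: res_fst_snd)
  note n = sqint_noise[OF k c(5,6)]
  have "(LINT \<omega>|M. fst (dh (Suc k) \<omega>) \<bullet> snd (dh (Suc k) \<omega>))
      = (LINT \<omega>|M. \<alpha> * (fst (snd (dcoef k \<omega>)) \<bullet> snd (dh (Suc k) \<omega>))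
          + \<alpha> * ((w k \<omega> *\<^sub>R snd (snd (dcoef k \<omega>))) \<bullet> snd (dh (Suc k) \<omega>))
          + fst (res \<alpha> (Suc k) \<omega>) \<bullet> snd (dh (Suc k) \<omega>))"
    by (simp only: fst_dh_Suc[of k _ \<alpha>] inner_add_left inner_scaleR_left distrib_left scaleR_add_right)
  also have "\<dots> = \<alpha> * (LINT \<omega>|M. fst (snd (dcoef k \<omega>)) \<bullet> snd (dh (Suc k) \<omega>))
      + \<alpha> * (LINT \<omega>|M. (w k \<omega> *\<^sub>R snd (snd (dcoef k \<omega>))) \<bullet> snd (dh (Suc k) \<omega>))
      + (LINT \<omega>|M. fst (res \<alpha> (Suc k) \<omega>) \<bullet> snd (dh (Suc k) \<omega>))"
    using sqint_inner[OF c(4) y] sqint_inner[OF n(1) y] sqint_inner[OF r1 y] by simp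
  also have "(LINT \<omega>|M. fst (snd (dcoef k \<omega>)) \<bullet> snd (dh (Suc k) \<omega>))
      = (LINT \<omega>|M. fst (snd (dcoef k \<omega>)) \<bullet> cond_mean M w (\<lambda>k \<omega>. snd (dh k \<omega>)) k \<omega>)"
    by (rule cm(3)[OF c(3,4), symmetric])
  also have "(LINT \<omega>|M. (w k \<omega> *\<^sub>R snd (snd (dcoef k \<omega>))) \<bullet> snd (dh (Suc k) \<omega>))
      = (LINT \<omega>|M. snd (snd (dcoef k \<omega>)) \<bullet> cond_corr M w (\<lambda>k \<omega>. snd (dh k \<omega>)) k \<omega>)"
    by (rule cc(3)[OF c(5,6), symmetric])
  finally have 1: "(LINT \<omega>|M. fst (dh (Suc k) \<omega>) \<bullet> snd (dh (Suc k) \<omega>))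
    = \<alpha> * (LINT \<omega>|M. fst (snd (dcoef k \<omega>)) \<bullet> cond_mean M w (\<lambda>k \<omega>. snd (dh k \<omega>)) k \<omega>)
      + \<alpha> * (LINT \<omega>|M. snd (snd (dcoef k \<omega>)) \<bullet> cond_corr M w (\<lambda>k \<omega>. snd (dh k \<omega>)) k \<omega>)
      + (LINT \<omega>|M. fst (res \<alpha> (Suc k) \<omega>) \<bullet> snd (dh (Suc k) \<omega>))" .
  have "(LINT \<omega>|M. fst (dh k \<omega>) \<bullet> snd (dh k \<omega>))
      = (LINT \<omega>|M. fst (dh k \<omega>) \<bullet> snd (res \<alpha> k \<omega>) - \<alpha> * (fst (dcoef k \<omega>) \<bullet> fst (dh k \<omega>)))"
    by (simp add: snd_dh[OF k, of _ \<alpha>] inner_add_right inner_commute algebra_simps)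
  also have "\<dots> = (LINT \<omega>|M. fst (dh k \<omega>) \<bullet> snd (res \<alpha> k \<omega>)) - \<alpha> * (LINT \<omega>|M. fst (dcoef k \<omega>) \<bullet> fst (dh k \<omega>))"
    using sqint_inner[OF x r2] sqint_inner[OF c(2) x] by simp
  finally have 2: "(LINT \<omega>|M. fst (dh k \<omega>) \<bullet> snd (dh k \<omega>)) = \<dots>" .
  have "(LINT \<omega>|M. dcoef k \<omega> \<bullet> dtri k \<omega>) = (LINT \<omega>|M. dcoef k \<omega> \<bullet> tri dh k \<omega>)"
    using dtri_AE[OF k] sqint_inner[OF dcoef_L2(2)[OF k] dtri_L2(2)[OF k]]
      sqint_inner[OF dcoef_L2(2)[OF k] tri_L2(2)[OF dh_L2F k]]
    by (intro integral_cong_AE) auto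
  also have "\<dots> = (LINT \<omega>|M. fst (dcoef k \<omega>) \<bullet> fst (dh k \<omega>)
      + (fst (snd (dcoef k \<omega>)) \<bullet> cond_mean M w (\<lambda>k \<omega>. snd (dh k \<omega>)) k \<omega>
        + snd (snd (dcoef k \<omega>)) \<bullet> cond_corr M w (\<lambda>k \<omega>. snd (dh k \<omega>)) k \<omega>))"
    by (simp add: tri_def inner_prod_def)
  also have "\<dots> = (LINT \<omega>|M. fst (dcoef k \<omega>) \<bullet> fst (dh k \<omega>))
      + ((LINT \<omega>|M. fst (snd (dcoef k \<omega>)) \<bullet> cond_mean M w (\<lambda>k \<omega>. snd (dh k \<omega>)) k \<omega>)
        + (LINT \<omega>|M. snd (snd (dcoef k \<omega>)) \<bullet> cond_corr M w (\<lambda>k \<omega>. snd (dh k \<omega>)) k \<omega>))"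
    using sqint_inner[OF c(2) x] sqint_inner[OF c(4) cm(1)] sqint_inner[OF c(6) cc(1)] by simp
  finally have 3: "(LINT \<omega>|M. dcoef k \<omega> \<bullet> dtri k \<omega>) = \<dots>" .
  show ?thesis unfolding 1 2 3 by (simp add: algebra_simps)
qed

text \<open>Summing the product rule leaves the pairing at time 0 and the residual pairings. The
  latter are split by Young with weight \<open>t\<close>, which multiplies the state and can be made
  small. The initial forward residual does not occur, since the forward terms start at time
  1.\<close>

lemma energy:
  assumes t: "0 < t"
  shows "\<alpha> * (\<Sum>k\<le>N. defect k) \<le> \<kappa> * (LINT \<omega>|M. fst (dh 0 \<omega>) \<bullet> snd (dh 0 \<omega>))
    + t * psq M N dh + (\<Sum>k\<le>N. rsq \<alpha> k) / (4 * t)"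
proof -
  define I where "I k = (LINT \<omega>|M. fst (dh k \<omega>) \<bullet> snd (dh k \<omega>))" for k
  define a where "a k = (LINT \<omega>|M. fst (res \<alpha> k \<omega>) \<bullet> snd (dh k \<omega>))" for k
  define b where "b k = (LINT \<omega>|M. fst (dh k \<omega>) \<bullet> snd (res \<alpha> k \<omega>))" for k
  have step: "\<kappa> * I (Suc k) - \<kappa> * I k = - (\<alpha> * defect k) + \<kappa> * a (Suc k) - \<kappa> * b k" if "k < N" for k
  proof -
    have "\<kappa> * I (Suc k) - \<kappa> * I k = \<kappa> * (I (Suc k) - I k)" by (simp add: algebra_simps)
    also have "\<dots> = \<kappa> * (\<alpha> * (LINT \<omega>|M. dcoef k \<omega> \<bullet> dtri k \<omega>) + a (Suc k) - b k)"
      unfolding I_def a_def b_def using duality_step[OF that, of \<alpha>] by simp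
    also have "\<dots> = - (\<alpha> * defect k) + \<kappa> * a (Suc k) - \<kappa> * b k"
      using that by (simp add: defect_def algebra_simps)
    finally show ?thesis .
  qed
  have "\<kappa> * I N - \<kappa> * I 0 = (\<Sum>k<N. \<kappa> * I (Suc k) - \<kappa> * I k)"
    by (rule sum_lessThan_telescope[symmetric])
  also have "\<dots> = - (\<alpha> * (\<Sum>k<N. defect k)) + ((\<Sum>k<N. \<kappa> * a (Suc k)) - (\<Sum>k<N. \<kappa> * b k))"
    by (simp add: step sum.distrib sum_subtractf sum_negf sum_distrib_left)
  finally have tel: "\<kappa> * I N - \<kappa> * I 0 = \<dots>" .
  \<comment> \<open>The terminal condition turns the last pairing into the terminal defect, which
    moves to the left-hand side with the same sign as the others.\<close>
  have "I N = (LINT \<omega>|M. \<alpha> * (dPhi \<omega> \<bullet> fst (dh N \<omega>)) + fst (dh N \<omega>) \<bullet> snd (res \<alpha> N \<omega>))"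
    unfolding I_def by (simp add: snd_dh_N[of _ \<alpha>] inner_add_right inner_commute)
  also have "\<dots> = \<alpha> * (LINT \<omega>|M. dPhi \<omega> \<bullet> fst (dh N \<omega>)) + b N"
    unfolding b_def using sqint_inner[OF dPhi_L2 dh_fst_snd(2)[OF order_refl]]
      sqint_inner[OF dh_fst_snd(2)[OF order_refl] res_fst_snd(2)[OF order_refl]] by simp
  finally have "\<kappa> * I N = \<alpha> * defect N + \<kappa> * b N"
    by (simp add: defect_def algebra_simps)
  then have "\<alpha> * (\<Sum>k\<le>N. defect k) = \<kappa> * I 0 + (\<Sum>k<N. \<kappa> * a (Suc k)) - (\<Sum>k\<le>N. \<kappa> * b k)"
    using tel by (simp add: lessThan_Suc_atMost[symmetric] algebra_simps)
  also have "\<dots> \<le> \<kappa> * I 0 + (\<Sum>k<N. \<bar>a (Suc k)\<bar>) + (\<Sum>k\<le>N. \<bar>b k\<bar>)"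
  proof -
    have k1: "\<kappa> * s \<le> \<bar>s\<bar>" "- (\<kappa> * s) \<le> \<bar>s\<bar>" for s
      using abs_kappa by (auto simp: abs_if split: if_splits)
    have "(\<Sum>k<N. \<kappa> * a (Suc k)) \<le> (\<Sum>k<N. \<bar>a (Suc k)\<bar>)" by (intro sum_mono k1)
    moreover have "(\<Sum>k\<le>N. - (\<kappa> * b k)) \<le> (\<Sum>k\<le>N. \<bar>b k\<bar>)" by (intro sum_mono k1)
    ultimately show ?thesis by (simp add: sum_negf)
  qed
  also have "(\<Sum>k<N. \<bar>a (Suc k)\<bar>) \<le> (\<Sum>k<N. t * Y (Suc k) + sqn M (\<lambda>\<omega>. fst (res \<alpha> (Suc k) \<omega>)) / (4 * t))"
  proof (rule sum_mono)
    fix k assume "k \<in> {..<N}"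
    then show "\<bar>a (Suc k)\<bar> \<le> t * Y (Suc k) + sqn M (\<lambda>\<omega>. fst (res \<alpha> (Suc k) \<omega>)) / (4 * t)"
      unfolding a_def Y_def using young_integral[OF dh_fst_snd(4) res_fst_snd(1) t, of "Suc k" "Suc k" \<alpha>]
      by (simp add: inner_commute)
  qed
  also have "(\<Sum>k\<le>N. \<bar>b k\<bar>) \<le> (\<Sum>k\<le>N. t * X k + sqn M (\<lambda>\<omega>. snd (res \<alpha> k \<omega>)) / (4 * t))"
  proof (rule sum_mono)
    fix k assume "k \<in> {..N}"
    then show "\<bar>b k\<bar> \<le> t * X k + sqn M (\<lambda>\<omega>. snd (res \<alpha> k \<omega>)) / (4 * t)"
      unfolding b_def X_def by (intro young_integral dh_fst_snd res_fst_snd t) auto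
  qed
  also have "\<kappa> * I 0 + (\<Sum>k<N. t * Y (Suc k) + sqn M (\<lambda>\<omega>. fst (res \<alpha> (Suc k) \<omega>)) / (4 * t))
      + (\<Sum>k\<le>N. t * X k + sqn M (\<lambda>\<omega>. snd (res \<alpha> k \<omega>)) / (4 * t))
    = \<kappa> * I 0 + t * ((\<Sum>k\<le>N. X k) + (\<Sum>k<N. Y (Suc k))) + (\<Sum>k\<le>N. rsq \<alpha> k) / (4 * t)"
    by (simp add: rsq_def sum.distrib sum_distrib_left[symmetric] sum_divide_distrib[symmetric] sum.atMost_shift algebra_simps add_divide_distrib)
  also have "\<dots> \<le> \<kappa> * I 0 + t * psq M N dh + (\<Sum>k\<le>N. rsq \<alpha> k) / (4 * t)"
    unfolding psq_dh using t X_Y_nonneg(2)[of 0] by (simp add: sum.distrib sum.atMost_shift)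
  finally show ?thesis by (simp add: I_def)
qed

end

context fbs_pair
begin

text \<open>At each time the forward part contributes \<open>6 * L\<close> and the backward part
  \<open>3 * L\<close>; there are \<open>N + 1\<close> times. The argument triple is bounded by
  \<open>X k + 2 * Y (Suc k)\<close>, hence by three times the full norm.\<close>

lemma sweep_lipschitz:
  "psq M N (\<lambda>k \<omega>. sweep h k \<omega> - sweep h' k \<omega>) \<le> (real N + 1) * (9 * L) * psq M N dh"
proof -
  define P where "P = psq M N dh"
  have P: "0 \<le> P" by (simp add: P_def)
  have LP: "0 \<le> L * P" using L_ge_1 P by simp
  have XY: "L * (X k + 2 * Y (Suc k)) \<le> L * (3 * P)" if "k < N" for k
    using X_Y_le_psq(1)[of k] X_Y_le_psq(2)[of "Suc k"] that L_ge_1 by (intro mult_left_mono) (auto simp: P_def)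
  have "sqn M (\<lambda>\<omega>. sweep h k \<omega> - sweep h' k \<omega>) \<le> 9 * L * P" if k: "k \<le> N" for k
  proof -
    have s: "sqint M (\<lambda>\<omega>. sweep h k \<omega> - sweep h' k \<omega>)"
      by (intro sqint_diff L2F_D(2)[OF sweep_L2F] h h' k)
    have 1: "sqn M (\<lambda>\<omega>. fst (sweep h k \<omega> - sweep h' k \<omega>)) \<le> 6 * (L * P)"
    proof (cases k)
      case 0
      then show ?thesis using LP by (simp add: sweep_def sqn_def)
    next
      case (Suc j)
      then have j: "j < N" using k by simp
      note c = dcoef_components[OF j]
      note n = sqint_noise[OF j c(5,6)]
      have "(\<lambda>\<omega>. fst (sweep h k \<omega> - sweep h' k \<omega>))
          = (\<lambda>\<omega>. fst (snd (dcoef j \<omega>)) + w j \<omega> *\<^sub>R snd (snd (dcoef j \<omega>)))"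
        by (simp add: Suc sweep_def dcoef_def algebra_simps)
      then have "sqn M (\<lambda>\<omega>. fst (sweep h k \<omega> - sweep h' k \<omega>)) \<le> 2 * sqn M (\<lambda>\<omega>. snd (dcoef j \<omega>))"
        using sqint_add(2)[OF c(4) n(1)] n(2) c(7) by simp
      also have "\<dots> \<le> 2 * (L * (3 * P))"
        using sqn_dcoef(3)[OF j] XY[OF j] by simp
      finally show ?thesis by simp
    qed
    have 2: "sqn M (\<lambda>\<omega>. snd (sweep h k \<omega> - sweep h' k \<omega>)) \<le> 3 * (L * P)"
    proof (cases "k < N")
      case True
      have "sqn M (\<lambda>\<omega>. snd (sweep h k \<omega> - sweep h' k \<omega>)) = sqn M (\<lambda>\<omega>. - fst (dcoef k \<omega>))"
        using True by (simp add: sweep_def dcoef_def algebra_simps)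
      also have "\<dots> = sqn M (\<lambda>\<omega>. fst (dcoef k \<omega>))" by (rule sqint_minus(2)[OF dcoef_components(2)[OF True]])
      finally show ?thesis using sqn_dcoef(2)[OF True] XY[OF True] by simp
    next
      case False
      then have kN: "k = N" using k by simp
      have "(\<lambda>\<omega>. snd (sweep h k \<omega> - sweep h' k \<omega>)) = dPhi"
        by (simp add: kN sweep_def dPhi_def fun_eq_iff)
      moreover have "L * X N \<le> L * P" using X_Y_le_psq(1)[of N] L_ge_1 by (intro mult_left_mono) (auto simp: P_def)
      ultimately show ?thesis using sqn_dPhi LP by simp
    qed
    show ?thesis using 1 2 sqint_fst_snd(3)[OF s] by simp
  qed
  then have "psq M N (\<lambda>k \<omega>. sweep h k \<omega> - sweep h' k \<omega>) \<le> real (card {..N}) * (9 * L * P)"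
    unfolding psq_def by (intro sum_bounded_above) auto
  then show ?thesis by (simp add: P_def algebra_simps)
qed

text \<open>Stability bounds the state by the defect, and energy bounds the defect by a small part
  of the state; inserting one in the other closes the estimate. The initial state difference is
  itself a component of the residual, because a sweep starts from 0.\<close>

lemma residual_bound:
  assumes \<alpha>: "0 \<le> \<alpha>" "\<alpha> \<le> 1"
  shows "psq M N dh \<le> (4 * fb_const L N + 4 * (fb_const L N)\<^sup>2) * psq M N (res \<alpha>)"
proof -
  define K where "K = fb_const L N"
  have K: "1 \<le> K" unfolding K_def by (rule fb_const_ge_1[OF L_ge_1])
  define r where "r = psq M N (res \<alpha>)"
  define P where "P = psq M N dh"
  define Q where "Q = \<alpha> * (\<Sum>k\<le>N. defect k)"
  \<comment> \<open>With this weight the two state terms add up to half of the left-hand side once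
    multiplied by \<open>K\<close>.\<close>
  define t where "t = 1 / (4 * K)"
  have t: "0 < t" using K by (simp add: t_def)
  have R: "(\<Sum>k\<le>N. rsq \<alpha> k) \<le> r" unfolding r_def by (rule sum_rsq_le)
  have x0: "(\<lambda>\<omega>. fst (dh 0 \<omega>)) = (\<lambda>\<omega>. fst (res \<alpha> 0 \<omega>))"
    by (simp add: res_def sweep_def)
  have X0: "X 0 \<le> r"
  proof -
    have "X 0 \<le> sqn M (res \<alpha> 0)"
      unfolding X_def x0 using sqint_fst_snd(3)[OF L2F_D(2)[OF res_L2F, of 0]] by simp
    also have "\<dots> \<le> r" unfolding r_def by (rule sqn_le_psq) simp
    finally show ?thesis .
  qed
  have "\<kappa> * (LINT \<omega>|M. fst (dh 0 \<omega>) \<bullet> snd (dh 0 \<omega>)) \<le> \<bar>LINT \<omega>|M. snd (dh 0 \<omega>) \<bullet> fst (dh 0 \<omega>)\<bar>"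
    using abs_kappa by (auto simp: abs_if inner_commute split: if_splits)
  also have "\<dots> \<le> t * Y 0 + X 0 / (4 * t)"
    unfolding Y_def X_def by (intro young_integral dh_fst_snd t) auto
  also have "\<dots> \<le> t * P + r / (4 * t)"
    using X_Y_le_psq(2)[of 0] X0 t by (intro add_mono mult_left_mono divide_right_mono) (auto simp: P_def)
  finally have "Q \<le> (t * P + r / (4 * t)) + t * P + r / (4 * t)"
    using energy[OF t, of \<alpha>] divide_right_mono[OF R, of "4 * t"] t by (simp add: Q_def P_def)
  then have Q: "Q \<le> 2 * (t * P) + 2 * (r * K)" by (simp add: t_def mult.commute)
  have "P \<le> K * (X 0 + Q + (\<Sum>k\<le>N. rsq \<alpha> k))"
    unfolding P_def K_def Q_def by (rule stability(1)[OF \<alpha>])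
  also have "\<dots> \<le> K * (r + (2 * (t * P) + 2 * (r * K)) + r)"
    using K X0 R Q by (intro mult_left_mono) auto
  also have "\<dots> = P / 2 + (2 * K + 2 * K\<^sup>2) * r"
    using K by (simp add: t_def field_simps power2_eq_square)
  finally have "P \<le> 2 * ((2 * K + 2 * K\<^sup>2) * r)" by linarith
  then show ?thesis by (simp add: P_def K_def r_def algebra_simps)
qed

end

section \<open>Solvability with a prescribed initial state\<close>

context fbs
begin

text \<open>With \<open>x 0\<close> prescribed as an inhomogeneity there is no initial coupling
  left, and the residual bound, uniform in \<open>\<alpha>\<close>, is the stability hypothesis of
  the continuation method.\<close>

lemma exists_with_initial_state:
  "\<exists>h\<in>L2F M w {..N}. \<forall>k\<le>N. AE \<omega> in M. h k \<omega> - sweep h k \<omega> = (if k = 0 then (a, 0) else 0)"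
proof -
  define \<eta> :: "nat \<Rightarrow> 'w \<Rightarrow> (real^'n) \<times> (real^'n)" where "\<eta> k \<omega> = (if k = 0 then (a, 0) else 0)" for k \<omega>
  have pair: "fbs_pair M N w g \<Phi> \<kappa> L h h'" if "h \<in> L2F M w {..N}" "h' \<in> L2F M w {..N}" for h h'
    using that by unfold_locales
  have "\<exists>h\<in>L2F M w {..N}. \<forall>k\<le>N. AE \<omega> in M. h k \<omega> - sweep h k \<omega> = \<eta> k \<omega>"
  proof (rule continuation)
    show "sweep h \<in> L2F M w {..N}" if "h \<in> L2F M w {..N}" for h
      by (rule sweep_L2F[OF that])
    show "psq M N (\<lambda>k \<omega>. sweep h k \<omega> - sweep h' k \<omega>) \<le> (real N + 1) * (9 * L) * psq M N (\<lambda>k \<omega>. h k \<omega> - h' k \<omega>)"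
      if "h \<in> L2F M w {..N}" "h' \<in> L2F M w {..N}" for h h'
    proof -
      interpret fbs_pair M N w g \<Phi> \<kappa> L h h' by (rule pair[OF that])
      show ?thesis using sweep_lipschitz by (simp add: dh_def[abs_def])
    qed
    show "psq M N (\<lambda>k \<omega>. h k \<omega> - h' k \<omega>) \<le> (4 * fb_const L N + 4 * (fb_const L N)\<^sup>2) *
        psq M N (\<lambda>k \<omega>. (h k \<omega> - \<alpha> *\<^sub>R sweep h k \<omega>) - (h' k \<omega> - \<alpha> *\<^sub>R sweep h' k \<omega>))"
      if "0 \<le> \<alpha>" "\<alpha> \<le> 1" "h \<in> L2F M w {..N}" "h' \<in> L2F M w {..N}" for \<alpha> h h'
    proof -
      interpret fbs_pair M N w g \<Phi> \<kappa> L h h' by (rule pair[OF that(3,4)])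
      have "res \<alpha> = (\<lambda>k \<omega>. (h k \<omega> - \<alpha> *\<^sub>R sweep h k \<omega>) - (h' k \<omega> - \<alpha> *\<^sub>R sweep h' k \<omega>))"
        by (simp add: fun_eq_iff res_def dh_def scaleR_diff_right)
      then show ?thesis using residual_bound[OF that(1,2)] by (simp add: dh_def[abs_def])
    qed
    show "0 \<le> 4 * fb_const L N + 4 * (fb_const L N)\<^sup>2"
      using fb_const_ge_1[OF L_ge_1, of N] by simp
    show "\<eta> \<in> L2F M w {..N}"
      by (intro L2F_I) (auto simp: \<eta>_def[abs_def] finite_measure_axioms)
  qed
  then show ?thesis by (simp add: \<eta>_def)
qed

text \<open>The forward equation is imposed from time 1 on only: the initial state remains free, so
  that it can be prescribed or coupled to \<open>y 0\<close> afterwards.\<close>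

definition solves :: "(nat \<Rightarrow> 'w \<Rightarrow> (real^'n) \<times> (real^'n)) \<Rightarrow> bool" where
  "solves h \<longleftrightarrow> h \<in> L2F M w {..N} \<and>
    (\<forall>k<N. AE \<omega> in M. fst (h (Suc k) \<omega>) = fst (sweep h (Suc k) \<omega>)) \<and>
    (\<forall>k\<le>N. AE \<omega> in M. snd (h k \<omega>) = snd (sweep h k \<omega>))"

end

text \<open>Functions measurable for the trivial sigma-algebra are constant on the space, so
  evaluation at one arbitrary point turns the initial values into deterministic vectors.\<close>

definition (in noise) base :: "'w" where
  "base = (SOME \<omega>. \<omega> \<in> space M)"

lemma (in noise) base_in_space: "base \<in> space M"
  unfolding base_def using not_empty by (rule some_in_eq[THEN iffD2])

lemma (in noise) filt_0_value:
  fixes f :: "'w \<Rightarrow> 'v::t1_space"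
  shows "f \<in> borel_measurable (filt M w 0) \<Longrightarrow> \<omega> \<in> space M \<Longrightarrow> f \<omega> = f base"
  by (rule filt_0_constant[OF _ _ base_in_space])

text \<open>Minimising the right-hand side over \<open>t\<close>. When \<open>P\<close> or
  \<open>R\<close> vanishes the infimum 0 is only approached, so \<open>q \<le> e\<close> is shown
  for every positive \<open>e\<close>.\<close>

lemma le_sqrt_of_young:
  fixes q P R :: real
  assumes "0 \<le> P" "0 \<le> R" and q: "\<And>t. 0 < t \<Longrightarrow> q \<le> t * P + R / (4 * t)"
  shows "q \<le> sqrt (P * R)"
proof (cases "P = 0 \<or> R = 0")
  case True
  have "q \<le> 0 + e" if e: "0 < e" for e
  proof (cases "P = 0")
    case True
    \<comment> \<open>The numerator \<open>R + 1\<close> keeps the weight positive even for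
      \<open>R = 0\<close>.\<close>
    have "q \<le> R / (4 * ((R + 1) / (4 * e)))"
      using q[of "(R + 1) / (4 * e)"] True e assms(2) by simp
    also have "\<dots> = e * (R / (R + 1))" using e assms(2) by (simp add: field_simps)
    also have "\<dots> \<le> e * 1" using e assms(2) by (intro mult_left_mono) auto
    finally show ?thesis by simp
  next
    case False
    then show ?thesis using q[of "e / P"] \<open>P = 0 \<or> R = 0\<close> e assms(1) by simp
  qed
  then have "q \<le> 0" by (rule field_le_epsilon)
  then show ?thesis using True by auto
next
  case False
  define p r where "p = sqrt P" and "r = sqrt R"
  have pr: "0 < p" "0 < r" "P = p\<^sup>2" "R = r\<^sup>2" using False assms by (auto simp: p_def r_def)
  have "q \<le> (r / (2 * p)) * p\<^sup>2 + r\<^sup>2 / (4 * (r / (2 * p)))"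
    using q[of "r / (2 * p)"] pr by simp
  also have "\<dots> = p * r" using pr by (simp add: field_simps power2_eq_square)
  finally show ?thesis by (simp add: p_def r_def real_sqrt_mult)
qed

text \<open>
  Composition of monotone maps of opposite orientation: Brouwer's theorem for the map truncated
  outside a ball, where the truncation is inactive by an a priori bound.
\<close>

lemma opposite_monotone_fixed_point:
  fixes \<Lambda> Y :: "'v::euclidean_space \<Rightarrow> 'v"
  assumes cont: "continuous_on UNIV \<Lambda>"
    and Y_lip: "\<And>a a'. norm (Y a - Y a') \<le> c * norm (a - a')" and c: "0 \<le> c"
    and Y_mono: "\<And>a a'. 0 \<le> \<kappa> * ((a - a') \<bullet> (Y a - Y a'))"
    and \<Lambda>_mono: "\<And>y y'. \<kappa> * ((\<Lambda> y - \<Lambda> y') \<bullet> (y - y')) \<le> 0"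
    and \<kappa>: "\<bar>\<kappa>\<bar> = 1" and K: "0 \<le> K"
    and coercive: "(\<forall>y y'. (norm (\<Lambda> y - \<Lambda> y'))\<^sup>2 \<le> - K * (\<kappa> * ((\<Lambda> y - \<Lambda> y') \<bullet> (y - y')))) \<or>
      (\<forall>a a'. (norm (Y a - Y a'))\<^sup>2 \<le> K * (\<kappa> * ((a - a') \<bullet> (Y a - Y a'))))"
  obtains a where "a = \<Lambda> (Y a)"
proof -
  define y0 where "y0 = Y 0"
  define b0 where "b0 = \<Lambda> y0"
  define \<beta> where "\<beta> = norm b0"
  \<comment> \<open>The two summands are the a priori bounds in the two coercive cases, the second
    after the bound \<open>(2 + 2 * (K * c)) * \<beta>\<close> on \<open>a\<close>; adding 1 makes
    the inequality strict, so that a fixed point lies inside the ball.\<close>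
  define R where "R = K * \<beta> + c * ((2 + 2 * (K * c)) * \<beta>) + 1"
  have \<beta>: "0 \<le> \<beta>" by (simp add: \<beta>_def)
  have R: "0 < R" using c K \<beta> by (simp add: R_def add_nonneg_pos)
  have kle: "\<kappa> * (u \<bullet> v) \<le> norm u * norm v" for u v :: 'v
    using \<kappa> Cauchy_Schwarz_ineq2[of u v] by (auto simp: abs_if split: if_splits)
  \<comment> \<open>The bound is needed for all scalings \<open>t\<close> in (0, 1], because a fixed
    point of the truncated map solves the equation with \<open>t\<close> equal to the truncation
    factor.\<close>
  have apriori: "norm (Y a - y0) < R" if t: "0 < t" "t \<le> 1" and a: "a = \<Lambda> (y0 + t *\<^sub>R (Y a - y0))" for a t
  proof -
    define d where "d = Y a - y0"
    have pos: "0 \<le> \<kappa> * (a \<bullet> d)" using Y_mono[of a 0] by (simp add: d_def y0_def)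
    have k_td: "\<kappa> * (u \<bullet> (t *\<^sub>R d)) = t * (\<kappa> * (u \<bullet> d))" for u by simp
    have ab: "\<kappa> * ((a - b0) \<bullet> (t *\<^sub>R d)) = t * (\<kappa> * (a \<bullet> d)) - t * (\<kappa> * (b0 \<bullet> d))"
      by (simp add: inner_diff_left algebra_simps)
    have al: "\<Lambda> (y0 + t *\<^sub>R d) = a" using a by (simp add: d_def)
    have "norm d \<le> K * \<beta> + c * ((2 + 2 * (K * c)) * \<beta>)"
      using coercive
    proof
      assume "\<forall>a a'. (norm (Y a - Y a'))\<^sup>2 \<le> K * (\<kappa> * ((a - a') \<bullet> (Y a - Y a')))"
      from this[rule_format, of a 0] have 1: "(norm d)\<^sup>2 \<le> K * (\<kappa> * (a \<bullet> d))" by (simp add: d_def y0_def)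
      \<comment> \<open>If \<open>Y\<close> is the coercive map, monotonicity of the initial map
        between \<open>y0\<close> and the scaled argument replaces the unknown \<open>a\<close> by
        the fixed vector \<open>b0\<close>; one power of \<open>norm d\<close> then cancels.\<close>
      have "t * (\<kappa> * (a \<bullet> d)) - t * (\<kappa> * (b0 \<bullet> d)) \<le> 0"
        using \<Lambda>_mono[of "y0 + t *\<^sub>R d" y0] ab al by (simp add: b0_def)
      then have "\<kappa> * (a \<bullet> d) \<le> \<kappa> * (b0 \<bullet> d)" using t by simp
      also have "\<dots> \<le> \<beta> * norm d" unfolding \<beta>_def by (rule kle)
      finally have "(norm d)\<^sup>2 \<le> (K * \<beta>) * norm d"
        using 1 K mult_left_mono[of "\<kappa> * (a \<bullet> d)" "\<beta> * norm d" K] by simp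
      then have "norm d \<le> K * \<beta>"
        by (cases "d = 0") (use K \<beta> in \<open>auto simp: power2_eq_square\<close>)
      then show ?thesis using c K \<beta> by (smt (verit) mult_nonneg_nonneg)
    next
      assume "\<forall>y y'. (norm (\<Lambda> y - \<Lambda> y'))\<^sup>2 \<le> - K * (\<kappa> * ((\<Lambda> y - \<Lambda> y') \<bullet> (y - y')))"
      from this[rule_format, of "y0 + t *\<^sub>R d" y0]
      have "(norm (a - b0))\<^sup>2 \<le> - K * (t * (\<kappa> * (a \<bullet> d)) - t * (\<kappa> * (b0 \<bullet> d)))"
        using ab al by (simp add: b0_def)
      \<comment> \<open>If the initial map is the coercive one, the dropped term is nonnegative by
        monotonicity of \<open>Y\<close>. What remains is linear in \<open>norm d\<close>, hence at
        most linear in \<open>norm a\<close>, against a square on the left.\<close>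
      also have "\<dots> \<le> K * (t * (\<kappa> * (b0 \<bullet> d)))"
        using mult_nonneg_nonneg[OF K mult_nonneg_nonneg[OF less_imp_le[OF t(1)] pos]]
        by (simp add: algebra_simps)
      also have "\<dots> \<le> K * (t * (\<beta> * norm d))"
        unfolding \<beta>_def using K t kle by (intro mult_left_mono) auto
      also have "\<dots> \<le> K * (1 * (\<beta> * norm d))"
        using K t \<beta> by (intro mult_left_mono mult_right_mono) auto
      also have "norm d \<le> c * norm a" using Y_lip[of a 0] by (simp add: d_def y0_def)
      also have "norm a \<le> norm (a - b0) + \<beta>"
        using norm_triangle_ineq[of "a - b0" b0] by (simp add: \<beta>_def)
      finally have s: "(norm (a - b0))\<^sup>2 \<le> K * (1 * (\<beta> * (c * (norm (a - b0) + \<beta>))))"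
        using K \<beta> c by (simp add: mult_left_mono)
      have "norm (a - b0) \<le> (1 + 2 * (K * c)) * \<beta>"
      proof (rule ccontr)
        assume "\<not> ?thesis"
        then have gt: "(1 + 2 * (K * c)) * \<beta> < norm (a - b0)" by simp
        have "\<beta> \<le> (1 + 2 * (K * c)) * \<beta>" using K c \<beta> by (simp add: algebra_simps)
        then have b: "\<beta> < norm (a - b0)" using gt by simp
        have "(norm (a - b0))\<^sup>2 \<le> K * (1 * (\<beta> * (c * (norm (a - b0) + norm (a - b0)))))"
          using s b K c \<beta> by (smt (verit) mult_left_mono)
        also have "\<dots> = (2 * (K * c) * \<beta>) * norm (a - b0)" by simp
        finally have "norm (a - b0) * norm (a - b0) \<le> (2 * (K * c) * \<beta>) * norm (a - b0)"
          by (simp add: power2_eq_square)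
        moreover have "0 < norm (a - b0)" using b \<beta> by linarith
        ultimately have "norm (a - b0) \<le> 2 * (K * c) * \<beta>" by (rule mult_right_le_imp_le)
        then show False using gt \<beta> by (simp add: algebra_simps)
      qed
      then have "norm a \<le> (2 + 2 * (K * c)) * \<beta>"
        using \<open>norm a \<le> norm (a - b0) + \<beta>\<close> by (simp add: algebra_simps)
      then have "norm d \<le> c * ((2 + 2 * (K * c)) * \<beta>)"
        using \<open>norm d \<le> c * norm a\<close> c by (meson mult_left_mono order_trans)
      then show ?thesis using K \<beta> by (smt (verit) mult_nonneg_nonneg)
    qed
    then show ?thesis by (simp add: R_def d_def)
  qed
  \<comment> \<open>Radial retraction onto the ball of radius \<open>R\<close> around
    \<open>y0\<close>: the factor is continuous, and it equals 1 as soon as \<open>v\<close> lies in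
    the ball. The argument of the initial map then stays in a compact set, so \<open>F\<close> maps
    a ball into itself.\<close>
  define T where "T v = R / max R (norm (v - y0))" for v
  have T: "0 < T v" "T v \<le> 1" for v using R by (auto simp: T_def)
  define F where "F a = \<Lambda> (y0 + T (Y a) *\<^sub>R (Y a - y0))" for a
  have Y_cont: "continuous_on UNIV Y"
    by (rule lipschitz_on_continuous_on[of c]) (use Y_lip c in \<open>auto simp: lipschitz_on_def dist_norm\<close>)
  have F_cont: "continuous_on S F" for S
  proof -
    have "continuous_on UNIV F"
      unfolding F_def T_def using R
      by (intro continuous_on_compose2[OF cont] continuous_intros Y_cont) auto
    then show ?thesis by (rule continuous_on_subset) simp
  qed
  have "bounded (\<Lambda> ` cball y0 R)"
    by (intro compact_imp_bounded compact_continuous_image continuous_on_subset[OF cont]) auto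
  then obtain B where B: "0 < B" "\<And>v. v \<in> cball y0 R \<Longrightarrow> norm (\<Lambda> v) \<le> B"
    unfolding bounded_pos by auto
  have "F \<in> cball 0 B \<rightarrow> cball 0 B"
  proof
    fix a
    have "norm (T (Y a) *\<^sub>R (Y a - y0)) = T (Y a) * norm (Y a - y0)"
      using T(1)[of "Y a"] by (simp only: norm_scaleR abs_of_pos)
    also have "\<dots> \<le> R"
      using R by (auto simp: T_def max_def field_simps)
    finally have "norm (T (Y a) *\<^sub>R (Y a - y0)) \<le> R" .
    then show "F a \<in> cball 0 B" unfolding F_def by (auto intro!: B(2) simp: dist_norm)
  qed
  then obtain a where "F a = a" using brouwer_ball[OF B(1) F_cont] by blast
  moreover from this have "norm (Y a - y0) < R" by (intro apriori[OF T[of "Y a"]]) (simp add: F_def)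
  then have "T (Y a) = 1" using R by (simp add: T_def)
  ultimately show thesis by (intro that[of a]) (simp add: F_def)
qed

section \<open>Dependence on the initial state, and the initial coupling\<close>

context fbs
begin

lemma solves_pair:
  assumes "solves h" "solves h'"
  shows "fbs_pair M N w g \<Phi> \<kappa> L h h'"
    "\<And>k. k \<le> N \<Longrightarrow> fbs_pair.rsq M N w g \<Phi> h h' 1 k = 0"
proof -
  show p: "fbs_pair M N w g \<Phi> \<kappa> L h h'"
    using assms by unfold_locales (auto simp: solves_def)
  interpret fbs_pair M N w g \<Phi> \<kappa> L h h' by (rule p)
  fix k assume k: "k \<le> N"
  have 1: "sqn M (\<lambda>\<omega>. fst (res 1 k \<omega>)) = 0" if "k \<noteq> 0"
  proof -
    obtain j where j: "k = Suc j" "j < N" using \<open>k \<noteq> 0\<close> k by (cases k) auto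
    have "AE \<omega> in M. fst (h (Suc j) \<omega>) = fst (sweep h (Suc j) \<omega>)"
      "AE \<omega> in M. fst (h' (Suc j) \<omega>) = fst (sweep h' (Suc j) \<omega>)"
      using assms j by (auto simp: solves_def)
    then have "AE \<omega> in M. fst (res 1 k \<omega>) = 0"
      by eventually_elim (simp add: j res_def dh_def)
    then show ?thesis using sqn_eq_0_iff[OF res_fst_snd(1)[OF k]] by simp
  qed
  have "AE \<omega> in M. snd (h k \<omega>) = snd (sweep h k \<omega>)" "AE \<omega> in M. snd (h' k \<omega>) = snd (sweep h' k \<omega>)"
    using assms k by (auto simp: solves_def)
  then have "AE \<omega> in M. snd (res 1 k \<omega>) = 0"
    by eventually_elim (simp add: res_def dh_def)
  then have "sqn M (\<lambda>\<omega>. snd (res 1 k \<omega>)) = 0" using sqn_eq_0_iff[OF res_fst_snd(2)[OF k]] by simp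
  then show "rsq 1 k = 0" using 1 by (simp add: rsq_def)
qed

text \<open>For two solutions the residual vanishes and the energy estimate reduces to: total defect
  at most the oriented pairing of the initial differences. Nonnegativity of the defect gives
  monotonicity of \<open>y 0\<close> in \<open>x 0\<close>; inserting the bound in the stability
  estimates gives the other two claims, the last one being cocoercivity.\<close>

lemma solution_comparison:
  assumes sol: "solves h" "solves h'"
    and x: "AE \<omega> in M. fst (h 0 \<omega>) = a" "AE \<omega> in M. fst (h' 0 \<omega>) = a'"
  defines "y \<equiv> snd (h 0 base)" and "y' \<equiv> snd (h' 0 base)"
  shows "0 \<le> \<kappa> * ((a - a') \<bullet> (y - y'))"
    "(norm (y - y'))\<^sup>2 \<le> fb_const L N * ((norm (a - a'))\<^sup>2 + \<kappa> * ((a - a') \<bullet> (y - y')))"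
    "bwd_coercive M N g \<Phi> \<kappa> L \<Longrightarrow> (norm (y - y'))\<^sup>2 \<le> fb_const L N * (\<kappa> * ((a - a') \<bullet> (y - y')))"
proof -
  interpret fbs_pair M N w g \<Phi> \<kappa> L h h' by (rule solves_pair(1)[OF sol])
  have R: "(\<Sum>k\<le>N. rsq 1 k) = 0" using solves_pair(2)[OF sol] by simp
  have K: "1 \<le> fb_const L N" by (rule fb_const_ge_1[OF L_ge_1])
  have yv: "snd (h 0 \<omega>) = y" "snd (h' 0 \<omega>) = y'" if "\<omega> \<in> space M" for \<omega>
    unfolding y_def y'_def
    using filt_0_value[OF process_fst_snd(3)[OF h, of 0] that] filt_0_value[OF process_fst_snd(3)[OF h', of 0] that] by auto
  have d: "AE \<omega> in M. fst (dh 0 \<omega>) = a - a' \<and> snd (dh 0 \<omega>) = y - y'"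
    using x AE_space by eventually_elim (simp add: dh_def yv)
  have X0: "X 0 = (norm (a - a'))\<^sup>2"
  proof -
    have "X 0 = (LINT \<omega>|M. (norm (a - a'))\<^sup>2)"
      unfolding X_def sqn_def using d dh_fst_snd(2)[of 0] by (intro integral_cong_AE) auto
    then show ?thesis by (simp add: prob_space)
  qed
  have Y0: "Y 0 = (norm (y - y'))\<^sup>2"
  proof -
    have "Y 0 = (LINT \<omega>|M. (norm (y - y'))\<^sup>2)"
      unfolding Y_def sqn_def using d dh_fst_snd(4)[of 0] by (intro integral_cong_AE) auto
    then show ?thesis by (simp add: prob_space)
  qed
  have I0: "(LINT \<omega>|M. fst (dh 0 \<omega>) \<bullet> snd (dh 0 \<omega>)) = (a - a') \<bullet> (y - y')"
  proof -
    have "(LINT \<omega>|M. fst (dh 0 \<omega>) \<bullet> snd (dh 0 \<omega>)) = (LINT \<omega>|M. (a - a') \<bullet> (y - y'))"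
      using d sqint_inner[OF dh_fst_snd(2)[of 0] dh_fst_snd(4)[of 0]]
      by (intro integral_cong_AE) auto
    then show ?thesis by (simp add: prob_space)
  qed
  define Q where "Q = 1 * (\<Sum>k\<le>N. defect k)"
  have Q0: "0 \<le> Q" unfolding Q_def by (auto intro!: sum_nonneg defect_nonneg)
  have "Q - \<kappa> * ((a - a') \<bullet> (y - y')) \<le> sqrt (psq M N dh * 0)"
  proof (rule le_sqrt_of_young)
    show "Q - \<kappa> * ((a - a') \<bullet> (y - y')) \<le> t * psq M N dh + 0 / (4 * t)" if "0 < t" for t
      using energy[OF that, of 1] unfolding Q_def R I0 by simp
  qed auto
  then have Q: "Q \<le> \<kappa> * ((a - a') \<bullet> (y - y'))" by simp
  then show "0 \<le> \<kappa> * ((a - a') \<bullet> (y - y'))" using Q0 by simp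
  have "Y 0 \<le> psq M N dh" by (rule X_Y_le_psq) simp
  also have "\<dots> \<le> fb_const L N * (X 0 + Q + (\<Sum>k\<le>N. rsq 1 k))"
    unfolding Q_def by (rule stability(1)) auto
  also have "\<dots> \<le> fb_const L N * ((norm (a - a'))\<^sup>2 + \<kappa> * ((a - a') \<bullet> (y - y')))"
    unfolding R X0 using K Q by (intro mult_left_mono) auto
  finally show "(norm (y - y'))\<^sup>2 \<le> fb_const L N * ((norm (a - a'))\<^sup>2 + \<kappa> * ((a - a') \<bullet> (y - y')))"
    by (simp add: Y0)
  assume b: "bwd_coercive M N g \<Phi> \<kappa> L"
  have "Y 0 \<le> fb_const L N * (Q + (\<Sum>k\<le>N. rsq 1 k))"
    unfolding Q_def by (rule stability(2)[OF _ _ b]) auto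
  also have "\<dots> \<le> fb_const L N * (\<kappa> * ((a - a') \<bullet> (y - y')))"
    unfolding R using K Q by (intro mult_left_mono) auto
  finally show "(norm (y - y'))\<^sup>2 \<le> fb_const L N * (\<kappa> * ((a - a') \<bullet> (y - y')))"
    by (simp add: Y0)
qed

text \<open>In every case one side of the coupling \<open>x 0 = \<Lambda> (y 0)\<close> is
  cocoercive: either \<open>\<Lambda>\<close> itself, or, by backward coercivity, the map from the
  initial state to \<open>y 0\<close>. In the latter case \<open>\<Lambda>\<close> is merely
  continuous and monotone.\<close>

definition compatible_init :: "(real^'n \<Rightarrow> real^'n) \<Rightarrow> bool" where
  "compatible_init \<Lambda> \<longleftrightarrow> continuous_on UNIV \<Lambda> \<and>
    (\<forall>y y'. \<kappa> * ((\<Lambda> y - \<Lambda> y') \<bullet> (y - y')) \<le> 0) \<and>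
    ((\<forall>y y'. (norm (\<Lambda> y - \<Lambda> y'))\<^sup>2 \<le> - L * (\<kappa> * ((\<Lambda> y - \<Lambda> y') \<bullet> (y - y')))) \<or> bwd_coercive M N g \<Phi> \<kappa> L)"

text \<open>Solving with each prescribed initial state \<open>a\<close> yields a map
  \<open>Yv\<close>, monotone in the orientation opposite to that of \<open>\<Lambda>\<close>; the
  coupled system is the equation \<open>a = \<Lambda> (Yv a)\<close>.\<close>

lemma exists_solution:
  assumes \<Lambda>: "compatible_init \<Lambda>"
  shows "\<exists>h. solves h \<and> (AE \<omega> in M. fst (h 0 \<omega>) = \<Lambda> (snd (h 0 \<omega>)))"
proof -
  have "\<exists>h. solves h \<and> (AE \<omega> in M. fst (h 0 \<omega>) = a)" for a
  proof -
    obtain h where h: "h \<in> L2F M w {..N}"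
      and eq: "\<And>k. k \<le> N \<Longrightarrow> AE \<omega> in M. h k \<omega> - sweep h k \<omega> = (if k = 0 then (a, 0) else 0)"
      using exists_with_initial_state[of a] by blast
    have "AE \<omega> in M. fst (h (Suc k) \<omega>) = fst (sweep h (Suc k) \<omega>)" if "k < N" for k
      using eq[of "Suc k"] that by auto
    moreover have "AE \<omega> in M. snd (h k \<omega>) = snd (sweep h k \<omega>)" if "k \<le> N" for k
      using eq[OF that]
    proof eventually_elim
      case (elim \<omega>)
      then have "snd (h k \<omega> - sweep h k \<omega>) = 0" by (simp split: if_splits)
      then show ?case by simp
    qed
    moreover have "AE \<omega> in M. fst (h 0 \<omega>) = a"
      using eq[OF le0]
    proof eventually_elim
      case (elim \<omega>)
      then have "fst (h 0 \<omega> - sweep h 0 \<omega>) = a" by simp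
      then show ?case by (simp add: sweep_def)
    qed
    ultimately show ?thesis using h by (auto simp: solves_def)
  qed
  then obtain hs where hs: "\<And>a. solves (hs a)" "\<And>a. AE \<omega> in M. fst (hs a 0 \<omega>) = a" by metis
  define Yv where "Yv a = snd (hs a 0 base)" for a
  define K where "K = fb_const L N"
  have K: "1 \<le> K" unfolding K_def by (rule fb_const_ge_1[OF L_ge_1])
  note cmp = solution_comparison[OF hs(1) hs(1) hs(2) hs(2), folded Yv_def K_def]
  \<comment> \<open>With \<open>p\<close> and \<open>q\<close> the norms of the increments,
    comparison gives \<open>q\<^sup>2 \<le> K * (p\<^sup>2 + p * q)\<close>. If \<open>q\<close>
    exceeded \<open>2 * K * p\<close>, the two terms on the right would be at most a quarter and a
    half of \<open>q\<^sup>2\<close>.\<close>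
  have lip: "norm (Yv a - Yv a') \<le> 2 * K * norm (a - a')" for a a'
  proof (rule ccontr)
    assume "\<not> ?thesis"
    then have gt: "2 * K * norm (a - a') < norm (Yv a - Yv a')" by simp
    define p q where "p = norm (a - a')" and "q = norm (Yv a - Yv a')"
    have q0: "0 \<le> q" by (simp add: q_def)
    have pq: "0 \<le> p" "2 * K * p < q" using gt by (auto simp: p_def q_def)
    have "\<kappa> * ((a - a') \<bullet> (Yv a - Yv a')) \<le> p * q"
      using abs_kappa Cauchy_Schwarz_ineq2[of "a - a'" "Yv a - Yv a'"]
      by (auto simp: abs_if p_def q_def split: if_splits)
    then have "q\<^sup>2 \<le> K * (p\<^sup>2 + p * q)"
      using cmp(2)[of a a'] K unfolding p_def[symmetric] q_def[symmetric]
      by (smt (verit) mult_left_mono)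
    moreover have "2 * (K * (p * q)) \<le> q\<^sup>2"
      using mult_right_mono[of "2 * K * p" q q] pq q0 by (simp add: power2_eq_square mult.assoc)
    moreover have "K * p\<^sup>2 * 4 \<le> q\<^sup>2"
    proof -
      have "K \<le> K * K" using mult_left_mono[of 1 K K] K by simp
      from mult_right_mono[OF this, of "p\<^sup>2"]
      have "K * p\<^sup>2 * 4 \<le> (2 * K * p)\<^sup>2" by (simp add: power2_eq_square algebra_simps)
      also have "\<dots> \<le> q\<^sup>2" using pq K by (intro power_mono) auto
      finally show ?thesis .
    qed
    moreover have "0 < q" using pq K by (smt (verit) mult_nonneg_nonneg)
    then have "0 < q\<^sup>2" by simp
    ultimately show False by (simp add: distrib_left)
  qed
  obtain a where a: "a = \<Lambda> (Yv a)"
  proof (rule opposite_monotone_fixed_point[of \<Lambda> Yv "2 * K" \<kappa> "max K L"])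
    show "continuous_on UNIV \<Lambda>" "\<And>y y'. \<kappa> * ((\<Lambda> y - \<Lambda> y') \<bullet> (y - y')) \<le> 0"
      using \<Lambda> by (auto simp: compatible_init_def)
    show "norm (Yv a - Yv a') \<le> 2 * K * norm (a - a')" for a a' by (rule lip)
    show "0 \<le> \<kappa> * ((a - a') \<bullet> (Yv a - Yv a'))" for a a' by (rule cmp(1))
    show "0 \<le> 2 * K" "0 \<le> max K L" "\<bar>\<kappa>\<bar> = 1" using K abs_kappa by auto
    show "(\<forall>y y'. (norm (\<Lambda> y - \<Lambda> y'))\<^sup>2 \<le> - max K L * (\<kappa> * ((\<Lambda> y - \<Lambda> y') \<bullet> (y - y')))) \<or>
        (\<forall>a a'. (norm (Yv a - Yv a'))\<^sup>2 \<le> max K L * (\<kappa> * ((a - a') \<bullet> (Yv a - Yv a'))))"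
    proof -
      have m: "\<kappa> * ((\<Lambda> y - \<Lambda> y') \<bullet> (y - y')) \<le> 0" for y y'
        using \<Lambda> by (auto simp: compatible_init_def)
      have 1: "- L * (\<kappa> * ((\<Lambda> y - \<Lambda> y') \<bullet> (y - y'))) \<le> - max K L * (\<kappa> * ((\<Lambda> y - \<Lambda> y') \<bullet> (y - y')))" for y y'
        by (intro mult_right_mono_neg m) simp
      have 2: "K * (\<kappa> * ((a - a') \<bullet> (Yv a - Yv a'))) \<le> max K L * (\<kappa> * ((a - a') \<bullet> (Yv a - Yv a')))" for a a'
        by (intro mult_right_mono cmp(1)) simp
      from \<Lambda> have "(\<forall>y y'. (norm (\<Lambda> y - \<Lambda> y'))\<^sup>2 \<le> - L * (\<kappa> * ((\<Lambda> y - \<Lambda> y') \<bullet> (y - y')))) \<or> bwd_coercive M N g \<Phi> \<kappa> L"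
        by (simp add: compatible_init_def)
      then show ?thesis
        using order_trans[OF _ 1] order_trans[OF cmp(3) 2] by blast
    qed
  qed
  have "AE \<omega> in M. fst (hs a 0 \<omega>) = \<Lambda> (snd (hs a 0 \<omega>))"
    using hs(2)[of a] AE_space
  proof eventually_elim
    case (elim \<omega>)
    have "hs a \<in> L2F M w {..N}" using hs(1) by (simp add: solves_def)
    from filt_0_value[OF process_fst_snd(3)[OF this, of 0] elim(2)]
    have "snd (hs a 0 \<omega>) = Yv a" by (simp add: Yv_def)
    then show ?case using elim a by simp
  qed
  then show ?thesis using hs(1) by blast
qed

end

text \<open>
  Stability is only local because of the initial map, which for backward coercive systems
  is merely locally Lipschitz, with constant \<open>D (1 + u)\<close> for the squares.
\<close>

definition stab_const :: "real \<Rightarrow> real \<Rightarrow> real \<Rightarrow> real" where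
  "stab_const L K D = K\<^sup>2 * (L + 1)\<^sup>2 + 2 * K + 2 * ((K * (D * K + 1))\<^sup>2 + K * (D * K + 2 * (D * K\<^sup>2) + 1))"

text \<open>Chosen so that \<open>R \<le> 1\<close> and \<open>8 * (D * K ^ 3) * R \<le> 1\<close>;
  the second makes the term of order \<open>R * P\<close> at most a quarter of
  \<open>P\<close>.\<close>

definition stab_radius :: "real \<Rightarrow> real \<Rightarrow> real" where
  "stab_radius K D = 1 / (1 + 8 * (D * K ^ 3))"

text \<open>Here \<open>u\<close> is the squared increment of \<open>y 0\<close>, and
  \<open>D * (1 + u) * u\<close> bounds that of the initial map. The independent bound on
  \<open>u\<close> makes \<open>u\<^sup>2\<close> of order \<open>P * R + R\<close>; the product
  \<open>P * R\<close> is absorbed by the smallness of \<open>R\<close>, and the geometric mean of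
  \<open>P\<close> and \<open>R\<close> by completing a square. Each absorption costs a quarter of
  \<open>P\<close>, hence the final factor 2.\<close>

lemma local_stability_real:
  fixes K D P R u Q :: real
  assumes K: "1 \<le> K" and D: "0 \<le> D" and nn: "0 \<le> P" "0 \<le> R" "0 \<le> u"
    and P: "P \<le> K * (D * (1 + u) * u + Q + R)" and u: "u \<le> K * (Q + R)" and Q: "Q \<le> sqrt (P * R)"
    and R: "R \<le> stab_radius K D"
  shows "P \<le> 2 * ((K * (D * K + 1))\<^sup>2 + K * (D * K + 2 * (D * K\<^sup>2) + 1)) * R"
proof -
  define s where "s = sqrt (P * R)"
  have s0: "0 \<le> s" and s2: "s\<^sup>2 = P * R" using nn by (auto simp: s_def)
  have DK: "0 \<le> D * K ^ 3" using K D by simp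
  have R1: "R \<le> 1"
    using R DK by (simp add: stab_radius_def) (smt (verit) divide_le_eq_1)
  have R8: "8 * (D * K ^ 3) * R \<le> 1"
  proof -
    have "R * (1 + 8 * (D * K ^ 3)) \<le> 1" using R DK by (simp add: stab_radius_def field_simps)
    then show ?thesis using nn by (simp add: algebra_simps)
  qed
  have R2: "R\<^sup>2 \<le> R" using nn R1 by (simp add: power2_eq_square mult_left_le)
  have us: "u \<le> K * (s + R)" using u Q K by (smt (verit) mult_left_mono s_def)
  have u2: "u\<^sup>2 \<le> K\<^sup>2 * (2 * (P * R) + 2 * R)"
  proof -
    have "u\<^sup>2 \<le> (K * (s + R))\<^sup>2" using us nn by (intro power_mono) auto
    also have "\<dots> = K\<^sup>2 * (s + R)\<^sup>2" by (simp add: power_mult_distrib)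
    also have "(s + R)\<^sup>2 \<le> 2 * s\<^sup>2 + 2 * R\<^sup>2"
      using sum_squares_bound[of s R] by (simp add: power2_sum)
    also have "\<dots> \<le> 2 * (P * R) + 2 * R" using s2 R2 by simp
    finally show ?thesis by (simp add: mult_left_mono)
  qed
  have "P \<le> K * (D * u + D * u\<^sup>2 + Q + R)" using P by (simp add: power2_eq_square algebra_simps)
  also have "\<dots> \<le> K * (D * (K * (s + R)) + D * (K\<^sup>2 * (2 * (P * R) + 2 * R)) + s + R)"
    using K D us u2 Q by (intro mult_left_mono add_mono) (auto simp: s_def)
  also have "\<dots> = (K * (D * K + 1)) * s + 2 * (D * K ^ 3) * R * P + K * (D * K + 2 * (D * K\<^sup>2) + 1) * R"
    by (simp add: algebra_simps power2_eq_square power3_eq_cube)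
  finally have 1: "P \<le> \<dots>" .
  have 2: "2 * (D * K ^ 3) * R * P \<le> P / 4"
    using mult_right_mono[OF R8 nn(1)] by simp
  define A where "A = K * (D * K + 1)"
  have 3: "A * s \<le> P / 4 + A\<^sup>2 * R"
  proof -
    define p r where "p = sqrt P" and "r = sqrt R"
    have pr: "P = p\<^sup>2" "R = r\<^sup>2" "s = p * r" using nn by (auto simp: p_def r_def s_def real_sqrt_mult)
    have "0 \<le> (p / 2 - A * r)\<^sup>2" by simp
    then show ?thesis unfolding pr by (simp add: power2_eq_square algebra_simps)
  qed
  from 1 2 3 show ?thesis unfolding A_def[symmetric] by (simp add: algebra_simps)
qed

text \<open>If the initial map is cocoercive, its squared increment \<open>X\<close> is paid for by
  the energy inequality together with the defect, and no smallness enters. What is left is a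
  quadratic inequality for the square root of \<open>P\<close>.\<close>

lemma local_stability_real_fwd:
  fixes K L P R X Q :: real
  assumes K: "1 \<le> K" and L: "1 \<le> L" and nn: "0 \<le> P" "0 \<le> R" "0 \<le> Q"
    and P: "P \<le> K * (X + Q + R)" and QX: "L * Q + X \<le> L * sqrt (P * R)"
  shows "P \<le> (K\<^sup>2 * (L + 1)\<^sup>2 + 2 * K) * R"
proof -
  define p r where "p = sqrt P" and "r = sqrt R"
  have pr: "P = p\<^sup>2" "R = r\<^sup>2" "sqrt (P * R) = p * r" "0 \<le> p" "0 \<le> r"
    using nn by (auto simp: p_def r_def real_sqrt_mult)
  have "Q \<le> L * Q" using mult_right_mono[OF L nn(3)] by simp
  then have "X + Q \<le> L * (p * r)" using QX pr by simp
  also have "\<dots> \<le> (L + 1) * (p * r)" using pr by (simp add: algebra_simps)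
  finally have "P \<le> K * ((L + 1) * (p * r) + R)"
    using P K by (smt (verit) mult_left_mono)
  moreover have "0 \<le> (p - K * (L + 1) * r)\<^sup>2" by simp
  ultimately show ?thesis unfolding pr by (simp add: power2_eq_square algebra_simps)
qed

text \<open>The process \<open>h'\<close> is the fixed reference and \<open>h\<close> the perturbed
  one: \<open>D\<close> depends only on the value of \<open>h'\<close> at time 0, so radius and
  constant do not change along a family of perturbations.\<close>

lemma (in fbs_pair) local_stability:
  assumes \<Lambda>: "compatible_init \<Lambda>"
    and growth: "\<And>y y'. norm (\<Lambda> y - \<Lambda> y') \<le> c * (1 + norm y + norm y') * norm (y - y')"
    and init: "AE \<omega> in M. fst (h 0 \<omega>) = \<Lambda> (snd (h 0 \<omega>))" "AE \<omega> in M. fst (h' 0 \<omega>) = \<Lambda> (snd (h' 0 \<omega>))"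
  defines "R \<equiv> (\<Sum>k\<le>N. rsq 1 k)" and "D \<equiv> 2 * (c * (1 + 2 * norm (snd (h' 0 base))))\<^sup>2"
    and "K \<equiv> fb_const L N"
  assumes R: "R \<le> stab_radius K D"
  shows "psq M N dh \<le> stab_const L K D * R"
proof -
  define y y' where "y = snd (h 0 base)" and "y' = snd (h' 0 base)"
  define v where "v = \<Lambda> y - \<Lambda> y'"
  define I where "I = \<kappa> * (v \<bullet> (y - y'))"
  have K: "1 \<le> K" unfolding K_def by (rule fb_const_ge_1[OF L_ge_1])
  have D: "0 \<le> D" by (simp add: D_def)
  have R0: "0 \<le> R" unfolding R_def by (intro sum_nonneg) simp
  have yv: "snd (h 0 \<omega>) = y" "snd (h' 0 \<omega>) = y'" if "\<omega> \<in> space M" for \<omega>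
    unfolding y_def y'_def
    using filt_0_value[OF process_fst_snd(3)[OF h, of 0] that] filt_0_value[OF process_fst_snd(3)[OF h', of 0] that] by auto
  have d: "AE \<omega> in M. fst (dh 0 \<omega>) = v \<and> snd (dh 0 \<omega>) = y - y'"
    using init AE_space by eventually_elim (simp add: dh_def yv v_def)
  have X0: "X 0 = (norm v)\<^sup>2"
  proof -
    have "X 0 = (LINT \<omega>|M. (norm v)\<^sup>2)"
      unfolding X_def sqn_def using d dh_fst_snd(2)[of 0] by (intro integral_cong_AE) auto
    then show ?thesis by (simp add: prob_space)
  qed
  have Y0: "Y 0 = (norm (y - y'))\<^sup>2"
  proof -
    have "Y 0 = (LINT \<omega>|M. (norm (y - y'))\<^sup>2)"
      unfolding Y_def sqn_def using d dh_fst_snd(4)[of 0] by (intro integral_cong_AE) auto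
    then show ?thesis by (simp add: prob_space)
  qed
  have I0: "\<kappa> * (LINT \<omega>|M. fst (dh 0 \<omega>) \<bullet> snd (dh 0 \<omega>)) = I"
  proof -
    have "(LINT \<omega>|M. fst (dh 0 \<omega>) \<bullet> snd (dh 0 \<omega>)) = (LINT \<omega>|M. v \<bullet> (y - y'))"
      using d sqint_inner[OF dh_fst_snd(2)[of 0] dh_fst_snd(4)[of 0]]
      by (intro integral_cong_AE) auto
    then show ?thesis by (simp add: prob_space I_def)
  qed
  \<comment> \<open>Initial map and coefficients are oriented oppositely, so the boundary term of
    the energy estimate has a favourable sign.\<close>
  have I_le: "I \<le> 0" using \<Lambda> by (simp add: I_def v_def compatible_init_def)
  define P where "P = psq M N dh"
  have P0: "0 \<le> P" by (simp add: P_def)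
  define Q where "Q = 1 * (\<Sum>k\<le>N. defect k)"
  have Q0: "0 \<le> Q" unfolding Q_def by (auto intro!: sum_nonneg defect_nonneg)
  have QI: "Q - I \<le> sqrt (P * R)"
  proof (rule le_sqrt_of_young[OF P0 R0])
    show "Q - I \<le> t * P + R / (4 * t)" if "0 < t" for t
      using energy[OF that, of 1] unfolding I0 Q_def P_def R_def by linarith
  qed
  have PK: "P \<le> K * (X 0 + Q + R)"
    unfolding P_def K_def Q_def R_def by (rule stability(1)) auto
  from \<Lambda> consider (fwd) "(norm v)\<^sup>2 \<le> - L * I" | (bwd) "bwd_coercive M N g \<Phi> \<kappa> L"
    by (auto simp: compatible_init_def v_def I_def)
  then show ?thesis
  proof cases
    case fwd
    have "L * (Q - I) \<le> L * sqrt (P * R)" using QI L_ge_1 by (intro mult_left_mono) auto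
    then have "L * Q + X 0 \<le> L * sqrt (P * R)" using fwd by (simp add: X0 algebra_simps)
    from local_stability_real_fwd[OF K L_ge_1 P0 R0 Q0 PK this]
    have "P \<le> (K\<^sup>2 * (L + 1)\<^sup>2 + 2 * K) * R" .
    also have "\<dots> \<le> stab_const L K D * R"
      using R0 K D by (intro mult_right_mono) (auto simp: stab_const_def)
    finally show ?thesis by (simp add: P_def)
  next
    case bwd
    have Yb: "Y 0 \<le> K * (Q + R)"
      unfolding K_def Q_def R_def by (rule stability(2)[OF _ _ bwd]) auto
    have QP: "Q \<le> sqrt (P * R)" using QI I_le by simp
    \<comment> \<open>The growth factor at the unknown \<open>y\<close> is expressed through the
      reference value and the increment \<open>e\<close>; since \<open>m\<close> is at least 1, its
      square is at most \<open>2 * m\<^sup>2 * (1 + e\<^sup>2)\<close>, which explains the form of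
      \<open>D\<close>.\<close>
    define m e where "m = 1 + 2 * norm y'" and "e = norm (y - y')"
    have me: "1 \<le> m" "0 \<le> e" by (auto simp: m_def e_def)
    have "norm v \<le> \<bar>c\<bar> * (m + e) * e"
    proof -
      have "norm y \<le> norm y' + e" unfolding e_def using norm_triangle_ineq[of y' "y - y'"] by simp
      then have le: "1 + norm y + norm y' \<le> m + e" by (simp add: m_def)
      have "norm v \<le> c * (1 + norm y + norm y') * e" unfolding v_def e_def by (rule growth)
      also have "\<dots> \<le> \<bar>c\<bar> * (1 + norm y + norm y') * e"
        using me by (intro mult_right_mono) auto
      also have "\<dots> \<le> \<bar>c\<bar> * (m + e) * e"
        using me le by (intro mult_right_mono mult_left_mono) auto
      finally show ?thesis .
    qed
    then have "(norm v)\<^sup>2 \<le> (\<bar>c\<bar> * (m + e) * e)\<^sup>2" by (intro power_mono) auto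
    also have "\<dots> = c\<^sup>2 * (m + e)\<^sup>2 * e\<^sup>2" by (simp add: power_mult_distrib)
    also have "\<dots> \<le> c\<^sup>2 * (2 * m\<^sup>2 * (1 + e\<^sup>2)) * e\<^sup>2"
    proof (intro mult_right_mono mult_left_mono)
      have "(m + e)\<^sup>2 \<le> 2 * m\<^sup>2 + 2 * e\<^sup>2" using sum_squares_bound[of m e] by (simp add: power2_sum)
      moreover have "1 * e\<^sup>2 \<le> m\<^sup>2 * e\<^sup>2" using me by (intro mult_right_mono one_le_power) auto
      ultimately show "(m + e)\<^sup>2 \<le> 2 * m\<^sup>2 * (1 + e\<^sup>2)" by (simp add: algebra_simps)
    qed auto
    also have "\<dots> = D * (1 + Y 0) * Y 0"
      by (simp add: D_def Y0 m_def y'_def e_def power_mult_distrib)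
    finally have X: "X 0 \<le> D * (1 + Y 0) * Y 0" by (simp add: X0)
    have "P \<le> K * (D * (1 + Y 0) * Y 0 + Q + R)"
      using PK X K by (smt (verit) mult_left_mono)
    from local_stability_real[OF K D P0 R0 _ this Yb QP R]
    have "P \<le> 2 * ((K * (D * K + 1))\<^sup>2 + K * (D * K + 2 * (D * K\<^sup>2) + 1)) * R" by simp
    also have "\<dots> \<le> stab_const L K D * R"
      using R0 K L_ge_1 by (intro mult_right_mono) (auto simp: stab_const_def)
    finally show ?thesis by (simp add: P_def)
  qed
qed

section \<open>The control system as a monotone forward-backward system\<close>

lemma C1_derivative:
  assumes "C1 g"
  shows "(g has_derivative frechet_derivative g (at a)) (at a)"
  using assms frechet_derivative_works unfolding C1_def differentiable_def by blast

lemma C1_continuous: "C1 g \<Longrightarrow> continuous_on S g"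
  by (meson C1_derivative has_derivative_at_withinI has_derivative_continuous_on)

lemma C1_increment:
  fixes g :: "'a::real_normed_vector \<Rightarrow> 'b::real_normed_vector"
  assumes g: "C1 g" and B: "\<And>c. c \<in> closed_segment a b \<Longrightarrow> dnorm g c \<le> B"
  shows "norm (g a - g b) \<le> B * norm (a - b)"
proof (rule differentiable_bound[of "closed_segment a b" g "\<lambda>c. frechet_derivative g (at c)"])
  show "(g has_derivative frechet_derivative g (at c)) (at c within closed_segment a b)" for c
    using C1_derivative[OF g] by (rule has_derivative_at_withinI)
  show "onorm (frechet_derivative g (at c)) \<le> B" if "c \<in> closed_segment a b" for c
    using B[OF that] by (simp add: dnorm_def)
qed auto

lemma norm_in_segment_le:
  fixes a b :: "'a::real_normed_vector"
  assumes "c \<in> closed_segment a b"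
  shows "norm c \<le> norm a + norm b"
proof -
  obtain t where t: "0 \<le> t" "t \<le> 1" "c = (1 - t) *\<^sub>R a + t *\<^sub>R b"
    using assms by (auto simp: closed_segment_def)
  have "norm c \<le> (1 - t) * norm a + t * norm b"
    unfolding t(3) using t(1,2) by (intro order_trans[OF norm_triangle_ineq]) simp
  also have "\<dots> \<le> 1 * norm a + 1 * norm b" using t by (intro add_mono mult_right_mono) auto
  finally show ?thesis by simp
qed

lemma C1_growth:
  fixes g :: "'a::real_normed_vector \<Rightarrow> 'b::real_normed_vector"
  assumes g: "C1 g" and B: "\<And>c. dnorm g c \<le> C * (1 + norm c)" and C: "0 \<le> C"
  shows "norm (g a - g b) \<le> C * (1 + norm a + norm b) * norm (a - b)"
proof (rule C1_increment[OF g])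
  fix c assume "c \<in> closed_segment a b"
  then have "C * (1 + norm c) \<le> C * (1 + norm a + norm b)"
    using norm_in_segment_le C by (intro mult_left_mono) (auto simp: add.assoc)
  then show "dnorm g c \<le> C * (1 + norm a + norm b)" using B[of c] by linarith
qed

lemma norm_fst_snd_le: "norm (fst p) \<le> norm p" "norm (snd p) \<le> norm p"
  for p :: "'a::real_normed_vector \<times> 'b::real_normed_vector"
  using norm_fst_le[of "fst p" "snd p"] norm_snd_le[of "snd p" "fst p"] by simp_all

lemma norm_matrix_vector_le:
  fixes G :: "real^'a^'b"
  shows "norm (G *v x) \<le> real CARD('b) * real CARD('a) * norm G * norm x"
proof -
  have "\<bar>G $ i $ j\<bar> \<le> norm G" for i j
    by (rule order_trans[OF component_le_norm_cart Finite_Cartesian_Product.norm_nth_le])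
  then have "onorm ((*v) G) \<le> real CARD('b) * real CARD('a) * norm G"
    by (rule onorm_le_matrix_component)
  then show ?thesis
    using onorm[OF matrix_vector_mul_bounded_linear[of G], of x] by (meson mult_right_mono norm_ge_zero order_trans)
qed

lemma two_term_square:
  fixes a b c d e :: real
  assumes "a \<le> c * d + b * e" "0 \<le> a"
  shows "a\<^sup>2 \<le> 2 * c\<^sup>2 * d\<^sup>2 + 2 * b\<^sup>2 * e\<^sup>2"
proof -
  have "a\<^sup>2 \<le> (c * d + b * e)\<^sup>2" using assms by (intro power_mono) auto
  also have "\<dots> \<le> 2 * (c * d)\<^sup>2 + 2 * (b * e)\<^sup>2"
    using sum_squares_bound[of "c * d" "b * e"] by (simp add: power2_sum)
  finally show ?thesis by (simp add: power_mult_distrib)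
qed

locale control_system = noise M N w for M :: "'w measure" and N w +
  fixes S :: "('w, 'n::finite, 'm::finite) system" and U :: "nat \<Rightarrow> (real^'m) set"
  assumes U_convex: "\<And>k. k < N \<Longrightarrow> convex (U k)"
    and terminal: "terminal_data S M N w"
    and A: "assumption_A S M N w U"
begin

lemmas A_conj = A[unfolded assumption_A_def]
lemmas A_measurable = A_conj[THEN conjunct1]
lemmas A_drift_0 = A_conj[THEN conjunct2, THEN conjunct1]
lemmas A_diffusion_0 = A_conj[THEN conjunct2, THEN conjunct2, THEN conjunct1]
lemmas A_backward_0 = A_conj[THEN conjunct2, THEN conjunct2, THEN conjunct2, THEN conjunct1]
lemmas A_rest = A_conj[THEN conjunct2, THEN conjunct2, THEN conjunct2, THEN conjunct2]
lemmas A_coef_C1 = A_rest[THEN conjunct1]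
lemmas A_cost_C1 = A_rest[THEN conjunct2, THEN conjunct1]
lemmas A_end_C1 = A_rest[THEN conjunct2, THEN conjunct2, THEN conjunct1]
lemmas A_init_C1 = A_rest[THEN conjunct2, THEN conjunct2, THEN conjunct2]
lemmas A_growth = A_init_C1[THEN conjunct2, THEN conjunct2]

definition gmap :: "(nat \<Rightarrow> 'w \<Rightarrow> real^'m) \<Rightarrow> nat \<Rightarrow> 'n triple \<Rightarrow> 'w \<Rightarrow> 'n triple" where
  "gmap v k \<theta> \<omega> = Gamma_map S k (fst \<theta>) (fst (snd \<theta>)) (snd (snd \<theta>)) (v k \<omega>) \<omega>"

lemma controls_D:
  assumes "v \<in> controls M N w U" "k < N"
  shows "v k \<in> borel_measurable (filt M w k)" "sqint M (v k)" "\<And>\<omega>. \<omega> \<in> space M \<Longrightarrow> v k \<omega> \<in> U k"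
proof -
  have sub: "{..<N} \<subseteq> {..N}" by auto
  show "v k \<in> borel_measurable (filt M w k)" "sqint M (v k)"
    using assms L2F_iff[OF sub, of v] by (auto simp: controls_def)
  show "\<And>\<omega>. \<omega> \<in> space M \<Longrightarrow> v k \<omega> \<in> U k" using assms by (auto simp: controls_def)
qed

lemma coefficients_lipschitz:
  obtains K where "0 \<le> K"
    "\<And>k \<omega> h x y z u x' y' z' u'. k < N \<Longrightarrow> \<omega> \<in> space M \<Longrightarrow>
      h \<in> {drift S k, diffusion S k, backward S (Suc k)} \<Longrightarrow>
      norm (h x y z u \<omega> - h x' y' z' u' \<omega>) \<le> K * norm ((x, y, z, u) - (x', y', z', u'))"
proof -
  obtain K where K: "\<And>k \<omega> h. k < N \<Longrightarrow> \<omega> \<in> space M \<Longrightarrow>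
      h \<in> {drift S k, diffusion S k, backward S (Suc k)} \<Longrightarrow>
      C1 (\<lambda>(x, y, z, u). h x y z u \<omega>) \<and> (\<forall>a. dnorm (\<lambda>(x, y, z, u). h x y z u \<omega>) a \<le> K)"
    using A_coef_C1 by meson
  show thesis
  proof
    show "0 \<le> max K 0" by simp
    fix k \<omega> h x y z u x' y' z' u'
    assume "k < N" "\<omega> \<in> space M" "h \<in> {drift S k, diffusion S k, backward S (Suc k)}"
    from K[OF this] have h: "C1 (\<lambda>(x, y, z, u). h x y z u \<omega>)"
      "\<And>a. dnorm (\<lambda>(x, y, z, u). h x y z u \<omega>) a \<le> max K 0"
      by (auto simp: le_max_iff_disj)
    show "norm (h x y z u \<omega> - h x' y' z' u' \<omega>) \<le> max K 0 * norm ((x, y, z, u) - (x', y', z', u'))"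
      using C1_increment[OF h(1) h(2), of "(x, y, z, u)" "(x', y', z', u')"] by simp
  qed
qed

lemma coefficients_C1:
  assumes "k < N" "\<omega> \<in> space M"
  shows "C1 (\<lambda>(x, y, z, u). drift S k x y z u \<omega>)" "C1 (\<lambda>(x, y, z, u). diffusion S k x y z u \<omega>)"
    "C1 (\<lambda>(x, y, z, u). backward S (Suc k) x y z u \<omega>)" "C1 (\<lambda>(x, y, z, u). run_cost S k x y z u \<omega>)"
  using A_coef_C1 A_cost_C1 assms by blast+

text \<open>Continuity is available for all control values, but adaptedness for values in
  \<open>U k\<close> only, so the parameter ranges over a product with last factor
  \<open>U k\<close>.\<close>

lemma coefficient_measurable:
  fixes h :: "real^'n \<Rightarrow> real^'n \<Rightarrow> real^'n \<Rightarrow> real^'m \<Rightarrow> 'w \<Rightarrow> 'c::metric_space"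
  assumes h: "\<And>x y z u. u \<in> U k \<Longrightarrow> h x y z u \<in> borel_measurable (filt M w k)"
    and cont: "\<And>\<omega>. \<omega> \<in> space M \<Longrightarrow> continuous_on UNIV (\<lambda>(x, y, z, u). h x y z u \<omega>)"
    and a: "x \<in> borel_measurable (filt M w k)" "y \<in> borel_measurable (filt M w k)"
      "z \<in> borel_measurable (filt M w k)" "v \<in> borel_measurable (filt M w k)"
    and v: "\<And>\<omega>. \<omega> \<in> space M \<Longrightarrow> v \<omega> \<in> U k"
  shows "(\<lambda>\<omega>. h (x \<omega>) (y \<omega>) (z \<omega>) (v \<omega>) \<omega>) \<in> borel_measurable (filt M w k)"
proof -
  have "(\<lambda>\<omega>. (\<lambda>(x, y, z, u). h x y z u \<omega>) (x \<omega>, y \<omega>, z \<omega>, v \<omega>)) \<in> borel_measurable (filt M w k)"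
  proof (rule caratheodory_measurable[where S = "UNIV \<times> UNIV \<times> UNIV \<times> U k"])
    show "(\<lambda>\<omega>. (\<lambda>(x, y, z, u). h x y z u \<omega>) q) \<in> borel_measurable (filt M w k)"
      if "q \<in> UNIV \<times> UNIV \<times> UNIV \<times> U k" for q
      using that h by auto
    show "continuous_on (UNIV \<times> UNIV \<times> UNIV \<times> U k) (\<lambda>(x, y, z, u). h x y z u \<omega>)"
      if "\<omega> \<in> space (filt M w k)" for \<omega>
      using cont[of \<omega>] that by (auto intro: continuous_on_subset)
    show "(\<lambda>\<omega>. (x \<omega>, y \<omega>, z \<omega>, v \<omega>)) \<in> borel_measurable (filt M w k)"
      by (intro borel_measurable_Pair a)
  qed (use v in auto)
  then show ?thesis by simp
qed

lemma coefficients_measurable: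
  assumes k: "k < N"
    and a: "x \<in> borel_measurable (filt M w k)" "y \<in> borel_measurable (filt M w k)"
      "z \<in> borel_measurable (filt M w k)" "v \<in> borel_measurable (filt M w k)"
      "\<And>\<omega>. \<omega> \<in> space M \<Longrightarrow> v \<omega> \<in> U k"
  shows "(\<lambda>\<omega>. drift S k (x \<omega>) (y \<omega>) (z \<omega>) (v \<omega>) \<omega>) \<in> borel_measurable (filt M w k)"
    "(\<lambda>\<omega>. diffusion S k (x \<omega>) (y \<omega>) (z \<omega>) (v \<omega>) \<omega>) \<in> borel_measurable (filt M w k)"
    "(\<lambda>\<omega>. backward S (Suc k) (x \<omega>) (y \<omega>) (z \<omega>) (v \<omega>) \<omega>) \<in> borel_measurable (filt M w k)"
    "(\<lambda>\<omega>. run_cost S k (x \<omega>) (y \<omega>) (z \<omega>) (v \<omega>) \<omega>) \<in> borel_measurable (filt M w k)"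
proof -
  have m: "drift S k x y z u \<in> borel_measurable (filt M w k)" "diffusion S k x y z u \<in> borel_measurable (filt M w k)"
    "backward S (Suc k) x y z u \<in> borel_measurable (filt M w k)" "run_cost S k x y z u \<in> borel_measurable (filt M w k)"
    if "u \<in> U k" for x y z u
    using A_measurable k that by blast+
  note c = C1_continuous[OF coefficients_C1(1)[OF k]] C1_continuous[OF coefficients_C1(2)[OF k]]
    C1_continuous[OF coefficients_C1(3)[OF k]] C1_continuous[OF coefficients_C1(4)[OF k]]
  show "(\<lambda>\<omega>. drift S k (x \<omega>) (y \<omega>) (z \<omega>) (v \<omega>) \<omega>) \<in> borel_measurable (filt M w k)"
    by (rule coefficient_measurable[OF m(1) c(1) a])
  show "(\<lambda>\<omega>. diffusion S k (x \<omega>) (y \<omega>) (z \<omega>) (v \<omega>) \<omega>) \<in> borel_measurable (filt M w k)"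
    by (rule coefficient_measurable[OF m(2) c(2) a])
  show "(\<lambda>\<omega>. backward S (Suc k) (x \<omega>) (y \<omega>) (z \<omega>) (v \<omega>) \<omega>) \<in> borel_measurable (filt M w k)"
    by (rule coefficient_measurable[OF m(3) c(3) a])
  show "(\<lambda>\<omega>. run_cost S k (x \<omega>) (y \<omega>) (z \<omega>) (v \<omega>) \<omega>) \<in> borel_measurable (filt M w k)"
    by (rule coefficient_measurable[OF m(4) c(4) a])
qed

lemma end_C1:
  assumes "\<omega> \<in> space M"
  shows "C1 (end_map S \<omega>)" "C1 (end_cost S \<omega>)"
  using A_end_C1 assms by blast+

lemma init_C1: "C1 (init_map S)" "C1 (init_cost S)"
  using A_init_C1[THEN conjunct1] A_init_C1[THEN conjunct2, THEN conjunct1] by auto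

lemma end_measurable:
  assumes "x \<in> borel_measurable (filt M w N)"
  shows "(\<lambda>\<omega>. end_map S \<omega> (x \<omega>)) \<in> borel_measurable (filt M w N)"
    "(\<lambda>\<omega>. end_cost S \<omega> (x \<omega>)) \<in> borel_measurable (filt M w N)"
proof -
  show "(\<lambda>\<omega>. end_map S \<omega> (x \<omega>)) \<in> borel_measurable (filt M w N)"
    using terminal assms C1_continuous[OF end_C1(1)]
    by (rule_tac caratheodory_measurable[where S = UNIV and g = "end_map S"]) (simp_all add: terminal_data_def)
  show "(\<lambda>\<omega>. end_cost S \<omega> (x \<omega>)) \<in> borel_measurable (filt M w N)"
    using terminal assms C1_continuous[OF end_C1(2)]
    by (rule_tac caratheodory_measurable[where S = UNIV and g = "end_cost S"]) (simp_all add: terminal_data_def)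
qed

lemma gmap_measurable:
  assumes v: "v \<in> controls M N w U" and k: "k < N" and \<theta>: "\<theta> \<in> borel_measurable (filt M w k)"
  shows "(\<lambda>\<omega>. gmap v k (\<theta> \<omega>) \<omega>) \<in> borel_measurable (filt M w k)"
proof -
  have \<theta>': "(\<lambda>\<omega>. fst (\<theta> \<omega>)) \<in> borel_measurable (filt M w k)" "(\<lambda>\<omega>. fst (snd (\<theta> \<omega>))) \<in> borel_measurable (filt M w k)"
    "(\<lambda>\<omega>. snd (snd (\<theta> \<omega>))) \<in> borel_measurable (filt M w k)"
    by (auto intro!: borel_measurable_continuous_on[where f=fst and g=\<theta>]
        borel_measurable_continuous_on[where f="\<lambda>q. fst (snd q)" and g=\<theta>]
        borel_measurable_continuous_on[where f="\<lambda>q. snd (snd q)" and g=\<theta>] continuous_intros \<theta>)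
  show ?thesis
    unfolding gmap_def Gamma_map_def
    by (intro borel_measurable_Pair coefficients_measurable k \<theta>' controls_D[OF v k])
qed

lemma gmap_lipschitz:
  obtains K where "0 \<le> K"
    "\<And>k \<omega> x y z u x' y' z' u'. k < N \<Longrightarrow> \<omega> \<in> space M \<Longrightarrow>
      norm (Gamma_map S k x y z u \<omega> - Gamma_map S k x' y' z' u' \<omega>) \<le> K * norm ((x, y, z, u) - (x', y', z', u'))"
proof -
  obtain K where K: "0 \<le> K"
    "\<And>k \<omega> h x y z u x' y' z' u'. k < N \<Longrightarrow> \<omega> \<in> space M \<Longrightarrow>
      h \<in> {drift S k, diffusion S k, backward S (Suc k)} \<Longrightarrow>
      norm (h x y z u \<omega> - h x' y' z' u' \<omega>) \<le> K * norm ((x, y, z, u) - (x', y', z', u'))"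
    by (rule coefficients_lipschitz) blast
  show thesis
  proof
    show "0 \<le> 3 * K" using K by simp
    fix k \<omega> x y z u x' y' z' u' assume k: "k < N" "\<omega> \<in> space M"
    have p3: "norm (a, b, c) \<le> norm a + norm b + norm c" for a b c :: "real^'n"
      using norm_Pair_le[of a "(b, c)"] norm_Pair_le[of b c] by simp
    have "norm (Gamma_map S k x y z u \<omega> - Gamma_map S k x' y' z' u' \<omega>)
        \<le> norm (backward S (Suc k) x y z u \<omega> - backward S (Suc k) x' y' z' u' \<omega>)
          + norm (drift S k x y z u \<omega> - drift S k x' y' z' u' \<omega>)
          + norm (diffusion S k x y z u \<omega> - diffusion S k x' y' z' u' \<omega>)"
      unfolding Gamma_map_def diff_Pair by (rule p3)
    also have "\<dots> \<le> 3 * K * norm ((x, y, z, u) - (x', y', z', u'))"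
      using K(2)[OF k, of "backward S (Suc k)" x y z u x' y' z' u'] K(2)[OF k, of "drift S k" x y z u x' y' z' u']
        K(2)[OF k, of "diffusion S k" x y z u x' y' z' u'] by simp
    finally show "norm (Gamma_map S k x y z u \<omega> - Gamma_map S k x' y' z' u' \<omega>)
        \<le> 3 * K * norm ((x, y, z, u) - (x', y', z', u'))" .
  qed
qed

text \<open>Square integrability is assumed for the control value 0, which need not belong to
  \<open>U k\<close>. The Lipschitz bound in the control, valid for all values, transfers it to
  \<open>v\<close> at the cost of the square of \<open>v k\<close>.\<close>

lemma gmap_0:
  assumes v: "v \<in> controls M N w U" and k: "k < N"
  shows "sqint M (gmap v k 0)"
proof -
  obtain K where K: "0 \<le> K"
    "\<And>k \<omega> x y z u x' y' z' u'. k < N \<Longrightarrow> \<omega> \<in> space M \<Longrightarrow>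
      norm (Gamma_map S k x y z u \<omega> - Gamma_map S k x' y' z' u' \<omega>) \<le> K * norm ((x, y, z, u) - (x', y', z', u'))"
    by (rule gmap_lipschitz) blast
  have sub: "{..<N} \<subseteq> {..N}" by auto
  have "sqint M (drift S k 0 0 0 0)" "sqint M (diffusion S k 0 0 0 0)" "sqint M (backward S (Suc k) 0 0 0 0)"
    using A_drift_0 A_diffusion_0 A_backward_0 k unfolding L2F_iff[OF sub] by blast+
  then have s0: "sqint M (Gamma_map S k 0 0 0 0)"
    unfolding Gamma_map_def[abs_def] by (intro sqint_Pair(1))
  note su = controls_D(2)[OF v k]
  have "integrable M (\<lambda>\<omega>. 2 * (norm (Gamma_map S k 0 0 0 0 \<omega>))\<^sup>2 + 2 * (K\<^sup>2 * (norm (v k \<omega>))\<^sup>2))"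
    using sqintD(2)[OF s0] sqintD(2)[OF su] by simp
  then show ?thesis
  proof (rule sqint_bound(1))
    have "(\<lambda>\<omega>. gmap v k 0 \<omega>) \<in> borel_measurable (filt M w k)"
      by (rule gmap_measurable[OF v k]) simp
    then show "gmap v k 0 \<in> borel_measurable M" using filt_measurable_imp[of k] k by simp
    show "AE \<omega> in M. (norm (gmap v k 0 \<omega>))\<^sup>2
        \<le> 2 * (norm (Gamma_map S k 0 0 0 0 \<omega>))\<^sup>2 + 2 * (K\<^sup>2 * (norm (v k \<omega>))\<^sup>2)"
    proof (rule AE_I2)
      fix \<omega> assume "\<omega> \<in> space M"
      from K(2)[OF k this, of 0 0 0 "v k \<omega>" 0 0 0 0]
      have "norm (gmap v k 0 \<omega> - Gamma_map S k 0 0 0 0 \<omega>) \<le> K * norm (v k \<omega>)"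
        by (simp add: gmap_def norm_Pair)
      then have "(norm (gmap v k 0 \<omega> - Gamma_map S k 0 0 0 0 \<omega>))\<^sup>2 \<le> K\<^sup>2 * (norm (v k \<omega>))\<^sup>2"
        unfolding power_mult_distrib[symmetric] by (intro power_mono) auto
      then show "(norm (gmap v k 0 \<omega>))\<^sup>2
          \<le> 2 * (norm (Gamma_map S k 0 0 0 0 \<omega>))\<^sup>2 + 2 * (K\<^sup>2 * (norm (v k \<omega>))\<^sup>2)"
        using norm_add_sq_le[of "Gamma_map S k 0 0 0 0 \<omega>" "gmap v k 0 \<omega> - Gamma_map S k 0 0 0 0 \<omega>"] by simp
    qed
  qed
qed

text \<open>
  The coefficients of the monotone system: \<open>\<kappa>\<close> encodes the alternative in (B)(iii), and squaring
  the bounds in (B)(ii) and inserting (B)(iii) turns the matrices into the monotonicity defect.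
\<close>

lemma fbs_instance:
  assumes B: "assumption_B S M N w U \<mu> \<nu> M0 G A' B' C'"
    and lip_end: "\<nu> = 0 \<longrightarrow> lipschitz_end_map S M"
  obtains \<kappa> L where
    "\<And>v. v \<in> controls M N w U \<Longrightarrow> fbs M N w (gmap v) (end_map S) \<kappa> L"
    "\<And>v. v \<in> controls M N w U \<Longrightarrow> fbs.compatible_init M N (gmap v) (end_map S) \<kappa> L (init_map S)"
proof -
  obtain K where K: "0 \<le> K"
    and Kg: "\<And>k \<omega> x y z u x' y' z' u'. k < N \<Longrightarrow> \<omega> \<in> space M \<Longrightarrow>
      norm (Gamma_map S k x y z u \<omega> - Gamma_map S k x' y' z' u' \<omega>) \<le> K * norm ((x, y, z, u) - (x', y', z', u'))"
    by (rule gmap_lipschitz) blast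
  have mn: "\<mu> > 0 \<and> \<nu> = 0 \<or> \<mu> = 0 \<and> \<nu> > 0" using B by (simp add: assumption_B_def)
  \<comment> \<open>Two sources for the Lipschitz constant of the terminal map: the separate
    hypothesis for \<open>\<nu> = 0\<close>, the bound by the essentially bounded matrix
    \<open>G\<close> otherwise.\<close>
  obtain K\<Phi> where K\<Phi>: "0 \<le> K\<Phi>"
    "AE \<omega> in M. \<forall>x x'. norm (end_map S \<omega> x - end_map S \<omega> x') \<le> K\<Phi> * norm (x - x')"
  proof (cases "\<nu> = 0")
    case True
    then obtain L where L: "AE \<omega> in M. \<forall>x x'. norm (end_map S \<omega> x - end_map S \<omega> x') \<le> L * norm (x - x')"
      using lip_end by (auto simp: lipschitz_end_map_def)
    show thesis
    proof (rule that[of "max L 0"])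
      show "AE \<omega> in M. \<forall>x x'. norm (end_map S \<omega> x - end_map S \<omega> x') \<le> max L 0 * norm (x - x')"
        using L by eventually_elim (meson max.cobounded1 mult_right_mono norm_ge_zero order_trans)
    qed simp
  next
    case False
    then have \<nu>: "\<nu> > 0" using mn by auto
    then have 1: "AE \<omega> in M. \<forall>x x'. norm (end_map S \<omega> x - end_map S \<omega> x') \<le> 1 / \<nu> * norm (G \<omega> *v (x - x'))"
      using B by (simp add: assumption_B_def)
    obtain KG where 2: "AE \<omega> in M. norm (G \<omega>) \<le> KG" using B by (auto simp: assumption_B_def)
    define c where "c = real CARD('a) * real CARD('n) * max KG 0"
    have c: "0 \<le> c" by (simp add: c_def)
    show thesis
    proof (rule that[of "1 / \<nu> * c"])
      show "0 \<le> 1 / \<nu> * c" using \<nu> c by simp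
      show "AE \<omega> in M. \<forall>x x'. norm (end_map S \<omega> x - end_map S \<omega> x') \<le> 1 / \<nu> * c * norm (x - x')"
        using 1 2
      proof eventually_elim
        case (elim \<omega>)
        show ?case
        proof (intro allI)
          fix x x'
          have "norm (G \<omega> *v (x - x')) \<le> real CARD('a) * real CARD('n) * norm (G \<omega>) * norm (x - x')"
            by (rule norm_matrix_vector_le)
          also have "\<dots> \<le> c * norm (x - x')"
            unfolding c_def using elim(2) by (intro mult_right_mono mult_left_mono) auto
          finally have "1 / \<nu> * norm (G \<omega> *v (x - x')) \<le> 1 / \<nu> * (c * norm (x - x'))"
            using \<nu> by (intro mult_left_mono) auto
          then show "norm (end_map S \<omega> x - end_map S \<omega> x') \<le> 1 / \<nu> * c * norm (x - x')"
            using elim(1)[rule_format, of x x'] by simp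
        qed
      qed
    qed
  qed
  \<comment> \<open>The sign is fixed once for the whole system, since the two alternatives are
    global; afterwards both read as the same inequality.\<close>
  define \<kappa> :: real where "\<kappa> = (if monotone_1 S M N U \<mu> \<nu> M0 G A' B' C' then 1 else -1)"
  have \<kappa>: "\<bar>\<kappa>\<bar> = 1" by (simp add: \<kappa>_def)
  have mono: "monotone_1 S M N U \<mu> \<nu> M0 G A' B' C' \<or> monotone_2 S M N U \<mu> \<nu> M0 G A' B' C'"
    using B by (simp add: assumption_B_def)
  have mono_init: "\<kappa> * ((init_map S y - init_map S y') \<bullet> (y - y')) \<le> - \<mu> * (norm (M0 *v (y - y')))\<^sup>2" for y y'
    using mono by (auto simp: \<kappa>_def monotone_1_def monotone_2_def)
  have mono_end: "AE \<omega> in M. \<forall>x x'. \<kappa> * ((end_map S \<omega> x - end_map S \<omega> x') \<bullet> (x - x')) \<ge> \<nu> * (norm (G \<omega> *v (x - x')))\<^sup>2"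
  proof (cases "monotone_1 S M N U \<mu> \<nu> M0 G A' B' C'")
    case True
    then show ?thesis by (auto simp: \<kappa>_def monotone_1_def)
  next
    case False
    then have "AE \<omega> in M. \<forall>x x'. (end_map S \<omega> x - end_map S \<omega> x') \<bullet> (x - x') \<le> - \<nu> * (norm (G \<omega> *v (x - x')))\<^sup>2"
      using mono by (auto simp: monotone_2_def)
    then show ?thesis
    proof eventually_elim
      case (elim \<omega>)
      show ?case
      proof (intro allI)
        fix x x'
        show "\<kappa> * ((end_map S \<omega> x - end_map S \<omega> x') \<bullet> (x - x')) \<ge> \<nu> * (norm (G \<omega> *v (x - x')))\<^sup>2"
          using elim[rule_format, of x x'] False by (simp add: \<kappa>_def)
      qed
    qed
  qed
  have mono_g: "AE \<omega> in M. \<forall>u\<in>U k. \<forall>x x' y y' z z'.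
      \<kappa> * ((Gamma_map S k x y z u \<omega> - Gamma_map S k x' y' z' u \<omega>) \<bullet> (x - x', y - y', z - z'))
        \<le> - \<nu> * (norm (A' k \<omega> *v (x - x')))\<^sup>2 - \<mu> * (norm (B' k \<omega> *v (y - y') + C' k \<omega> *v (z - z')))\<^sup>2"
    if k: "k < N" for k
  proof (cases "monotone_1 S M N U \<mu> \<nu> M0 G A' B' C'")
    case True
    then show ?thesis using k by (auto simp: \<kappa>_def monotone_1_def)
  next
    case False
    then have "AE \<omega> in M. \<forall>u\<in>U k. \<forall>x x' y y' z z'.
      (Gamma_map S k x y z u \<omega> - Gamma_map S k x' y' z' u \<omega>) \<bullet> (x - x', y - y', z - z')
        \<ge> \<nu> * (norm (A' k \<omega> *v (x - x')))\<^sup>2 + \<mu> * (norm (B' k \<omega> *v (y - y') + C' k \<omega> *v (z - z')))\<^sup>2"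
      using mono k by (auto simp: monotone_2_def)
    then show ?thesis
    proof eventually_elim
      case (elim \<omega>)
      show ?case
      proof (intro ballI allI)
        fix u x x' y y' z z' assume "u \<in> U k"
        from elim[rule_format, OF this, of x x' y y' z z']
        show "\<kappa> * ((Gamma_map S k x y z u \<omega> - Gamma_map S k x' y' z' u \<omega>) \<bullet> (x - x', y - y', z - z'))
          \<le> - \<nu> * (norm (A' k \<omega> *v (x - x')))\<^sup>2 - \<mu> * (norm (B' k \<omega> *v (y - y') + C' k \<omega> *v (z - z')))\<^sup>2"
          using False by (simp add: \<kappa>_def)
      qed
    qed
  qed
  \<comment> \<open>The cubes arise as follows: a bound \<open>2 / \<mu> * \<beta>\<close> for drift
    and diffusion together squares to \<open>8 / \<mu>\<^sup>2 * \<beta>\<^sup>2\<close> after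
    splitting, and \<open>\<mu> * \<beta>\<^sup>2\<close> is at most the defect. The summand of the
    vanishing parameter is 0, because division by 0 gives 0.\<close>
  define L where "L = 1 + 2 * K\<^sup>2 + K\<Phi>\<^sup>2 + 8 / \<mu> ^ 3 + 8 / \<nu> ^ 3"
  have \<mu>0: "0 \<le> \<mu>" "0 \<le> \<nu>" using mn by auto
  have "0 \<le> 8 / \<mu> ^ 3" "0 \<le> 8 / \<nu> ^ 3" using \<mu>0 by simp_all
  then have L: "1 \<le> L" "2 * K\<^sup>2 \<le> L" "K\<Phi>\<^sup>2 \<le> L" "8 / \<mu> ^ 3 \<le> L" "8 / \<nu> ^ 3 \<le> L"
    unfolding L_def using zero_le_power2[of K] zero_le_power2[of K\<Phi>] by linarith+
  have sc: "b * s \<le> L * r" if "c * s \<le> r" "b = d * c" "d \<le> L" "0 \<le> d" "0 \<le> r" for b s r c d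
  proof -
    have "b * s = d * (c * s)" by (simp add: that(2))
    also have "\<dots> \<le> d * r" by (intro mult_left_mono that)
    also have "\<dots> \<le> L * r" by (intro mult_right_mono that)
    finally show ?thesis .
  qed
  have cube: "2 * (2 / t)\<^sup>2 = 8 / t ^ 3 * t" "2 * (1 / t)\<^sup>2 = 2 / t ^ 3 * t" "0 \<le> 8 / t ^ 3" "0 \<le> 2 / t ^ 3"
    if "0 < t" for t :: real
    using that by (simp_all add: power2_eq_square power3_eq_cube)
  \<comment> \<open>The matrix bounds change either \<open>x\<close> alone or \<open>(y, z)\<close>
    alone, so an increment is made in two moves. The move that the coercive bound does not cover is
    estimated by the Lipschitz constant \<open>K\<close>.\<close>
  have split: "Gamma_map S k x y z u \<omega> - Gamma_map S k x' y' z' u \<omega>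
      = (Gamma_map S k x y z u \<omega> - Gamma_map S k x' y z u \<omega>) + (Gamma_map S k x' y z u \<omega> - Gamma_map S k x' y' z' u \<omega>)"
    for k x y z u \<omega> x' y' z' by simp
  have D0: "AE \<omega> in M. \<forall>u\<in>U k. \<forall>x x' y y' z z'.
      \<kappa> * ((Gamma_map S k x y z u \<omega> - Gamma_map S k x' y' z' u \<omega>) \<bullet> (x - x', y - y', z - z')) \<le> 0"
    if "k < N" for k
    using mono_g[OF that]
  proof eventually_elim
    case (elim \<omega>)
    show ?case
    proof (intro ballI allI)
      fix u x x' y y' z z' assume "u \<in> U k"
      moreover have "0 \<le> \<nu> * (norm (A' k \<omega> *v (x - x')))\<^sup>2" "0 \<le> \<mu> * (norm (B' k \<omega> *v (y - y') + C' k \<omega> *v (z - z')))\<^sup>2"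
        using \<mu>0 by auto
      ultimately show "\<kappa> * ((Gamma_map S k x y z u \<omega> - Gamma_map S k x' y' z' u \<omega>) \<bullet> (x - x', y - y', z - z')) \<le> 0"
        using elim[rule_format, of u x y z x' y' z'] by linarith
    qed
  qed
  have fwd: "fwd_coercive M N (gmap v) \<kappa> L" if \<mu>: "\<mu> > 0" and v: "v \<in> controls M N w U" for v
    unfolding fwd_coercive_def
  proof (intro allI impI)
    fix k assume k: "k < N"
    have "AE \<omega> in M. \<forall>u\<in>U k. \<forall>x y y' z z'. \<forall>h\<in>{drift S k, diffusion S k}.
          norm (h x y z u \<omega> - h x y' z' u \<omega>) \<le> 1 / \<mu> * norm (B' k \<omega> *v (y - y') + C' k \<omega> *v (z - z'))"
      using B \<mu> k by (simp add: assumption_B_def)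
    with mono_g[OF k] D0[OF k] AE_space
    show "AE \<omega> in M. \<forall>\<theta> \<theta>'. (norm (snd (gmap v k \<theta> \<omega> - gmap v k \<theta>' \<omega>)))\<^sup>2
       \<le> L * ((norm (fst (\<theta> - \<theta>')))\<^sup>2 - \<kappa> * ((gmap v k \<theta> \<omega> - gmap v k \<theta>' \<omega>) \<bullet> (\<theta> - \<theta>')))"
    proof eventually_elim
      case (elim \<omega>)
      have u: "v k \<omega> \<in> U k" using controls_D(3)[OF v k elim(3)] .
      show ?case
      proof (intro allI)
        fix \<theta> \<theta>' :: "'n triple"
        obtain x y z x' y' z' where \<theta>: "\<theta> = (x, y, z)" "\<theta>' = (x', y', z')" by (cases \<theta>, cases \<theta>') auto
        let ?u = "v k \<omega>"
        define \<beta> where "\<beta> = norm (B' k \<omega> *v (y - y') + C' k \<omega> *v (z - z'))"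
        define d where "d = - (\<kappa> * ((Gamma_map S k x y z ?u \<omega> - Gamma_map S k x' y' z' ?u \<omega>) \<bullet> (x - x', y - y', z - z')))"
        have d: "\<mu> * \<beta>\<^sup>2 \<le> d" "0 \<le> d"
        proof -
          have "0 \<le> \<nu> * (norm (A' k \<omega> *v (x - x')))\<^sup>2" using \<mu>0 by simp
          then show "\<mu> * \<beta>\<^sup>2 \<le> d"
            using elim(1)[rule_format, OF u, of x y z x' y' z'] unfolding d_def \<beta>_def by linarith
          show "0 \<le> d" using elim(2)[rule_format, OF u, of x y z x' y' z'] unfolding d_def by linarith
        qed
        have 1: "norm (snd (Gamma_map S k x y z ?u \<omega> - Gamma_map S k x' y z ?u \<omega>)) \<le> K * norm (x - x')"
          by (rule order_trans[OF norm_fst_snd_le(2) order_trans[OF Kg[OF k elim(3)]]]) (simp add: norm_Pair)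
        have "norm (drift S k x' y z ?u \<omega> - drift S k x' y' z' ?u \<omega>) \<le> 1 / \<mu> * \<beta>"
          "norm (diffusion S k x' y z ?u \<omega> - diffusion S k x' y' z' ?u \<omega>) \<le> 1 / \<mu> * \<beta>"
          using elim(4) u unfolding \<beta>_def by blast+
        then have 2: "norm (snd (Gamma_map S k x' y z ?u \<omega> - Gamma_map S k x' y' z' ?u \<omega>)) \<le> 2 / \<mu> * \<beta>"
          unfolding Gamma_map_def diff_Pair snd_conv
          by (intro order_trans[OF norm_Pair_le]) linarith
        have "norm (snd (Gamma_map S k x y z ?u \<omega> - Gamma_map S k x' y' z' ?u \<omega>)) \<le> K * norm (x - x') + 2 / \<mu> * \<beta>"
          unfolding split[of k x y z ?u \<omega> x' y' z'] snd_add by (rule order_trans[OF norm_triangle_ineq add_mono[OF 1 2]])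
        from two_term_square[OF this]
        have "(norm (snd (Gamma_map S k x y z ?u \<omega> - Gamma_map S k x' y' z' ?u \<omega>)))\<^sup>2
            \<le> 2 * K\<^sup>2 * (norm (x - x'))\<^sup>2 + 2 * (2 / \<mu>)\<^sup>2 * \<beta>\<^sup>2" by simp
        also have "\<dots> \<le> L * (norm (x - x'))\<^sup>2 + L * d"
        proof (rule add_mono)
          show "2 * K\<^sup>2 * (norm (x - x'))\<^sup>2 \<le> L * (norm (x - x'))\<^sup>2" using L by (intro mult_right_mono) auto
          show "2 * (2 / \<mu>)\<^sup>2 * \<beta>\<^sup>2 \<le> L * d"
            by (rule sc[OF d(1) cube(1)[OF \<mu>] L(4) cube(3)[OF \<mu>] d(2)])
        qed
        finally show "(norm (snd (gmap v k \<theta> \<omega> - gmap v k \<theta>' \<omega>)))\<^sup>2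
           \<le> L * ((norm (fst (\<theta> - \<theta>')))\<^sup>2 - \<kappa> * ((gmap v k \<theta> \<omega> - gmap v k \<theta>' \<omega>) \<bullet> (\<theta> - \<theta>')))"
          by (simp add: \<theta> gmap_def d_def algebra_simps)
      qed
    qed
  qed
  have bwd: "bwd_coercive M N (gmap v) (end_map S) \<kappa> L" if \<nu>: "\<nu> > 0" and v: "v \<in> controls M N w U" for v
    unfolding bwd_coercive_def
  proof (intro conjI allI impI)
    fix k assume k: "k < N"
    have "AE \<omega> in M. \<forall>u\<in>U k. \<forall>x x' y z.
          norm (backward S (Suc k) x y z u \<omega> - backward S (Suc k) x' y z u \<omega>) \<le> 1 / \<nu> * norm (A' k \<omega> *v (x - x'))"
      using B \<nu> k by (simp add: assumption_B_def)
    with mono_g[OF k] D0[OF k] AE_space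
    show "AE \<omega> in M. \<forall>\<theta> \<theta>'. (norm (fst (gmap v k \<theta> \<omega> - gmap v k \<theta>' \<omega>)))\<^sup>2
       \<le> L * ((norm (snd (\<theta> - \<theta>')))\<^sup>2 - \<kappa> * ((gmap v k \<theta> \<omega> - gmap v k \<theta>' \<omega>) \<bullet> (\<theta> - \<theta>')))"
    proof eventually_elim
      case (elim \<omega>)
      have u: "v k \<omega> \<in> U k" using controls_D(3)[OF v k elim(3)] .
      show ?case
      proof (intro allI)
        fix \<theta> \<theta>' :: "'n triple"
        obtain x y z x' y' z' where \<theta>: "\<theta> = (x, y, z)" "\<theta>' = (x', y', z')" by (cases \<theta>, cases \<theta>') auto
        let ?u = "v k \<omega>"
        define \<beta> where "\<beta> = norm (A' k \<omega> *v (x - x'))"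
        define d where "d = - (\<kappa> * ((Gamma_map S k x y z ?u \<omega> - Gamma_map S k x' y' z' ?u \<omega>) \<bullet> (x - x', y - y', z - z')))"
        have d: "\<nu> * \<beta>\<^sup>2 \<le> d" "0 \<le> d"
        proof -
          have "0 \<le> \<mu> * (norm (B' k \<omega> *v (y - y') + C' k \<omega> *v (z - z')))\<^sup>2" using \<mu>0 by simp
          then show "\<nu> * \<beta>\<^sup>2 \<le> d"
            using elim(1)[rule_format, OF u, of x y z x' y' z'] unfolding d_def \<beta>_def by linarith
          show "0 \<le> d" using elim(2)[rule_format, OF u, of x y z x' y' z'] unfolding d_def by linarith
        qed
        have 1: "norm (fst (Gamma_map S k x' y z ?u \<omega> - Gamma_map S k x' y' z' ?u \<omega>)) \<le> K * norm (y - y', z - z')"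
          by (rule order_trans[OF norm_fst_snd_le(1) order_trans[OF Kg[OF k elim(3)]]]) (simp add: norm_Pair)
        have 2: "norm (fst (Gamma_map S k x y z ?u \<omega> - Gamma_map S k x' y z ?u \<omega>)) \<le> 1 / \<nu> * \<beta>"
          using elim(4) u unfolding \<beta>_def Gamma_map_def diff_Pair fst_conv by blast
        have "norm (fst (Gamma_map S k x y z ?u \<omega> - Gamma_map S k x' y' z' ?u \<omega>))
            \<le> K * norm (y - y', z - z') + 1 / \<nu> * \<beta>"
          unfolding split[of k x y z ?u \<omega> x' y' z'] fst_add
          by (rule order_trans[OF norm_triangle_ineq]) (use 1 2 in linarith)
        from two_term_square[OF this]
        have "(norm (fst (Gamma_map S k x y z ?u \<omega> - Gamma_map S k x' y' z' ?u \<omega>)))\<^sup>2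
            \<le> 2 * K\<^sup>2 * (norm (y - y', z - z'))\<^sup>2 + 2 * (1 / \<nu>)\<^sup>2 * \<beta>\<^sup>2" by simp
        also have "\<dots> \<le> L * (norm (y - y', z - z'))\<^sup>2 + L * d"
        proof (rule add_mono)
          show "2 * K\<^sup>2 * (norm (y - y', z - z'))\<^sup>2 \<le> L * (norm (y - y', z - z'))\<^sup>2" using L by (intro mult_right_mono) auto
          have "2 / \<nu> ^ 3 \<le> 8 / \<nu> ^ 3" using \<nu> by (intro divide_right_mono) auto
          then have "2 / \<nu> ^ 3 \<le> L" using L(5) by linarith
          then show "2 * (1 / \<nu>)\<^sup>2 * \<beta>\<^sup>2 \<le> L * d"
            by (rule sc[OF d(1) cube(2)[OF \<nu>] _ cube(4)[OF \<nu>] d(2)])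
        qed
        finally show "(norm (fst (gmap v k \<theta> \<omega> - gmap v k \<theta>' \<omega>)))\<^sup>2
           \<le> L * ((norm (snd (\<theta> - \<theta>')))\<^sup>2 - \<kappa> * ((gmap v k \<theta> \<omega> - gmap v k \<theta>' \<omega>) \<bullet> (\<theta> - \<theta>')))"
          by (simp add: \<theta> gmap_def d_def algebra_simps)
      qed
    qed
  next
    have "AE \<omega> in M. \<forall>x x'. norm (end_map S \<omega> x - end_map S \<omega> x') \<le> 1 / \<nu> * norm (G \<omega> *v (x - x'))"
      using B \<nu> by (simp add: assumption_B_def)
    with mono_end
    show "AE \<omega> in M. \<forall>x x'. (norm (end_map S \<omega> x - end_map S \<omega> x'))\<^sup>2
        \<le> L * (\<kappa> * ((end_map S \<omega> x - end_map S \<omega> x') \<bullet> (x - x')))"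
    proof eventually_elim
      case (elim \<omega>)
      show ?case
      proof (intro allI)
        fix x x'
        let ?d = "\<kappa> * ((end_map S \<omega> x - end_map S \<omega> x') \<bullet> (x - x'))" and ?\<beta> = "norm (G \<omega> *v (x - x'))"
        have d: "\<nu> * ?\<beta>\<^sup>2 \<le> ?d" using elim(1) by blast
        moreover have "0 \<le> \<nu> * ?\<beta>\<^sup>2" using \<nu> by simp
        ultimately have d0: "0 \<le> ?d" by linarith
        have "2 / \<nu> ^ 3 \<le> 8 / \<nu> ^ 3" using \<nu> by (intro divide_right_mono) auto
        then have c: "2 / \<nu> ^ 3 \<le> L" using L(5) by linarith
        have "norm (end_map S \<omega> x - end_map S \<omega> x') \<le> 0 * 0 + 1 / \<nu> * ?\<beta>" using elim(2) by simp
        from two_term_square[OF this]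
        have "(norm (end_map S \<omega> x - end_map S \<omega> x'))\<^sup>2 \<le> 2 * (1 / \<nu>)\<^sup>2 * ?\<beta>\<^sup>2" by simp
        also have "\<dots> \<le> L * ?d"
          by (rule sc[OF d cube(2)[OF \<nu>] c cube(4)[OF \<nu>] d0])
        finally show "(norm (end_map S \<omega> x - end_map S \<omega> x'))\<^sup>2 \<le> L * ?d" .
      qed
    qed
  qed
  have fbs: "fbs M N w (gmap v) (end_map S) \<kappa> L" if v: "v \<in> controls M N w U" for v
  proof unfold_locales
    show "1 \<le> L" "\<bar>\<kappa>\<bar> = 1" by (rule L \<kappa>)+
    show "(\<lambda>\<omega>. gmap v k (\<theta> \<omega>) \<omega>) \<in> borel_measurable (filt M w k)"
      if "k < N" "\<theta> \<in> borel_measurable (filt M w k)" for k \<theta>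
      by (rule gmap_measurable[OF v that])
    show "(\<lambda>\<omega>. end_map S \<omega> (x \<omega>)) \<in> borel_measurable (filt M w N)"
      if "x \<in> borel_measurable (filt M w N)" for x
      by (rule end_measurable(1)[OF that])
    show "sqint M (gmap v k 0)" if "k < N" for k by (rule gmap_0[OF v that])
    have sub: "(\<lambda>\<omega>. end_map S \<omega> 0) \<in> borel_measurable (filt M w N)" "integrable M (\<lambda>\<omega>. (norm (end_map S \<omega> 0))\<^sup>2)"
      using terminal by (auto simp: terminal_data_def)
    then show "sqint M (\<lambda>\<omega>. end_map S \<omega> 0)"
      using filt_measurable_imp[of N] by (simp add: sqint_def)
    show "AE \<omega> in M. \<forall>\<theta> \<theta>'. (norm (gmap v k \<theta> \<omega> - gmap v k \<theta>' \<omega>))\<^sup>2 \<le> L * (norm (\<theta> - \<theta>'))\<^sup>2" if k: "k < N" for k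
    proof (intro AE_I2 allI)
      fix \<omega> and \<theta> \<theta>' :: "'n triple" assume \<omega>: "\<omega> \<in> space M"
      obtain x y z x' y' z' where \<theta>: "\<theta> = (x, y, z)" "\<theta>' = (x', y', z')" by (cases \<theta>, cases \<theta>') auto
      have "norm (gmap v k \<theta> \<omega> - gmap v k \<theta>' \<omega>) \<le> K * norm (\<theta> - \<theta>')"
        using Kg[OF k \<omega>, of x y z "v k \<omega>" x' y' z' "v k \<omega>"] by (simp add: \<theta> gmap_def norm_Pair)
      then have "(norm (gmap v k \<theta> \<omega> - gmap v k \<theta>' \<omega>))\<^sup>2 \<le> (K * norm (\<theta> - \<theta>'))\<^sup>2" by (intro power_mono) auto
      also have "\<dots> = K\<^sup>2 * (norm (\<theta> - \<theta>'))\<^sup>2" by (simp add: power_mult_distrib)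
      also have "\<dots> \<le> L * (norm (\<theta> - \<theta>'))\<^sup>2"
        using L(2) zero_le_power2[of K] by (intro mult_right_mono) (linarith, simp)
      finally show "(norm (gmap v k \<theta> \<omega> - gmap v k \<theta>' \<omega>))\<^sup>2 \<le> L * (norm (\<theta> - \<theta>'))\<^sup>2" .
    qed
    show "AE \<omega> in M. \<forall>x x'. (norm (end_map S \<omega> x - end_map S \<omega> x'))\<^sup>2 \<le> L * (norm (x - x'))\<^sup>2"
      using K\<Phi>(2)
    proof eventually_elim
      case (elim \<omega>)
      show ?case
      proof (intro allI)
        fix x x'
        have "(norm (end_map S \<omega> x - end_map S \<omega> x'))\<^sup>2 \<le> (K\<Phi> * norm (x - x'))\<^sup>2"
          using elim by (intro power_mono) auto
        also have "\<dots> = K\<Phi>\<^sup>2 * (norm (x - x'))\<^sup>2" by (simp add: power_mult_distrib)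
        also have "\<dots> \<le> L * (norm (x - x'))\<^sup>2" using L(3) by (intro mult_right_mono) auto
        finally show "(norm (end_map S \<omega> x - end_map S \<omega> x'))\<^sup>2 \<le> L * (norm (x - x'))\<^sup>2" .
      qed
    qed
    show "AE \<omega> in M. \<forall>\<theta> \<theta>'. \<kappa> * ((gmap v k \<theta> \<omega> - gmap v k \<theta>' \<omega>) \<bullet> (\<theta> - \<theta>')) \<le> 0" if k: "k < N" for k
      using D0[OF k] AE_space
    proof eventually_elim
      case (elim \<omega>)
      show ?case
      proof (intro allI)
        fix \<theta> \<theta>' :: "'n triple"
        obtain x y z x' y' z' where \<theta>: "\<theta> = (x, y, z)" "\<theta>' = (x', y', z')" by (cases \<theta>, cases \<theta>') auto
        show "\<kappa> * ((gmap v k \<theta> \<omega> - gmap v k \<theta>' \<omega>) \<bullet> (\<theta> - \<theta>')) \<le> 0"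
          using elim(1)[rule_format, OF controls_D(3)[OF v k elim(2)], of x y z x' y' z'] by (simp add: \<theta> gmap_def)
      qed
    qed
    show "AE \<omega> in M. \<forall>x x'. 0 \<le> \<kappa> * ((end_map S \<omega> x - end_map S \<omega> x') \<bullet> (x - x'))"
      using mono_end
    proof eventually_elim
      case (elim \<omega>)
      show ?case
      proof (intro allI)
        fix x x'
        have "0 \<le> \<nu> * (norm (G \<omega> *v (x - x')))\<^sup>2" using \<mu>0 by simp
        also have "\<dots> \<le> \<kappa> * ((end_map S \<omega> x - end_map S \<omega> x') \<bullet> (x - x'))" using elim by blast
        finally show "0 \<le> \<kappa> * ((end_map S \<omega> x - end_map S \<omega> x') \<bullet> (x - x'))" .
      qed
    qed
    show "fwd_coercive M N (gmap v) \<kappa> L \<or> bwd_coercive M N (gmap v) (end_map S) \<kappa> L"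
      using mn fwd[OF _ v] bwd[OF _ v] by blast
  qed
  have init: "fbs.compatible_init M N (gmap v) (end_map S) \<kappa> L (init_map S)" if v: "v \<in> controls M N w U" for v
    unfolding fbs.compatible_init_def[OF fbs[OF v]]
  proof (intro conjI)
    show "continuous_on UNIV (init_map S)" by (rule C1_continuous[OF init_C1(1)])
    show "\<forall>y y'. \<kappa> * ((init_map S y - init_map S y') \<bullet> (y - y')) \<le> 0"
    proof (intro allI)
      fix y y'
      have "0 \<le> \<mu> * (norm (M0 *v (y - y')))\<^sup>2" using \<mu>0 by simp
      then show "\<kappa> * ((init_map S y - init_map S y') \<bullet> (y - y')) \<le> 0" using mono_init[of y y'] by linarith
    qed
    show "(\<forall>y y'. (norm (init_map S y - init_map S y'))\<^sup>2 \<le> - L * (\<kappa> * ((init_map S y - init_map S y') \<bullet> (y - y')))) \<or>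
        bwd_coercive M N (gmap v) (end_map S) \<kappa> L"
    proof (cases "\<nu> > 0")
      case True
      then show ?thesis using bwd[OF _ v] by blast
    next
      case False
      then have \<mu>: "\<mu> > 0" using mn by auto
      have "(norm (init_map S y - init_map S y'))\<^sup>2 \<le> L * - (\<kappa> * ((init_map S y - init_map S y') \<bullet> (y - y')))" for y y'
      proof -
        let ?d = "- (\<kappa> * ((init_map S y - init_map S y') \<bullet> (y - y')))" and ?\<beta> = "norm (M0 *v (y - y'))"
        have d: "\<mu> * ?\<beta>\<^sup>2 \<le> ?d" using mono_init[of y y'] by simp
        moreover have "0 \<le> \<mu> * ?\<beta>\<^sup>2" using \<mu> by simp
        ultimately have d0: "0 \<le> ?d" by linarith
        have "2 / \<mu> ^ 3 \<le> 8 / \<mu> ^ 3" using \<mu> by (intro divide_right_mono) auto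
        then have c: "2 / \<mu> ^ 3 \<le> L" using L(4) by linarith
        have "norm (init_map S y - init_map S y') \<le> 0 * 0 + 1 / \<mu> * ?\<beta>" using B \<mu> by (simp add: assumption_B_def)
        from two_term_square[OF this]
        have "(norm (init_map S y - init_map S y'))\<^sup>2 \<le> 2 * (1 / \<mu>)\<^sup>2 * ?\<beta>\<^sup>2" by simp
        also have "\<dots> \<le> L * ?d"
          by (rule sc[OF d cube(2)[OF \<mu>] c cube(4)[OF \<mu>] d0])
        finally show ?thesis .
      qed
      then show ?thesis by simp
    qed
  qed
  show thesis
  proof (rule that)
    show "fbs M N w (gmap v) (end_map S) \<kappa> L" if "v \<in> controls M N w U" for v
      using that by (rule fbs)
    show "fbs.compatible_init M N (gmap v) (end_map S) \<kappa> L (init_map S)" if "v \<in> controls M N w U" for v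
      using that by (rule init)
  qed
qed

text \<open>The bridge to the abstract system: pairing the forward and the backward state turns the
  state equation into \<open>solves\<close> plus the initial coupling, which the abstract notion
  leaves open.\<close>

lemma state_solution_iff:
  assumes fbs: "fbs M N w (gmap v) (end_map S) \<kappa> L"
  shows "state_solution S M N w v x y \<longleftrightarrow>
    fbs.solves M N w (gmap v) (end_map S) (\<lambda>k \<omega>. (x k \<omega>, y k \<omega>)) \<and> (AE \<omega> in M. x 0 \<omega> = init_map S (y 0 \<omega>))"
proof -
  interpret fbs M N w "gmap v" "end_map S" \<kappa> L by (rule fbs)
  have L2: "(\<lambda>k \<omega>. (x k \<omega>, y k \<omega>)) \<in> L2F M w {..N} \<longleftrightarrow> x \<in> L2F M w {..N} \<and> y \<in> L2F M w {..N}"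
  proof
    assume "(\<lambda>k \<omega>. (x k \<omega>, y k \<omega>)) \<in> L2F M w {..N}"
    from process_fst_snd[OF this] show "x \<in> L2F M w {..N} \<and> y \<in> L2F M w {..N}"
      by (simp add: L2F_atMost)
  next
    assume "x \<in> L2F M w {..N} \<and> y \<in> L2F M w {..N}"
    then show "(\<lambda>k \<omega>. (x k \<omega>, y k \<omega>)) \<in> L2F M w {..N}"
      by (auto intro!: L2F_I borel_measurable_Pair sqint_Pair(1) simp: L2F_atMost)
  qed
  have coef: "coef (\<lambda>k \<omega>. (x k \<omega>, y k \<omega>)) k \<omega>
      = Gamma_map S k (x k \<omega>) (cond_mean M w y k \<omega>) (cond_corr M w y k \<omega>) (v k \<omega>) \<omega>" for k \<omega>
    by (simp add: coef_def tri_def gmap_def)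
  have split: "(\<forall>k\<le>N. P k) \<longleftrightarrow> (\<forall>k<N. P k) \<and> P N" for P by (auto simp: le_less)
  let ?h = "\<lambda>k \<omega>. (x k \<omega>, y k \<omega>)"
  have sw: "fst (sweep ?h (Suc k) \<omega>)
        = drift S k (x k \<omega>) (cond_mean M w y k \<omega>) (cond_corr M w y k \<omega>) (v k \<omega>) \<omega>
          + w k \<omega> *\<^sub>R diffusion S k (x k \<omega>) (cond_mean M w y k \<omega>) (cond_corr M w y k \<omega>) (v k \<omega>) \<omega>"
      "k < N \<Longrightarrow> snd (sweep ?h k \<omega>)
        = - backward S (Suc k) (x k \<omega>) (cond_mean M w y k \<omega>) (cond_corr M w y k \<omega>) (v k \<omega>) \<omega>"
      "snd (sweep ?h N \<omega>) = end_map S \<omega> (x N \<omega>)" for k \<omega>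
    by (simp_all add: sweep_def coef Gamma_map_def)
  have sw2: "(\<forall>k<N. AE \<omega> in M. y k \<omega> = snd (sweep ?h k \<omega>)) \<longleftrightarrow> (\<forall>k<N. AE \<omega> in M. y k \<omega>
        = - backward S (Suc k) (x k \<omega>) (cond_mean M w y k \<omega>) (cond_corr M w y k \<omega>) (v k \<omega>) \<omega>)"
    by (intro all_cong) (simp only: sw(2))
  show ?thesis
    unfolding state_solution_def solves_def L2 split fst_conv snd_conv sw(1) sw(3) sw2
    by (rule iffI; elim conjE; intro conjI; assumption)
qed

end

section \<open>First order remainders\<close>

text \<open>A countable sequence of difference quotients represents the derivative, so that
  measurability in the sample point and growth bounds pass to it.\<close>

lemma has_derivative_directional_LIMSEQ:
  fixes g :: "'v::real_normed_vector \<Rightarrow> real"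
  assumes "(g has_derivative D) (at a)"
  shows "(\<lambda>m. real (Suc m) * (g (a + inverse (real (Suc m)) *\<^sub>R h) - g a)) \<longlonglongrightarrow> D h"
proof -
  interpret D: bounded_linear D using assms by (rule has_derivative_bounded_linear)
  have "((\<lambda>t. g (a + t *\<^sub>R h)) has_derivative (\<lambda>t. D (t *\<^sub>R h))) (at 0)"
  proof (rule has_derivative_compose[of "\<lambda>t. a + t *\<^sub>R h" "\<lambda>t. t *\<^sub>R h" 0 UNIV g D])
    show "((\<lambda>t. a + t *\<^sub>R h) has_derivative (\<lambda>t. t *\<^sub>R h)) (at 0)"
      by (auto intro!: derivative_eq_intros)
    show "(g has_derivative D) (at (a + 0 *\<^sub>R h))" using assms by simp
  qed
  then have "((\<lambda>t. g (a + t *\<^sub>R h)) has_field_derivative D h) (at 0)"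
    by (simp add: has_field_derivative_def D.scaleR mult.commute[of _ "D h"])
  then have lim: "((\<lambda>t. (g (a + t *\<^sub>R h) - g a) / t) \<longlongrightarrow> D h) (at 0)"
    by (simp add: has_field_derivative_iff)
  have "filterlim (\<lambda>m. inverse (real (Suc m))) (at 0) sequentially"
    using LIMSEQ_inverse_real_of_nat by (auto simp: filterlim_at)
  from filterlim_compose[OF lim this] show ?thesis by (simp add: mult.commute divide_inverse)
qed

text \<open>Common pattern of the Hamiltonian and of the terminal and initial functions:
  differentiable at a random point \<open>a\<close>, with increments bounded by a locally Lipschitz
  factor of linear growth. The random coefficient \<open>G\<close> carries the adjoint processes,
  which are only square integrable, so this is the most that can be asked for.\<close>

locale smooth_growth =
  fixes M :: "'w measure" and g :: "'w \<Rightarrow> 'v::euclidean_space \<Rightarrow> real" and D :: "'w \<Rightarrow> 'v \<Rightarrow> real"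
    and a :: "'w \<Rightarrow> 'v" and G :: "'w \<Rightarrow> real" and C :: real
  assumes a: "sqint M a" and G: "sqint M G" and C: "0 \<le> C"
    and deriv: "\<And>\<omega>. \<omega> \<in> space M \<Longrightarrow> (g \<omega> has_derivative D \<omega>) (at (a \<omega>))"
    and growth: "AE \<omega> in M. \<forall>v v'. \<bar>g \<omega> v - g \<omega> v'\<bar> \<le> (G \<omega> + C * (norm v + norm v')) * norm (v - v')"
begin

text \<open>Measurability is asked for on the segment \<open>t\<close> in [0, 1] only, since beyond
  it the control may leave the convex set. The sigma-algebra is left open because both the full one
  and the adapted ones are used.\<close>

lemma deriv_measurable:
  assumes "space F = space M"
    and "\<And>t. 0 \<le> t \<Longrightarrow> t \<le> 1 \<Longrightarrow> (\<lambda>\<omega>. g \<omega> (a \<omega> + t *\<^sub>R h \<omega>)) \<in> borel_measurable F"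
  shows "(\<lambda>\<omega>. D \<omega> (h \<omega>)) \<in> borel_measurable F"
proof (rule borel_measurable_LIMSEQ_real)
  show "(\<lambda>m. real (Suc m) * (g \<omega> (a \<omega> + inverse (real (Suc m)) *\<^sub>R h \<omega>) - g \<omega> (a \<omega>))) \<longlonglongrightarrow> D \<omega> (h \<omega>)"
    if "\<omega> \<in> space F" for \<omega>
    using deriv[of \<omega>] that assms(1) by (intro has_derivative_directional_LIMSEQ) simp
  show "(\<lambda>\<omega>. real (Suc m) * (g \<omega> (a \<omega> + inverse (real (Suc m)) *\<^sub>R h \<omega>) - g \<omega> (a \<omega>))) \<in> borel_measurable F" for m
    using assms(2)[of "inverse (real (Suc m))"] assms(2)[of 0]
    by (intro borel_measurable_times borel_measurable_diff borel_measurable_const) (auto simp: inverse_le_1_iff)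
qed

text \<open>The growth bound, divided by the step, passes to the limit along the difference
  quotients; both arguments of the bound then tend to \<open>a\<close>, hence the factor 2.\<close>

lemma deriv_bound: "AE \<omega> in M. \<forall>h. \<bar>D \<omega> h\<bar> \<le> (G \<omega> + 2 * C * norm (a \<omega>)) * norm h"
  using growth AE_space
proof eventually_elim
  case (elim \<omega>)
  show ?case
  proof
    fix h
    let ?t = "\<lambda>m. inverse (real (Suc m))"
    have t0: "?t \<longlonglongrightarrow> 0" by (rule LIMSEQ_inverse_real_of_nat)
    have "(\<lambda>m. \<bar>real (Suc m) * (g \<omega> (a \<omega> + ?t m *\<^sub>R h) - g \<omega> (a \<omega>))\<bar>) \<longlonglongrightarrow> \<bar>D \<omega> h\<bar>"
      by (intro tendsto_rabs has_derivative_directional_LIMSEQ deriv elim)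
    moreover have "(\<lambda>m. (G \<omega> + C * (norm (a \<omega> + ?t m *\<^sub>R h) + norm (a \<omega>))) * norm h)
        \<longlonglongrightarrow> (G \<omega> + C * (norm (a \<omega> + 0 *\<^sub>R h) + norm (a \<omega>))) * norm h"
      by (intro tendsto_intros t0)
    moreover have "\<bar>real (Suc m) * (g \<omega> (a \<omega> + ?t m *\<^sub>R h) - g \<omega> (a \<omega>))\<bar>
        \<le> (G \<omega> + C * (norm (a \<omega> + ?t m *\<^sub>R h) + norm (a \<omega>))) * norm h" for m
    proof -
      have "\<bar>real (Suc m) * (g \<omega> (a \<omega> + ?t m *\<^sub>R h) - g \<omega> (a \<omega>))\<bar>
          = real (Suc m) * \<bar>g \<omega> (a \<omega> + ?t m *\<^sub>R h) - g \<omega> (a \<omega>)\<bar>"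
        by (simp only: abs_mult abs_of_nat)
      also have "\<dots> \<le> real (Suc m) * ((G \<omega> + C * (norm (a \<omega> + ?t m *\<^sub>R h) + norm (a \<omega>))) * norm ((a \<omega> + ?t m *\<^sub>R h) - a \<omega>))"
        by (intro mult_left_mono elim(1)[rule_format]) simp
      also have "norm ((a \<omega> + ?t m *\<^sub>R h) - a \<omega>) = ?t m * norm h" by simp
      also have "real (Suc m) * ((G \<omega> + C * (norm (a \<omega> + ?t m *\<^sub>R h) + norm (a \<omega>))) * (?t m * norm h))
          = (G \<omega> + C * (norm (a \<omega> + ?t m *\<^sub>R h) + norm (a \<omega>))) * norm h"
        by (simp add: field_simps del: of_nat_Suc)
      finally show ?thesis .
    qed
    ultimately have "\<bar>D \<omega> h\<bar> \<le> (G \<omega> + C * (norm (a \<omega> + 0 *\<^sub>R h) + norm (a \<omega>))) * norm h"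
      by (intro LIMSEQ_le) auto
    then show "\<bar>D \<omega> h\<bar> \<le> (G \<omega> + 2 * C * norm (a \<omega>)) * norm h" by (simp add: algebra_simps)
  qed
qed

lemma bound_L2: "sqint M (\<lambda>\<omega>. G \<omega> + 2 * C * norm (a \<omega>))"
proof -
  have "sqint M (\<lambda>\<omega>. (2 * C) *\<^sub>R norm (a \<omega>))"
    using a by (intro sqint_scaleR(1)) (auto simp: sqint_def)
  from sqint_add(1)[OF G this] show ?thesis by simp
qed

lemma deriv_integrable:
  assumes h: "sqint M h"
    and m: "\<And>t. 0 \<le> t \<Longrightarrow> t \<le> 1 \<Longrightarrow> (\<lambda>\<omega>. g \<omega> (a \<omega> + t *\<^sub>R h \<omega>)) \<in> borel_measurable M"
  shows "integrable M (\<lambda>\<omega>. D \<omega> (h \<omega>))"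
proof (rule Bochner_Integration.integrable_bound)
  have "sqint M (\<lambda>\<omega>. norm (h \<omega>))" using h by (auto simp: sqint_def)
  from sqint_inner[OF bound_L2 this]
  show "integrable M (\<lambda>\<omega>. (G \<omega> + 2 * C * norm (a \<omega>)) * norm (h \<omega>))" by simp
  show "(\<lambda>\<omega>. D \<omega> (h \<omega>)) \<in> borel_measurable M" by (rule deriv_measurable[OF refl m])
  show "AE \<omega> in M. norm (D \<omega> (h \<omega>)) \<le> norm ((G \<omega> + 2 * C * norm (a \<omega>)) * norm (h \<omega>))"
    using deriv_bound by eventually_elim (metis abs_ge_self order_trans real_norm_def)
qed

lemma increment_integrable:
  assumes h: "sqint M h"
    and m: "\<And>t. 0 \<le> t \<Longrightarrow> t \<le> 1 \<Longrightarrow> (\<lambda>\<omega>. g \<omega> (a \<omega> + t *\<^sub>R h \<omega>)) \<in> borel_measurable M"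
  shows "integrable M (\<lambda>\<omega>. g \<omega> (a \<omega> + h \<omega>) - g \<omega> (a \<omega>))"
proof (rule Bochner_Integration.integrable_bound)
  have h': "sqint M (\<lambda>\<omega>. norm (h \<omega>))" using h by (auto simp: sqint_def)
  have "sqint M (\<lambda>\<omega>. (G \<omega> + 2 * C * norm (a \<omega>)) + C *\<^sub>R norm (h \<omega>))"
    by (intro sqint_add(1) bound_L2 sqint_scaleR(1) h')
  from sqint_inner[OF this h']
  show "integrable M (\<lambda>\<omega>. ((G \<omega> + 2 * C * norm (a \<omega>)) + C * norm (h \<omega>)) * norm (h \<omega>))" by simp
  show "(\<lambda>\<omega>. g \<omega> (a \<omega> + h \<omega>) - g \<omega> (a \<omega>)) \<in> borel_measurable M"
    using m[of 1] m[of 0] by simp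
  show "AE \<omega> in M. norm (g \<omega> (a \<omega> + h \<omega>) - g \<omega> (a \<omega>))
      \<le> norm (((G \<omega> + 2 * C * norm (a \<omega>)) + C * norm (h \<omega>)) * norm (h \<omega>))"
    using growth
  proof eventually_elim
    case (elim \<omega>)
    have "\<bar>g \<omega> (a \<omega> + h \<omega>) - g \<omega> (a \<omega>)\<bar> \<le> (G \<omega> + C * (norm (a \<omega> + h \<omega>) + norm (a \<omega>))) * norm (h \<omega>)"
      using elim[rule_format, of "a \<omega> + h \<omega>" "a \<omega>"] by simp
    also have "\<dots> \<le> ((G \<omega> + 2 * C * norm (a \<omega>)) + C * norm (h \<omega>)) * norm (h \<omega>)"
    proof (rule mult_right_mono)
      have "C * (norm (a \<omega> + h \<omega>) + norm (a \<omega>)) \<le> C * (norm (a \<omega>) + norm (h \<omega>) + norm (a \<omega>))"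
        using norm_triangle_ineq[of "a \<omega>" "h \<omega>"] C by (intro mult_left_mono) auto
      then show "G \<omega> + C * (norm (a \<omega> + h \<omega>) + norm (a \<omega>)) \<le> (G \<omega> + 2 * C * norm (a \<omega>)) + C * norm (h \<omega>)"
        by (simp add: algebra_simps)
    qed simp
    finally show ?case by simp
  qed
qed

text \<open>The remainder is factored as \<open>\<psi> n * norm (h n)\<close>. The fast decay of
  \<open>\<epsilon>\<close> supplies an integrable majorant of all squared increments, which
  dominates the squares of \<open>\<psi> n\<close> and forces the increments to 0 almost everywhere;
  differentiability then gives \<open>\<psi> n\<close> to 0, and dominated convergence gives this in
  L2. Cauchy-Schwarz contributes the remaining factor \<open>sqrt c * \<epsilon> n\<close>.\<close>

lemma remainder_tendsto:
  fixes h :: "nat \<Rightarrow> 'w \<Rightarrow> 'v" and \<epsilon> :: "nat \<Rightarrow> real"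
  assumes h: "\<And>n. sqint M (h n)"
    and m: "\<And>n t. 0 \<le> t \<Longrightarrow> t \<le> 1 \<Longrightarrow> (\<lambda>\<omega>. g \<omega> (a \<omega> + t *\<^sub>R h n \<omega>)) \<in> borel_measurable M"
    and le: "\<And>n. sqn M (h n) \<le> c * (\<epsilon> n)\<^sup>2" and \<epsilon>: "\<And>n. 0 < \<epsilon> n" "\<And>n. \<epsilon> n \<le> (1/4)^n" and c: "0 \<le> c"
  shows "(\<lambda>n. (LINT \<omega>|M. g \<omega> (a \<omega> + h n \<omega>) - g \<omega> (a \<omega>) - D \<omega> (h n \<omega>)) / \<epsilon> n) \<longlonglongrightarrow> 0"
proof -
  have [measurable]: "h n \<in> borel_measurable M" for n using h by auto
  have [measurable]: "a \<in> borel_measurable M" "G \<in> borel_measurable M" using a G by auto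
  define r where "r n \<omega> = g \<omega> (a \<omega> + h n \<omega>) - g \<omega> (a \<omega>) - D \<omega> (h n \<omega>)" for n \<omega>
  have [measurable]: "r n \<in> borel_measurable M" for n
  proof -
    have "(\<lambda>\<omega>. g \<omega> (a \<omega> + h n \<omega>)) \<in> borel_measurable M" "(\<lambda>\<omega>. g \<omega> (a \<omega>)) \<in> borel_measurable M"
      using m[of 1 n] m[of 0 n] by simp_all
    moreover have "(\<lambda>\<omega>. D \<omega> (h n \<omega>)) \<in> borel_measurable M" by (rule deriv_measurable[OF refl m])
    ultimately show ?thesis unfolding r_def[abs_def] by simp
  qed
  \<comment> \<open>Where the increment vanishes the quotient is 0 by convention; the remainder
    vanishes there too, so the factorisation stays valid.\<close>
  define \<psi> where "\<psi> n \<omega> = \<bar>r n \<omega>\<bar> / norm (h n \<omega>)" for n \<omega>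
  have [measurable]: "\<psi> n \<in> borel_measurable M" for n unfolding \<psi>_def[abs_def] by measurable
  have le16: "sqn M (h n) \<le> c * (1/16)^n" for n
  proof -
    have "(\<epsilon> n)\<^sup>2 \<le> ((1/4)^n)\<^sup>2" using \<epsilon>[of n] by (intro power_mono) auto
    also have "\<dots> = (1/16)^n" by (simp add: power2_eq_square power_mult_distrib[symmetric])
    finally show ?thesis using le[of n] c by (meson mult_left_mono order_trans)
  qed
  obtain W where W: "integrable M W" "\<And>\<omega>. 0 \<le> W \<omega>"
    "AE \<omega> in M. \<forall>n. (norm (h n \<omega>))\<^sup>2 \<le> (1/4)^n * W \<omega>"
    using L2_summable_majorant[OF h le16] by blast
  have [measurable]: "W \<in> borel_measurable M" using W by auto
  define Z where "Z \<omega> = 2 * (2 * (G \<omega> + 2 * C * norm (a \<omega>)))\<^sup>2 + 2 * (C\<^sup>2 * W \<omega>)" for \<omega>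
  have Z: "integrable M Z"
    unfolding Z_def[abs_def] power_mult_distrib
    using W(1) sqintD(2)[OF bound_L2] by (intro Bochner_Integration.integrable_add integrable_mult_right) auto
  have psi: "AE \<omega> in M. (\<forall>n. (\<psi> n \<omega>)\<^sup>2 \<le> Z \<omega>) \<and> (\<lambda>n. \<psi> n \<omega>) \<longlonglongrightarrow> 0 \<and> (\<forall>n. \<bar>r n \<omega>\<bar> = \<psi> n \<omega> * norm (h n \<omega>))"
    using growth deriv_bound W(3) AE_space
  proof eventually_elim
    case (elim \<omega>)
    interpret D: bounded_linear "D \<omega>" by (rule has_derivative_bounded_linear[OF deriv[OF elim(4)]])
    let ?B = "G \<omega> + 2 * C * norm (a \<omega>)"
    have r0: "r n \<omega> = 0" if "h n \<omega> = 0" for n using that by (simp add: r_def D.zero)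
    have bd: "\<psi> n \<omega> \<le> 1 * (2 * ?B) + C * norm (h n \<omega>)" for n
    proof (cases "h n \<omega> = 0")
      case True
      \<comment> \<open>Any nonzero direction shows that the bound of the derivative is
        nonnegative.\<close>
      from elim(2)[rule_format, of "SOME b. b \<in> Basis"] have "0 \<le> ?B"
        by (smt (verit) SOME_Basis nonzero_Basis zero_less_norm_iff zero_le_mult_iff)
      with True show ?thesis by (simp add: \<psi>_def)
    next
      case False
      have "\<bar>g \<omega> (a \<omega> + h n \<omega>) - g \<omega> (a \<omega>)\<bar> \<le> (G \<omega> + C * (norm (a \<omega> + h n \<omega>) + norm (a \<omega>))) * norm (h n \<omega>)"
        using elim(1)[rule_format, of "a \<omega> + h n \<omega>" "a \<omega>"] by simp
      also have "\<dots> \<le> (?B + C * norm (h n \<omega>)) * norm (h n \<omega>)"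
      proof (rule mult_right_mono)
        have "C * (norm (a \<omega> + h n \<omega>) + norm (a \<omega>)) \<le> C * (norm (a \<omega>) + norm (h n \<omega>) + norm (a \<omega>))"
          using norm_triangle_ineq[of "a \<omega>" "h n \<omega>"] C by (intro mult_left_mono) auto
        then show "G \<omega> + C * (norm (a \<omega> + h n \<omega>) + norm (a \<omega>)) \<le> ?B + C * norm (h n \<omega>)"
          by (simp add: algebra_simps)
      qed simp
      moreover have "\<bar>D \<omega> (h n \<omega>)\<bar> \<le> ?B * norm (h n \<omega>)" using elim(2) by blast
      ultimately have "\<bar>r n \<omega>\<bar> \<le> (2 * ?B + C * norm (h n \<omega>)) * norm (h n \<omega>)"
        unfolding r_def by (simp add: algebra_simps)
      then show ?thesis using False by (simp add: \<psi>_def field_simps)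
    qed
    have "(\<psi> n \<omega>)\<^sup>2 \<le> Z \<omega>" for n
    proof -
      have "(\<psi> n \<omega>)\<^sup>2 \<le> 2 * 1\<^sup>2 * (2 * ?B)\<^sup>2 + 2 * C\<^sup>2 * (norm (h n \<omega>))\<^sup>2"
        by (rule two_term_square[OF bd]) (simp add: \<psi>_def)
      moreover have "(norm (h n \<omega>))\<^sup>2 \<le> W \<omega>"
      proof -
        have "(norm (h n \<omega>))\<^sup>2 \<le> (1/4)^n * W \<omega>" using elim(3) by blast
        also have "\<dots> \<le> 1 * W \<omega>" using W(2)[of \<omega>] by (intro mult_right_mono power_le_one) auto
        finally show ?thesis by simp
      qed
      then have "C\<^sup>2 * (norm (h n \<omega>))\<^sup>2 \<le> C\<^sup>2 * W \<omega>" by (intro mult_left_mono) auto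
      ultimately show ?thesis by (simp add: Z_def)
    qed
    moreover have "\<bar>r n \<omega>\<bar> = \<psi> n \<omega> * norm (h n \<omega>)" for n
      using r0[of n] by (cases "h n \<omega> = 0") (auto simp: \<psi>_def)
    moreover have "(\<lambda>n. \<psi> n \<omega>) \<longlonglongrightarrow> 0"
    proof -
      have "(\<lambda>n. (norm (h n \<omega>))\<^sup>2) \<longlonglongrightarrow> 0"
      proof (rule Lim_null_comparison[rotated])
        have "(\<lambda>n. (1/4::real)^n * W \<omega>) \<longlonglongrightarrow> 0 * W \<omega>" by (intro tendsto_intros LIMSEQ_power_zero) simp
        then show "(\<lambda>n. (1/4::real)^n * W \<omega>) \<longlonglongrightarrow> 0" by simp
        show "\<forall>\<^sub>F n in sequentially. norm ((norm (h n \<omega>))\<^sup>2) \<le> (1/4)^n * W \<omega>" using elim(3) by simp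
      qed
      from tendsto_real_sqrt[OF this] have h0: "(\<lambda>n. norm (h n \<omega>)) \<longlonglongrightarrow> 0" by simp
      show ?thesis
      proof (rule LIMSEQ_I)
        fix e :: real assume e: "0 < e"
        from deriv[OF elim(4)] e obtain d where d: "0 < d"
          "\<And>y. norm (y - a \<omega>) < d \<Longrightarrow> norm (g \<omega> y - g \<omega> (a \<omega>) - D \<omega> (y - a \<omega>)) \<le> e / 2 * norm (y - a \<omega>)"
          unfolding has_derivative_at_alt by (meson half_gt_zero)
        from LIMSEQ_D[OF h0 d(1)] obtain n0 where n0: "\<And>n. n0 \<le> n \<Longrightarrow> norm (h n \<omega>) < d" by auto
        show "\<exists>no. \<forall>n\<ge>no. norm (\<psi> n \<omega> - 0) < e"
        proof (intro exI allI impI)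
          fix n assume "n0 \<le> n"
          then have "\<bar>r n \<omega>\<bar> \<le> e / 2 * norm (h n \<omega>)"
            using d(2)[of "a \<omega> + h n \<omega>"] n0 by (simp add: r_def)
          then have "\<psi> n \<omega> \<le> e / 2"
            using e by (cases "h n \<omega> = 0") (auto simp: \<psi>_def field_simps)
          moreover have "0 \<le> \<psi> n \<omega>" by (simp add: \<psi>_def)
          ultimately show "norm (\<psi> n \<omega> - 0) < e" using e by simp
        qed
      qed
    qed
    ultimately show ?case by blast
  qed
  have sp: "sqint M (\<psi> n)" for n
    by (rule sqint_bound(1)[OF Z]) (use psi in auto)
  have "(\<lambda>n. sqn M (\<psi> n)) \<longlonglongrightarrow> (LINT \<omega>|M. 0)"
    unfolding sqn_def
  proof (rule integral_dominated_convergence[OF _ _ Z])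
    show "AE \<omega> in M. (\<lambda>n. (norm (\<psi> n \<omega>))\<^sup>2) \<longlonglongrightarrow> 0"
      using psi
    proof eventually_elim
      case (elim \<omega>)
      then have "(\<lambda>n. (norm (\<psi> n \<omega>))\<^sup>2) \<longlonglongrightarrow> (norm (0::real))\<^sup>2" by (intro tendsto_intros) auto
      then show ?case by simp
    qed
    show "AE \<omega> in M. norm ((norm (\<psi> n \<omega>))\<^sup>2) \<le> Z \<omega>" for n using psi by auto
  qed auto
  then have "(\<lambda>n. sqn M (\<psi> n)) \<longlonglongrightarrow> 0" by simp
  from tendsto_mult[OF tendsto_real_sqrt[OF this] tendsto_const[of "sqrt c"]]
  have lim: "(\<lambda>n. sqrt (sqn M (\<psi> n)) * sqrt c) \<longlonglongrightarrow> 0" by simp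
  have "norm ((LINT \<omega>|M. r n \<omega>) / \<epsilon> n) \<le> sqrt (sqn M (\<psi> n)) * sqrt c" for n
  proof -
    have hn: "sqint M (\<lambda>\<omega>. norm (h n \<omega>))" "sqn M (\<lambda>\<omega>. norm (h n \<omega>)) = sqn M (h n)"
      using h[of n] by (auto simp: sqint_def sqn_def)
    have "\<bar>LINT \<omega>|M. r n \<omega>\<bar> \<le> (LINT \<omega>|M. \<bar>r n \<omega>\<bar>)" by (rule integral_abs_bound)
    also have "\<dots> = (LINT \<omega>|M. \<psi> n \<omega> \<bullet> norm (h n \<omega>))"
      using psi by (intro integral_cong_AE) auto
    also have "\<dots> \<le> sqrt (sqn M (\<psi> n)) * sqrt (sqn M (\<lambda>\<omega>. norm (h n \<omega>)))"
      using cauchy_schwarz_integral[OF sp hn(1)] by (rule order_trans[OF abs_ge_self])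
    also have "\<dots> \<le> sqrt (sqn M (\<psi> n)) * (sqrt c * \<epsilon> n)"
    proof (rule mult_left_mono)
      have "sqrt (sqn M (h n)) \<le> sqrt (c * (\<epsilon> n)\<^sup>2)" using le by (rule real_sqrt_le_mono)
      then show "sqrt (sqn M (\<lambda>\<omega>. norm (h n \<omega>))) \<le> sqrt c * \<epsilon> n"
        using \<epsilon>(1)[of n] by (simp add: hn(2) real_sqrt_mult)
    qed simp
    finally show ?thesis using \<epsilon>(1)[of n] by (simp add: field_simps)
  qed
  then show ?thesis unfolding r_def[symmetric]
    by (intro Lim_null_comparison[OF _ lim] always_eventually) blast
qed

end

lemma gradient_inner:
  fixes g :: "real^'d \<Rightarrow> real"
  assumes "(g has_derivative D) (at a)"
  shows "gradient g a \<bullet> h = D h"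
proof -
  interpret D: bounded_linear D using assms by (rule has_derivative_bounded_linear)
  have fd: "frechet_derivative g (at a) = D" by (rule frechet_derivative_at[OF assms, symmetric])
  have "h = (\<Sum>i\<in>UNIV. h $ i *\<^sub>R axis i 1)"
    by (simp add: basis_expansion scalar_mult_eq_scaleR[symmetric])
  then have "D h = D (\<Sum>i\<in>UNIV. h $ i *\<^sub>R axis i 1)" by (rule arg_cong)
  also have "\<dots> = (\<Sum>i\<in>UNIV. h $ i * D (axis i 1))" by (simp add: D.sum D.scaleR)
  finally show ?thesis by (simp add: gradient_def inner_vec_def fd mult.commute)
qed

lemma gradient_norm_le:
  fixes g :: "real^'d \<Rightarrow> real"
  assumes "(g has_derivative D) (at a)" "\<And>h. \<bar>D h\<bar> \<le> B * norm h"
  shows "norm (gradient g a) \<le> B"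
proof (cases "gradient g a = 0")
  case True
  obtain e :: "real^'d" where "norm e = 1" using vector_choose_size[of 1] by auto
  then have "0 \<le> B" using assms(2)[of e] by (metis abs_ge_zero mult_1_right order_trans)
  then show ?thesis using True by simp
next
  case False
  have "(norm (gradient g a))\<^sup>2 = D (gradient g a)"
    using gradient_inner[OF assms(1), of "gradient g a"] by (simp add: power2_norm_eq_inner)
  also have "\<dots> \<le> B * norm (gradient g a)" using assms(2)[of "gradient g a"] by simp
  finally show ?thesis using False by (simp add: power2_eq_square)
qed

section \<open>The duality identity for the cost\<close>

lemma has_derivative_partials:
  fixes f :: "'a::real_normed_vector \<times> 'b::real_normed_vector \<times> 'c::real_normed_vector \<times> 'd::real_normed_vector \<Rightarrow> real"
  assumes f: "(f has_derivative D) (at (x, y, z, u))"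
  shows "((\<lambda>x. f (x, y, z, u)) has_derivative (\<lambda>h. D (h, 0, 0, 0))) (at x)"
    "((\<lambda>y. f (x, y, z, u)) has_derivative (\<lambda>h. D (0, h, 0, 0))) (at y)"
    "((\<lambda>z. f (x, y, z, u)) has_derivative (\<lambda>h. D (0, 0, h, 0))) (at z)"
    "((\<lambda>u. f (x, y, z, u)) has_derivative (\<lambda>h. D (0, 0, 0, h))) (at u)"
    "D (hx, hy, hz, hu) = D (hx, 0, 0, 0) + D (0, hy, 0, 0) + D (0, 0, hz, 0) + D (0, 0, 0, hu)"
proof -
  show "((\<lambda>x. f (x, y, z, u)) has_derivative (\<lambda>h. D (h, 0, 0, 0))) (at x)"
    by (rule has_derivative_compose[of "\<lambda>x. (x, y, z, u)" "\<lambda>h. (h, 0, 0, 0)", OF _ f])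
      (auto intro!: derivative_eq_intros simp: zero_prod_def)
  show "((\<lambda>y. f (x, y, z, u)) has_derivative (\<lambda>h. D (0, h, 0, 0))) (at y)"
    by (rule has_derivative_compose[of "\<lambda>y. (x, y, z, u)" "\<lambda>h. (0, h, 0, 0)", OF _ f])
      (auto intro!: derivative_eq_intros simp: zero_prod_def)
  show "((\<lambda>z. f (x, y, z, u)) has_derivative (\<lambda>h. D (0, 0, h, 0))) (at z)"
    by (rule has_derivative_compose[of "\<lambda>z. (x, y, z, u)" "\<lambda>h. (0, 0, h, 0)", OF _ f])
      (auto intro!: derivative_eq_intros simp: zero_prod_def)
  show "((\<lambda>u. f (x, y, z, u)) has_derivative (\<lambda>h. D (0, 0, 0, h))) (at u)"
    by (rule has_derivative_compose[of "\<lambda>u. (x, y, z, u)" "\<lambda>h. (0, 0, 0, h)", OF _ f])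
      (auto intro!: derivative_eq_intros simp: zero_prod_def)
  interpret D: bounded_linear D using f by (rule has_derivative_bounded_linear)
  have "D ((hx, 0, 0, 0) + (0, hy, 0, 0) + (0, 0, hz, 0) + (0, 0, 0, hu))
      = D (hx, 0, 0, 0) + D (0, hy, 0, 0) + D (0, 0, hz, 0) + D (0, 0, 0, hu)"
    by (simp only: D.add)
  then show "D (hx, hy, hz, hu) = D (hx, 0, 0, 0) + D (0, hy, 0, 0) + D (0, 0, hz, 0) + D (0, 0, 0, hu)" by simp
qed

lemma norm_components_le:
  fixes q :: "'a::real_normed_vector \<times> 'b::real_normed_vector \<times> 'c::real_normed_vector \<times> 'd::real_normed_vector"
  assumes "q = (x, y, z, u)"
  shows "norm x \<le> norm q" "norm y \<le> norm q" "norm z \<le> norm q" "norm u \<le> norm q"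
proof -
  have 1: "norm (y, z, u) \<le> norm q" unfolding assms by (rule norm_snd_le)
  have 2: "norm (z, u) \<le> norm (y, z, u)" by (rule norm_snd_le)
  show "norm x \<le> norm q" unfolding assms by (rule norm_fst_le)
  show "norm y \<le> norm q" using 1 norm_fst_le[of y "(z, u)"] by linarith
  show "norm z \<le> norm q" using 1 2 norm_fst_le[of z u] by linarith
  show "norm u \<le> norm q" using 1 2 norm_snd_le[of u z] by linarith
qed

section \<open>Growth and integrability of the cost terms\<close>

context control_system
begin

text \<open>For the running cost only the four partial derivatives are bounded; continuous
  differentiability in all variables lets them be added up to a bound of the full derivative, from
  which the increment bound follows along segments.\<close>

lemma cost_growth:
  obtains C where "0 \<le> C"
    "\<And>k \<omega> q q'. k < N \<Longrightarrow> \<omega> \<in> space M \<Longrightarrow>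
      \<bar>(\<lambda>(x, y, z, u). run_cost S k x y z u \<omega>) q - (\<lambda>(x, y, z, u). run_cost S k x y z u \<omega>) q'\<bar>
        \<le> C * (1 + norm q + norm q') * norm (q - q')"
    "\<And>k \<omega> x y z u. k < N \<Longrightarrow> \<omega> \<in> space M \<Longrightarrow>
      \<bar>run_cost S k x y z u \<omega>\<bar> \<le> C * (1 + (norm x)\<^sup>2 + (norm y)\<^sup>2 + (norm z)\<^sup>2 + (norm u)\<^sup>2)"
    "\<And>\<omega> x x'. \<omega> \<in> space M \<Longrightarrow> \<bar>end_cost S \<omega> x - end_cost S \<omega> x'\<bar> \<le> C * (1 + norm x + norm x') * norm (x - x')"
    "\<And>y y'. norm (init_map S y - init_map S y') \<le> C * (1 + norm y + norm y') * norm (y - y')"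
    "\<And>y y'. \<bar>init_cost S y - init_cost S y'\<bar> \<le> C * (1 + norm y + norm y') * norm (y - y')"
proof -
  from A_growth obtain C where C: "0 < C"
    and run: "\<forall>k<N. \<forall>\<omega>\<in>space M. \<forall>x y z u.
          \<bar>run_cost S k x y z u \<omega>\<bar>
            \<le> C * (1 + (norm x)\<^sup>2 + (norm y)\<^sup>2 + (norm z)\<^sup>2 + (norm u)\<^sup>2) \<and>
          dnorm (\<lambda>x. run_cost S k x y z u \<omega>) x \<le> C * (1 + norm x + norm y + norm z + norm u) \<and>
          dnorm (\<lambda>y. run_cost S k x y z u \<omega>) y \<le> C * (1 + norm x + norm y + norm z + norm u) \<and>
          dnorm (\<lambda>z. run_cost S k x y z u \<omega>) z \<le> C * (1 + norm x + norm y + norm z + norm u) \<and>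
          dnorm (\<lambda>u. run_cost S k x y z u \<omega>) u \<le> C * (1 + norm x + norm y + norm z + norm u)"
    and endg: "\<forall>\<omega>\<in>space M. \<forall>x. dnorm (end_map S \<omega>) x \<le> C * (1 + norm x) \<and> dnorm (end_cost S \<omega>) x \<le> C * (1 + norm x)"
    and init: "\<forall>y. dnorm (init_map S) y \<le> C * (1 + norm y) \<and> dnorm (init_cost S) y \<le> C * (1 + norm y)"
    by blast
  have big: "C * a \<le> 16 * C * b" if "a \<le> b" "0 \<le> b" for a b
  proof -
    have "C * a \<le> C * b" using that C by (intro mult_left_mono) auto
    also have "\<dots> \<le> 16 * C * b" using that C by simp
    finally show ?thesis .
  qed
  have big_growth: "C * (1 + a + b) * d \<le> 16 * C * (1 + a + b) * d" if "0 \<le> a" "0 \<le> b" "0 \<le> d" for a b d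
  proof -
    have "C * (1 + a + b) \<le> 16 * C * (1 + a + b)" by (rule big) (use that in auto)
    then show ?thesis by (rule mult_right_mono) (rule that)
  qed
  show thesis
  \<comment> \<open>A factor 4 for the four partial derivatives and a factor 4 for bounding the sum
    of four norms by the norm of the tuple; the same constant is then used for all cost
    terms.\<close>
  proof (rule that[of "16 * C"])
    show "0 \<le> 16 * C" using C by simp
    fix k \<omega> assume k: "k < N" "\<omega> \<in> space M"
    let ?l = "\<lambda>(x, y, z, u). run_cost S k x y z u \<omega>"
    have l: "C1 ?l" by (rule coefficients_C1(4)[OF k])
    show "\<bar>?l q - ?l q'\<bar> \<le> 16 * C * (1 + norm q + norm q') * norm (q - q')" for q q'
    proof -
      have "dnorm ?l c \<le> 16 * C * (1 + norm c)" for c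
        unfolding dnorm_def
      proof (rule onorm_le)
        fix h :: "(real^'n) \<times> (real^'n) \<times> (real^'n) \<times> (real^'m)"
        obtain x y z u where c: "c = (x, y, z, u)" by (cases c) auto
        obtain hx hy hz hu where h: "h = (hx, hy, hz, hu)" by (cases h) auto
        let ?D = "frechet_derivative ?l (at c)"
        have D: "(?l has_derivative ?D) (at (x, y, z, u))" using C1_derivative[OF l, of c] unfolding c .
        note P = has_derivative_partials[OF D, simplified]
        have nb: "1 + norm x + norm y + norm z + norm u \<le> 4 * (1 + norm c)"
          using norm_components_le[OF c] by simp
        have part: "\<bar>E e\<bar> \<le> C * (4 * (1 + norm c)) * norm h"
          if E: "(f has_derivative E) (at b)" and d: "dnorm f b \<le> C * (1 + norm x + norm y + norm z + norm u)"
            and e: "norm e \<le> norm h"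
          for E and f :: "'e::real_normed_vector \<Rightarrow> real" and b e
        proof -
          have "frechet_derivative f (at b) = E" by (rule frechet_derivative_at[OF E, symmetric])
          then have "onorm E \<le> C * (1 + norm x + norm y + norm z + norm u)" using d by (simp add: dnorm_def)
          also have "\<dots> \<le> C * (4 * (1 + norm c))" using nb C by (intro mult_left_mono) auto
          finally have o: "onorm E \<le> C * (4 * (1 + norm c))" .
          have "\<bar>E e\<bar> \<le> onorm E * norm e"
            using onorm[OF has_derivative_bounded_linear[OF E], of e] by simp
          also have "\<dots> \<le> C * (4 * (1 + norm c)) * norm h"
            using o e C by (intro mult_mono) auto
          finally show ?thesis .
        qed
        note r = run[rule_format, OF k, of x y z u]
        note nh = norm_components_le[OF h]
        have 1: "\<bar>?D (hx, 0, 0, 0)\<bar> \<le> C * (4 * (1 + norm c)) * norm h"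
          by (rule part[OF P(1) _ nh(1)]) (use r in blast)
        have 2: "\<bar>?D (0, hy, 0, 0)\<bar> \<le> C * (4 * (1 + norm c)) * norm h"
          by (rule part[OF P(2) _ nh(2)]) (use r in blast)
        have 3: "\<bar>?D (0, 0, hz, 0)\<bar> \<le> C * (4 * (1 + norm c)) * norm h"
          by (rule part[OF P(3) _ nh(3)]) (use r in blast)
        have 4: "\<bar>?D (0, 0, 0, hu)\<bar> \<le> C * (4 * (1 + norm c)) * norm h"
          by (rule part[OF P(4) _ nh(4)]) (use r in blast)
        have "norm (?D h) \<le> 4 * (C * (4 * (1 + norm c)) * norm h)"
          using 1 2 3 4 has_derivative_partials(5)[OF D, of hx hy hz hu] unfolding h real_norm_def by linarith
        then show "norm (?D h) \<le> 16 * C * (1 + norm c) * norm h" by (simp add: algebra_simps)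
      qed
      from C1_growth[OF l this, of q q'] C show ?thesis by simp
    qed
    show "\<bar>run_cost S k x y z u \<omega>\<bar> \<le> 16 * C * (1 + (norm x)\<^sup>2 + (norm y)\<^sup>2 + (norm z)\<^sup>2 + (norm u)\<^sup>2)" for x y z u
      using run[rule_format, OF k, of x y z u] big[OF order_refl, of "1 + (norm x)\<^sup>2 + (norm y)\<^sup>2 + (norm z)\<^sup>2 + (norm u)\<^sup>2"]
      by (smt (verit) zero_le_power2)
  next
    show "\<bar>end_cost S \<omega> x - end_cost S \<omega> x'\<bar> \<le> 16 * C * (1 + norm x + norm x') * norm (x - x')"
      if "\<omega> \<in> space M" for \<omega> x x'
      using order_trans[OF C1_growth[OF end_C1(2)[OF that], of C x x'] big_growth] endg that C by simp
    show "norm (init_map S y - init_map S y') \<le> 16 * C * (1 + norm y + norm y') * norm (y - y')" for y y'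
      using order_trans[OF C1_growth[OF init_C1(1), of C y y'] big_growth] init C by simp
    show "\<bar>init_cost S y - init_cost S y'\<bar> \<le> 16 * C * (1 + norm y + norm y') * norm (y - y')" for y y'
      using order_trans[OF C1_growth[OF init_C1(2), of C y y'] big_growth] init C by simp
  qed
qed

definition arg :: "(nat \<Rightarrow> 'w \<Rightarrow> real^'n) \<Rightarrow> (nat \<Rightarrow> 'w \<Rightarrow> real^'n) \<Rightarrow> (nat \<Rightarrow> 'w \<Rightarrow> real^'m) \<Rightarrow> nat \<Rightarrow> 'w \<Rightarrow>
    (real^'n) \<times> (real^'n) \<times> (real^'n) \<times> (real^'m)" where
  "arg x y v k \<omega> = (x k \<omega>, cond_mean M w y k \<omega>, cond_corr M w y k \<omega>, v k \<omega>)"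

lemma arg_L2:
  assumes x: "x \<in> L2F M w {..N}" and y: "y \<in> L2F M w {..N}" and v: "v \<in> controls M N w U" and k: "k < N"
  shows "arg x y v k \<in> borel_measurable (filt M w k)" "sqint M (arg x y v k)"
proof -
  have sy: "sqint M (y (Suc k))" using L2F_D(2)[OF y] k by simp
  have kN: "k \<le> N" using k by simp
  have "(\<lambda>\<omega>. arg x y v k \<omega>) \<in> borel_measurable (filt M w k)"
    unfolding arg_def
    by (intro borel_measurable_Pair L2F_D(1)[OF x kN] cond_mean_measurable cond_corr_measurable controls_D(1)[OF v k])
  then show "arg x y v k \<in> borel_measurable (filt M w k)" by simp
  have "sqint M (\<lambda>\<omega>. arg x y v k \<omega>)"
    unfolding arg_def
    by (intro sqint_Pair(1) L2F_D(2)[OF x kN] cond_mean_L2(1)[OF k, of y, OF sy] cond_corr_L2(1)[OF k, of y, OF sy] controls_D(2)[OF v k])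
  then show "sqint M (arg x y v k)" by simp
qed

lemma trajectory_cost_parts:
  assumes x: "x \<in> L2F M w {..N}" and y: "y \<in> L2F M w {..N}" and v: "v \<in> controls M N w U"
  shows "k < N \<Longrightarrow> integrable M (\<lambda>\<omega>. (\<lambda>(x, y, z, u). run_cost S k x y z u \<omega>) (arg x y v k \<omega>))"
    "integrable M (\<lambda>\<omega>. end_cost S \<omega> (x N \<omega>))" "integrable M (\<lambda>\<omega>. init_cost S (y 0 \<omega>))"
    "trajectory_cost S M N w v x y = (LINT \<omega>|M. end_cost S \<omega> (x N \<omega>)) + (LINT \<omega>|M. init_cost S (y 0 \<omega>))
      + (\<Sum>k<N. LINT \<omega>|M. (\<lambda>(x, y, z, u). run_cost S k x y z u \<omega>) (arg x y v k \<omega>))"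
proof -
  obtain C where C: "0 \<le> C"
    and run: "\<And>k \<omega> x y z u. k < N \<Longrightarrow> \<omega> \<in> space M \<Longrightarrow>
      \<bar>run_cost S k x y z u \<omega>\<bar> \<le> C * (1 + (norm x)\<^sup>2 + (norm y)\<^sup>2 + (norm z)\<^sup>2 + (norm u)\<^sup>2)"
    and endg: "\<And>\<omega> x x'. \<omega> \<in> space M \<Longrightarrow> \<bar>end_cost S \<omega> x - end_cost S \<omega> x'\<bar> \<le> C * (1 + norm x + norm x') * norm (x - x')"
    by (rule cost_growth) blast
  show run_i: "integrable M (\<lambda>\<omega>. (\<lambda>(x, y, z, u). run_cost S k x y z u \<omega>) (arg x y v k \<omega>))" if k: "k < N" for k
  proof (rule Bochner_Integration.integrable_bound)
    note s = arg_L2(2)[OF x y v k]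
    show "integrable M (\<lambda>\<omega>. C * (1 + (norm (arg x y v k \<omega>))\<^sup>2))"
      using sqintD(2)[OF s] by (simp add: finite_measure_axioms)
    have sy: "sqint M (y (Suc k))" using L2F_D(2)[OF y] k by simp
    have kN: "k \<le> N" using k by simp
    have "(\<lambda>\<omega>. run_cost S k (x k \<omega>) (cond_mean M w y k \<omega>) (cond_corr M w y k \<omega>) (v k \<omega>) \<omega>) \<in> borel_measurable (filt M w k)"
      by (intro coefficients_measurable k L2F_D(1)[OF x kN] cond_mean_measurable cond_corr_measurable controls_D[OF v k])
    from filt_measurable_imp[OF kN this]
    show "(\<lambda>\<omega>. (\<lambda>(x, y, z, u). run_cost S k x y z u \<omega>) (arg x y v k \<omega>)) \<in> borel_measurable M" by (simp add: arg_def)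
    show "AE \<omega> in M. norm ((\<lambda>(x, y, z, u). run_cost S k x y z u \<omega>) (arg x y v k \<omega>)) \<le> norm (C * (1 + (norm (arg x y v k \<omega>))\<^sup>2))"
    proof (rule AE_I2)
      fix \<omega> assume "\<omega> \<in> space M"
      from run[OF k this, of "x k \<omega>" "cond_mean M w y k \<omega>" "cond_corr M w y k \<omega>" "v k \<omega>"]
      have "\<bar>(\<lambda>(x, y, z, u). run_cost S k x y z u \<omega>) (arg x y v k \<omega>)\<bar> \<le> C * (1 + (norm (arg x y v k \<omega>))\<^sup>2)"
        by (simp add: arg_def norm_Pair add.assoc)
      then show "norm ((\<lambda>(x, y, z, u). run_cost S k x y z u \<omega>) (arg x y v k \<omega>)) \<le> norm (C * (1 + (norm (arg x y v k \<omega>))\<^sup>2))"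
        using C by simp
    qed
  qed
  show end_i: "integrable M (\<lambda>\<omega>. end_cost S \<omega> (x N \<omega>))"
  proof (rule Bochner_Integration.integrable_bound)
    have xs: "sqint M (x N)" using L2F_D(2)[OF x] by simp
    have e0: "integrable M (\<lambda>\<omega>. \<bar>end_cost S \<omega> 0\<bar>)"
    proof -
      have m: "(\<lambda>\<omega>. end_cost S \<omega> 0) \<in> borel_measurable (filt M w N)" "integrable M (\<lambda>\<omega>. (end_cost S \<omega> 0)\<^sup>2)"
        using terminal by (auto simp: terminal_data_def)
      have "sqint M (\<lambda>\<omega>. end_cost S \<omega> 0)" using m filt_measurable_imp[of N] by (simp add: sqint_def)
      then have "integrable M (\<lambda>\<omega>. end_cost S \<omega> 0)" by (rule sqint_imp_integrable[OF finite_measure_axioms])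
      then show ?thesis by (rule integrable_abs)
    qed
    then show "integrable M (\<lambda>\<omega>. \<bar>end_cost S \<omega> 0\<bar> + C * (1 + 2 * (norm (x N \<omega>))\<^sup>2))"
      using sqintD(2)[OF xs] by (simp add: finite_measure_axioms)
    show "(\<lambda>\<omega>. end_cost S \<omega> (x N \<omega>)) \<in> borel_measurable M"
      by (intro filt_measurable_imp[OF order_refl] end_measurable L2F_D(1)[OF x]) simp
    show "AE \<omega> in M. norm (end_cost S \<omega> (x N \<omega>)) \<le> norm (\<bar>end_cost S \<omega> 0\<bar> + C * (1 + 2 * (norm (x N \<omega>))\<^sup>2))"
    proof (rule AE_I2)
      fix \<omega> assume "\<omega> \<in> space M"
      from endg[OF this, of "x N \<omega>" 0]
      have "\<bar>end_cost S \<omega> (x N \<omega>)\<bar> \<le> \<bar>end_cost S \<omega> 0\<bar> + C * ((1 + norm (x N \<omega>)) * norm (x N \<omega>))" by (simp add: mult.assoc)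
      also have "(1 + norm (x N \<omega>)) * norm (x N \<omega>) \<le> 1 + 2 * (norm (x N \<omega>))\<^sup>2"
        using sum_squares_bound[of "norm (x N \<omega>)" 1] norm_ge_zero[of "x N \<omega>"]
          by (simp add: power2_eq_square algebra_simps del: norm_ge_zero)
      finally show "norm (end_cost S \<omega> (x N \<omega>)) \<le> norm (\<bar>end_cost S \<omega> 0\<bar> + C * (1 + 2 * (norm (x N \<omega>))\<^sup>2))"
        using C by (simp add: mult_left_mono)
    qed
  qed
  \<comment> \<open>\<open>y 0\<close> is constant on the space, so the integrand is a
    constant.\<close>
  show init_i: "integrable M (\<lambda>\<omega>. init_cost S (y 0 \<omega>))"
  proof -
    have "integrable M (\<lambda>\<omega>. init_cost S (y 0 base))" by (simp add: finite_measure_axioms)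
    moreover have "init_cost S (y 0 \<omega>) = init_cost S (y 0 base)" if "\<omega> \<in> space M" for \<omega>
      using filt_0_value[OF L2F_D(1)[OF y, of 0] that] by simp
    ultimately show ?thesis using Bochner_Integration.integrable_cong[OF refl, of M "\<lambda>\<omega>. init_cost S (y 0 \<omega>)"] by simp
  qed
  have "trajectory_cost S M N w v x y = (LINT \<omega>|M. end_cost S \<omega> (x N \<omega>) + init_cost S (y 0 \<omega>)
      + (\<Sum>k<N. (\<lambda>(x, y, z, u). run_cost S k x y z u \<omega>) (arg x y v k \<omega>)))"
    by (simp add: trajectory_cost_def arg_def)
  also have "\<dots> = (LINT \<omega>|M. end_cost S \<omega> (x N \<omega>)) + (LINT \<omega>|M. init_cost S (y 0 \<omega>))
      + (\<Sum>k<N. LINT \<omega>|M. (\<lambda>(x, y, z, u). run_cost S k x y z u \<omega>) (arg x y v k \<omega>))"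
    using end_i init_i run_i by (subst Bochner_Integration.integral_add, (auto)[2],
        subst Bochner_Integration.integral_add, (auto)[2], subst Bochner_Integration.integral_sum) auto
  finally show "trajectory_cost S M N w v x y = \<dots>" .
qed

end

section \<open>Hamiltonian and boundary functions along the reference trajectory\<close>

locale extremal = control_system M N w S U
  for M :: "'w measure" and N w and S :: "('w, 'n::finite, 'm::finite) system" and U +
  fixes us :: "nat \<Rightarrow> 'w \<Rightarrow> real^'m" and xs ys ps rs :: "nat \<Rightarrow> 'w \<Rightarrow> real^'n"
  assumes us: "us \<in> controls M N w U" and state: "state_solution S M N w us xs ys"
    and adjoint: "adjoint_solution S M N w us xs ys ps rs" and lip_end: "lipschitz_end_map S M"
begin

lemma xs: "xs \<in> L2F M w {..N}" and ys: "ys \<in> L2F M w {..N}"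
  and ps: "ps \<in> L2F M w {..N}" and rs: "rs \<in> L2F M w {..N}"
  using state adjoint unfolding state_solution_def adjoint_solution_def by blast+

text \<open>The adjoint processes are frozen at the reference trajectory, so only state and control
  vary and the adjoints act as random coefficients.\<close>

definition Ham :: "nat \<Rightarrow> 'w \<Rightarrow> (real^'n) \<times> (real^'n) \<times> (real^'n) \<times> (real^'m) \<Rightarrow> real" where
  "Ham k \<omega> q = (\<lambda>(x, y, z, u). hamiltonian S k x y z u (cond_mean M w ps k \<omega>) (cond_corr M w ps k \<omega>) (rs k \<omega>) \<omega>) q"

definition DHam :: "nat \<Rightarrow> 'w \<Rightarrow> (real^'n) \<times> (real^'n) \<times> (real^'n) \<times> (real^'m) \<Rightarrow> real" where
  "DHam k \<omega> = frechet_derivative (Ham k \<omega>) (at (arg xs ys us k \<omega>))"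

abbreviation Hx where "Hx \<equiv> along M w us xs ys ps rs (ham_x S)"
abbreviation Hy where "Hy \<equiv> along M w us xs ys ps rs (ham_y S)"
abbreviation Hz where "Hz \<equiv> along M w us xs ys ps rs (ham_z S)"
abbreviation Hu where "Hu \<equiv> along M w us xs ys ps rs (ham_u S)"

lemma Ham_eq:
  "Ham k \<omega> q = (\<lambda>(x, y, z, u). drift S k x y z u \<omega>) q \<bullet> cond_mean M w ps k \<omega>
    + (\<lambda>(x, y, z, u). diffusion S k x y z u \<omega>) q \<bullet> cond_corr M w ps k \<omega>
    + (\<lambda>(x, y, z, u). backward S (Suc k) x y z u \<omega>) q \<bullet> rs k \<omega> + (\<lambda>(x, y, z, u). run_cost S k x y z u \<omega>) q"
  by (cases q) (simp add: Ham_def hamiltonian_def)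

lemma Ham_derivative:
  assumes k: "k < N" "\<omega> \<in> space M"
  shows "(Ham k \<omega> has_derivative DHam k \<omega>) (at (arg xs ys us k \<omega>))"
proof -
  note c = coefficients_C1[OF k, THEN C1_derivative, of "arg xs ys us k \<omega>"]
  have "\<exists>D. (Ham k \<omega> has_derivative D) (at (arg xs ys us k \<omega>))"
    unfolding Ham_eq[abs_def]
    by (rule exI) (rule has_derivative_add[OF has_derivative_add[OF has_derivative_add[OF
          has_derivative_inner_left[OF c(1)] has_derivative_inner_left[OF c(2)]] has_derivative_inner_left[OF c(3)]] c(4)])
  then show ?thesis
    unfolding DHam_def differentiable_def[symmetric] frechet_derivative_works .
qed

lemma DHam_partials:
  assumes k: "k < N" "\<omega> \<in> space M"
  shows "Hx k \<omega> \<bullet> hx = DHam k \<omega> (hx, 0, 0, 0)" "Hy k \<omega> \<bullet> hy = DHam k \<omega> (0, hy, 0, 0)"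
    "Hz k \<omega> \<bullet> hz = DHam k \<omega> (0, 0, hz, 0)" "Hu k \<omega> \<bullet> hu = DHam k \<omega> (0, 0, 0, hu)"
    "DHam k \<omega> (hx, hy, hz, hu) = Hx k \<omega> \<bullet> hx + Hy k \<omega> \<bullet> hy + Hz k \<omega> \<bullet> hz + Hu k \<omega> \<bullet> hu"
    "\<And>B. (\<And>h. \<bar>DHam k \<omega> h\<bar> \<le> B * norm h) \<Longrightarrow> norm (Hy k \<omega>) \<le> B"
    "\<And>B. (\<And>h. \<bar>DHam k \<omega> h\<bar> \<le> B * norm h) \<Longrightarrow> norm (Hz k \<omega>) \<le> B"
proof -
  have D: "(Ham k \<omega> has_derivative DHam k \<omega>)
      (at (xs k \<omega>, cond_mean M w ys k \<omega>, cond_corr M w ys k \<omega>, us k \<omega>))"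
    using Ham_derivative[OF k] by (simp add: arg_def)
  note P = has_derivative_partials[OF D]
  show x: "Hx k \<omega> \<bullet> hx = DHam k \<omega> (hx, 0, 0, 0)" for hx
    using gradient_inner[OF P(1)] by (simp add: along_def ham_x_def Ham_def)
  show y: "Hy k \<omega> \<bullet> hy = DHam k \<omega> (0, hy, 0, 0)" for hy
    using gradient_inner[OF P(2)] by (simp add: along_def ham_y_def Ham_def)
  show z: "Hz k \<omega> \<bullet> hz = DHam k \<omega> (0, 0, hz, 0)" for hz
    using gradient_inner[OF P(3)] by (simp add: along_def ham_z_def Ham_def)
  show u: "Hu k \<omega> \<bullet> hu = DHam k \<omega> (0, 0, 0, hu)" for hu
    using gradient_inner[OF P(4)] by (simp add: along_def ham_u_def Ham_def)
  show "DHam k \<omega> (hx, hy, hz, hu) = Hx k \<omega> \<bullet> hx + Hy k \<omega> \<bullet> hy + Hz k \<omega> \<bullet> hz + Hu k \<omega> \<bullet> hu"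
    unfolding x y z u by (rule P(5))
  fix B assume B: "\<And>h. \<bar>DHam k \<omega> h\<bar> \<le> B * norm h"
  have "\<bar>DHam k \<omega> (0, h, 0, 0)\<bar> \<le> B * norm h" "\<bar>DHam k \<omega> (0, 0, h, 0)\<bar> \<le> B * norm h" for h
    using B[of "(0, h, 0, 0)"] B[of "(0, 0, h, 0)"] by (simp_all add: norm_Pair)
  then show "norm (Hy k \<omega>) \<le> B" "norm (Hz k \<omega>) \<le> B"
    using gradient_norm_le[OF P(2), of B] gradient_norm_le[OF P(3), of B]
    by (simp_all add: along_def ham_y_def ham_z_def Ham_def)
qed

lemma Ham_measurable:
  assumes k: "k < N"
    and a: "x \<in> borel_measurable (filt M w k)" "y \<in> borel_measurable (filt M w k)"
      "z \<in> borel_measurable (filt M w k)" "v \<in> borel_measurable (filt M w k)"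
      "\<And>\<omega>. \<omega> \<in> space M \<Longrightarrow> v \<omega> \<in> U k"
  shows "(\<lambda>\<omega>. Ham k \<omega> (x \<omega>, y \<omega>, z \<omega>, v \<omega>)) \<in> borel_measurable (filt M w k)"
proof -
  have kN: "k \<le> N" using k by simp
  show ?thesis
    unfolding Ham_eq prod.case
    by (intro borel_measurable_add borel_measurable_inner coefficients_measurable k a
        cond_mean_measurable cond_corr_measurable L2F_D(1)[OF rs kN])
qed

text \<open>The coefficients are Lipschitz, so their pairings with the adjoints contribute only to
  \<open>G\<close>; the growth constant comes from the running cost.\<close>

lemma Ham_smooth:
  assumes k: "k < N"
  obtains G C where "smooth_growth M (Ham k) (DHam k) (arg xs ys us k) G C"
proof -
  obtain C where C: "0 \<le> C"
    and run: "\<And>k \<omega> q q'. k < N \<Longrightarrow> \<omega> \<in> space M \<Longrightarrow>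
      \<bar>(\<lambda>(x, y, z, u). run_cost S k x y z u \<omega>) q - (\<lambda>(x, y, z, u). run_cost S k x y z u \<omega>) q'\<bar>
        \<le> C * (1 + norm q + norm q') * norm (q - q')"
    by (rule cost_growth) blast
  obtain K where K: "0 \<le> K"
    and Kl: "\<And>k \<omega> h x y z u x' y' z' u'. k < N \<Longrightarrow> \<omega> \<in> space M \<Longrightarrow>
      h \<in> {drift S k, diffusion S k, backward S (Suc k)} \<Longrightarrow>
      norm (h x y z u \<omega> - h x' y' z' u' \<omega>) \<le> K * norm ((x, y, z, u) - (x', y', z', u'))"
    by (rule coefficients_lipschitz) blast
  have kN: "k \<le> N" using k by simp
  have sp: "sqint M (ps (Suc k))" using L2F_D(2)[OF ps] k by simp
  define G where "G \<omega> = (K * norm (cond_mean M w ps k \<omega>) + K * norm (cond_corr M w ps k \<omega>)) + (K * norm (rs k \<omega>) + C)" for \<omega>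
  have nrm: "sqint M (\<lambda>\<omega>. K * norm (f \<omega>))" if "sqint M f" for f :: "'w \<Rightarrow> real^'n"
  proof -
    have "sqint M (\<lambda>\<omega>. norm (f \<omega>))" using that by (auto simp: sqint_def)
    from sqint_scaleR(1)[OF this, of K] show ?thesis by simp
  qed
  have G: "sqint M G"
    unfolding G_def[abs_def]
    by (intro sqint_add(1) nrm cond_mean_L2(1)[OF k, of ps, OF sp] cond_corr_L2(1)[OF k, of ps, OF sp]
        L2F_D(2)[OF rs kN] sqint_const finite_measure_axioms)
  have "smooth_growth M (Ham k) (DHam k) (arg xs ys us k) G C"
  proof
    show "sqint M (arg xs ys us k)" by (rule arg_L2(2)[OF xs ys us k])
    show "AE \<omega> in M. \<forall>v v'. \<bar>Ham k \<omega> v - Ham k \<omega> v'\<bar> \<le> (G \<omega> + C * (norm v + norm v')) * norm (v - v')"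
    proof (intro AE_I2 allI)
      fix \<omega> and q q' :: "(real^'n) \<times> (real^'n) \<times> (real^'n) \<times> (real^'m)" assume \<omega>: "\<omega> \<in> space M"
      obtain x y z u where q: "q = (x, y, z, u)" by (cases q) auto
      obtain x' y' z' u' where q': "q' = (x', y', z', u')" by (cases q') auto
      have ip: "\<bar>h x y z u \<omega> \<bullet> p - h x' y' z' u' \<omega> \<bullet> p\<bar> \<le> K * norm p * norm (q - q')"
        if "h \<in> {drift S k, diffusion S k, backward S (Suc k)}" for h and p :: "real^'n"
      proof -
        have "\<bar>(h x y z u \<omega> - h x' y' z' u' \<omega>) \<bullet> p\<bar> \<le> norm (h x y z u \<omega> - h x' y' z' u' \<omega>) * norm p"
          by (rule Cauchy_Schwarz_ineq2)
        also have "\<dots> \<le> (K * norm (q - q')) * norm p"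
          unfolding q q' by (intro mult_right_mono Kl[OF k \<omega> that]) simp
        finally show ?thesis by (simp add: inner_diff_left algebra_simps)
      qed
      have "\<bar>Ham k \<omega> q - Ham k \<omega> q'\<bar> \<le> K * norm (cond_mean M w ps k \<omega>) * norm (q - q')
          + K * norm (cond_corr M w ps k \<omega>) * norm (q - q') + K * norm (rs k \<omega>) * norm (q - q')
          + C * (1 + norm q + norm q') * norm (q - q')"
        using ip[of "drift S k" "cond_mean M w ps k \<omega>"] ip[of "diffusion S k" "cond_corr M w ps k \<omega>"]
          ip[of "backward S (Suc k)" "rs k \<omega>"] run[OF k \<omega>, of q q']
        unfolding Ham_eq by (simp add: q q')
      also have "\<dots> = (G \<omega> + C * (norm q + norm q')) * norm (q - q')"
        by (simp add: G_def algebra_simps)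
      finally show "\<bar>Ham k \<omega> q - Ham k \<omega> q'\<bar> \<le> (G \<omega> + C * (norm q + norm q')) * norm (q - q')" .
    qed
  qed (use G C Ham_derivative[OF k] in auto)
  then show thesis by (rule that)
qed

text \<open>Adaptedness matters here: the duality with \<open>cond_mean\<close> and
  \<open>cond_corr\<close> requires test functions measurable for \<open>filt M w k\<close>.
  Components are directional derivatives in fixed directions that leave the control
  unchanged.\<close>

lemma Hy_Hz_L2:
  assumes k: "k < N"
  shows "Hy k \<in> borel_measurable (filt M w k)" "sqint M (Hy k)"
    "Hz k \<in> borel_measurable (filt M w k)" "sqint M (Hz k)"
proof -
  have kN: "k \<le> N" using k by simp
  obtain G C where "smooth_growth M (Ham k) (DHam k) (arg xs ys us k) G C" by (rule Ham_smooth[OF k])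
  then interpret smooth_growth M "Ham k" "DHam k" "arg xs ys us k" G C .
  have D: "(\<lambda>\<omega>. DHam k \<omega> (0, hy, hz, 0)) \<in> borel_measurable (filt M w k)" for hy hz
  proof (rule deriv_measurable)
    fix t :: real
    have "(\<lambda>\<omega>. Ham k \<omega> (xs k \<omega>, cond_mean M w ys k \<omega> + t *\<^sub>R hy, cond_corr M w ys k \<omega> + t *\<^sub>R hz, us k \<omega>))
        \<in> borel_measurable (filt M w k)"
      by (intro Ham_measurable k L2F_D(1)[OF xs kN] borel_measurable_add borel_measurable_const
          cond_mean_measurable cond_corr_measurable controls_D[OF us k])
    then show "(\<lambda>\<omega>. Ham k \<omega> (arg xs ys us k \<omega> + t *\<^sub>R (0, hy, hz, 0))) \<in> borel_measurable (filt M w k)"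
      by (simp add: arg_def)
  qed simp
  have vec: "f \<in> borel_measurable (filt M w k)"
    if "\<And>i. (\<lambda>\<omega>. f \<omega> \<bullet> axis i 1) \<in> borel_measurable (filt M w k)" for f :: "'w \<Rightarrow> real^'n"
    by (subst borel_measurable_euclidean_space) (use that in \<open>auto simp: Basis_vec_def\<close>)
  show y: "Hy k \<in> borel_measurable (filt M w k)"
  proof (rule vec)
    fix i
    show "(\<lambda>\<omega>. Hy k \<omega> \<bullet> axis i 1) \<in> borel_measurable (filt M w k)"
      using D[of "axis i 1" 0] by (rule measurable_cong[THEN iffD1, rotated]) (simp add: DHam_partials(2)[OF k] zero_prod_def)
  qed
  show z: "Hz k \<in> borel_measurable (filt M w k)"
  proof (rule vec)
    fix i
    show "(\<lambda>\<omega>. Hz k \<omega> \<bullet> axis i 1) \<in> borel_measurable (filt M w k)"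
      using D[of 0 "axis i 1"] by (rule measurable_cong[THEN iffD1, rotated]) (simp add: DHam_partials(3)[OF k] zero_prod_def)
  qed
  note I = sqintD(2)[OF bound_L2]
  show "sqint M (Hy k)"
  proof (rule sqint_bound(1)[OF I filt_measurable_imp[OF kN y]])
    show "AE \<omega> in M. (norm (Hy k \<omega>))\<^sup>2 \<le> (norm (G \<omega> + 2 * C * norm (arg xs ys us k \<omega>)))\<^sup>2"
      using deriv_bound AE_space
    proof eventually_elim
      case (elim \<omega>)
      have "norm (Hy k \<omega>) \<le> G \<omega> + 2 * C * norm (arg xs ys us k \<omega>)"
        by (rule DHam_partials(6)[OF k elim(2)]) (use elim(1) in blast)
      then have "norm (Hy k \<omega>) \<le> norm (G \<omega> + 2 * C * norm (arg xs ys us k \<omega>))" by simp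
      then show ?case by (rule power_mono) simp
    qed
  qed
  show "sqint M (Hz k)"
  proof (rule sqint_bound(1)[OF I filt_measurable_imp[OF kN z]])
    show "AE \<omega> in M. (norm (Hz k \<omega>))\<^sup>2 \<le> (norm (G \<omega> + 2 * C * norm (arg xs ys us k \<omega>)))\<^sup>2"
      using deriv_bound AE_space
    proof eventually_elim
      case (elim \<omega>)
      have "norm (Hz k \<omega>) \<le> G \<omega> + 2 * C * norm (arg xs ys us k \<omega>)"
        by (rule DHam_partials(7)[OF k elim(2)]) (use elim(1) in blast)
      then have "norm (Hz k \<omega>) \<le> norm (G \<omega> + 2 * C * norm (arg xs ys us k \<omega>))" by simp
      then show ?case by (rule power_mono) simp
    qed
  qed
qed

text \<open>
  The terminal and initial terms are treated like the Hamiltonian: the adjoint boundary conditions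
  say that \<open>p\<^sub>N\<close> and \<open>-r\<^sub>0\<close> are the gradients of the following functions at \<open>x\<^sub>N\<close> and \<open>y\<^sub>0\<close>.
\<close>

definition end_fun :: "'w \<Rightarrow> real^'n \<Rightarrow> real" where
  "end_fun \<omega> x = end_cost S \<omega> x - rs N \<omega> \<bullet> end_map S \<omega> x"

definition init_fun :: "'w \<Rightarrow> real^'n \<Rightarrow> real" where
  "init_fun \<omega> y = init_cost S y + ps 0 \<omega> \<bullet> init_map S y"

definition Dend :: "'w \<Rightarrow> real^'n \<Rightarrow> real" where
  "Dend \<omega> = frechet_derivative (end_fun \<omega>) (at (xs N \<omega>))"

definition Dinit :: "'w \<Rightarrow> real^'n \<Rightarrow> real" where
  "Dinit \<omega> = frechet_derivative (init_fun \<omega>) (at (ys 0 \<omega>))"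

lemma jacobian_derivative:
  fixes f :: "real^'n \<Rightarrow> real^'n"
  assumes "C1 f"
  shows "(f has_derivative (\<lambda>h. jacobian f (at a) *v h)) (at a)"
  using C1_derivative[OF assms, of a] jacobian_works differentiable_def by blast

lemma end_fun_derivative:
  assumes \<omega>: "\<omega> \<in> space M"
  shows "(end_fun \<omega> has_derivative Dend \<omega>) (at (xs N \<omega>))"
    "Dend \<omega> h = (gradient (end_cost S \<omega>) (xs N \<omega>) - transpose (jacobian (end_map S \<omega>) (at (xs N \<omega>))) *v rs N \<omega>) \<bullet> h"
proof -
  have d: "(end_fun \<omega> has_derivative (\<lambda>h. frechet_derivative (end_cost S \<omega>) (at (xs N \<omega>)) h
      - rs N \<omega> \<bullet> (jacobian (end_map S \<omega>) (at (xs N \<omega>)) *v h))) (at (xs N \<omega>))"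
    unfolding end_fun_def[abs_def]
    by (intro has_derivative_diff has_derivative_inner_right C1_derivative end_C1 \<omega> jacobian_derivative)
  have e: "Dend \<omega> = (\<lambda>h. frechet_derivative (end_cost S \<omega>) (at (xs N \<omega>)) h
      - rs N \<omega> \<bullet> (jacobian (end_map S \<omega>) (at (xs N \<omega>)) *v h))"
    unfolding Dend_def by (rule frechet_derivative_at[OF d, symmetric])
  show "(end_fun \<omega> has_derivative Dend \<omega>) (at (xs N \<omega>))" using d unfolding e .
  show "Dend \<omega> h = (gradient (end_cost S \<omega>) (xs N \<omega>) - transpose (jacobian (end_map S \<omega>) (at (xs N \<omega>))) *v rs N \<omega>) \<bullet> h"
    unfolding e inner_diff_left gradient_inner[OF C1_derivative[OF end_C1(2)[OF \<omega>]]]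
    by (simp add: dot_lmul_matrix transpose_matrix_vector)
qed

lemma init_fun_derivative:
  shows "(init_fun \<omega> has_derivative Dinit \<omega>) (at (ys 0 \<omega>))"
    "Dinit \<omega> h = (gradient (init_cost S) (ys 0 \<omega>) + transpose (jacobian (init_map S) (at (ys 0 \<omega>))) *v ps 0 \<omega>) \<bullet> h"
proof -
  have d: "(init_fun \<omega> has_derivative (\<lambda>h. frechet_derivative (init_cost S) (at (ys 0 \<omega>)) h
      + ps 0 \<omega> \<bullet> (jacobian (init_map S) (at (ys 0 \<omega>)) *v h))) (at (ys 0 \<omega>))"
    unfolding init_fun_def[abs_def]
    by (intro has_derivative_add has_derivative_inner_right C1_derivative init_C1 jacobian_derivative)
  have e: "Dinit \<omega> = (\<lambda>h. frechet_derivative (init_cost S) (at (ys 0 \<omega>)) h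
      + ps 0 \<omega> \<bullet> (jacobian (init_map S) (at (ys 0 \<omega>)) *v h))"
    unfolding Dinit_def by (rule frechet_derivative_at[OF d, symmetric])
  show "(init_fun \<omega> has_derivative Dinit \<omega>) (at (ys 0 \<omega>))" using d unfolding e .
  show "Dinit \<omega> h = (gradient (init_cost S) (ys 0 \<omega>) + transpose (jacobian (init_map S) (at (ys 0 \<omega>))) *v ps 0 \<omega>) \<bullet> h"
    unfolding e inner_add_left gradient_inner[OF C1_derivative[OF init_C1(2)]]
    by (simp add: dot_lmul_matrix transpose_matrix_vector)
qed

lemma Dend_AE: "AE \<omega> in M. \<forall>h. Dend \<omega> h = ps N \<omega> \<bullet> h"
proof -
  have "AE \<omega> in M. ps N \<omega> = gradient (end_cost S \<omega>) (xs N \<omega>) - transpose (jacobian (end_map S \<omega>) (at (xs N \<omega>))) *v rs N \<omega>"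
    using adjoint by (simp add: adjoint_solution_def)
  then show ?thesis using AE_space by eventually_elim (simp add: end_fun_derivative(2))
qed

lemma Dinit_AE: "AE \<omega> in M. \<forall>h. Dinit \<omega> h = - (rs 0 \<omega> \<bullet> h)"
proof -
  have "AE \<omega> in M. rs 0 \<omega> = - gradient (init_cost S) (ys 0 \<omega>) - transpose (jacobian (init_map S) (at (ys 0 \<omega>))) *v ps 0 \<omega>"
    using adjoint by (simp add: adjoint_solution_def)
  then show ?thesis by eventually_elim (simp add: init_fun_derivative(2) inner_diff_left inner_add_left)
qed

text \<open>The multiplier \<open>rs N\<close> is random and only in L2, so the terminal map has to
  be Lipschitz for the bound to have a square integrable coefficient.\<close>

lemma end_smooth: obtains G C where "smooth_growth M end_fun Dend (xs N) G C"
proof -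
  obtain C where C: "0 \<le> C"
    and gr: "\<And>\<omega> x x'. \<omega> \<in> space M \<Longrightarrow> \<bar>end_cost S \<omega> x - end_cost S \<omega> x'\<bar> \<le> C * (1 + norm x + norm x') * norm (x - x')"
    by (rule cost_growth) blast
  obtain L where L: "AE \<omega> in M. \<forall>x x'. norm (end_map S \<omega> x - end_map S \<omega> x') \<le> L * norm (x - x')"
    using lip_end by (auto simp: lipschitz_end_map_def)
  have rN: "sqint M (rs N)" by (rule L2F_D(2)[OF rs order_refl])
  have "sqint M (\<lambda>\<omega>. C + L *\<^sub>R norm (rs N \<omega>))"
    using rN by (intro sqint_add(1) sqint_scaleR(1) sqint_const finite_measure_axioms) (auto simp: sqint_def)
  then have G: "sqint M (\<lambda>\<omega>. C + L * norm (rs N \<omega>))" by simp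
  have "smooth_growth M end_fun Dend (xs N) (\<lambda>\<omega>. C + L * norm (rs N \<omega>)) C"
  proof
    show "sqint M (xs N)" by (rule L2F_D(2)[OF xs order_refl])
    show "AE \<omega> in M. \<forall>x x'. \<bar>end_fun \<omega> x - end_fun \<omega> x'\<bar>
        \<le> (C + L * norm (rs N \<omega>) + C * (norm x + norm x')) * norm (x - x')"
      using L AE_space
    proof eventually_elim
      case (elim \<omega>)
      show ?case
      proof (intro allI)
        fix x x'
        have "\<bar>rs N \<omega> \<bullet> (end_map S \<omega> x - end_map S \<omega> x')\<bar> \<le> norm (rs N \<omega>) * norm (end_map S \<omega> x - end_map S \<omega> x')"
          by (rule Cauchy_Schwarz_ineq2)
        also have "\<dots> \<le> norm (rs N \<omega>) * (L * norm (x - x'))"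
          using elim(1) by (intro mult_left_mono) auto
        finally have "\<bar>end_fun \<omega> x - end_fun \<omega> x'\<bar> \<le> C * (1 + norm x + norm x') * norm (x - x') + norm (rs N \<omega>) * (L * norm (x - x'))"
          using gr[OF elim(2), of x x'] by (simp add: end_fun_def inner_diff_right)
        then show "\<bar>end_fun \<omega> x - end_fun \<omega> x'\<bar> \<le> (C + L * norm (rs N \<omega>) + C * (norm x + norm x')) * norm (x - x')"
          by (simp add: algebra_simps)
      qed
    qed
  qed (use G C end_fun_derivative in auto)
  then show thesis by (rule that)
qed

text \<open>The initial map has a derivative of linear growth, which is harmless because its
  multiplier \<open>ps 0\<close> is a deterministic vector; the coefficient is a constant.\<close>

lemma init_smooth: obtains G C where "smooth_growth M init_fun Dinit (ys 0) G C"
proof -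
  obtain C where C: "0 \<le> C"
    and gr: "\<And>y y'. norm (init_map S y - init_map S y') \<le> C * (1 + norm y + norm y') * norm (y - y')"
      "\<And>y y'. \<bar>init_cost S y - init_cost S y'\<bar> \<le> C * (1 + norm y + norm y') * norm (y - y')"
    by (rule cost_growth) blast
  define c where "c = C * (1 + norm (ps 0 base))"
  have c: "0 \<le> c" using C by (simp add: c_def)
  have "smooth_growth M init_fun Dinit (ys 0) (\<lambda>_. c) c"
  proof
    show "sqint M (ys 0)" by (rule L2F_D(2)[OF ys le0])
    show "AE \<omega> in M. \<forall>y y'. \<bar>init_fun \<omega> y - init_fun \<omega> y'\<bar> \<le> (c + c * (norm y + norm y')) * norm (y - y')"
    proof (intro AE_I2 allI)
      fix \<omega> y y' assume \<omega>: "\<omega> \<in> space M"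
      have p: "ps 0 \<omega> = ps 0 base" by (rule filt_0_value[OF L2F_D(1)[OF ps le0] \<omega>])
      have "\<bar>ps 0 \<omega> \<bullet> (init_map S y - init_map S y')\<bar> \<le> norm (ps 0 base) * norm (init_map S y - init_map S y')"
        unfolding p by (rule Cauchy_Schwarz_ineq2)
      also have "\<dots> \<le> norm (ps 0 base) * (C * (1 + norm y + norm y') * norm (y - y'))"
        by (intro mult_left_mono gr) simp
      finally have "\<bar>init_fun \<omega> y - init_fun \<omega> y'\<bar> \<le> C * (1 + norm y + norm y') * norm (y - y')
          + norm (ps 0 base) * (C * (1 + norm y + norm y') * norm (y - y'))"
        using gr(2)[of y y'] by (simp add: init_fun_def inner_diff_right)
      then show "\<bar>init_fun \<omega> y - init_fun \<omega> y'\<bar> \<le> (c + c * (norm y + norm y')) * norm (y - y')"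
        by (simp add: c_def algebra_simps)
    qed
  qed (use c init_fun_derivative finite_measure_axioms in auto)
  then show thesis by (rule that)
qed

end

section \<open>The exact cost difference for a competing control\<close>

locale competitor = extremal M N w S U us xs ys ps rs
  for M :: "'w measure" and N w and S :: "('w, 'n::finite, 'm::finite) system" and U us xs ys ps rs +
  fixes v :: "nat \<Rightarrow> 'w \<Rightarrow> real^'m" and x y :: "nat \<Rightarrow> 'w \<Rightarrow> real^'n"
  assumes v: "v \<in> controls M N w U" and solution: "state_solution S M N w v x y"
begin

lemma x: "x \<in> L2F M w {..N}" and y: "y \<in> L2F M w {..N}"
  using solution unfolding state_solution_def by blast+

definition dx :: "nat \<Rightarrow> 'w \<Rightarrow> real^'n" where "dx k \<omega> = x k \<omega> - xs k \<omega>"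
definition dy :: "nat \<Rightarrow> 'w \<Rightarrow> real^'n" where "dy k \<omega> = y k \<omega> - ys k \<omega>"
definition du :: "nat \<Rightarrow> 'w \<Rightarrow> real^'m" where "du k \<omega> = v k \<omega> - us k \<omega>"
definition dq where "dq k \<omega> = arg x y v k \<omega> - arg xs ys us k \<omega>"

lemma dx_L2: "k \<le> N \<Longrightarrow> sqint M (dx k)" and dy_L2: "k \<le> N \<Longrightarrow> sqint M (dy k)"
  unfolding dx_def[abs_def] dy_def[abs_def] by (intro sqint_diff(1) L2F_D(2) x xs y ys; assumption)+

lemma dx_measurable: "k \<le> N \<Longrightarrow> dx k \<in> borel_measurable (filt M w k)"
  unfolding dx_def[abs_def] by (intro borel_measurable_diff L2F_D(1) x xs)

lemma dq_L2: "k < N \<Longrightarrow> sqint M (dq k)"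
  unfolding dq_def[abs_def] by (intro sqint_diff(1) arg_L2(2) x xs y ys v us)

lemma segment_measurable:
  assumes k: "k < N" and t: "0 \<le> t" "t \<le> 1"
  shows "(\<lambda>\<omega>. Ham k \<omega> (arg xs ys us k \<omega> + t *\<^sub>R dq k \<omega>)) \<in> borel_measurable M"
proof -
  have kN: "k \<le> N" using k by simp
  \<comment> \<open>The segment between two admissible controls stays in the convex set, where the
    coefficients are adapted.\<close>
  have U: "us k \<omega> + t *\<^sub>R (v k \<omega> - us k \<omega>) \<in> U k" if "\<omega> \<in> space M" for \<omega>
  proof -
    have "(1 - t) *\<^sub>R us k \<omega> + t *\<^sub>R v k \<omega> \<in> U k"
      using convexD[OF U_convex[OF k] controls_D(3)[OF us k that] controls_D(3)[OF v k that], of "1 - t" t] t by simp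
    then show ?thesis by (simp add: algebra_simps)
  qed
  have "(\<lambda>\<omega>. Ham k \<omega> (xs k \<omega> + t *\<^sub>R (x k \<omega> - xs k \<omega>),
      cond_mean M w ys k \<omega> + t *\<^sub>R (cond_mean M w y k \<omega> - cond_mean M w ys k \<omega>),
      cond_corr M w ys k \<omega> + t *\<^sub>R (cond_corr M w y k \<omega> - cond_corr M w ys k \<omega>),
      us k \<omega> + t *\<^sub>R (v k \<omega> - us k \<omega>))) \<in> borel_measurable (filt M w k)"
    by (intro Ham_measurable k borel_measurable_add borel_measurable_scaleR borel_measurable_diff borel_measurable_const
        L2F_D(1)[OF xs kN] L2F_D(1)[OF x kN] cond_mean_measurable cond_corr_measurable
        controls_D(1)[OF us k] controls_D(1)[OF v k] U)
  from filt_measurable_imp[OF kN this] show ?thesis by (simp add: arg_def dq_def)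
qed

lemma end_segment_measurable: "(\<lambda>\<omega>. end_fun \<omega> (xs N \<omega> + t *\<^sub>R dx N \<omega>)) \<in> borel_measurable M"
  unfolding end_fun_def
  by (intro filt_measurable_imp[OF order_refl] borel_measurable_diff borel_measurable_inner end_measurable
      borel_measurable_add borel_measurable_scaleR borel_measurable_const dx_measurable
      L2F_D(1)[OF xs] L2F_D(1)[OF rs] order_refl)

lemma init_segment_measurable: "(\<lambda>\<omega>. init_fun \<omega> (ys 0 \<omega> + t *\<^sub>R dy 0 \<omega>)) \<in> borel_measurable M"
proof -
  have "init_fun \<omega> (ys 0 \<omega> + t *\<^sub>R dy 0 \<omega>) = init_fun base (ys 0 base + t *\<^sub>R dy 0 base)" if \<omega>: "\<omega> \<in> space M" for \<omega>
    using filt_0_value[OF L2F_D(1)[OF ys le0] \<omega>] filt_0_value[OF L2F_D(1)[OF y le0] \<omega>]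
      filt_0_value[OF L2F_D(1)[OF ps le0] \<omega>] by (simp add: init_fun_def dy_def)
  then show ?thesis by (subst measurable_cong[where g = "\<lambda>_. init_fun base (ys 0 base + t *\<^sub>R dy 0 base)"]) auto
qed

definition RH :: "nat \<Rightarrow> 'w \<Rightarrow> real" where
  "RH k \<omega> = Ham k \<omega> (arg xs ys us k \<omega> + dq k \<omega>) - Ham k \<omega> (arg xs ys us k \<omega>) - DHam k \<omega> (dq k \<omega>)"

definition Rend :: "'w \<Rightarrow> real" where
  "Rend \<omega> = end_fun \<omega> (xs N \<omega> + dx N \<omega>) - end_fun \<omega> (xs N \<omega>) - Dend \<omega> (dx N \<omega>)"

definition Rinit :: "'w \<Rightarrow> real" where
  "Rinit \<omega> = init_fun \<omega> (ys 0 \<omega> + dy 0 \<omega>) - init_fun \<omega> (ys 0 \<omega>) - Dinit \<omega> (dy 0 \<omega>)"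

definition dl :: "nat \<Rightarrow> 'w \<Rightarrow> real" where
  "dl k \<omega> = (\<lambda>(x, y, z, u). run_cost S k x y z u \<omega>) (arg x y v k \<omega>)
    - (\<lambda>(x, y, z, u). run_cost S k x y z u \<omega>) (arg xs ys us k \<omega>)"

text \<open>The increment of the Hamiltonian is evaluated in two ways. Exactly, the state equations
  produce the pairings of \<open>ps\<close> at time \<open>Suc k\<close> and of \<open>rs\<close> at
  time \<open>k\<close>; linearly, the adjoint equations produce those of \<open>ps\<close> at
  \<open>k\<close> and of \<open>rs\<close> at \<open>Suc k\<close>, plus the control term. The
  difference telescopes in \<open>k\<close>.\<close>

lemma integral_RH:
  assumes k: "k < N"
  shows "(LINT \<omega>|M. RH k \<omega>) = (LINT \<omega>|M. ps (Suc k) \<omega> \<bullet> dx (Suc k) \<omega>) + (LINT \<omega>|M. rs (Suc k) \<omega> \<bullet> dy (Suc k) \<omega>)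
    - (LINT \<omega>|M. ps k \<omega> \<bullet> dx k \<omega>) - (LINT \<omega>|M. rs k \<omega> \<bullet> dy k \<omega>) + (LINT \<omega>|M. dl k \<omega>)
    - (LINT \<omega>|M. Hu k \<omega> \<bullet> du k \<omega>)"
proof -
  have kN: "k \<le> N" "Suc k \<le> N" using k by auto
  obtain G C where "smooth_growth M (Ham k) (DHam k) (arg xs ys us k) G C" by (rule Ham_smooth[OF k])
  then interpret SG: smooth_growth M "Ham k" "DHam k" "arg xs ys us k" G C .
  note iD = SG.deriv_integrable[OF dq_L2[OF k] segment_measurable[OF k]]
    and iH = SG.increment_integrable[OF dq_L2[OF k] segment_measurable[OF k]]
  have sps: "sqint M (ps (Suc k))" "sqint M (ps k)" and srs: "sqint M (rs (Suc k))" "sqint M (rs k)"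
    using L2F_D(2)[OF ps] L2F_D(2)[OF rs] kN by auto
  have sy: "sqint M (y (Suc k))" "sqint M (ys (Suc k))" using L2F_D(2)[OF y] L2F_D(2)[OF ys] kN by auto
  obtain K where K: "0 \<le> K"
    and Kl: "\<And>k \<omega> h x y z u x' y' z' u'. k < N \<Longrightarrow> \<omega> \<in> space M \<Longrightarrow>
      h \<in> {drift S k, diffusion S k, backward S (Suc k)} \<Longrightarrow>
      norm (h x y z u \<omega> - h x' y' z' u' \<omega>) \<le> K * norm ((x, y, z, u) - (x', y', z', u'))"
    by (rule coefficients_lipschitz) blast
  define dc where "dc h \<omega> = h (x k \<omega>) (cond_mean M w y k \<omega>) (cond_corr M w y k \<omega>) (v k \<omega>) \<omega>
    - h (xs k \<omega>) (cond_mean M w ys k \<omega>) (cond_corr M w ys k \<omega>) (us k \<omega>) \<omega>"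
    for h :: "real^'n \<Rightarrow> real^'n \<Rightarrow> real^'n \<Rightarrow> real^'m \<Rightarrow> 'w \<Rightarrow> real^'n" and \<omega>
  have dc: "dc h \<in> borel_measurable (filt M w k)" "sqint M (dc h)"
    if h: "h \<in> {drift S k, diffusion S k, backward S (Suc k)}" for h
  proof -
    have "(\<lambda>\<omega>. h (x k \<omega>) (cond_mean M w y k \<omega>) (cond_corr M w y k \<omega>) (v k \<omega>) \<omega>) \<in> borel_measurable (filt M w k)"
      "(\<lambda>\<omega>. h (xs k \<omega>) (cond_mean M w ys k \<omega>) (cond_corr M w ys k \<omega>) (us k \<omega>) \<omega>) \<in> borel_measurable (filt M w k)"
      using h coefficients_measurable[OF k L2F_D(1)[OF x kN(1)] cond_mean_measurable cond_corr_measurable controls_D(1)[OF v k] controls_D(3)[OF v k]]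
        coefficients_measurable[OF k L2F_D(1)[OF xs kN(1)] cond_mean_measurable cond_corr_measurable controls_D(1)[OF us k] controls_D(3)[OF us k]]
      by auto
    then show m: "dc h \<in> borel_measurable (filt M w k)" unfolding dc_def[abs_def] by (rule borel_measurable_diff)
    show "sqint M (dc h)"
    proof (rule sqint_bound(1)[OF _ filt_measurable_imp[OF kN(1) m]])
      show "integrable M (\<lambda>\<omega>. K\<^sup>2 * (norm (dq k \<omega>))\<^sup>2)" using sqintD(2)[OF dq_L2[OF k]] by simp
      show "AE \<omega> in M. (norm (dc h \<omega>))\<^sup>2 \<le> K\<^sup>2 * (norm (dq k \<omega>))\<^sup>2"
        unfolding power_mult_distrib[symmetric] dc_def dq_def arg_def
        by (intro AE_I2 power_mono Kl[OF k _ h]) simp_all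
    qed
  qed
  note cm = cond_mean_L2[OF k, of ps, OF sps(1)] and cc = cond_corr_L2[OF k, of ps, OF sps(1)]
  note b = dc[of "drift S k", simplified] and sg = dc[of "diffusion S k", simplified]
    and f = dc[of "backward S (Suc k)", simplified]
  note n = sqint_noise[OF k sg]
  have idl: "integrable M (dl k)"
    unfolding dl_def[abs_def] by (intro Bochner_Integration.integrable_diff trajectory_cost_parts(1)[OF x y v k]
        trajectory_cost_parts(1)[OF xs ys us k])
  \<comment> \<open>Nothing is linearised in this part: the true increments of drift, diffusion and
    backward coefficient are paired with the adjoints, and the conditional quantities of
    \<open>ps\<close> are replaced by \<open>ps (Suc k)\<close> itself.\<close>
  have "(LINT \<omega>|M. Ham k \<omega> (arg xs ys us k \<omega> + dq k \<omega>) - Ham k \<omega> (arg xs ys us k \<omega>))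
      = (LINT \<omega>|M. dc (drift S k) \<omega> \<bullet> cond_mean M w ps k \<omega> + dc (diffusion S k) \<omega> \<bullet> cond_corr M w ps k \<omega>
          + dc (backward S (Suc k)) \<omega> \<bullet> rs k \<omega> + dl k \<omega>)"
    by (intro Bochner_Integration.integral_cong refl)
      (simp add: Ham_eq dq_def arg_def dc_def dl_def inner_diff_left)
  also have "\<dots> = (LINT \<omega>|M. dc (drift S k) \<omega> \<bullet> cond_mean M w ps k \<omega>) + (LINT \<omega>|M. dc (diffusion S k) \<omega> \<bullet> cond_corr M w ps k \<omega>)
          + (LINT \<omega>|M. dc (backward S (Suc k)) \<omega> \<bullet> rs k \<omega>) + (LINT \<omega>|M. dl k \<omega>)"
    using sqint_inner[OF b(2) cm(1)] sqint_inner[OF sg(2) cc(1)] sqint_inner[OF f(2) srs(2)] idl by simp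
  also have "(LINT \<omega>|M. dc (drift S k) \<omega> \<bullet> cond_mean M w ps k \<omega>) = (LINT \<omega>|M. dc (drift S k) \<omega> \<bullet> ps (Suc k) \<omega>)"
    by (rule cm(3)[OF b])
  also have "(LINT \<omega>|M. dc (diffusion S k) \<omega> \<bullet> cond_corr M w ps k \<omega>)
      = (LINT \<omega>|M. (w k \<omega> *\<^sub>R dc (diffusion S k) \<omega>) \<bullet> ps (Suc k) \<omega>)"
    by (rule cc(3)[OF sg])
  also have "(LINT \<omega>|M. dc (drift S k) \<omega> \<bullet> ps (Suc k) \<omega>) + (LINT \<omega>|M. (w k \<omega> *\<^sub>R dc (diffusion S k) \<omega>) \<bullet> ps (Suc k) \<omega>)
      = (LINT \<omega>|M. dc (drift S k) \<omega> \<bullet> ps (Suc k) \<omega> + (w k \<omega> *\<^sub>R dc (diffusion S k) \<omega>) \<bullet> ps (Suc k) \<omega>)"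
    using sqint_inner[OF b(2) sps(1)] sqint_inner[OF n(1) sps(1)] by simp
  also have "\<dots> = (LINT \<omega>|M. ps (Suc k) \<omega> \<bullet> dx (Suc k) \<omega>)"
  proof (rule integral_cong_AE)
    show "(\<lambda>\<omega>. dc (drift S k) \<omega> \<bullet> ps (Suc k) \<omega> + (w k \<omega> *\<^sub>R dc (diffusion S k) \<omega>) \<bullet> ps (Suc k) \<omega>) \<in> borel_measurable M"
      using sqint_inner[OF b(2) sps(1)] sqint_inner[OF n(1) sps(1)] by simp
    show "(\<lambda>\<omega>. ps (Suc k) \<omega> \<bullet> dx (Suc k) \<omega>) \<in> borel_measurable M"
      using sqint_inner[OF sps(1) dx_L2[OF kN(2)]] by simp
    have "AE \<omega> in M. x (Suc k) \<omega> = drift S k (x k \<omega>) (cond_mean M w y k \<omega>) (cond_corr M w y k \<omega>) (v k \<omega>) \<omega>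
        + w k \<omega> *\<^sub>R diffusion S k (x k \<omega>) (cond_mean M w y k \<omega>) (cond_corr M w y k \<omega>) (v k \<omega>) \<omega>"
      "AE \<omega> in M. xs (Suc k) \<omega> = drift S k (xs k \<omega>) (cond_mean M w ys k \<omega>) (cond_corr M w ys k \<omega>) (us k \<omega>) \<omega>
        + w k \<omega> *\<^sub>R diffusion S k (xs k \<omega>) (cond_mean M w ys k \<omega>) (cond_corr M w ys k \<omega>) (us k \<omega>) \<omega>"
      using solution state k by (auto simp: state_solution_def)
    then show "AE \<omega> in M. dc (drift S k) \<omega> \<bullet> ps (Suc k) \<omega> + (w k \<omega> *\<^sub>R dc (diffusion S k) \<omega>) \<bullet> ps (Suc k) \<omega>
        = ps (Suc k) \<omega> \<bullet> dx (Suc k) \<omega>"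
    proof eventually_elim
      case (elim \<omega>)
      have "dx (Suc k) \<omega> = dc (drift S k) \<omega> + w k \<omega> *\<^sub>R dc (diffusion S k) \<omega>"
        unfolding dx_def elim dc_def by (simp add: algebra_simps)
      then show ?case by (simp add: inner_add_left inner_add_right inner_commute)
    qed
  qed
  also have "(LINT \<omega>|M. dc (backward S (Suc k)) \<omega> \<bullet> rs k \<omega>) = (LINT \<omega>|M. - (rs k \<omega> \<bullet> dy k \<omega>))"
  proof (rule integral_cong_AE)
    show "(\<lambda>\<omega>. dc (backward S (Suc k)) \<omega> \<bullet> rs k \<omega>) \<in> borel_measurable M"
      using sqint_inner[OF f(2) srs(2)] by simp
    show "(\<lambda>\<omega>. - (rs k \<omega> \<bullet> dy k \<omega>)) \<in> borel_measurable M"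
      using sqint_inner[OF srs(2) dy_L2[OF kN(1)]] by simp
    have "AE \<omega> in M. y k \<omega> = - backward S (Suc k) (x k \<omega>) (cond_mean M w y k \<omega>) (cond_corr M w y k \<omega>) (v k \<omega>) \<omega>"
      "AE \<omega> in M. ys k \<omega> = - backward S (Suc k) (xs k \<omega>) (cond_mean M w ys k \<omega>) (cond_corr M w ys k \<omega>) (us k \<omega>) \<omega>"
      using solution state k by (auto simp: state_solution_def)
    then show "AE \<omega> in M. dc (backward S (Suc k)) \<omega> \<bullet> rs k \<omega> = - (rs k \<omega> \<bullet> dy k \<omega>)"
    proof eventually_elim
      case (elim \<omega>)
      have "dy k \<omega> = - dc (backward S (Suc k)) \<omega>" unfolding dy_def elim dc_def by simp
      then show ?case by (simp add: inner_commute)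
    qed
  qed
  finally have 1: "(LINT \<omega>|M. Ham k \<omega> (arg xs ys us k \<omega> + dq k \<omega>) - Ham k \<omega> (arg xs ys us k \<omega>))
      = (LINT \<omega>|M. ps (Suc k) \<omega> \<bullet> dx (Suc k) \<omega>) + (LINT \<omega>|M. - (rs k \<omega> \<bullet> dy k \<omega>)) + (LINT \<omega>|M. dl k \<omega>)" .
  note H = Hy_Hz_L2[OF k]
  define dm where "dm \<omega> = cond_mean M w y k \<omega> - cond_mean M w ys k \<omega>" for \<omega>
  define dr where "dr \<omega> = cond_corr M w y k \<omega> - cond_corr M w ys k \<omega>" for \<omega>
  have dm: "sqint M dm" and dr: "sqint M dr"
    unfolding dm_def[abs_def] dr_def[abs_def]
    by (intro sqint_diff(1) cond_mean_L2(1)[OF k, of y, OF sy(1)] cond_mean_L2(1)[OF k, of ys, OF sy(2)]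
        cond_corr_L2(1)[OF k, of y, OF sy(1)] cond_corr_L2(1)[OF k, of ys, OF sy(2)])+
  have px: "AE \<omega> in M. Hx k \<omega> = ps k \<omega>" using adjoint k by (auto simp: adjoint_solution_def)
  have i1: "integrable M (\<lambda>\<omega>. ps k \<omega> \<bullet> dx k \<omega>)" "integrable M (\<lambda>\<omega>. Hy k \<omega> \<bullet> dm \<omega>)" "integrable M (\<lambda>\<omega>. Hz k \<omega> \<bullet> dr \<omega>)"
    by (intro sqint_inner sps dx_L2 kN H dm dr)+
  \<comment> \<open>The control term is what remains of the full derivative after the three state
    terms; since those are integrable, so is it.\<close>
  have Hu_eq: "AE \<omega> in M. Hu k \<omega> \<bullet> du k \<omega> = DHam k \<omega> (dq k \<omega>) - ps k \<omega> \<bullet> dx k \<omega> - Hy k \<omega> \<bullet> dm \<omega> - Hz k \<omega> \<bullet> dr \<omega>"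
    using px AE_space
  proof eventually_elim
    case (elim \<omega>)
    have "dq k \<omega> = (dx k \<omega>, dm \<omega>, dr \<omega>, du k \<omega>)" by (simp add: dq_def arg_def dx_def dm_def dr_def du_def)
    then show ?case using DHam_partials(5)[OF k elim(2), of "dx k \<omega>" "dm \<omega>" "dr \<omega>" "du k \<omega>"] elim(1) by simp
  qed
  have Hu_m: "(\<lambda>\<omega>. Hu k \<omega> \<bullet> du k \<omega>) \<in> borel_measurable M"
  proof -
    have "(\<lambda>\<omega>. DHam k \<omega> (0, 0, 0, du k \<omega>)) \<in> borel_measurable M"
    proof (rule SG.deriv_measurable[OF refl])
      fix t :: real assume t: "0 \<le> t" "t \<le> 1"
      have U: "us k \<omega> + t *\<^sub>R (v k \<omega> - us k \<omega>) \<in> U k" if "\<omega> \<in> space M" for \<omega>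
      proof -
        have "(1 - t) *\<^sub>R us k \<omega> + t *\<^sub>R v k \<omega> \<in> U k"
          using convexD[OF U_convex[OF k] controls_D(3)[OF us k that] controls_D(3)[OF v k that], of "1 - t" t] t by simp
        then show ?thesis by (simp add: algebra_simps)
      qed
      have "(\<lambda>\<omega>. Ham k \<omega> (xs k \<omega>, cond_mean M w ys k \<omega>, cond_corr M w ys k \<omega>, us k \<omega> + t *\<^sub>R (v k \<omega> - us k \<omega>)))
          \<in> borel_measurable (filt M w k)"
        by (intro Ham_measurable k borel_measurable_add borel_measurable_scaleR borel_measurable_diff borel_measurable_const
            L2F_D(1)[OF xs kN(1)] cond_mean_measurable cond_corr_measurable
            controls_D(1)[OF us k] controls_D(1)[OF v k] U)
      from filt_measurable_imp[OF kN(1) this]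
      show "(\<lambda>\<omega>. Ham k \<omega> (arg xs ys us k \<omega> + t *\<^sub>R (0, 0, 0, du k \<omega>))) \<in> borel_measurable M"
        by (simp add: arg_def du_def)
    qed
    then show ?thesis
      by (rule measurable_cong[THEN iffD1, rotated]) (simp add: DHam_partials(4)[OF k])
  qed
  have "(LINT \<omega>|M. Hu k \<omega> \<bullet> du k \<omega>) = (LINT \<omega>|M. DHam k \<omega> (dq k \<omega>) - ps k \<omega> \<bullet> dx k \<omega> - Hy k \<omega> \<bullet> dm \<omega> - Hz k \<omega> \<bullet> dr \<omega>)"
    using Hu_eq Hu_m iD i1 by (intro integral_cong_AE) auto
  also have "\<dots> = (LINT \<omega>|M. DHam k \<omega> (dq k \<omega>)) - (LINT \<omega>|M. ps k \<omega> \<bullet> dx k \<omega>)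
      - (LINT \<omega>|M. Hy k \<omega> \<bullet> dm \<omega>) - (LINT \<omega>|M. Hz k \<omega> \<bullet> dr \<omega>)"
    using iD i1 by simp
  finally have 2: "(LINT \<omega>|M. DHam k \<omega> (dq k \<omega>)) = (LINT \<omega>|M. Hu k \<omega> \<bullet> du k \<omega>) + (LINT \<omega>|M. ps k \<omega> \<bullet> dx k \<omega>)
      + ((LINT \<omega>|M. Hy k \<omega> \<bullet> dm \<omega>) + (LINT \<omega>|M. Hz k \<omega> \<bullet> dr \<omega>))" by simp
  have sdy: "sqint M (dy (Suc k))" by (rule dy_L2[OF kN(2)])
  note cmd = cond_mean_L2[OF k, of dy, OF sdy] and ccd = cond_corr_L2[OF k, of dy, OF sdy]
  note nz = sqint_noise[OF k H(3,4)]
  \<comment> \<open>Differences of conditional quantities become conditional quantities of the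
    difference, and testing with an adapted gradient replaces them by \<open>dy (Suc k)\<close>, so
    that the adjoint recursion for \<open>rs (Suc k)\<close> applies.\<close>
  have "(LINT \<omega>|M. Hy k \<omega> \<bullet> dm \<omega>) = (LINT \<omega>|M. Hy k \<omega> \<bullet> cond_mean M w dy k \<omega>)"
  proof (rule integral_cong_AE)
    show "AE \<omega> in M. Hy k \<omega> \<bullet> dm \<omega> = Hy k \<omega> \<bullet> cond_mean M w dy k \<omega>"
      using cond_mean_diff[OF k, of y ys, OF sy] by eventually_elim (simp add: dm_def dy_def[abs_def])
  qed (use i1 sqint_inner[OF H(2) cmd(1)] in auto)
  also have "\<dots> = (LINT \<omega>|M. Hy k \<omega> \<bullet> dy (Suc k) \<omega>)" by (rule cmd(3)[OF H(1,2)])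
  finally have 3: "(LINT \<omega>|M. Hy k \<omega> \<bullet> dm \<omega>) = (LINT \<omega>|M. Hy k \<omega> \<bullet> dy (Suc k) \<omega>)" .
  have "(LINT \<omega>|M. Hz k \<omega> \<bullet> dr \<omega>) = (LINT \<omega>|M. Hz k \<omega> \<bullet> cond_corr M w dy k \<omega>)"
  proof (rule integral_cong_AE)
    show "AE \<omega> in M. Hz k \<omega> \<bullet> dr \<omega> = Hz k \<omega> \<bullet> cond_corr M w dy k \<omega>"
      using cond_corr_diff[OF k, of y ys, OF sy] by eventually_elim (simp add: dr_def dy_def[abs_def])
  qed (use i1 sqint_inner[OF H(4) ccd(1)] in auto)
  also have "\<dots> = (LINT \<omega>|M. (w k \<omega> *\<^sub>R Hz k \<omega>) \<bullet> dy (Suc k) \<omega>)" by (rule ccd(3)[OF H(3,4)])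
  finally have 4: "(LINT \<omega>|M. Hz k \<omega> \<bullet> dr \<omega>) = (LINT \<omega>|M. (w k \<omega> *\<^sub>R Hz k \<omega>) \<bullet> dy (Suc k) \<omega>)" .
  have i2: "integrable M (\<lambda>\<omega>. Hy k \<omega> \<bullet> dy (Suc k) \<omega>)" "integrable M (\<lambda>\<omega>. (w k \<omega> *\<^sub>R Hz k \<omega>) \<bullet> dy (Suc k) \<omega>)"
    by (intro sqint_inner H sdy nz)+
  have "(LINT \<omega>|M. Hy k \<omega> \<bullet> dy (Suc k) \<omega>) + (LINT \<omega>|M. (w k \<omega> *\<^sub>R Hz k \<omega>) \<bullet> dy (Suc k) \<omega>)
      = (LINT \<omega>|M. Hy k \<omega> \<bullet> dy (Suc k) \<omega> + (w k \<omega> *\<^sub>R Hz k \<omega>) \<bullet> dy (Suc k) \<omega>)"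
    using i2 by simp
  also have "\<dots> = (LINT \<omega>|M. - (rs (Suc k) \<omega> \<bullet> dy (Suc k) \<omega>))"
  proof (rule integral_cong_AE)
    have "AE \<omega> in M. rs (Suc k) \<omega> = - Hy k \<omega> - w k \<omega> *\<^sub>R Hz k \<omega>"
      using adjoint k by (auto simp: adjoint_solution_def)
    then show "AE \<omega> in M. Hy k \<omega> \<bullet> dy (Suc k) \<omega> + (w k \<omega> *\<^sub>R Hz k \<omega>) \<bullet> dy (Suc k) \<omega> = - (rs (Suc k) \<omega> \<bullet> dy (Suc k) \<omega>)"
      by eventually_elim (simp add: inner_diff_left)
  qed (use i2 sqint_inner[OF srs(1) sdy] in auto)
  finally have 5: "(LINT \<omega>|M. Hy k \<omega> \<bullet> dy (Suc k) \<omega>) + (LINT \<omega>|M. (w k \<omega> *\<^sub>R Hz k \<omega>) \<bullet> dy (Suc k) \<omega>)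
      = - (LINT \<omega>|M. rs (Suc k) \<omega> \<bullet> dy (Suc k) \<omega>)" by simp
  have "(LINT \<omega>|M. RH k \<omega>) = (LINT \<omega>|M. Ham k \<omega> (arg xs ys us k \<omega> + dq k \<omega>) - Ham k \<omega> (arg xs ys us k \<omega>))
      - (LINT \<omega>|M. DHam k \<omega> (dq k \<omega>))"
    unfolding RH_def using iH iD by (rule Bochner_Integration.integral_diff)
  then show ?thesis unfolding 1 2 3 4 5 by simp
qed

end

context competitor
begin

text \<open>The state's terminal condition turns the increment of the terminal map into
  \<open>dy N\<close>, and the adjoint's identifies the derivative with \<open>ps N\<close>: the two
  pairings are those left over from the telescoping sum.\<close>

lemma integral_Rend:
  "(LINT \<omega>|M. Rend \<omega>) = (LINT \<omega>|M. end_cost S \<omega> (x N \<omega>)) - (LINT \<omega>|M. end_cost S \<omega> (xs N \<omega>))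
    - (LINT \<omega>|M. rs N \<omega> \<bullet> dy N \<omega>) - (LINT \<omega>|M. ps N \<omega> \<bullet> dx N \<omega>)"
proof -
  obtain G C where "smooth_growth M end_fun Dend (xs N) G C" by (rule end_smooth)
  then interpret SG: smooth_growth M end_fun Dend "xs N" G C .
  note iD = SG.deriv_integrable[OF dx_L2[OF order_refl] end_segment_measurable]
    and iH = SG.increment_integrable[OF dx_L2[OF order_refl] end_segment_measurable]
  have i: "integrable M (\<lambda>\<omega>. rs N \<omega> \<bullet> dy N \<omega>)" "integrable M (\<lambda>\<omega>. ps N \<omega> \<bullet> dx N \<omega>)"
    by (intro sqint_inner dx_L2 dy_L2 order_refl L2F_D(2)[OF rs] L2F_D(2)[OF ps])+
  note ie = trajectory_cost_parts(2)[OF x y v] trajectory_cost_parts(2)[OF xs ys us]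
  have "(LINT \<omega>|M. Rend \<omega>) = (LINT \<omega>|M. end_cost S \<omega> (x N \<omega>) - end_cost S \<omega> (xs N \<omega>)
      - rs N \<omega> \<bullet> dy N \<omega> - ps N \<omega> \<bullet> dx N \<omega>)"
  proof (rule integral_cong_AE)
    have "AE \<omega> in M. y N \<omega> = end_map S \<omega> (x N \<omega>)" "AE \<omega> in M. ys N \<omega> = end_map S \<omega> (xs N \<omega>)"
      using solution state by (auto simp: state_solution_def)
    with Dend_AE
    show "AE \<omega> in M. Rend \<omega> = end_cost S \<omega> (x N \<omega>) - end_cost S \<omega> (xs N \<omega>) - rs N \<omega> \<bullet> dy N \<omega> - ps N \<omega> \<bullet> dx N \<omega>"
      by eventually_elim (simp add: Rend_def end_fun_def dx_def dy_def inner_diff_right)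
  qed (use iD iH ie i in \<open>auto simp: Rend_def[abs_def]\<close>)
  then show ?thesis using ie i by simp
qed

lemma integral_Rinit:
  "(LINT \<omega>|M. Rinit \<omega>) = (LINT \<omega>|M. init_cost S (y 0 \<omega>)) - (LINT \<omega>|M. init_cost S (ys 0 \<omega>))
    + (LINT \<omega>|M. ps 0 \<omega> \<bullet> dx 0 \<omega>) + (LINT \<omega>|M. rs 0 \<omega> \<bullet> dy 0 \<omega>)"
proof -
  obtain G C where "smooth_growth M init_fun Dinit (ys 0) G C" by (rule init_smooth)
  then interpret SG: smooth_growth M init_fun Dinit "ys 0" G C .
  note iD = SG.deriv_integrable[OF dy_L2[OF le0] init_segment_measurable]
    and iH = SG.increment_integrable[OF dy_L2[OF le0] init_segment_measurable]
  have i: "integrable M (\<lambda>\<omega>. rs 0 \<omega> \<bullet> dy 0 \<omega>)" "integrable M (\<lambda>\<omega>. ps 0 \<omega> \<bullet> dx 0 \<omega>)"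
    by (intro sqint_inner dx_L2 dy_L2 le0 L2F_D(2)[OF rs] L2F_D(2)[OF ps])+
  note ie = trajectory_cost_parts(3)[OF x y v] trajectory_cost_parts(3)[OF xs ys us]
  have "(LINT \<omega>|M. Rinit \<omega>) = (LINT \<omega>|M. init_cost S (y 0 \<omega>) - init_cost S (ys 0 \<omega>)
      + ps 0 \<omega> \<bullet> dx 0 \<omega> + rs 0 \<omega> \<bullet> dy 0 \<omega>)"
  proof (rule integral_cong_AE)
    have "AE \<omega> in M. x 0 \<omega> = init_map S (y 0 \<omega>)" "AE \<omega> in M. xs 0 \<omega> = init_map S (ys 0 \<omega>)"
      using solution state by (auto simp: state_solution_def)
    with Dinit_AE
    show "AE \<omega> in M. Rinit \<omega> = init_cost S (y 0 \<omega>) - init_cost S (ys 0 \<omega>) + ps 0 \<omega> \<bullet> dx 0 \<omega> + rs 0 \<omega> \<bullet> dy 0 \<omega>"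
      by eventually_elim (simp add: Rinit_def init_fun_def dx_def dy_def inner_diff_right)
  qed (use iD iH ie i in \<open>auto simp: Rinit_def[abs_def]\<close>)
  then show ?thesis using ie i by simp
qed

text \<open>An identity without error terms, valid for every competitor: all nonlinearity is
  collected in first order remainders at the reference trajectory, and the boundary pairings
  cancel.\<close>

lemma cost_difference:
  "trajectory_cost S M N w v x y - trajectory_cost S M N w us xs ys
    = (\<Sum>k<N. LINT \<omega>|M. RH k \<omega>) + (LINT \<omega>|M. Rend \<omega>) + (LINT \<omega>|M. Rinit \<omega>) + (\<Sum>k<N. LINT \<omega>|M. Hu k \<omega> \<bullet> du k \<omega>)"
proof -
  define a where "a k = (LINT \<omega>|M. ps k \<omega> \<bullet> dx k \<omega>) + (LINT \<omega>|M. rs k \<omega> \<bullet> dy k \<omega>)" for k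
  have dl: "(LINT \<omega>|M. dl k \<omega>) = (LINT \<omega>|M. (\<lambda>(x, y, z, u). run_cost S k x y z u \<omega>) (arg x y v k \<omega>))
      - (LINT \<omega>|M. (\<lambda>(x, y, z, u). run_cost S k x y z u \<omega>) (arg xs ys us k \<omega>))" if "k < N" for k
    unfolding dl_def using trajectory_cost_parts(1)[OF x y v that] trajectory_cost_parts(1)[OF xs ys us that]
    by (rule Bochner_Integration.integral_diff)
  have "(\<Sum>k<N. LINT \<omega>|M. RH k \<omega>) + (\<Sum>k<N. LINT \<omega>|M. Hu k \<omega> \<bullet> du k \<omega>)
      = (\<Sum>k<N. (a (Suc k) - a k) + (LINT \<omega>|M. dl k \<omega>))"
    unfolding sum.distrib[symmetric] by (intro sum.cong refl) (simp add: integral_RH a_def)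
  also have "\<dots> = a N - a 0 + (\<Sum>k<N. LINT \<omega>|M. dl k \<omega>)"
    by (simp add: sum.distrib sum_lessThan_telescope)
  also have "(\<Sum>k<N. LINT \<omega>|M. dl k \<omega>) = (\<Sum>k<N. LINT \<omega>|M. (\<lambda>(x, y, z, u). run_cost S k x y z u \<omega>) (arg x y v k \<omega>))
      - (\<Sum>k<N. LINT \<omega>|M. (\<lambda>(x, y, z, u). run_cost S k x y z u \<omega>) (arg xs ys us k \<omega>))"
    by (simp add: dl sum_subtractf)
  finally show ?thesis
    unfolding trajectory_cost_parts(4)[OF x y v] trajectory_cost_parts(4)[OF xs ys us] integral_Rend integral_Rinit
    by (simp add: a_def)
qed

text \<open>
  The solution for \<open>us\<close> solves the system for \<open>v\<close> up to a residual controlled by \<open>v - us\<close>.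
\<close>

lemma state_difference:
  assumes fbs_v: "fbs M N w (gmap v) (end_map S) \<kappa> L" and fbs_us: "fbs M N w (gmap us) (end_map S) \<kappa> L"
    and init: "fbs.compatible_init M N (gmap v) (end_map S) \<kappa> L (init_map S)"
    and growth: "\<forall>y y'. norm (init_map S y - init_map S y') \<le> c * (1 + norm y + norm y') * norm (y - y')"
    and lip: "\<forall>k<N. \<forall>\<omega>\<in>space M. \<forall>x y z u x' y' z' u'.
      norm (Gamma_map S k x y z u \<omega> - Gamma_map S k x' y' z' u' \<omega>) \<le> K * norm ((x, y, z, u) - (x', y', z', u'))"
    and du: "\<forall>k<N. sqn M (du k) \<le> b"
  defines "R \<equiv> (real N + 1) * (3 * (K\<^sup>2 * b))"
    and "D \<equiv> 2 * (c * (1 + 2 * norm (ys 0 base)))\<^sup>2"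
  assumes R: "R \<le> stab_radius (fb_const L N) D" and b: "0 \<le> b"
  defines "P \<equiv> stab_const L (fb_const L N) D * R"
  shows "\<forall>k<N. sqn M (dq k) \<le> 3 * P + b" "sqn M (dx N) \<le> P" "sqn M (dy 0) \<le> P"
proof -
  let ?h = "\<lambda>k \<omega>. (x k \<omega>, y k \<omega>)" and ?h' = "\<lambda>k \<omega>. (xs k \<omega>, ys k \<omega>)"
  interpret Us: fbs M N w "gmap us" "end_map S" \<kappa> L by (rule fbs_us)
  interpret V: fbs M N w "gmap v" "end_map S" \<kappa> L by (rule fbs_v)
  have sol: "V.solves ?h" "AE \<omega> in M. x 0 \<omega> = init_map S (y 0 \<omega>)"
    using solution state_solution_iff[OF fbs_v] by auto
  have sol': "Us.solves ?h'" "AE \<omega> in M. xs 0 \<omega> = init_map S (ys 0 \<omega>)"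
    using state state_solution_iff[OF fbs_us] by auto
  have h: "?h \<in> L2F M w {..N}" and h': "?h' \<in> L2F M w {..N}"
    using sol sol' by (auto simp: V.solves_def Us.solves_def)
  interpret fbs_pair M N w "gmap v" "end_map S" \<kappa> L ?h ?h' using h h' by unfold_locales
  \<comment> \<open>The coefficients are evaluated along the same reference process and differ only
    in the control, so the Lipschitz bound in the control applies.\<close>
  define \<delta> where "\<delta> k \<omega> = V.coef ?h' k \<omega> - Us.coef ?h' k \<omega>" for k \<omega>
  have \<delta>m: "\<delta> k \<in> borel_measurable (filt M w k)" and \<delta>s: "sqint M (\<delta> k)" if "k < N" for k
    unfolding \<delta>_def[abs_def] using V.coef_L2[OF h' that] Us.coef_L2[OF h' that] by (auto intro: sqint_diff)
  have \<delta>b: "sqn M (\<delta> k) \<le> K\<^sup>2 * b" if k: "k < N" for k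
  proof -
    have sdu: "sqint M (du k)"
      unfolding du_def[abs_def] by (intro sqint_diff(1) controls_D(2)[OF v k] controls_D(2)[OF us k])
    have I: "integrable M (\<lambda>\<omega>. K\<^sup>2 * (norm (du k \<omega>))\<^sup>2)" using sqintD(2)[OF sdu] by simp
    have "sqn M (\<delta> k) \<le> (LINT \<omega>|M. K\<^sup>2 * (norm (du k \<omega>))\<^sup>2)"
    proof (rule sqint_bound(2)[OF I])
      show "\<delta> k \<in> borel_measurable M" using \<delta>s[OF k] by auto
      show "AE \<omega> in M. (norm (\<delta> k \<omega>))\<^sup>2 \<le> K\<^sup>2 * (norm (du k \<omega>))\<^sup>2"
      proof (rule AE_I2)
        fix \<omega> assume \<omega>: "\<omega> \<in> space M"
        have "norm (\<delta> k \<omega>) \<le> K * norm (du k \<omega>)"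
          using lip[rule_format, OF k \<omega>, of "xs k \<omega>" "cond_mean M w ys k \<omega>" "cond_corr M w ys k \<omega>" "v k \<omega>"
              "xs k \<omega>" "cond_mean M w ys k \<omega>" "cond_corr M w ys k \<omega>" "us k \<omega>"]
          by (simp add: \<delta>_def V.coef_def Us.coef_def V.tri_def gmap_def du_def norm_Pair)
        then show "(norm (\<delta> k \<omega>))\<^sup>2 \<le> K\<^sup>2 * (norm (du k \<omega>))\<^sup>2"
          unfolding power_mult_distrib[symmetric] by (intro power_mono) auto
      qed
    qed
    also have "\<dots> = K\<^sup>2 * sqn M (du k)" by (simp add: sqn_def)
    also have "\<dots> \<le> K\<^sup>2 * b" by (intro mult_left_mono du[rule_format] k) simp
    finally show ?thesis .
  qed
  have Kb: "0 \<le> K\<^sup>2 * b" using b by simp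
  have r1: "sqn M (\<lambda>\<omega>. fst (res 1 (Suc j) \<omega>)) \<le> 2 * (K\<^sup>2 * b)" if j: "j < N" for j
  proof -
    note m = V.measurable_fst_snd[OF V.measurable_fst_snd(2)[OF \<delta>m[OF j]]]
    note s = sqint_fst_snd[OF sqint_fst_snd(2)[OF \<delta>s[OF j]]]
    note n = sqint_noise[OF j m(2) s(2)]
    have "AE \<omega> in M. fst (?h (Suc j) \<omega>) = fst (V.sweep ?h (Suc j) \<omega>)"
      "AE \<omega> in M. fst (?h' (Suc j) \<omega>) = fst (Us.sweep ?h' (Suc j) \<omega>)"
      using sol(1) sol'(1) j unfolding V.solves_def Us.solves_def by blast+
    then have ae: "AE \<omega> in M. fst (res 1 (Suc j) \<omega>) = fst (snd (\<delta> j \<omega>)) + w j \<omega> *\<^sub>R snd (snd (\<delta> j \<omega>))"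
    proof eventually_elim
      case (elim \<omega>)
      have "fst (res 1 (Suc j) \<omega>) = fst (V.sweep ?h' (Suc j) \<omega>) - fst (Us.sweep ?h' (Suc j) \<omega>)"
        using elim by (simp add: res_def dh_def)
      then show ?case by (simp add: V.sweep_def Us.sweep_def \<delta>_def algebra_simps)
    qed
    have "sqn M (\<lambda>\<omega>. fst (res 1 (Suc j) \<omega>)) = sqn M (\<lambda>\<omega>. fst (snd (\<delta> j \<omega>)) + w j \<omega> *\<^sub>R snd (snd (\<delta> j \<omega>)))"
      using res_fst_snd(1)[of "Suc j" 1] j sqint_add(1)[OF s(1) n(1)] ae by (intro sqn_cong_AE) auto
    also have "\<dots> \<le> 2 * sqn M (\<lambda>\<omega>. fst (snd (\<delta> j \<omega>))) + 2 * sqn M (\<lambda>\<omega>. snd (snd (\<delta> j \<omega>)))"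
      using sqint_add(2)[OF s(1) n(1)] n(2) by simp
    also have "\<dots> = 2 * sqn M (\<lambda>\<omega>. snd (\<delta> j \<omega>))" using s(3) by simp
    also have "\<dots> \<le> 2 * sqn M (\<delta> j)" using sqint_fst_snd(3)[OF \<delta>s[OF j]] by simp
    finally show ?thesis using \<delta>b[OF j] by simp
  qed
  have r2: "sqn M (\<lambda>\<omega>. snd (res 1 k \<omega>)) \<le> K\<^sup>2 * b" if k: "k \<le> N" for k
  proof -
    have "AE \<omega> in M. snd (?h k \<omega>) = snd (V.sweep ?h k \<omega>)" "AE \<omega> in M. snd (?h' k \<omega>) = snd (Us.sweep ?h' k \<omega>)"
      using sol(1) sol'(1) k unfolding V.solves_def Us.solves_def by blast+
    then have ae: "AE \<omega> in M. snd (res 1 k \<omega>) = snd (V.sweep ?h' k \<omega>) - snd (Us.sweep ?h' k \<omega>)"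
      by eventually_elim (simp add: res_def dh_def)
    show ?thesis
    proof (cases "k < N")
      case True
      note s = sqint_fst_snd[OF \<delta>s[OF True]]
      have "AE \<omega> in M. snd (res 1 k \<omega>) = - fst (\<delta> k \<omega>)"
        using ae by eventually_elim (simp add: V.sweep_def Us.sweep_def \<delta>_def True)
      then have "sqn M (\<lambda>\<omega>. snd (res 1 k \<omega>)) = sqn M (\<lambda>\<omega>. - fst (\<delta> k \<omega>))"
        using res_fst_snd(2)[OF k, of 1] sqint_minus(1)[OF s(1)] by (intro sqn_cong_AE) auto
      also have "\<dots> = sqn M (\<lambda>\<omega>. fst (\<delta> k \<omega>))" by (rule sqint_minus(2)[OF s(1)])
      also have "\<dots> \<le> sqn M (\<delta> k)" using s(3) by simp
      finally show ?thesis using \<delta>b[OF True] by simp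
    next
      case False
      \<comment> \<open>The terminal map does not contain the control, so the reference process
        leaves no residual at time \<open>N\<close>.\<close>
      have "AE \<omega> in M. snd (res 1 k \<omega>) = 0"
        using ae by eventually_elim (simp add: V.sweep_def Us.sweep_def False)
      then have "sqn M (\<lambda>\<omega>. snd (res 1 k \<omega>)) = 0"
        using sqn_eq_0_iff[OF res_fst_snd(2)[OF k, of 1]] by blast
      then show ?thesis using Kb by simp
    qed
  qed
  \<comment> \<open>Two units from the forward equation, where drift and noise terms are split, and
    one from the backward equation.\<close>
  have "rsq 1 k \<le> 3 * (K\<^sup>2 * b)" if "k \<le> N" for k
    using r1[of "k - 1"] r2[OF that] that Kb by (cases k) (auto simp: rsq_def)
  then have rs_le: "(\<Sum>k\<le>N. rsq 1 k) \<le> R"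
    using sum_bounded_above[of "{..N}" "rsq 1" "3 * (K\<^sup>2 * b)"] by (simp add: R_def add.commute)
  have L: "1 \<le> fb_const L N" "1 \<le> L" using fb_const_ge_1[OF V.L_ge_1] V.L_ge_1 by auto
  have D: "0 \<le> D" by (simp add: D_def)
  have sc: "0 \<le> stab_const L (fb_const L N) D" using L D by (simp add: stab_const_def)
  have "psq M N dh \<le> stab_const L (fb_const L N) D * (\<Sum>k\<le>N. rsq 1 k)"
    using local_stability[OF init growth[rule_format]] sol(2) sol'(2) order_trans[OF rs_le R] by (simp add: D_def)
  also have "\<dots> \<le> P" unfolding P_def using rs_le sc by (rule mult_left_mono)
  finally have P: "psq M N dh \<le> P" .
  have X: "X k = sqn M (dx k)" and Y: "Y k = sqn M (dy k)" for k
    by (simp_all add: X_def Y_def dh_def dx_def[abs_def] dy_def[abs_def])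
  show "sqn M (dx N) \<le> P" "sqn M (dy 0) \<le> P"
    using X_Y_le_psq(1)[OF order_refl] X_Y_le_psq(2)[OF le0] P by (auto simp: X Y)
  show "\<forall>k<N. sqn M (dq k) \<le> 3 * P + b"
  proof (intro allI impI)
    fix k assume k: "k < N"
    have sdu: "sqint M (du k)"
      unfolding du_def[abs_def] by (intro sqint_diff(1) controls_D(2)[OF v k] controls_D(2)[OF us k])
    have "(norm (dq k \<omega>))\<^sup>2 = (norm (dtri k \<omega>))\<^sup>2 + (norm (du k \<omega>))\<^sup>2" for \<omega>
      by (simp add: dq_def dtri_def V.tri_def arg_def du_def norm_Pair)
    then have "sqn M (dq k) = sqn M (dtri k) + sqn M (du k)"
      unfolding sqn_def using sqintD(2)[OF dtri_L2(2)[OF k]] sqintD(2)[OF sdu] by simp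
    also have "\<dots> \<le> (X k + 2 * Y (Suc k)) + b" using sqn_dtri(2)[OF k] du[rule_format, OF k] by simp
    also have "\<dots> \<le> 3 * P + b" using X_Y_le_psq(1)[of k] X_Y_le_psq(2)[of "Suc k"] k P by simp
    finally show "sqn M (dq k) \<le> 3 * P + b" .
  qed
qed

end

section \<open>Existence of trajectories and passage to the limit\<close>

context control_system
begin

lemma exists_state_solution:
  assumes fbs: "fbs M N w (gmap v) (end_map S) \<kappa> L"
    and init: "fbs.compatible_init M N (gmap v) (end_map S) \<kappa> L (init_map S)"
  shows "\<exists>x y. state_solution S M N w v x y"
proof -
  obtain h where "fbs.solves M N w (gmap v) (end_map S) h" "AE \<omega> in M. fst (h 0 \<omega>) = init_map S (snd (h 0 \<omega>))"
    using fbs.exists_solution[OF fbs init] by blast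
  then have "state_solution S M N w v (\<lambda>k \<omega>. fst (h k \<omega>)) (\<lambda>k \<omega>. snd (h k \<omega>))"
    by (simp add: state_solution_iff[OF fbs])
  then show ?thesis by blast
qed

text \<open>\<open>cost\<close> is defined through the choice operator, so the chosen pair is known
  to be a trajectory only after existence has been shown.\<close>

lemma cost_of_some_solution:
  assumes "\<exists>x y. state_solution S M N w v x y"
  obtains x y where "state_solution S M N w v x y" "cost S M N w v = trajectory_cost S M N w v x y"
proof -
  obtain x y where xy: "(x, y) = (SOME (x, y). state_solution S M N w v x y)"
    by (metis surj_pair)
  have "case (SOME (x, y). state_solution S M N w v x y) of (x, y) \<Rightarrow> state_solution S M N w v x y"
    by (rule someI_ex) (use assms in auto)
  then have "state_solution S M N w v x y" unfolding xy[symmetric] by simp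
  moreover have "cost S M N w v = trajectory_cost S M N w v x y"
    unfolding cost_def xy[symmetric] by simp
  ultimately show thesis by (rule that)
qed

lemma perturbed_controls:
  assumes us: "us \<in> controls M N w U" and u: "u \<in> controls M N w U" and \<epsilon>: "0 \<le> \<epsilon>" "\<epsilon> \<le> 1"
  shows "perturbed s us u \<epsilon> \<in> controls M N w U"
proof -
  have eq: "perturbed s us u \<epsilon> k = (\<lambda>\<omega>. us k \<omega> + (if k = s then \<epsilon> else 0) *\<^sub>R (u k \<omega> - us k \<omega>))" for k
    by (auto simp: perturbed_def)
  have "perturbed s us u \<epsilon> k \<in> borel_measurable (filt M w k) \<and> sqint M (perturbed s us u \<epsilon> k)" if k: "k < N" for k
    unfolding eq
    by (intro conjI borel_measurable_add borel_measurable_scaleR borel_measurable_const borel_measurable_diff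
        sqint_add(1) sqint_scaleR(1) sqint_diff(1) controls_D(1,2)[OF us k] controls_D(1,2)[OF u k])
  moreover have "{..<N} \<subseteq> {..N}" by auto
  moreover have "perturbed s us u \<epsilon> k \<omega> \<in> U k" if k: "k < N" and \<omega>: "\<omega> \<in> space M" for k \<omega>
  proof (cases "k = s")
    case True
    have "(1 - \<epsilon>) *\<^sub>R us k \<omega> + \<epsilon> *\<^sub>R u k \<omega> \<in> U k"
      using convexD[OF U_convex[OF k] controls_D(3)[OF us k \<omega>] controls_D(3)[OF u k \<omega>], of "1 - \<epsilon>" \<epsilon>] \<epsilon> by simp
    then show ?thesis using True by (simp add: eq algebra_simps)
  next
    case False
    then show ?thesis using controls_D(3)[OF us k \<omega>] by (simp add: eq)
  qed
  ultimately show ?thesis by (simp add: controls_def L2F_iff)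
qed

end

context extremal
begin

text \<open>If the quotient stayed away from the claimed value, there would be bad \<epsilon>
  arbitrarily close to 0, hence a sequence of them decaying as fast as desired. Along it the
  remainders divided by \<epsilon> tend to 0, a contradiction.\<close>

lemma directional_derivative:
  assumes fbs: "\<And>v. v \<in> controls M N w U \<Longrightarrow> fbs M N w (gmap v) (end_map S) \<kappa> L"
    and init: "\<And>v. v \<in> controls M N w U \<Longrightarrow> fbs.compatible_init M N (gmap v) (end_map S) \<kappa> L (init_map S)"
    and u: "u \<in> controls M N w U" and s: "s < N"
  shows "((\<lambda>\<epsilon>. (cost S M N w (perturbed s us u \<epsilon>) - cost S M N w us) / \<epsilon>) \<longlongrightarrow>
           (LINT \<omega>|M. Hu s \<omega> \<bullet> (u s \<omega> - us s \<omega>))) (at_right 0)"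
proof -
  obtain c where c: "\<forall>y y'. norm (init_map S y - init_map S y') \<le> c * (1 + norm y + norm y') * norm (y - y')"
    by (rule cost_growth) blast
  obtain K where K: "\<forall>k<N. \<forall>\<omega>\<in>space M. \<forall>x y z u x' y' z' u'.
      norm (Gamma_map S k x y z u \<omega> - Gamma_map S k x' y' z' u' \<omega>) \<le> K * norm ((x, y, z, u) - (x', y', z', u'))"
    by (rule gmap_lipschitz) blast
  have L: "1 \<le> L" by (rule fbs.L_ge_1[OF fbs[OF us]])
  define D where "D = 2 * (c * (1 + 2 * norm (ys 0 base)))\<^sup>2"
  define \<rho> where "\<rho> = stab_radius (fb_const L N) D"
  define B where "B = sqn M (\<lambda>\<omega>. u s \<omega> - us s \<omega>)"
  define r where "r = (real N + 1) * (3 * (K\<^sup>2 * B))"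
  define p where "p = stab_const L (fb_const L N) D * r"
  have D: "0 \<le> D" by (simp add: D_def)
  have B: "0 \<le> B" by (simp add: B_def)
  have r: "0 \<le> r" using B by (simp add: r_def)
  have F1: "1 \<le> fb_const L N" by (rule fb_const_ge_1[OF L])
  have p: "0 \<le> p" using r L D F1 by (simp add: p_def stab_const_def)
  have \<rho>: "0 < \<rho>"
    using D F1 by (simp add: \<rho>_def stab_radius_def add_pos_nonneg)
  have comp: "competitor M N w S U us xs ys ps rs v x y"
    if "v \<in> controls M N w U" "state_solution S M N w v x y" for v x y
    using that by unfold_locales
  \<comment> \<open>The trajectory chosen inside \<open>cost\<close> need not be
    \<open>(xs, ys)\<close>. Stability with control increment 0 shows that its relevant differences
    vanish almost surely, and the duality identity then yields equality of the costs.\<close>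
  have J0: "cost S M N w us = trajectory_cost S M N w us xs ys"
  proof -
    obtain x y where xy: "state_solution S M N w us x y" "cost S M N w us = trajectory_cost S M N w us x y"
      using cost_of_some_solution[OF exists_state_solution[OF fbs[OF us] init[OF us]]] by blast
    interpret competitor M N w S U us xs ys ps rs us x y by (rule comp[OF us xy(1)])
    have du: "\<forall>k<N. sqn M (du k) \<le> 0" by (simp add: du_def[abs_def] sqn_def)
    have R0: "(real N + 1) * (3 * (K\<^sup>2 * 0)) \<le> stab_radius (fb_const L N) (2 * (c * (1 + 2 * norm (ys 0 base)))\<^sup>2)"
      using \<rho> by (simp add: \<rho>_def D_def)
    note sd = state_difference[OF fbs[OF us] fbs[OF us] init[OF us] c K du R0 order_refl]
    have q0: "AE \<omega> in M. dq k \<omega> = 0" if "k < N" for k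
      using sd(1)[rule_format, OF that] sqn_nonneg[of M "dq k"] sqn_eq_0_iff[OF dq_L2[OF that]] by simp
    have x0: "AE \<omega> in M. dx N \<omega> = 0" using sd(2) sqn_nonneg[of M "dx N"] sqn_eq_0_iff[OF dx_L2[OF order_refl]] by simp
    have y0: "AE \<omega> in M. dy 0 \<omega> = 0" using sd(3) sqn_nonneg[of M "dy 0"] sqn_eq_0_iff[OF dy_L2[OF le0]] by simp
    have "(LINT \<omega>|M. RH k \<omega>) = 0" if k: "k < N" for k
    proof (rule integral_eq_zero_AE)
      show "AE \<omega> in M. RH k \<omega> = 0"
        using q0[OF k] AE_space
      proof eventually_elim
        case (elim \<omega>)
        interpret bounded_linear "DHam k \<omega>" by (rule has_derivative_bounded_linear[OF Ham_derivative[OF k elim(2)]])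
        show ?case by (simp add: RH_def elim zero)
      qed
    qed
    moreover have "(LINT \<omega>|M. Rend \<omega>) = 0"
      by (rule integral_eq_zero_AE) (use x0 Dend_AE in \<open>eventually_elim, simp add: Rend_def\<close>)
    moreover have "(LINT \<omega>|M. Rinit \<omega>) = 0"
      by (rule integral_eq_zero_AE) (use y0 Dinit_AE in \<open>eventually_elim, simp add: Rinit_def\<close>)
    ultimately show ?thesis using cost_difference xy(2) by (simp add: du_def)
  qed
  define \<Delta> where "\<Delta> = (LINT \<omega>|M. Hu s \<omega> \<bullet> (u s \<omega> - us s \<omega>))"
  let ?q = "\<lambda>\<epsilon>. (cost S M N w (perturbed s us u \<epsilon>) - cost S M N w us) / \<epsilon>"
  have "(?q \<longlongrightarrow> \<Delta>) (at_right 0)"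
  proof (rule ccontr)
    assume "\<not> ?thesis"
    then obtain e where e: "0 < e" "\<not> (\<forall>\<^sub>F \<epsilon> in at_right 0. dist (?q \<epsilon>) \<Delta> < e)"
      unfolding tendsto_iff by blast
    have bad: "\<exists>\<epsilon>>0. \<epsilon> < d \<and> e \<le> dist (?q \<epsilon>) \<Delta>" if "0 < d" for d
      using e(2) that unfolding eventually_at_right_field by (meson not_le)
    \<comment> \<open>Three requirements on the step: decay for the common majorant, at most 1 so
      that the perturbed control stays admissible, and a residual below the radius of local
      stability.\<close>
    define d where "d n = min ((1/4)^n) (min 1 (\<rho> / (r + 1)))" for n :: nat
    have d: "0 < d n" for n using \<rho> r by (simp add: d_def)
    obtain \<epsilon> where \<epsilon>: "\<And>n. 0 < \<epsilon> n" "\<And>n. \<epsilon> n < d n" "\<And>n. e \<le> dist (?q (\<epsilon> n)) \<Delta>"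
      using bad[OF d] by metis
    have \<epsilon>1: "\<epsilon> n \<le> 1" "\<epsilon> n \<le> (1/4)^n" "(\<epsilon> n)\<^sup>2 * r \<le> \<rho>" for n
    proof -
      show "\<epsilon> n \<le> 1" "\<epsilon> n \<le> (1/4)^n" using \<epsilon>(2)[of n] by (auto simp: d_def)
      then have "(\<epsilon> n)\<^sup>2 \<le> \<epsilon> n" using \<epsilon>(1)[of n] by (simp add: power2_eq_square mult_left_le)
      also have "\<dots> \<le> \<rho> / (r + 1)" using \<epsilon>(2)[of n] by (auto simp: d_def)
      finally have "(\<epsilon> n)\<^sup>2 * r \<le> \<rho> / (r + 1) * r" using r by (intro mult_right_mono)
      also have "\<dots> \<le> \<rho>" using \<rho> r by (simp add: field_simps)
      finally show "(\<epsilon> n)\<^sup>2 * r \<le> \<rho>" .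
    qed
    define v where "v n = perturbed s us u (\<epsilon> n)" for n
    have v: "v n \<in> controls M N w U" for n
      unfolding v_def using \<epsilon>(1)[of n] \<epsilon>1(1)[of n] by (intro perturbed_controls us u) auto
    have "\<exists>x y. state_solution S M N w (v n) x y \<and> cost S M N w (v n) = trajectory_cost S M N w (v n) x y" for n
      using cost_of_some_solution[OF exists_state_solution[OF fbs[OF v] init[OF v]], of n] by metis
    then obtain x y where xy: "\<And>n. state_solution S M N w (v n) (x n) (y n)"
      "\<And>n. cost S M N w (v n) = trajectory_cost S M N w (v n) (x n) (y n)" by metis
    note cmp = comp[OF v xy(1)]
    have vu: "v n k \<omega> - us k \<omega> = (if k = s then \<epsilon> n else 0) *\<^sub>R (u k \<omega> - us k \<omega>)" for n k \<omega>
      by (simp add: v_def perturbed_def)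
    have suu: "sqint M (\<lambda>\<omega>. u s \<omega> - us s \<omega>)" by (intro sqint_diff(1) controls_D(2)[OF u s] controls_D(2)[OF us s])
    have eB: "0 \<le> (\<epsilon> n)\<^sup>2 * B" for n using B by simp
    have Rn: "(real N + 1) * (3 * (K\<^sup>2 * ((\<epsilon> n)\<^sup>2 * B))) = (\<epsilon> n)\<^sup>2 * r" for n by (simp add: r_def)
    have small: "(real N + 1) * (3 * (K\<^sup>2 * ((\<epsilon> n)\<^sup>2 * B))) \<le> stab_radius (fb_const L N) (2 * (c * (1 + 2 * norm (ys 0 base)))\<^sup>2)" for n
      unfolding Rn using \<epsilon>1(3)[of n] by (simp add: \<rho>_def D_def)
    \<comment> \<open>One constant for all three increments: \<open>p\<close> bounds the states, and
      the argument tuple of the Hamiltonian costs \<open>3 * p\<close> plus the squared control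
      increment \<open>B\<close>.\<close>
    define C0 where "C0 = 3 * p + B"
    have C0: "0 \<le> C0" using p B by (simp add: C0_def)
    have stab: "stab_const L (fb_const L N) D * ((\<epsilon> n)\<^sup>2 * r) = p * (\<epsilon> n)\<^sup>2" for n by (simp add: p_def)
    define dq where "dq n = competitor.dq M w us xs ys (v n) (x n) (y n)" for n
    define dx where "dx n = competitor.dx xs (x n) N" for n
    define dy where "dy n = competitor.dy ys (y n) 0" for n
    have bounds: "\<forall>k<N. sqn M (dq n k) \<le> C0 * (\<epsilon> n)\<^sup>2" "sqn M (dx n) \<le> C0 * (\<epsilon> n)\<^sup>2" "sqn M (dy n) \<le> C0 * (\<epsilon> n)\<^sup>2" for n
    proof -
      interpret C: competitor M N w S U us xs ys ps rs "v n" "x n" "y n" by (rule cmp)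
      have du: "\<forall>k<N. sqn M (C.du k) \<le> (\<epsilon> n)\<^sup>2 * B"
      proof (intro allI impI)
        fix k
        show "sqn M (C.du k) \<le> (\<epsilon> n)\<^sup>2 * B"
          using sqint_scaleR(2)[OF suu, of "\<epsilon> n"] B
          by (cases "k = s") (simp_all add: C.du_def[abs_def] vu B_def sqn_def[of M "\<lambda>_. 0"])
      qed
      note sd = C.state_difference[OF fbs[OF v] fbs[OF us] init[OF v] c K du small eB, unfolded Rn, folded D_def, unfolded stab]
      have "p * (\<epsilon> n)\<^sup>2 \<le> C0 * (\<epsilon> n)\<^sup>2" using p B by (intro mult_right_mono) (auto simp: C0_def)
      then show "sqn M (dx n) \<le> C0 * (\<epsilon> n)\<^sup>2" "sqn M (dy n) \<le> C0 * (\<epsilon> n)\<^sup>2"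
        unfolding dx_def dy_def using sd(2,3) by linarith+
      show "\<forall>k<N. sqn M (dq n k) \<le> C0 * (\<epsilon> n)\<^sup>2"
        unfolding dq_def using sd(1) by (simp add: C0_def algebra_simps)
    qed
    define remH where "remH n k = (LINT \<omega>|M. Ham k \<omega> (arg xs ys us k \<omega> + dq n k \<omega>) - Ham k \<omega> (arg xs ys us k \<omega>) - DHam k \<omega> (dq n k \<omega>))" for n k
    define remE where "remE n = (LINT \<omega>|M. end_fun \<omega> (xs N \<omega> + dx n \<omega>) - end_fun \<omega> (xs N \<omega>) - Dend \<omega> (dx n \<omega>))" for n
    define remI where "remI n = (LINT \<omega>|M. init_fun \<omega> (ys 0 \<omega> + dy n \<omega>) - init_fun \<omega> (ys 0 \<omega>) - Dinit \<omega> (dy n \<omega>))" for n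
    have "(\<lambda>n. remH n k / \<epsilon> n) \<longlonglongrightarrow> 0" if k: "k < N" for k
    proof -
      obtain G C where "smooth_growth M (Ham k) (DHam k) (arg xs ys us k) G C" by (rule Ham_smooth[OF k])
      then interpret SG: smooth_growth M "Ham k" "DHam k" "arg xs ys us k" G C .
      show ?thesis
        unfolding remH_def
      proof (rule SG.remainder_tendsto)
        show "sqint M (dq n k)" for n unfolding dq_def by (rule competitor.dq_L2[OF cmp k])
        show "(\<lambda>\<omega>. Ham k \<omega> (arg xs ys us k \<omega> + t *\<^sub>R dq n k \<omega>)) \<in> borel_measurable M" if "0 \<le> t" "t \<le> 1" for n t
          unfolding dq_def by (rule competitor.segment_measurable[OF cmp k that])
        show "sqn M (dq n k) \<le> C0 * (\<epsilon> n)\<^sup>2" for n using bounds(1) k by blast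
      qed (rule \<epsilon>(1) \<epsilon>1(2) C0)+
    qed
    then have "(\<lambda>n. \<Sum>k<N. remH n k / \<epsilon> n) \<longlonglongrightarrow> (\<Sum>k<N. 0)" by (intro tendsto_sum) simp
    moreover have "(\<lambda>n. remE n / \<epsilon> n) \<longlonglongrightarrow> 0"
    proof -
      obtain G C where "smooth_growth M end_fun Dend (xs N) G C" by (rule end_smooth)
      then interpret SG: smooth_growth M end_fun Dend "xs N" G C .
      show ?thesis
        unfolding remE_def
      proof (rule SG.remainder_tendsto)
        show "sqint M (dx n)" for n unfolding dx_def by (rule competitor.dx_L2[OF cmp order_refl])
        show "(\<lambda>\<omega>. end_fun \<omega> (xs N \<omega> + t *\<^sub>R dx n \<omega>)) \<in> borel_measurable M" for n t
          unfolding dx_def by (rule competitor.end_segment_measurable[OF cmp])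
      qed (rule \<epsilon>(1) \<epsilon>1(2) C0 bounds(2))+
    qed
    moreover have "(\<lambda>n. remI n / \<epsilon> n) \<longlonglongrightarrow> 0"
    proof -
      obtain G C where "smooth_growth M init_fun Dinit (ys 0) G C" by (rule init_smooth)
      then interpret SG: smooth_growth M init_fun Dinit "ys 0" G C .
      show ?thesis
        unfolding remI_def
      proof (rule SG.remainder_tendsto)
        show "sqint M (dy n)" for n unfolding dy_def by (rule competitor.dy_L2[OF cmp le0])
        show "(\<lambda>\<omega>. init_fun \<omega> (ys 0 \<omega> + t *\<^sub>R dy n \<omega>)) \<in> borel_measurable M" for n t
          unfolding dy_def by (rule competitor.init_segment_measurable[OF cmp])
      qed (rule \<epsilon>(1) \<epsilon>1(2) C0 bounds(3))+
    qed
    ultimately have "(\<lambda>n. (\<Sum>k<N. remH n k / \<epsilon> n) + remE n / \<epsilon> n + remI n / \<epsilon> n) \<longlonglongrightarrow> (\<Sum>k<N. 0) + 0 + 0"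
      by (intro tendsto_add)
    \<comment> \<open>Only the time \<open>s\<close> contributes to the control terms, and there
      exactly \<open>\<epsilon> n * \<Delta>\<close>; the rest of the quotient consists of
      remainders.\<close>
    moreover have "(\<Sum>k<N. remH n k / \<epsilon> n) + remE n / \<epsilon> n + remI n / \<epsilon> n = ?q (\<epsilon> n) - \<Delta>" for n
    proof -
      interpret C: competitor M N w S U us xs ys ps rs "v n" "x n" "y n" by (rule cmp)
      have "(LINT \<omega>|M. Hu k \<omega> \<bullet> C.du k \<omega>) = (if k = s then \<epsilon> n * \<Delta> else 0)" for k
        by (simp add: C.du_def vu \<Delta>_def)
      then have "(\<Sum>k<N. LINT \<omega>|M. Hu k \<omega> \<bullet> C.du k \<omega>) = \<epsilon> n * \<Delta>" using s by simp
      then have "cost S M N w (v n) - cost S M N w us = (\<Sum>k<N. remH n k) + remE n + remI n + \<epsilon> n * \<Delta>"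
        unfolding xy(2) J0 C.cost_difference C.RH_def C.Rend_def C.Rinit_def remH_def remE_def remI_def dq_def dx_def dy_def
        by simp
      then have "?q (\<epsilon> n) = ((\<Sum>k<N. remH n k) + remE n + remI n + \<epsilon> n * \<Delta>) / \<epsilon> n" by (simp add: v_def)
      then show ?thesis using \<epsilon>(1)[of n] by (simp add: sum_divide_distrib add_divide_distrib)
    qed
    ultimately have "(\<lambda>n. ?q (\<epsilon> n) - \<Delta>) \<longlonglongrightarrow> 0" by simp
    then have "\<forall>\<^sub>F n in sequentially. dist (?q (\<epsilon> n) - \<Delta>) 0 < e" using e(1) by (rule tendstoD)
    then obtain n where "dist (?q (\<epsilon> n) - \<Delta>) 0 < e" by (auto simp: eventually_sequentially)
    then show False using \<epsilon>(3)[of n] by (simp add: dist_norm)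
  qed
  then show ?thesis by (simp add: \<Delta>_def)
qed

end

theorem theorem3p3:
  fixes M :: "'w measure" and N :: nat and w :: "nat \<Rightarrow> 'w \<Rightarrow> real"
    and U :: "nat \<Rightarrow> (real^'m) set"
    and S :: "('w, 'n::finite, 'm::finite) system"
    and \<mu> \<nu> :: real and M0 :: "real^'n^'mt" and G :: "'w \<Rightarrow> real^'n^'mt"
    and A B C :: "nat \<Rightarrow> 'w \<Rightarrow> real^'n^'m"
    and us u :: "nat \<Rightarrow> 'w \<Rightarrow> real^'m"
    and xs ys ps rs :: "nat \<Rightarrow> 'w \<Rightarrow> real^'n"
    and s :: nat
  assumes "prob_space M" and "complete_measure M" and "N > 0"
    and "martingale_difference M N w"
    and "\<forall>k<N. U k \<noteq> {} \<and> convex (U k)"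
    and "terminal_data S M N w"
    and "assumption_A S M N w U"
    and "assumption_B S M N w U \<mu> \<nu> M0 G A B C"
    and "\<nu> = 0 \<longrightarrow> lipschitz_end_map S M"
    and "us \<in> controls M N w U"
    and "ereal (cost S M N w us) = (INF v\<in>controls M N w U. ereal (cost S M N w v))"
    and "state_solution S M N w us xs ys"
    and "adjoint_solution S M N w us xs ys ps rs"
    and "s < N" and "u \<in> controls M N w U"
  shows "((\<lambda>\<epsilon>. (cost S M N w (perturbed s us u \<epsilon>) - cost S M N w us) / \<epsilon>) \<longlongrightarrow>
           (LINT \<omega>|M. along M w us xs ys ps rs (ham_u S) s \<omega> \<bullet> (u s \<omega> - us s \<omega>))) (at_right 0)"
proof -
  interpret prob_space M by fact
  interpret control_system M N w S U
    using assms by unfold_locales auto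
  obtain \<kappa> L where fbs: "\<And>v. v \<in> controls M N w U \<Longrightarrow> fbs M N w (gmap v) (end_map S) \<kappa> L"
    and init: "\<And>v. v \<in> controls M N w U \<Longrightarrow> fbs.compatible_init M N (gmap v) (end_map S) \<kappa> L (init_map S)"
    by (rule fbs_instance[OF \<open>assumption_B S M N w U \<mu> \<nu> M0 G A B C\<close> \<open>\<nu> = 0 \<longrightarrow> lipschitz_end_map S M\<close>]) blast
  \<comment> \<open>The Lipschitz property of the terminal map is hypothesised for
    \<open>\<nu> = 0\<close> and follows from the matrix bound for \<open>\<nu> > 0\<close>. The
    abstract system already combines both cases in a bound on squares, hence the constant
    \<open>sqrt L\<close>.\<close>
  have "AE \<omega> in M. \<forall>x x'. norm (end_map S \<omega> x - end_map S \<omega> x') \<le> sqrt L * norm (x - x')"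
    using fbs.Phi_lipschitz[OF fbs[OF \<open>us \<in> controls M N w U\<close>]]
  proof eventually_elim
    case (elim \<omega>)
    have "norm (end_map S \<omega> x - end_map S \<omega> x') \<le> sqrt (L * (norm (x - x'))\<^sup>2)" for x x'
      using elim by (intro real_le_rsqrt) blast
    then show ?case by (simp add: real_sqrt_mult)
  qed
  then have "lipschitz_end_map S M" unfolding lipschitz_end_map_def by blast
  then interpret extremal M N w S U us xs ys ps rs
    using assms by unfold_locales auto
  show ?thesis by (rule directional_derivative[OF fbs init \<open>u \<in> controls M N w U\<close> \<open>s < N\<close>])
qed

end
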